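(* Let $x_1,\dots,x_d\in\mathbb S^2$ and let $(Z_1,\dots,Z_d)$ be a centred Gaussian vector with covariance matrix $(P_\ell(\langle x_i,x_j\rangle))_{i,j=1,\dots,d}$. Then, as $\ell\to\infty$ and $\nu_t\to\infty$ jointly (the dimension $d$ being allowed to grow with $\ell$ and $\nu_t$), $$\sup_{h\in C^3,\ |h|_{C^3}<1}\left|\mathbb E[h(T_{\ell;t}(x_1),\dots,T_{\ell;t}(x_d))]-\mathbb E[h(Z_1,\dots,Z_d)]\right|=O\left(d\times(\sqrt\ell\wedge d)\times\sqrt{\frac{\log\ell}{\nu_t}}\right).$$
   Context: Let $\mu$ be the Lebesgue (surface) measure on the unit sphere $\mathbb S^2\subset\mathbb R^3$, so $\mu(\mathbb S^2)=4\pi$. For $t>0$ let $\nu_t>0$ be the rate (with $\nu_t\to\infty$ as $t\to\infty$) and let $N_t$ be a Poisson random measure on $\mathbb S^2$ with intensity measure $\nu_t\,\mu$. Let $P_\ell$ be the Legendre polynomial of degree $\ell$ (normalized by $P_\ell(1)=1$). The Poisson spherical random wave is $$T_{\ell;t}(x)=\frac{1}{\sqrt{\nu_t}}\int_{\mathbb S^2}\sqrt{\frac{2\ell+1}{4\pi}}\,P_\ell(\langle x,\xi\rangle)\,dN_t(\xi),\qquad x\in\mathbb S^2.$$ Here $a\wedge b=\min(a,b)$, and for $h\in C^3(\mathbb R^d)$ we write $|h|_{C^3}=\sup_{j=1,2,3}\sup_{x\in\mathbb R^d}\|D^jh(x)\|_{op}$, where derivatives are viewed as multilinear forms and $\|\psi\|_{op}=\sup\{|\psi(u_1,\dots,u_j)|:\|u_i\|_2=1\}$.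 *)

theory Defs
  imports "HOL-Probability.Probability" "HOL-Computational_Algebra.Polynomial"
begin

section \<open>Legendre polynomials and the surface measure of the unit sphere\<close>

text \<open>Rodrigues' formula; this is the normalization with value 1 at 1.\<close>

definition legendre :: "nat \<Rightarrow> real poly" where
  "legendre n = smult (1 / (2 ^ n * fact n)) ((pderiv ^^ n) ([:-1, 0, 1:] ^ n))"

text \<open>
  The surface measure of a Borel set A of the sphere is three times the volume of the cone
  of all r a with a in A and r between 0 and 1 (cone measure, from integration in polar
  coordinates). Equivalently, it is three times the image of Lebesgue measure on the
  punctured unit ball under the radial projection \<^term>\<open>sgn\<close>. The total mass is
  4 pi, see below.
\<close>

definition sphere_measure :: "(real ^ 3) measure" where
  "sphere_measure =
     scale_measure 3
       (distr (restrict_space lborel (cball 0 1 - {0})) (restrict_space borel (sphere 0 1)) sgn)"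

lemma emeasure_sphere_measure: "emeasure sphere_measure (sphere 0 1) = ennreal (4 * pi)"
proof -
  let ?B = "cball (0 :: real ^ 3) 1 - {0}"
  have B: "?B \<in> sets borel" by auto
  have m: "(sgn :: real ^ 3 \<Rightarrow> _) \<in> measurable (restrict_space lborel ?B) (restrict_space borel (sphere 0 1))"
  proof (rule measurable_restrict_space2)
    show "(sgn :: real ^ 3 \<Rightarrow> _) \<in> space (restrict_space lborel ?B) \<rightarrow> sphere 0 1"
      by (auto simp: space_restrict_space norm_sgn)
    have "continuous_on ?B (sgn :: real ^ 3 \<Rightarrow> _)"
      unfolding sgn_div_norm by (auto intro!: continuous_intros)
    hence "(sgn :: real ^ 3 \<Rightarrow> _) \<in> measurable (restrict_space borel ?B) borel"
      by (rule borel_measurable_continuous_on_restrict)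
    thus "(sgn :: real ^ 3 \<Rightarrow> _) \<in> measurable (restrict_space lborel ?B) borel"
      by (simp cong: measurable_cong_sets add: measurable_def sets_restrict_space space_restrict_space)
  qed
  have vimage: "(sgn :: real ^ 3 \<Rightarrow> _) -` sphere 0 1 \<inter> ?B = ?B"
    by (auto simp: space_restrict_space norm_sgn)
  have "emeasure (distr (restrict_space lborel ?B) (restrict_space borel (sphere 0 1)) sgn) (sphere 0 1)
        = emeasure (restrict_space lborel ?B) ?B"
    by (subst emeasure_distr[OF m])
      (simp_all add: vimage sets_restrict_space space_restrict_space image_iff, use vimage in auto)
  also have "\<dots> = emeasure lborel ?B"
    using B by (intro emeasure_restrict_space) auto
  also have "\<dots> = emeasure lborel (cball (0 :: real ^ 3) 1)"
    by (intro emeasure_Diff_null_set) (auto simp: null_sets_def)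
  also have "\<dots> = ennreal (4 / 3 * pi)"
    using emeasure_cball[of 1 "0 :: real ^ 3"]
    by (simp add: unit_ball_vol_numeral fact_numeral)
  finally show ?thesis
    by (simp add: sphere_measure_def emeasure_scale_measure flip: ennreal_numeral ennreal_mult)
qed


section \<open>Poisson random measures and Poisson spherical random waves\<close>

definition poisson_random_measure :: "'w measure \<Rightarrow> 'a measure \<Rightarrow> ('w \<Rightarrow> 'a measure) \<Rightarrow> bool" where
  "poisson_random_measure M L N \<longleftrightarrow>
     (\<forall>\<omega>\<in>space M. sets (N \<omega>) = sets L) \<and>
     (\<forall>\<omega>\<in>space M. \<forall>A\<in>sets L. emeasure (N \<omega>) A \<in> range of_nat \<union> {\<infinity>}) \<and>
     (\<forall>A\<in>sets L. (\<lambda>\<omega>. emeasure (N \<omega>) A) \<in> borel_measurable M) \<and>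
     (\<forall>A\<in>sets L. emeasure L A < \<infinity> \<longrightarrow>
        (\<forall>k::nat. measure M {\<omega> \<in> space M. emeasure (N \<omega>) A = of_nat k} =
                  exp (- measure L A) * measure L A ^ k / fact k)) \<and>
     (\<forall>A\<in>sets L. emeasure L A = \<infinity> \<longrightarrow> (AE \<omega> in M. emeasure (N \<omega>) A = \<infinity>)) \<and>
     (\<forall>(n::nat) A. (\<forall>i<n. A i \<in> sets L) \<and> disjoint_family_on A {..<n} \<longrightarrow>
        prob_space.indep_vars M (\<lambda>_. borel) (\<lambda>i \<omega>. emeasure (N \<omega>) (A i)) {..<n})"

definition poisson_wave :: "real \<Rightarrow> (real ^ 3) measure \<Rightarrow> nat \<Rightarrow> real ^ 3 \<Rightarrow> real" where
  "poisson_wave rate N l x =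
     1 / sqrt rate *
       (\<integral>\<xi>. sqrt ((2 * real l + 1) / (4 * pi)) * poly (legendre l) (x \<bullet> \<xi>) \<partial>N)"


section \<open>Gaussian vectors\<close>

text \<open>Degenerate (constant) variables count as Gaussian, as covariance matrices may be singular.\<close>

definition gaussian_rv :: "'w measure \<Rightarrow> ('w \<Rightarrow> real) \<Rightarrow> bool" where
  "gaussian_rv M X \<longleftrightarrow> X \<in> borel_measurable M \<and>
     (\<exists>m \<sigma>. \<sigma> \<ge> 0 \<and>
        distr M borel X =
          (if \<sigma> = 0 then return borel m else density lborel (\<lambda>y. ennreal (normal_density m \<sigma> y))))"

definition centred_gaussian_vector ::
  "'w measure \<Rightarrow> nat \<Rightarrow> (nat \<Rightarrow> nat \<Rightarrow> real) \<Rightarrow> (nat \<Rightarrow> 'w \<Rightarrow> real) \<Rightarrow> bool" where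
  "centred_gaussian_vector M d S Z \<longleftrightarrow>
     (\<forall>i<d. Z i \<in> borel_measurable M) \<and>
     (\<forall>u. gaussian_rv M (\<lambda>\<omega>. \<Sum>i<d. u i * Z i \<omega>)) \<and>
     (\<forall>i<d. (\<integral>\<omega>. Z i \<omega> \<partial>M) = 0) \<and>
     (\<forall>i<d. \<forall>j<d. (\<integral>\<omega>. Z i \<omega> * Z j \<omega> \<partial>M) = S i j)"


section \<open>Functions of class $C^k$ on d-dimensional space, for variable d\<close>

text \<open>
  Since d is not fixed, d-dimensional space is represented by the functions on the
  naturals that are \<^term>\<open>undefined\<close> outside \<open>{..<d}\<close>; on this set the product topology of
  \<^typ>\<open>nat \<Rightarrow> real\<close> is the Euclidean one.
\<close>

definition Rd :: "nat \<Rightarrow> (nat \<Rightarrow> real) set" where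
  "Rd d = (\<Pi>\<^sub>E i\<in>{..<d}. UNIV)"

definition partial_deriv :: "nat \<Rightarrow> ((nat \<Rightarrow> real) \<Rightarrow> real) \<Rightarrow> (nat \<Rightarrow> real) \<Rightarrow> real" where
  "partial_deriv i h x = deriv (\<lambda>s. h (x(i := s))) (x i)"

text \<open>All partial derivatives of order at most k exist and are continuous.\<close>

primrec Ck :: "nat \<Rightarrow> nat \<Rightarrow> ((nat \<Rightarrow> real) \<Rightarrow> real) \<Rightarrow> bool" where
  "Ck d 0 h \<longleftrightarrow> continuous_on (Rd d) h"
| "Ck d (Suc k) h \<longleftrightarrow> continuous_on (Rd d) h \<and>
     (\<forall>i<d. (\<forall>x\<in>Rd d. (\<lambda>s. h (x(i := s))) differentiable (at (x i))) \<and>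
            Ck d k (partial_deriv i h))"

text \<open>
  The derivative of h of order \<open>length us\<close> at x, as a multilinear form evaluated at the
  list of vectors us. The empty list gives h itself.
\<close>

primrec deriv_form ::
  "nat \<Rightarrow> (nat \<Rightarrow> real) list \<Rightarrow> ((nat \<Rightarrow> real) \<Rightarrow> real) \<Rightarrow> (nat \<Rightarrow> real) \<Rightarrow> real" where
  "deriv_form d [] h x = h x"
| "deriv_form d (u # us) h x = (\<Sum>i<d. u i * deriv_form d us (partial_deriv i h) x)"

definition deriv_op_norm :: "nat \<Rightarrow> nat \<Rightarrow> ((nat \<Rightarrow> real) \<Rightarrow> real) \<Rightarrow> (nat \<Rightarrow> real) \<Rightarrow> ereal" where
  "deriv_op_norm d j h x =
     (SUP us\<in>{us. length us = j \<and> (\<forall>u\<in>set us. u \<in> Rd d \<and> L2_set u {..<d} = 1)}.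
        ereal \<bar>deriv_form d us h x\<bar>)"

definition C3_norm :: "nat \<Rightarrow> ((nat \<Rightarrow> real) \<Rightarrow> real) \<Rightarrow> ereal" where
  "C3_norm d h = (SUP j\<in>{1, 2, 3}. SUP x\<in>Rd d. deriv_op_norm d j h x)"

end

theory Submission
  imports Defs "HOL-Analysis.Cross3" "HOL-Real_Asymp.Real_Asymp"
begin

text \<open>
  The idea of the proof. Put
  \<open>w\<^sub>i(\<xi>) = sqrt ((2 l + 1) / (4 \<pi> \<nu>)) P\<^sub>l(x\<^sub>i \<bullet> \<xi>)\<close>. The wave at \<open>x\<^sub>i\<close> is the integral \<open>X\<^sub>i\<close> of \<open>w\<^sub>i\<close> with
  respect to the Poisson random measure. For \<open>l \<ge> 1\<close> the weights integrate to 0 over the sphere, and since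
  the Legendre polynomial is a multiple of a reproducing kernel (\<open>legendre_reproducing\<close>), X has the
  covariance matrix of the Gaussian vector Z.

  Take X and Z independent and interpolate by \<open>X sin \<theta> + Z cos \<theta>\<close>, which keeps the covariance matrix
  fixed. In the derivative of the expectation of h with respect to \<open>\<theta>\<close>, the X-part is evaluated by the formula of Mecke
  (\<open>mecke\<close>) and the Z-part by \<open>gaussian_integration_by_parts\<close>. The second-order terms cancel.
  What remains is an integral over \<open>\<xi>\<close> of the third derivative of h, averaged over the Gaussian
  part, with \<open>w(\<xi>)\<close> in all three arguments (\<open>gaussian_comparison\<close>). It is estimated in two ways.

  First, it is at most \<open>\<parallel>w(\<xi>)\<parallel> ^ 3\<close>, whose integral is at most \<open>d\<^sup>2\<close> times the largest third absolute moment of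
  a weight. Bernstein's inequality \<open>(1 - x\<^sup>2) P(x) ^ 4 \<le> (2 / (2 l + 1))\<^sup>2\<close>, proved by Sonin's monotonicity
  argument, shows that these moments are of order \<open>1 / sqrt \<nu>\<close>, uniformly in l. This
  gives the bound \<open>d\<^sup>2 / sqrt \<nu>\<close>.

  Secondly, one of the three derivatives can be removed. Up to the factor
  \<open>\<kappa> = sqrt ((2 l + 1) / (4 \<pi> \<nu>))\<close>, the vector \<open>w(\<xi>)\<close> equals S a for some a with \<open>a \<bullet> S a \<le> 1\<close>, because
  S is the Gram matrix of a reproducing kernel with value 1 on the diagonal
  (\<open>legendre_kernel_solve\<close>). Gaussian integration by parts in the direction \<open>S a\<close> trades the
  derivative for the factor \<open>a \<bullet> Z\<close> of variance at most 1 (\<open>smooth_form_square\<close>). It costs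
  \<open>1 / cos \<theta>\<close>, which the interpolation supplies. The remaining bound \<open>\<kappa> \<parallel>w(\<xi>)\<parallel>\<^sup>2\<close> integrates to
  \<open>\<kappa> d\<close>, which is of order \<open>d sqrt (l / \<nu>)\<close>.

  The smaller of both bounds is the assertion, since \<open>ln l \<ge> 1\<close> for \<open>l \<ge> 3\<close>.
\<close>

section \<open>Legendre polynomials\<close>

lemma poly_eqI_real:
  fixes p q :: "real poly"
  shows "(\<And>x. poly p x = poly q x) \<Longrightarrow> p = q"
  using poly_eq_poly_eq_iff by blast

lemma pderiv_power_Suc_mult:
  fixes p r :: "real poly"
  shows "pderiv (p ^ Suc k * r) = p ^ k * (of_nat (Suc k) * pderiv p * r + p * pderiv r)"
  by (rule poly_eqI_real) (simp add: pderiv_mult pderiv_power_Suc algebra_simps of_nat_poly del: power_Suc, simp add: algebra_simps)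

lemma pderiv_funpow_mult_X:
  fixes q :: "real poly"
  shows "(pderiv ^^ Suc m) ([:0, 1:] * q) = [:0, 1:] * (pderiv ^^ Suc m) q + of_nat (Suc m) * (pderiv ^^ m) q"
proof (induction m)
  case 0
  show ?case by (simp add: pderiv_mult pderiv_pCons algebra_simps)
next
  case (Suc m)
  have "(pderiv ^^ Suc (Suc m)) ([:0, 1:] * q) = pderiv ([:0, 1:] * (pderiv ^^ Suc m) q + of_nat (Suc m) * (pderiv ^^ m) q)"
    using Suc.IH by simp
  also have "\<dots> = [:0, 1:] * (pderiv ^^ Suc (Suc m)) q + of_nat (Suc (Suc m)) * (pderiv ^^ Suc m) q"
    by (simp add: pderiv_add pderiv_mult pderiv_pCons algebra_simps del: mult_pCons_left mult_pCons_right)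
  finally show ?case .
qed

lemma pderiv_funpow_mult_quadratic:
  fixes q :: "real poly"
  shows "(pderiv ^^ Suc (Suc m)) ([:-1, 0, 1:] * q) =
    [:-1, 0, 1:] * (pderiv ^^ Suc (Suc m)) q + of_nat (2 * Suc (Suc m)) * ([:0, 1:] * (pderiv ^^ Suc m) q)
      + of_nat (Suc (Suc m) * Suc m) * (pderiv ^^ m) q"
proof -
  have *: "[:-1, 0, 1:] * q = [:0, 1:] * ([:0, 1:] * q) - q" by simp
  have D: "(pderiv ^^ k) (p - q) = (pderiv ^^ k) p - (pderiv ^^ k) q" for k and p q :: "real poly"
    by (induction k) (auto simp: pderiv_diff)
  show ?thesis
    unfolding * D pderiv_funpow_mult_X
    by (simp add: algebra_simps del: funpow.simps)
qed

lemma pderiv_funpow_power_quadratic: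
  assumes "m \<le> n"
  shows "\<exists>r :: real poly. (pderiv ^^ m) ([:-1, 0, 1:] ^ n) = [:-1, 0, 1:] ^ (n - m) * r"
  using assms
proof (induction m)
  case 0
  show ?case by (auto intro: exI[of _ 1])
next
  case (Suc m)
  then obtain r :: "real poly" where r: "(pderiv ^^ m) ([:-1, 0, 1:] ^ n) = [:-1, 0, 1:] ^ (n - m) * r" by auto
  obtain k where k: "n - m = Suc k" using Suc.prems by (metis Suc_diff_Suc Suc_le_eq)
  have "(pderiv ^^ Suc m) ([:-1, 0, 1:] ^ n) = [:-1, 0, 1:] ^ k * (of_nat (Suc k) * [:0, 2:] * r + [:-1, 0, 1:] * pderiv r)"
    unfolding funpow.simps o_apply r k pderiv_power_Suc_mult by (simp add: pderiv_pCons)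
  moreover have "n - Suc m = k" using k by simp
  ultimately show ?case by blast
qed

text \<open>
  The polynomial \<open>v = (x\<^sup>2 - 1) ^ n\<close> satisfies \<open>(x\<^sup>2 - 1) v' = 2 n x v\<close>. Differentiating this
  n + 1 times by Leibniz' rule gives the Legendre equation for the n-th derivative of v.
\<close>

lemma legendre_deriv_ode_aux:
  fixes n :: nat
  defines "v \<equiv> [:-1, 0, 1:] ^ n :: real poly"
  defines "y \<equiv> (pderiv ^^ n) v"
  shows "[:-1, 0, 1:] * pderiv (pderiv y) + [:0, 2:] * pderiv y = of_nat (n * Suc n) * y"
proof (cases n)
  case 0
  thus ?thesis by (simp add: y_def v_def)
next
  case (Suc m)
  have v': "[:-1, 0, 1:] * pderiv v = of_nat (2 * n) * ([:0, 1:] * v)"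
  proof (rule poly_eqI_real)
    fix x
    have "pderiv v = [:-1, 0, 1:] ^ m * (of_nat (Suc m) * [:0, 2:])"
      using pderiv_power_Suc_mult[of "[:-1, 0, 1:]" m 1] by (simp add: v_def Suc pderiv_pCons del: power_Suc)
    thus "poly ([:-1, 0, 1:] * pderiv v) x = poly (of_nat (2 * n) * ([:0, 1:] * v)) x"
      by (simp add: v_def Suc of_nat_poly algebra_simps)
  qed
  have "(pderiv ^^ Suc (Suc m)) ([:-1, 0, 1:] * pderiv v) = (pderiv ^^ Suc (Suc m)) (of_nat (2 * n) * ([:0, 1:] * v))"
    by (simp only: v')
  also have "\<dots> = of_nat (2 * n) * (pderiv ^^ Suc (Suc m)) ([:0, 1:] * v)"
  proof -
    have "(pderiv ^^ k) (of_nat c * p) = of_nat c * (pderiv ^^ k) p" for k c and p :: "real poly"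
      by (induction k) (auto simp: pderiv_mult)
    thus ?thesis by blast
  qed
  also have "\<dots> = of_nat (2 * n) * ([:0, 1:] * pderiv y + of_nat (Suc n) * y)"
    unfolding pderiv_funpow_mult_X by (simp add: y_def Suc)
  finally have "[:-1, 0, 1:] * (pderiv ^^ Suc (Suc m)) (pderiv v)
      + of_nat (2 * Suc (Suc m)) * ([:0, 1:] * (pderiv ^^ Suc m) (pderiv v))
      + of_nat (Suc (Suc m) * Suc m) * (pderiv ^^ m) (pderiv v) =
      of_nat (2 * n) * ([:0, 1:] * pderiv y + of_nat (Suc n) * y)"
    unfolding pderiv_funpow_mult_quadratic .
  moreover have "(pderiv ^^ k) (pderiv v) = (pderiv ^^ Suc k) v" for k by (simp add: funpow_swap1)
  ultimately have eq: "[:-1, 0, 1:] * pderiv (pderiv y) + of_nat (2 * Suc n) * ([:0, 1:] * pderiv y) + of_nat (Suc n * n) * y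
     = of_nat (2 * n) * ([:0, 1:] * pderiv y + of_nat (Suc n) * y)"
    by (simp add: y_def Suc del: mult_pCons_left mult_pCons_right mult_Suc of_nat_mult)
  show ?thesis
  proof (rule poly_eqI_real)
    fix x
    show "poly ([:-1, 0, 1:] * pderiv (pderiv y) + [:0, 2:] * pderiv y) x = poly (of_nat (n * Suc n) * y) x"
      using arg_cong[OF eq, of "\<lambda>p. poly p x"] by (simp add: of_nat_poly algebra_simps)
  qed
qed

lemma legendre_ode_poly:
  "[:-1, 0, 1:] * pderiv (pderiv (legendre n)) + [:0, 2:] * pderiv (legendre n) = of_nat (n * Suc n) * legendre n"
proof -
  define c :: real where "c = 1 / (2 ^ n * fact n)"
  define y :: "real poly" where "y = (pderiv ^^ n) ([:-1, 0, 1:] ^ n)"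
  have L: "legendre n = smult c y" by (simp add: legendre_def c_def y_def)
  have "[:-1, 0, 1:] * pderiv (pderiv y) + [:0, 2:] * pderiv y = of_nat (n * Suc n) * y"
    unfolding y_def by (rule legendre_deriv_ode_aux)
  hence "smult c ([:-1, 0, 1:] * pderiv (pderiv y) + [:0, 2:] * pderiv y) = smult c (of_nat (n * Suc n) * y)" by simp
  thus ?thesis unfolding L by (simp add: pderiv_smult smult_add_right algebra_simps mult_smult_right
    del: mult_pCons_left mult_pCons_right mult_Suc of_nat_mult)
qed

lemma legendre_ode:
  "(1 - x\<^sup>2) * poly (pderiv (pderiv (legendre n))) x - 2 * x * poly (pderiv (legendre n)) x
     + real (n * Suc n) * poly (legendre n) x = 0"
proof -
  have "poly ([:-1, 0, 1:] * pderiv (pderiv (legendre n)) + [:0, 2:] * pderiv (legendre n)) x = poly (of_nat (n * Suc n) * legendre n) x"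
    by (simp only: legendre_ode_poly)
  thus ?thesis by (simp add: algebra_simps power2_eq_square of_nat_poly)
qed

lemma poly_pderiv_funpow_power_at_root:
  fixes u :: "real poly"
  shows "poly ((pderiv ^^ n) ([:-a, 1:] ^ n * u)) a = fact n * poly u a"
proof (induction n arbitrary: u)
  case (Suc n)
  have "pderiv ([:-a, 1:] ^ Suc n * u) = [:-a, 1:] ^ n * (of_nat (Suc n) * u + [:-a, 1:] * pderiv u)"
    unfolding pderiv_power_Suc_mult by (simp add: pderiv_pCons)
  hence "(pderiv ^^ Suc n) ([:-a, 1:] ^ Suc n * u) = (pderiv ^^ n) ([:-a, 1:] ^ n * (of_nat (Suc n) * u + [:-a, 1:] * pderiv u))"
    by (simp add: funpow_swap1)
  thus ?case by (simp only: Suc.IH) (simp add: of_nat_poly algebra_simps)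
qed auto

lemma legendre_1 [simp]: "poly (legendre n) 1 = 1"
proof -
  have "[:-1, 0, 1:] ^ n = [:-1, 1:] ^ n * ([:1, 1:] :: real poly) ^ n"
    by (simp flip: power_mult_distrib)
  hence "poly ((pderiv ^^ n) ([:-1, 0, 1:] ^ n)) 1 = fact n * (2 :: real) ^ n"
    using poly_pderiv_funpow_power_at_root[of n 1 "[:1, 1:] ^ n"] by (simp add: poly_power)
  thus ?thesis by (simp add: legendre_def)
qed

lemma legendre_minus_1: "poly (legendre n) (-1) = (-1) ^ n"
proof -
  have "[:-1, 0, 1:] ^ n = [:-(-1), 1:] ^ n * ([:-1, 1:] :: real poly) ^ n"
    by (simp flip: power_mult_distrib)
  hence "poly ((pderiv ^^ n) ([:-1, 0, 1:] ^ n)) (-1) = fact n * (-2 :: real) ^ n"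
    using poly_pderiv_funpow_power_at_root[of n "-1" "[:-1, 1:] ^ n"] by (simp add: poly_power)
  moreover have "(-2 :: real) ^ n = (-1) ^ n * 2 ^ n"
    by (simp flip: power_mult_distrib)
  ultimately show ?thesis by (simp add: legendre_def)
qed

lemma has_integral_pderiv:
  fixes p :: "real poly"
  shows "(poly (pderiv p) has_integral poly p 1 - poly p (-1)) {-1..1}"
  by (rule fundamental_theorem_of_calculus)
     (auto intro!: DERIV_subset[OF poly_DERIV] simp flip: has_real_derivative_iff_has_vector_derivative)

lemma poly_integrable [simp, intro]: "poly (p :: real poly) integrable_on {a..b}"
  by (intro integrable_continuous_interval continuous_intros)

lemma pderiv_funpow_eq_0:
  fixes q :: "real poly"
  assumes "degree q < m"
  shows "(pderiv ^^ m) q = 0"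
  using assms
proof (induction m arbitrary: q)
  case (Suc m)
  show ?case
  proof (cases "degree q = 0")
    case True
    have "(pderiv ^^ m) (0 :: real poly) = 0" by (induction m) auto
    moreover have "pderiv q = 0" using True by (simp add: pderiv_eq_0_iff)
    ultimately show ?thesis by (simp add: funpow_swap1)
  next
    case False
    hence "(pderiv ^^ m) (pderiv q) = 0" using Suc by (auto simp: degree_pderiv)
    thus ?thesis by (simp add: funpow_swap1)
  qed
qed auto

text \<open>
  Integration by parts m times: below order n, all derivatives of \<open>(x\<^sup>2 - 1) ^ n\<close> vanish at the
  end points, so there are no boundary terms.
\<close>

lemma rodrigues_orthogonal:
  fixes q :: "real poly"
  assumes "m \<le> n" "(pderiv ^^ m) q = 0"
  shows "integral {-1..1} (poly ((pderiv ^^ m) ([:-1, 0, 1:] ^ n) * q)) = 0"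
  using assms
proof (induction m arbitrary: q)
  case (Suc m)
  define w :: "real poly" where "w = (pderiv ^^ m) ([:-1, 0, 1:] ^ n)"
  have eq: "poly (pderiv w * q) = (\<lambda>x. poly (pderiv (w * q)) x - poly (w * pderiv q) x)"
    by (rule ext) (simp add: pderiv_mult algebra_simps)
  obtain r :: "real poly" where r: "w = [:-1, 0, 1:] ^ (n - m) * r"
    using pderiv_funpow_power_quadratic[of m n] Suc.prems by (auto simp: w_def)
  have "poly w 1 = 0" "poly w (-1) = 0" using Suc.prems by (auto simp: r poly_power)
  hence "integral {-1..1} (poly (pderiv (w * q))) = 0"
    using integral_unique[OF has_integral_pderiv[of "w * q"]] by simp
  moreover have "integral {-1..1} (poly (w * pderiv q)) = 0"
    unfolding w_def using Suc by (intro Suc.IH) (auto simp: funpow_swap1)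
  ultimately show ?case
    unfolding funpow.simps o_apply w_def[symmetric] eq by (subst integral_diff) auto
next
  case 0
  have "poly (0 :: real poly) = (\<lambda>_. 0)" by auto
  thus ?case using 0 by simp
qed

lemma legendre_orthogonal:
  assumes "(pderiv ^^ n) q = 0"
  shows "integral {-1..1} (poly (legendre n * q)) = 0"
proof -
  have "poly (legendre n * q) = (\<lambda>x. 1 / (2 ^ n * fact n) * poly ((pderiv ^^ n) ([:-1, 0, 1:] ^ n) * q) x)"
    by (rule ext) (simp add: legendre_def)
  thus ?thesis using rodrigues_orthogonal[of n n q] assms by (simp only: integral_mult_right mult_zero_right)
qed

lemma pderiv_funpow_Suc_legendre: "(pderiv ^^ Suc n) (legendre n) = 0"
proof -
  define v :: "real poly" where "v = [:-1, 0, 1:] ^ n"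
  have s: "(pderiv ^^ k) (smult c p) = smult c ((pderiv ^^ k) p)" for k c and p :: "real poly"
    by (induction k) (auto simp: pderiv_smult)
  have "degree v \<le> 2 * n"
    using degree_power_le[of "[:-1, 0, 1:] :: real poly" n] by (simp add: v_def)
  hence "(pderiv ^^ (Suc n + n)) v = 0"
    by (intro pderiv_funpow_eq_0) auto
  thus ?thesis unfolding legendre_def s v_def[symmetric] funpow_add o_apply by simp
qed

text \<open>
  The polynomial \<open>x P' - n P\<close> has degree below n and is therefore orthogonal to P. Together with
  the integral of \<open>(x P\<^sup>2)'\<close>, which is \<open>P(1)\<^sup>2 + P(-1)\<^sup>2 = 2\<close>, this determines the integral of \<open>P\<^sup>2\<close>.
\<close>

lemma integral_legendre_square: "integral {-1..1} (\<lambda>x. (poly (legendre n) x)\<^sup>2) = 2 / (2 * real n + 1)"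
proof -
  let ?P = "legendre n"
  define I where "I = integral {-1..1} (\<lambda>x. (poly ?P x)\<^sup>2)"
  have intP: "(\<lambda>x. (poly ?P x)\<^sup>2) integrable_on {-1..1}"
    by (intro integrable_continuous_interval continuous_intros)
  have intX: "(\<lambda>x. x * poly ?P x * poly (pderiv ?P) x) integrable_on {-1..1}"
    by (intro integrable_continuous_interval continuous_intros)
  have "(pderiv ^^ n) ([:0, 1:] * pderiv ?P - of_nat n * ?P) = 0"
  proof (cases n)
    case (Suc m)
    have D: "(pderiv ^^ k) (p - q) = (pderiv ^^ k) p - (pderiv ^^ k) q" for k and p q :: "real poly"
      by (induction k) (auto simp: pderiv_diff)
    have C: "(pderiv ^^ k) (of_nat c * p) = of_nat c * (pderiv ^^ k) p" for k c and p :: "real poly"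
      by (induction k) (auto simp: pderiv_mult)
    have "(pderiv ^^ n) (pderiv ?P) = 0" using pderiv_funpow_Suc_legendre[of n] by (simp add: funpow_swap1)
    moreover have "(pderiv ^^ m) (pderiv ?P) = (pderiv ^^ n) ?P" by (simp add: Suc funpow_swap1)
    ultimately show ?thesis
      unfolding D C using pderiv_funpow_mult_X[of m "pderiv ?P"] by (simp add: Suc del: mult_pCons_left)
  qed (simp add: legendre_def)
  from legendre_orthogonal[OF this]
  have "integral {-1..1} (poly (?P * ([:0, 1:] * pderiv ?P - of_nat n * ?P))) = 0" .
  also have "poly (?P * ([:0, 1:] * pderiv ?P - of_nat n * ?P)) = (\<lambda>x. x * poly ?P x * poly (pderiv ?P) x - real n * (poly ?P x)\<^sup>2)"
    by (rule ext) (simp add: of_nat_poly algebra_simps power2_eq_square)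
  finally have "integral {-1..1} (\<lambda>x. x * poly ?P x * poly (pderiv ?P) x - real n * (poly ?P x)\<^sup>2) = 0" .
  hence 1: "integral {-1..1} (\<lambda>x. x * poly ?P x * poly (pderiv ?P) x) = real n * I"
    using intP intX by (subst (asm) integral_diff) (intro integrable_continuous_interval continuous_intros | simp add: I_def)+
  have "integral {-1..1} (poly (pderiv ([:0, 1:] * ?P * ?P))) = 2"
    using integral_unique[OF has_integral_pderiv[of "[:0, 1:] * ?P * ?P"]]
    by (simp add: legendre_minus_1 flip: power_mult_distrib)
  also have "poly (pderiv ([:0, 1:] * ?P * ?P)) = (\<lambda>x. (poly ?P x)\<^sup>2 + 2 * (x * poly ?P x * poly (pderiv ?P) x))"
    by (rule ext) (simp add: pderiv_mult pderiv_pCons algebra_simps power2_eq_square)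
  also have "integral {-1..1} \<dots> = I + 2 * (real n * I)"
    using intP intX 1 by (subst integral_add) (intro integrable_continuous_interval continuous_intros | simp add: I_def)+
  finally have "I * (2 * real n + 1) = 2" by (simp add: algebra_simps)
  thus ?thesis by (simp add: I_def field_simps)
qed

text \<open>
  If p solves the Legendre equation with eigenvalue L, this quantity has the derivative \<open>2 x p'\<^sup>2\<close>.
  On [-1, 1] it is therefore smallest at 0 and grows towards the end points.
\<close>

definition legendre_energy :: "real \<Rightarrow> real poly \<Rightarrow> real \<Rightarrow> real" where
  "legendre_energy L p x = (1 - x\<^sup>2) * (poly (pderiv p) x)\<^sup>2 + L * (poly p x)\<^sup>2"

lemma legendre_energy_deriv:
  assumes "(1 - x\<^sup>2) * poly (pderiv (pderiv p)) x - 2 * x * poly (pderiv p) x + L * poly p x = 0"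
  shows "(legendre_energy L p has_real_derivative 2 * x * (poly (pderiv p) x)\<^sup>2) (at x)"
proof -
  have "(legendre_energy L p has_real_derivative
      -2 * x * (poly (pderiv p) x)\<^sup>2 + (1 - x\<^sup>2) * (2 * poly (pderiv p) x * poly (pderiv (pderiv p)) x)
        + L * (2 * poly p x * poly (pderiv p) x)) (at x)"
    unfolding legendre_energy_def[abs_def]
    by (auto intro!: derivative_eq_intros poly_DERIV)
  also have "-2 * x * (poly (pderiv p) x)\<^sup>2 + (1 - x\<^sup>2) * (2 * poly (pderiv p) x * poly (pderiv (pderiv p)) x)
        + L * (2 * poly p x * poly (pderiv p) x) =
      2 * poly (pderiv p) x * ((1 - x\<^sup>2) * poly (pderiv (pderiv p)) x - 2 * x * poly (pderiv p) x + L * poly p x)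
      + 2 * x * (poly (pderiv p) x)\<^sup>2"
    by (simp add: algebra_simps power2_eq_square)
  finally show ?thesis by (simp add: assms)
qed

lemma legendre_energy_mono:
  assumes "\<And>x. \<bar>x\<bar> \<le> 1 \<Longrightarrow> (1 - x\<^sup>2) * poly (pderiv (pderiv p)) x - 2 * x * poly (pderiv p) x + L * poly p x = 0"
  shows "0 \<le> x \<Longrightarrow> x \<le> y \<Longrightarrow> y \<le> 1 \<Longrightarrow> legendre_energy L p x \<le> legendre_energy L p y"
    and "-1 \<le> x \<Longrightarrow> x \<le> y \<Longrightarrow> y \<le> 0 \<Longrightarrow> legendre_energy L p y \<le> legendre_energy L p x"
proof -
  show "0 \<le> x \<Longrightarrow> x \<le> y \<Longrightarrow> y \<le> 1 \<Longrightarrow> legendre_energy L p x \<le> legendre_energy L p y"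
    using assms by (elim DERIV_nonneg_imp_nondecreasing) (force intro: legendre_energy_deriv)
  show "-1 \<le> x \<Longrightarrow> x \<le> y \<Longrightarrow> y \<le> 0 \<Longrightarrow> legendre_energy L p y \<le> legendre_energy L p x"
    using assms by (elim DERIV_nonpos_imp_nonincreasing) (force intro: legendre_energy_deriv mult_nonpos_nonneg)
qed

text \<open>
  The difference r of both sides solves the same equation and vanishes at 1, so its energy is 0
  at 1. As the energy grows on [0, 1], r vanishes there, and a polynomial with infinitely many
  zeros is 0.
\<close>

lemma legendre_ode_unique:
  assumes "\<And>x. \<bar>x\<bar> \<le> 1 \<Longrightarrow> (1 - x\<^sup>2) * poly (pderiv (pderiv k)) x - 2 * x * poly (pderiv k) x
             + real (n * Suc n) * poly k x = 0"
    and "n \<ge> 1"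
  shows "k = smult (poly k 1) (legendre n)"
proof -
  define r where "r = k - smult (poly k 1) (legendre n)"
  let ?L = "real (n * Suc n)"
  have ode: "(1 - x\<^sup>2) * poly (pderiv (pderiv r)) x - 2 * x * poly (pderiv r) x + ?L * poly r x = 0"
    if "\<bar>x\<bar> \<le> 1" for x
  proof -
    have "(1 - x\<^sup>2) * poly (pderiv (pderiv r)) x - 2 * x * poly (pderiv r) x + ?L * poly r x =
      ((1 - x\<^sup>2) * poly (pderiv (pderiv k)) x - 2 * x * poly (pderiv k) x + ?L * poly k x)
      - poly k 1 * ((1 - x\<^sup>2) * poly (pderiv (pderiv (legendre n))) x - 2 * x * poly (pderiv (legendre n)) x
     + ?L * poly (legendre n) x)"
      by (simp add: r_def pderiv_diff pderiv_smult algebra_simps)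
    thus ?thesis using assms(1)[OF that] legendre_ode[of x n] by simp
  qed
  have "poly r x = 0" if "x \<in> {0<..<1}" for x
  proof -
    have "legendre_energy ?L r x \<le> legendre_energy ?L r 1"
      using ode that by (intro legendre_energy_mono(1)) auto
    also have "\<dots> = 0" by (simp add: legendre_energy_def r_def)
    finally have "(1 - x\<^sup>2) * (poly (pderiv r) x)\<^sup>2 + ?L * (poly r x)\<^sup>2 \<le> 0" by (simp add: legendre_energy_def)
    moreover have "x\<^sup>2 \<le> 1" using that by (intro power_le_one) auto
    hence "(1 - x\<^sup>2) * (poly (pderiv r) x)\<^sup>2 \<ge> 0" by simp
    ultimately have "?L * (poly r x)\<^sup>2 \<le> 0" by linarith
    moreover have "?L > 0" using assms(2) by (simp only: of_nat_0_less_iff) simp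
    ultimately show ?thesis by (metis mult_le_0_iff not_less power2_less_eq_zero_iff zero_le_power2 order_antisym)
  qed
  hence "{0<..<1} \<subseteq> {x. poly r x = 0}" by auto
  hence "infinite {x. poly r x = 0}" using infinite_super[OF _ infinite_Ioo[of 0 "1::real"]] by simp
  hence "r = 0" using poly_roots_finite by blast
  thus ?thesis by (simp add: r_def)
qed

text \<open>
  On [-1, 1] the energy is at least its value at 0. Its integral is known: integrating by parts
  and using the differential equation, the integral of \<open>(1 - x\<^sup>2) P'\<^sup>2\<close> is L times that of \<open>P\<^sup>2\<close>.
\<close>

lemma legendre_energy_0:
  shows "legendre_energy (real (n * Suc n)) (legendre n) 0 \<le> real (n * Suc n) * (2 / (2 * real n + 1))"
proof -
  let ?P = "legendre n" and ?L = "real (n * Suc n)"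
  let ?E = "legendre_energy ?L ?P"
  let ?f = "\<lambda>x. (1 - x\<^sup>2) * (poly (pderiv ?P) x)\<^sup>2" and ?g = "\<lambda>x. (poly ?P x)\<^sup>2"
  have int: "?f integrable_on {-1..1}" "?g integrable_on {-1..1}" "?E integrable_on {-1..1}"
    unfolding legendre_energy_def[abs_def]
    by (intro integrable_continuous_interval continuous_intros)+
  have "?E 0 \<le> ?E x" if "x \<in> {-1..1}" for x
    using legendre_energy_mono[of ?P ?L 0 x] legendre_energy_mono[of ?P ?L x 0] legendre_ode[of _ n] that by fastforce
  hence "integral {-1..1} (\<lambda>x::real. ?E 0) \<le> integral {-1..1} ?E"
    using int by (intro integral_le) auto
  also have "integral {-1..1} ?E = integral {-1..1} ?f + ?L * integral {-1..1} ?g"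
    unfolding legendre_energy_def[abs_def] using int by (subst integral_add) ((intro integrable_continuous_interval continuous_intros)+, simp)
  also have "integral {-1..1} ?f = ?L * integral {-1..1} ?g"
  proof -
    have "integral {-1..1} (poly (pderiv ([:1, 0, -1:] * ?P * pderiv ?P))) = 0"
      using integral_unique[OF has_integral_pderiv[of "[:1, 0, -1:] * ?P * pderiv ?P"]] by simp
    also have "poly (pderiv ([:1, 0, -1:] * ?P * pderiv ?P)) = (\<lambda>x. ?f x - ?L * ?g x)"
    proof
      fix x
      have "poly (pderiv ([:1, 0, -1:] * ?P * pderiv ?P)) x = ?f x + poly ?P x * ((1 - x\<^sup>2) * poly (pderiv (pderiv ?P)) x - 2 * x * poly (pderiv ?P) x)"
        by (simp add: pderiv_mult pderiv_pCons power2_eq_square del: mult_pCons_left) (simp add: algebra_simps)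
      also have "(1 - x\<^sup>2) * poly (pderiv (pderiv ?P)) x - 2 * x * poly (pderiv ?P) x = - (?L * poly ?P x)"
        using legendre_ode[of x n] by linarith
      finally show "poly (pderiv ([:1, 0, -1:] * ?P * pderiv ?P)) x = ?f x - ?L * ?g x"
        by (simp add: power2_eq_square)
    qed
    finally show ?thesis
      using int by (subst (asm) integral_diff) ((intro integrable_continuous_interval continuous_intros)+, simp)
  qed
  finally have "integral {-1..1} (\<lambda>x::real. ?E 0) \<le> ?L * integral {-1..1} ?g + ?L * integral {-1..1} ?g" .
  moreover have "integral {-1..1} (\<lambda>x::real. ?E 0) = 2 * ?E 0" by simp
  ultimately show ?thesis unfolding integral_legendre_square by linarith
qed

section \<open>Pointwise decay of Legendre polynomials\<close>

text \<open>
  The algebra behind \<open>sonin_deriv\<close>, with s, c for sine and cosine: apart from the definitions of q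
  and d, only the vanishing of z enters, and z vanishes because of \<open>s\<^sup>2 + c\<^sup>2 = 1\<close>.
\<close>

lemma sonin_algebra:
  fixes s c p p' L q d :: real
  assumes q: "q = c * p - 2 * s\<^sup>2 * p'" and d: "d = (4 * L + 1) * s\<^sup>2 + 1" and sc: "c\<^sup>2 = 1 - s\<^sup>2"
  shows "c * (p\<^sup>2 * d\<^sup>2 + q\<^sup>2 * d) + s * (2 * p * (- s * p') * d\<^sup>2 +
       (2 * q * (- s * ((1 + 2 * L) * p + c * p')) * d - q\<^sup>2 * ((4 * L + 1) * 2 * s * c)))
     = 2 * c * q\<^sup>2"
proof -
  define z where "z = p * d - c * q - 2 * s\<^sup>2 * ((1 + 2 * L) * p + c * p')"
  have "z = p * (1 - s\<^sup>2 - c\<^sup>2)"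
    unfolding z_def q d by (simp add: algebra_simps power2_eq_square)
  hence "z = 0" using sc by simp
  have "c * (p\<^sup>2 * d\<^sup>2 + q\<^sup>2 * d) + s * (2 * p * (- s * p') * d\<^sup>2 +
       (2 * q * (- s * ((1 + 2 * L) * p + c * p')) * d - q\<^sup>2 * ((4 * L + 1) * 2 * s * c)))
     = 2 * c * q\<^sup>2 + d * q * z + 2 * c * q\<^sup>2 * (d - 1 - (4 * L + 1) * s\<^sup>2) + p * d\<^sup>2 * (c * p - 2 * s\<^sup>2 * p' - q)"
    unfolding z_def by (simp add: algebra_simps power2_eq_square)
  thus ?thesis using \<open>z = 0\<close> q d by simp
qed

text \<open>
  The function \<open>u(\<theta>) = sqrt(sin \<theta>) P(cos \<theta>)\<close> solves \<open>u'' + \<phi> u = 0\<close> with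
  \<open>\<phi> = D / (4 sin\<^sup>2 \<theta>) = (n + 1/2)\<^sup>2 + 1 / (4 sin\<^sup>2 \<theta>)\<close>. The function differentiated here is Sonin's
  \<open>u\<^sup>2 + u'\<^sup>2 / \<phi>\<close>, written without the singularity at the poles. Its derivative is
  \<open>- u'\<^sup>2 \<phi>' / \<phi>\<^sup>2\<close>, whose sign is that of the cosine.
\<close>

lemma sonin_deriv:
  fixes n :: nat and \<theta> :: real
  defines "L \<equiv> real (n * Suc n)"
  defines "p \<equiv> \<lambda>\<theta>. poly (legendre n) (cos \<theta>)" and "p' \<equiv> \<lambda>\<theta>. poly (pderiv (legendre n)) (cos \<theta>)"
  defines "Q \<equiv> \<lambda>\<theta>. cos \<theta> * p \<theta> - 2 * (sin \<theta>)\<^sup>2 * p' \<theta>" and "D \<equiv> \<lambda>\<theta>. (4 * L + 1) * (sin \<theta>)\<^sup>2 + 1"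
  shows "((\<lambda>\<theta>. sin \<theta> * ((p \<theta>)\<^sup>2 + (Q \<theta>)\<^sup>2 / D \<theta>)) has_real_derivative
           2 * cos \<theta> * (Q \<theta> / D \<theta>)\<^sup>2) (at \<theta>)"
proof -
  define p'' where "p'' = poly (pderiv (pderiv (legendre n))) (cos \<theta>)"
  let ?s = "sin \<theta>" and ?c = "cos \<theta>"
  have "L \<ge> 0" by (simp add: L_def)
  have D0: "D t > 0" for t
    unfolding D_def using \<open>L \<ge> 0\<close> by (intro add_nonneg_pos mult_nonneg_nonneg) auto
  have sc: "?c\<^sup>2 = 1 - ?s\<^sup>2" by (simp add: cos_squared_eq)
  have ode: "?s\<^sup>2 * p'' = 2 * ?c * p' \<theta> - L * p \<theta>"
    using legendre_ode[of ?c n] by (simp add: p''_def p'_def p_def L_def sc)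
  have dp: "(p has_real_derivative - ?s * p' \<theta>) (at \<theta>)" and dp': "(p' has_real_derivative - ?s * p'') (at \<theta>)"
    unfolding p_def p'_def p''_def by (auto intro!: derivative_eq_intros DERIV_chain2[OF poly_DERIV])
  have "(Q has_real_derivative - ?s * p \<theta> + ?c * (- ?s * p' \<theta>) - 4 * ?s * ?c * p' \<theta> - 2 * ?s\<^sup>2 * (- ?s * p'')) (at \<theta>)"
    unfolding Q_def by (rule derivative_eq_intros dp dp' refl)+ simp
  also have "- ?s * p \<theta> + ?c * (- ?s * p' \<theta>) - 4 * ?s * ?c * p' \<theta> - 2 * ?s\<^sup>2 * (- ?s * p'')
     = - ?s * p \<theta> - 5 * ?s * ?c * p' \<theta> + 2 * ?s * (?s\<^sup>2 * p'')" by (simp add: algebra_simps power2_eq_square)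
  also have "\<dots> = - ?s * ((1 + 2 * L) * p \<theta> + ?c * p' \<theta>)" unfolding ode by (simp add: algebra_simps)
  finally have dQ: "(Q has_real_derivative - ?s * ((1 + 2 * L) * p \<theta> + ?c * p' \<theta>)) (at \<theta>)" .
  have dD: "(D has_real_derivative (4 * L + 1) * 2 * ?s * ?c) (at \<theta>)"
    unfolding D_def by (auto intro!: derivative_eq_intros)
  let ?q = "Q \<theta>" and ?d = "D \<theta>"
  have "((\<lambda>\<theta>. sin \<theta> * ((p \<theta>)\<^sup>2 + (Q \<theta>)\<^sup>2 / D \<theta>)) has_real_derivative
     ?c * ((p \<theta>)\<^sup>2 + ?q\<^sup>2 / ?d) + ?s * (2 * p \<theta> * (- ?s * p' \<theta>) +
       (2 * ?q * (- ?s * ((1 + 2 * L) * p \<theta> + ?c * p' \<theta>)) * ?d - ?q\<^sup>2 * ((4 * L + 1) * 2 * ?s * ?c)) / (?d * ?d))) (at \<theta>)"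
    using D0[of \<theta>] by - ((rule derivative_eq_intros dp dQ dD refl | simp)+)
  also have "?c * ((p \<theta>)\<^sup>2 + ?q\<^sup>2 / ?d) + ?s * (2 * p \<theta> * (- ?s * p' \<theta>) +
       (2 * ?q * (- ?s * ((1 + 2 * L) * p \<theta> + ?c * p' \<theta>)) * ?d - ?q\<^sup>2 * ((4 * L + 1) * 2 * ?s * ?c)) / (?d * ?d))
     = 2 * ?c * (?q / ?d)\<^sup>2"
  proof -
    have "?c * ((p \<theta>)\<^sup>2 * ?d\<^sup>2 + ?q\<^sup>2 * ?d) + ?s * (2 * p \<theta> * (- ?s * p' \<theta>) * ?d\<^sup>2 +
       (2 * ?q * (- ?s * ((1 + 2 * L) * p \<theta> + ?c * p' \<theta>)) * ?d - ?q\<^sup>2 * ((4 * L + 1) * 2 * ?s * ?c)))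
     = 2 * ?c * ?q\<^sup>2"
      by (rule sonin_algebra[OF _ _ sc]) (simp_all add: Q_def D_def)
    hence "(?c * ((p \<theta>)\<^sup>2 * ?d\<^sup>2 + ?q\<^sup>2 * ?d) + ?s * (2 * p \<theta> * (- ?s * p' \<theta>) * ?d\<^sup>2 +
       (2 * ?q * (- ?s * ((1 + 2 * L) * p \<theta> + ?c * p' \<theta>)) * ?d - ?q\<^sup>2 * ((4 * L + 1) * 2 * ?s * ?c)))) / ?d\<^sup>2
     = 2 * ?c * ?q\<^sup>2 / ?d\<^sup>2" by simp
    moreover have "(?c * ((p \<theta>)\<^sup>2 * ?d\<^sup>2 + ?q\<^sup>2 * ?d) + ?s * (2 * p \<theta> * (- ?s * p' \<theta>) * ?d\<^sup>2 + X)) / ?d\<^sup>2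
       = ?c * ((p \<theta>)\<^sup>2 + ?q\<^sup>2 / ?d) + ?s * (2 * p \<theta> * (- ?s * p' \<theta>) + X / (?d * ?d))" for X
    proof -
      have "?q\<^sup>2 * ?d / ?d\<^sup>2 = ?q\<^sup>2 / ?d" using D0[of \<theta>] by (simp add: power2_eq_square)
      thus ?thesis using D0[of \<theta>] by (simp add: field_simps power2_eq_square)
    qed
    ultimately show ?thesis by (simp only: power_divide times_divide_eq_right)
  qed
  finally show ?thesis .
qed

text \<open>
  Sonin's function dominates \<open>sin \<theta> P(cos \<theta>)\<^sup>2\<close>, increases up to \<open>\<pi>/2\<close> and decreases after it.
  Its maximum, the value at \<open>\<pi>/2\<close>, is at most the energy of P at 0 divided by the eigenvalue.
\<close>

lemma legendre_bernstein_inequality: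
  assumes "n \<ge> 1" "\<bar>x\<bar> \<le> 1"
  shows "sqrt (1 - x\<^sup>2) * (poly (legendre n) x)\<^sup>2 \<le> 2 / (2 * real n + 1)"
proof -
  define L where "L = real (n * Suc n)"
  define p where "p = (\<lambda>\<theta>. poly (legendre n) (cos \<theta>))"
  define p' where "p' = (\<lambda>\<theta>. poly (pderiv (legendre n)) (cos \<theta>))"
  define Q where "Q = (\<lambda>\<theta>. cos \<theta> * p \<theta> - 2 * (sin \<theta>)\<^sup>2 * p' \<theta>)"
  define D where "D = (\<lambda>\<theta>. (4 * L + 1) * (sin \<theta>)\<^sup>2 + 1)"
  define S where "S = (\<lambda>\<theta>. sin \<theta> * ((p \<theta>)\<^sup>2 + (Q \<theta>)\<^sup>2 / D \<theta>))"
  have "n * Suc n > 0" using assms(1) by simp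
  hence "L > 0" unfolding L_def by linarith
  have D0: "D t > 0" for t
    unfolding D_def using \<open>L > 0\<close> by (intro add_nonneg_pos mult_nonneg_nonneg) auto
  have der: "(S has_real_derivative 2 * cos t * (Q t / D t)\<^sup>2) (at t)" for t
    unfolding S_def Q_def D_def p_def p'_def L_def by (rule sonin_deriv)
  define \<theta> where "\<theta> = arccos x"
  have \<theta>: "cos \<theta> = x" "0 \<le> \<theta>" "\<theta> \<le> pi" "sin \<theta> = sqrt (1 - x\<^sup>2)"
    using assms(2) by (auto simp: \<theta>_def arccos_lbound arccos_ubound sin_arccos_abs cos_arccos_abs)
  have "S \<theta> \<le> S (pi / 2)"
  proof (cases "\<theta> \<le> pi / 2")
    case True
    have "\<exists>y. DERIV S t :> y \<and> y \<ge> 0" if "\<theta> \<le> t" "t \<le> pi / 2" for t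
      using that \<theta> cos_ge_zero[of t] by (intro exI[of _ "2 * cos t * (Q t / D t)\<^sup>2"] conjI der mult_nonneg_nonneg) auto
    thus ?thesis using True by (intro DERIV_nonneg_imp_nondecreasing[of \<theta> "pi/2" S])
  next
    case False
    have "cos t \<le> 0" if "t \<ge> pi / 2" "t \<le> \<theta>" for t
      using that \<theta> cos_monotone_0_pi_le[of "pi/2" t] by simp
    hence "2 * cos t * (Q t / D t)\<^sup>2 \<le> 0" if "pi / 2 \<le> t" "t \<le> \<theta>" for t
      using that by (intro mult_nonpos_nonneg[of "2 * cos t"]) force+
    hence "\<exists>y. DERIV S t :> y \<and> y \<le> 0" if "pi / 2 \<le> t" "t \<le> \<theta>" for t
      using that der by blast
    thus ?thesis using False by (intro DERIV_nonpos_imp_nonincreasing[of "pi/2" \<theta> S]) auto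
  qed
  also have "S (pi / 2) = (poly (legendre n) 0)\<^sup>2 + 4 * (poly (pderiv (legendre n)) 0)\<^sup>2 / (4 * L + 2)"
    by (simp add: S_def p_def Q_def D_def p'_def power2_eq_square add.commute)
  also have "\<dots> \<le> (poly (legendre n) 0)\<^sup>2 + (poly (pderiv (legendre n)) 0)\<^sup>2 / L"
    using \<open>L > 0\<close> by (auto simp: field_simps)
  also have "\<dots> = legendre_energy L (legendre n) 0 / L"
    using \<open>L > 0\<close> by (simp add: legendre_energy_def field_simps)
  also have "\<dots> \<le> 2 / (2 * real n + 1)"
    using legendre_energy_0[of n] \<open>L > 0\<close> unfolding L_def[symmetric] by (simp add: pos_divide_le_eq mult.commute)
  finally have "S \<theta> \<le> 2 / (2 * real n + 1)" .
  moreover have "sin \<theta> * (p \<theta>)\<^sup>2 \<le> S \<theta>"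
    unfolding S_def using D0[of \<theta>] \<theta> sin_ge_zero[of \<theta>] by (intro mult_left_mono) auto
  ultimately show ?thesis using \<theta> by (simp add: p_def)
qed

text \<open>
  Raised to the power 3/2, Bernstein's inequality bounds \<open>\<bar>P\<bar> ^ 3\<close> by a multiple of the integrable
  function \<open>(1 - x\<^sup>2) powr (-3/4)\<close>. The decay in n is faster than that of the integral of \<open>\<bar>P\<bar>\<^sup>2\<close>
  by a factor of order \<open>n powr (-1/2)\<close>; this is what makes the third moments of the wave bounded
  in the degree.
\<close>

lemma legendre_cube_integral:
  assumes "n \<ge> 1"
  shows "integral {-1..1} (\<lambda>x. \<bar>poly (legendre n) x\<bar> ^ 3) \<le> 16 * (2 / (2 * real n + 1)) powr (3 / 2)"
proof -
  define B where "B = (2 / (2 * real n + 1)) powr (3 / 2)"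
  define g where "g = (\<lambda>x::real. (1 + x) powr (- 3 / 4) + (1 - x) powr (- 3 / 4))"
  define F where "F = (\<lambda>x::real. 4 * (1 + x) powr (1 / 4) - 4 * (1 - x) powr (1 / 4))"
  have "(g has_integral (F 1 - F (-1))) {-1..1}"
  proof (rule fundamental_theorem_of_calculus_interior)
    show "continuous_on {-1..1} F" unfolding F_def by (auto intro!: continuous_intros continuous_on_powr')
    fix x :: real assume "x \<in> {-1<..<1}"
    thus "(F has_vector_derivative g x) (at x)"
      unfolding F_def g_def has_real_derivative_iff_has_vector_derivative[symmetric]
      by (auto intro!: derivative_eq_intros)
  qed auto
  \<comment> \<open>0 powr (-3/4) is 0, so the majorant g is corrected at the two end points, where \<open>\<bar>P\<bar> = 1\<close>\<close>
  hence i1: "((\<lambda>x. B * (if x \<in> {-1, 1} then 1 / B else g x)) has_integral B * (F 1 - F (-1))) {-1..1}"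
    using has_integral_mult_right[OF has_integral_spike_finite[of "{-1, 1 :: real}" "{-1..1}" "\<lambda>x. if x \<in> {-1, 1} then 1 / B else g x" g], of _ B] by fastforce
  have i2: "((\<lambda>x. \<bar>poly (legendre n) x\<bar> ^ 3) has_integral integral {-1..1} (\<lambda>x. \<bar>poly (legendre n) x\<bar> ^ 3)) {-1..1}"
    by (rule integrable_integral, rule integrable_continuous_interval) (intro continuous_intros)
  have "integral {-1..1} (\<lambda>x. \<bar>poly (legendre n) x\<bar> ^ 3) \<le> B * (F 1 - F (-1))"
  proof (rule has_integral_le[OF i2 i1])
    fix x :: real assume x: "x \<in> {-1..1}"
    have "B > 0" by (simp add: B_def)
    show "\<bar>poly (legendre n) x\<bar> ^ 3 \<le> B * (if x \<in> {-1, 1} then 1 / B else g x)"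
    proof (cases "x \<in> {-1, 1}")
      case True
      thus ?thesis using \<open>B > 0\<close> by (auto simp: legendre_minus_1 power_abs)
    next
      case False
      with x have x': "-1 < x" "x < 1" by auto
      hence pos: "1 - x\<^sup>2 > 0" by (simp add: abs_square_less_1 abs_less_iff)
      define a where "a = 2 / (2 * real n + 1)"
      have "(poly (legendre n) x)\<^sup>2 = sqrt (1 - x\<^sup>2) * (poly (legendre n) x)\<^sup>2 / sqrt (1 - x\<^sup>2)"
        using pos by simp
      also have "\<dots> \<le> a / sqrt (1 - x\<^sup>2)"
        using legendre_bernstein_inequality[OF assms, of x] x' pos unfolding a_def by (intro divide_right_mono) auto
      also have "\<dots> = a * (1 - x\<^sup>2) powr (-1/2)"
        unfolding minus_divide_left[symmetric] powr_minus powr_half_sqrt[OF less_imp_le[OF pos]] by (rule divide_inverse)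
      finally have "(poly (legendre n) x)\<^sup>2 \<le> a * (1 - x\<^sup>2) powr (-1/2)" .
      hence "((poly (legendre n) x)\<^sup>2) powr (3/2) \<le> (a * (1 - x\<^sup>2) powr (-1/2)) powr (3/2)"
        by (intro powr_mono2) auto
      also have "((poly (legendre n) x)\<^sup>2) powr (3/2) = \<bar>poly (legendre n) x\<bar> ^ 3"
      proof (cases "poly (legendre n) x = 0")
        case False
        have "((poly (legendre n) x)\<^sup>2) powr (3/2) = (\<bar>poly (legendre n) x\<bar> powr 2) powr (3/2)"
          using False by (simp add: powr_numeral)
        also have "\<dots> = \<bar>poly (legendre n) x\<bar> powr (real 3)" by (subst powr_powr) simp
        also have "\<dots> = \<bar>poly (legendre n) x\<bar> ^ 3" using False by (subst powr_realpow) auto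
        finally show ?thesis .
      qed auto
      also have "(a * (1 - x\<^sup>2) powr (-1/2)) powr (3/2) = B * (1 - x\<^sup>2) powr (-3/4)"
        by (subst powr_mult) (auto simp: a_def B_def powr_powr)
      also have "1 - x\<^sup>2 = (1 + x) * (1 - x)" by (simp add: power2_eq_square algebra_simps)
      also have "\<dots> powr (-3/4) = (1 + x) powr (-3/4) * (1 - x) powr (-3/4)"
        using x' by (simp add: powr_mult)
      also have "\<dots> \<le> g x"
      proof (cases "x \<ge> 0")
        case True
        hence "(1 + x) powr (-3/4) \<le> 1" using powr_mono[of "-3/4" 0 "1 + x"] by simp
        hence "(1 + x) powr (-3/4) * (1 - x) powr (-3/4) \<le> 1 * (1 - x) powr (-3/4)"
          by (intro mult_right_mono) auto
        thus ?thesis by (simp add: g_def add_increasing)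
      next
        case False
        hence "(1 - x) powr (-3/4) \<le> 1" using powr_mono[of "-3/4" 0 "1 - x"] by simp
        hence "(1 + x) powr (-3/4) * (1 - x) powr (-3/4) \<le> (1 + x) powr (-3/4) * 1"
          by (intro mult_left_mono) auto
        thus ?thesis by (simp add: g_def add_increasing2)
      qed
      finally show ?thesis using False \<open>B > 0\<close> by simp
    qed
  qed
  also have "F 1 - F (-1) \<le> 16"
  proof -
    have "(2 :: real) powr (1/4) \<le> 2 powr 1" by (intro powr_mono) auto
    thus ?thesis by (simp add: F_def)
  qed
  finally show ?thesis by (simp add: B_def mult.commute mult_left_mono)
qed

section \<open>Integration over the sphere\<close>

lemma orthogonal_transformation_measurable:
  fixes f :: "real ^ 'n \<Rightarrow> real ^ 'n"
  assumes "orthogonal_transformation f"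
  shows "f \<in> borel_measurable borel"
  using assms by (intro borel_measurable_continuous_onI linear_continuous_on)
       (simp add: orthogonal_transformation_def linear_conv_bounded_linear)

lemma distr_lborel_orthogonal:
  fixes f :: "real ^ 3 \<Rightarrow> real ^ 3"
  assumes f: "orthogonal_transformation f"
  shows "distr lborel borel f = lborel"
proof (rule sym, rule lborel_eqI)
  fix l u :: "real ^ 3" assume le: "\<And>b. b \<in> Basis \<Longrightarrow> l \<bullet> b \<le> u \<bullet> b"
  have fi: "orthogonal_transformation (inv f)" using f by (rule orthogonal_transformation_inv)
  have bij: "bij f" using f by (rule orthogonal_transformation_bij)
  have meas: "f \<in> borel_measurable borel"
    using f by (rule orthogonal_transformation_measurable)
  have "emeasure (distr lborel borel f) (box l u) = emeasure lborel (f -` box l u)"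
    using meas by (subst emeasure_distr) auto
  also have "f -` box l u = inv f ` box l u"
    using bij by (simp add: bij_vimage_eq_inv_image)
  also have "emeasure lborel (inv f ` box l u) = emeasure lebesgue (inv f ` box l u)"
  proof -
    have "inv f ` box l u \<in> sets borel"
      using measurable_sets[OF meas, of "box l u"] bij by (simp add: bij_vimage_eq_inv_image)
    thus ?thesis by simp
  qed
  also have "\<dots> = ennreal (measure lebesgue (inv f ` box l u))"
  proof -
    have "inv f ` box l u \<in> lmeasurable"
      using fi by (intro measurable_orthogonal_image) auto
    thus ?thesis by (simp add: emeasure_eq_measure2)
  qed
  also have "measure lebesgue (inv f ` box l u) = measure lebesgue (box l u)"
    using fi by (intro measure_orthogonal_image) auto
  also have "ennreal \<dots> = emeasure lborel (box l u)"
  proof -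
    have "box l u \<in> lmeasurable" by simp
    hence "emeasure lebesgue (box l u) = ennreal (measure lebesgue (box l u))"
      by (rule emeasure_eq_measure2)
    thus ?thesis by simp
  qed
  also have "\<dots> = ennreal (prod ((\<bullet>) (u - l)) Basis)"
    using le by (simp add: emeasure_lborel_box inner_diff_left)
  finally show "emeasure (distr lborel borel f) (box l u) = ennreal (prod ((\<bullet>) (u - l)) Basis)" .
qed simp

lemma lborel_vec3:
  "distr (lborel :: (real \<times> real \<times> real) measure) borel (\<lambda>(a, b, c). vector [a, b, c]) = (lborel :: (real ^ 3) measure)"
proof (rule sym, rule lborel_eqI)
  let ?f = "\<lambda>(a, b, c). vector [a, b, c] :: real ^ 3"
  have eq: "?f x = (\<chi> i. if i = 1 then fst x else if i = 2 then fst (snd x) else snd (snd x))" for x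
    by (auto simp: vec_eq_iff forall_3 split: prod.splits)
  have meas: "?f \<in> borel_measurable borel"
    unfolding eq[abs_def]
    by (intro borel_measurable_continuous_onI continuous_on_vec_lambda; (rename_tac i, case_tac "i = 1"; case_tac "i = 2"))
       (auto intro!: continuous_intros)
  fix l u :: "real ^ 3" assume le: "\<And>b. b \<in> Basis \<Longrightarrow> l \<bullet> b \<le> u \<bullet> b"
  have le': "l $ i \<le> u $ i" for i
    using le[of "axis i 1"] by (auto simp: inner_axis axis_in_Basis_iff)
  have "emeasure (distr lborel borel ?f) (box l u) = emeasure lborel (?f -` box l u)"
    using meas by (subst emeasure_distr) auto
  also have "?f -` box l u = {l$1<..<u$1} \<times> {l$2<..<u$2} \<times> {l$3<..<u$3}"
    by (auto simp: mem_box_cart forall_3)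
  also have "emeasure lborel \<dots> = emeasure (lborel \<Otimes>\<^sub>M (lborel \<Otimes>\<^sub>M lborel)) \<dots>"
    by (simp only: lborel_prod)
  also have "\<dots> = ennreal ((u - l)$1 * ((u - l)$2 * (u - l)$3))"
    by (subst lborel_pair.emeasure_pair_measure_Times lborel.emeasure_pair_measure_Times, simp, simp)+
       (use le' in \<open>simp add: ennreal_mult\<close>)
  also have "(u - l)$1 * ((u - l)$2 * (u - l)$3) = prod ((\<bullet>) (u - l)) Basis"
  proof -
    have B: "Basis = (\<lambda>i. axis i 1 :: real ^ 3) ` UNIV" by (auto simp: Basis_vec_def)
    have "inj (\<lambda>i. axis i 1 :: real ^ 3)" by (auto simp: inj_on_def axis_eq_axis)
    hence "prod ((\<bullet>) (u - l)) Basis = (\<Prod>i\<in>UNIV. (u - l) \<bullet> axis i 1)"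
      unfolding B by (subst prod.reindex) auto
    also have "\<dots> = (u - l)$1 * ((u - l)$2 * (u - l)$3)" unfolding UNIV_3 by (simp add: inner_axis)
    finally show ?thesis by simp
  qed
  finally show "emeasure (distr lborel borel ?f) (box l u) = ennreal (prod ((\<bullet>) (u - l)) Basis)" .
qed simp

text \<open>
  The disc of radius \<open>sqrt r\<close> has area \<open>pi * r\<close>.
\<close>

lemma distr_sum_squares:
  "distr (lborel :: (real \<times> real) measure) borel (\<lambda>(b, c). b\<^sup>2 + c\<^sup>2)
     = density lborel (\<lambda>r. ennreal pi * indicator {0..} r)"
proof -
  let ?f = "\<lambda>(b, c). b\<^sup>2 + c\<^sup>2 :: real"
  let ?M = "distr (lborel :: (real \<times> real) measure) borel ?f"
  let ?N = "density lborel (\<lambda>r. ennreal pi * indicator {0..} r) :: real measure"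
  have meas [measurable]: "?f \<in> borel_measurable borel"
    by (intro borel_measurable_continuous_onI) (auto simp: case_prod_unfold intro!: continuous_intros)
  have M: "emeasure ?M {..r} = ennreal (pi * max 0 r)" for r
  proof -
    have "emeasure ?M {..r} = emeasure lborel (?f -` {..r})"
      using meas by (subst emeasure_distr) auto
    also have "?f -` {..r} = (if r \<ge> 0 then cball 0 (sqrt r) else {})"
    proof -
      have "b\<^sup>2 + c\<^sup>2 \<le> r \<longleftrightarrow> r \<ge> 0 \<and> norm (b, c) \<le> sqrt r" for b c :: real
        by (auto simp: norm_Pair intro: order_trans[of 0 "b\<^sup>2 + c\<^sup>2"])
      thus ?thesis by (intro set_eqI) (auto simp del: norm_Pair split: prod.splits)
    qed
    also have "emeasure lborel \<dots> = ennreal (pi * max 0 r)"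
      using emeasure_cball[of "sqrt r" "0 :: real \<times> real"]
      by (auto simp: max_def unit_ball_vol_2)
    finally show ?thesis .
  qed
  have N: "emeasure ?N {..r} = ennreal (pi * max 0 r)" for r
  proof -
    have "emeasure ?N {..r} = (\<integral>\<^sup>+x. ennreal pi * indicator {0..r} x \<partial>lborel)"
      by (subst emeasure_density) (auto intro!: nn_integral_cong simp: indicator_def)
    also have "\<dots> = ennreal (pi * max 0 r)"
      by (subst nn_integral_cmult) (auto simp: max_def ennreal_mult)
    finally show ?thesis .
  qed
  show ?thesis
  proof (rule measure_eqI_generator_eq[where E = "range atMost" and \<Omega> = UNIV and A = "\<lambda>i. {..real i}"])
    show "Int_stable (range (atMost :: real \<Rightarrow> _))"
      by (auto simp: Int_stable_def min_def intro!: rev_image_eqI[of "min _ _"])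
    show "emeasure ?M X = emeasure ?N X" if "X \<in> range atMost" for X using that M N by auto
    show "sets ?M = sigma_sets UNIV (range atMost)" "sets ?N = sigma_sets UNIV (range atMost)"
      by (simp_all add: borel_eq_atMost)
    show "(\<Union>i. {..real i}) = UNIV" using real_arch_simple by auto
    show "emeasure ?M {..real i} \<noteq> \<infinity>" for i unfolding M by simp
  qed auto
qed

lemma sets_sphere_measure [simp, measurable_cong]: "sets sphere_measure = sets (restrict_space borel (sphere 0 1))"
  by (simp add: sphere_measure_def)

lemma space_sphere_measure [simp]: "space sphere_measure = sphere 0 1"
  by (simp add: sphere_measure_def space_restrict_space space_scale_measure)

lemma measurable_sphere_measure [measurable (raw)]:
  "f \<in> borel_measurable borel \<Longrightarrow> f \<in> borel_measurable sphere_measure"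
  using measurable_restrict_space1 measurable_cong_sets[OF sets_sphere_measure refl] by blast

lemma nn_integral_sphere_measure:
  assumes [measurable]: "F \<in> borel_measurable borel"
  shows "(\<integral>\<^sup>+\<xi>. F \<xi> \<partial>sphere_measure) = 3 * (\<integral>\<^sup>+x. F (sgn x) * indicator (cball 0 1 - {0}) x \<partial>(lborel :: (real ^ 3) measure))"
proof -
  let ?B = "cball (0 :: real ^ 3) 1 - {0}"
  have m: "(sgn :: real ^ 3 \<Rightarrow> _) \<in> measurable (restrict_space lborel ?B) (restrict_space borel (sphere 0 1))"
  proof (rule measurable_restrict_space2)
    show "(sgn :: real ^ 3 \<Rightarrow> _) \<in> space (restrict_space lborel ?B) \<rightarrow> sphere 0 1"
      by (auto simp: space_restrict_space norm_sgn)
    have "continuous_on ?B (sgn :: real ^ 3 \<Rightarrow> _)"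
      unfolding sgn_div_norm by (auto intro!: continuous_intros)
    hence "(sgn :: real ^ 3 \<Rightarrow> _) \<in> measurable (restrict_space borel ?B) borel"
      by (rule borel_measurable_continuous_on_restrict)
    thus "(sgn :: real ^ 3 \<Rightarrow> _) \<in> measurable (restrict_space lborel ?B) borel"
      by (simp cong: measurable_cong_sets add: measurable_def sets_restrict_space space_restrict_space)
  qed
  have Fm: "F \<in> borel_measurable (restrict_space borel (sphere 0 1))"
    by (intro measurable_restrict_space1) auto
  have "(\<integral>\<^sup>+\<xi>. F \<xi> \<partial>sphere_measure) = 3 * (\<integral>\<^sup>+x. F (sgn x) \<partial>restrict_space lborel ?B)"
    unfolding sphere_measure_def using m Fm
    by (subst nn_integral_scale_measure) (auto simp: nn_integral_distr)
  also have "(\<integral>\<^sup>+x. F (sgn x) \<partial>restrict_space lborel ?B) = (\<integral>\<^sup>+x. F (sgn x) * indicator ?B x \<partial>lborel)"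
    by (subst nn_integral_restrict_space) auto
  finally show ?thesis .
qed

lemma borel_measurable_sgn_vec [measurable]: "(sgn :: real ^ 3 \<Rightarrow> real ^ 3) \<in> borel_measurable borel"
  unfolding sgn_div_norm by measurable

lemma nn_integral_sphere_orthogonal:
  assumes f: "orthogonal_transformation f" and [measurable]: "F \<in> borel_measurable borel"
  shows "(\<integral>\<^sup>+\<xi>. F (f \<xi>) \<partial>sphere_measure) = (\<integral>\<^sup>+\<xi>. F \<xi> \<partial>sphere_measure)"
proof -
  have [measurable]: "f \<in> borel_measurable borel" using f by (rule orthogonal_transformation_measurable)
  have [measurable]: "cball 0 1 - {0 :: real ^ 3} \<in> sets borel" by auto
  have norm: "norm (f x) = norm x" for x using f by (simp add: orthogonal_transformation)
  have lin: "linear f" using f by (simp add: orthogonal_transformation_def)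
  have sgn: "f (sgn x) = sgn (f x)" for x
    by (simp add: sgn_div_norm norm linear_cmul[OF lin])
  have ind: "indicator (cball 0 1 - {0}) (f x) = (indicator (cball 0 1 - {0}) x :: ennreal)" for x
    using norm[of x] by (auto simp: indicator_def)
  have "(\<integral>\<^sup>+\<xi>. F \<xi> \<partial>sphere_measure) = 3 * (\<integral>\<^sup>+x. F (sgn x) * indicator (cball 0 1 - {0}) x \<partial>(distr lborel borel f))"
    by (subst distr_lborel_orthogonal[OF f], subst nn_integral_sphere_measure) auto
  also have "(\<integral>\<^sup>+x. F (sgn x) * indicator (cball 0 1 - {0}) x \<partial>(distr lborel borel f)) =
      (\<integral>\<^sup>+x. F (f (sgn x)) * indicator (cball 0 1 - {0}) x \<partial>lborel)"
    by (subst nn_integral_distr) (auto simp: ind sgn)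
  finally show ?thesis by (subst nn_integral_sphere_measure) auto
qed

text \<open>
  Archimedes' theorem: the projection of the surface measure to an axis is uniform. A point
  \<open>(a, b, c)\<close> of the unit ball enters the cone integral through a and \<open>b\<^sup>2 + c\<^sup>2\<close> only. In the
  coordinates \<open>q = a\<^sup>2 + b\<^sup>2 + c\<^sup>2\<close> and \<open>v = a / sqrt q\<close> the variables separate, and the radial part
  contributes the integral of \<open>sqrt q\<close>, that is 2/3.
\<close>

lemma sphere_marginal_nn_integral:
  assumes [measurable]: "g \<in> borel_measurable borel"
  shows "(\<integral>\<^sup>+\<xi>. g (\<xi> $ 1) \<partial>sphere_measure) = ennreal (2 * pi) * (\<integral>\<^sup>+v. g v * indicator {-1..1} v \<partial>lborel)"
proof -
  have [measurable]: "(\<lambda>x :: real ^ 3. x $ i) \<in> borel_measurable borel" for i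
    by (intro borel_measurable_continuous_onI continuous_intros)
  have [measurable]: "cball 0 1 - {0 :: real ^ 3} \<in> sets borel" by auto
  let ?v = "\<lambda>(a, b, c). vector [a, b, c] :: real ^ 3"
  let ?I = "\<lambda>a \<rho>. g (a / sqrt (a\<^sup>2 + \<rho>)) * indicator {0<..1} (a\<^sup>2 + \<rho>) :: ennreal"
  have vm: "?v \<in> borel_measurable borel"
  proof -
    have eq: "?v x = (\<chi> i. if i = 1 then fst x else if i = 2 then fst (snd x) else snd (snd x))" for x
      by (auto simp: vec_eq_iff forall_3 split: prod.splits)
    show ?thesis unfolding eq[abs_def]
      by (intro borel_measurable_continuous_onI continuous_on_vec_lambda; (rename_tac i, case_tac "i = 1"; case_tac "i = 2"))
         (auto intro!: continuous_intros)
  qed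
  have nrm: "norm (?v (a, b, c)) = sqrt (a\<^sup>2 + (b\<^sup>2 + c\<^sup>2))" for a b c
    by (simp add: norm_vec_def L2_set_def sum_3 add.assoc)
  have pt: "g (sgn (?v (a, b, c)) $ 1) * indicator (cball 0 1 - {0}) (?v (a, b, c)) = ?I a (b\<^sup>2 + c\<^sup>2)" for a b c
  proof -
    have "?v (a, b, c) \<in> cball 0 1 - {0} \<longleftrightarrow> a\<^sup>2 + (b\<^sup>2 + c\<^sup>2) \<in> {0<..1}"
    proof -
      have "?v (a, b, c) = 0 \<longleftrightarrow> a\<^sup>2 + (b\<^sup>2 + c\<^sup>2) = 0"
        by (metis nrm norm_eq_zero real_sqrt_eq_zero_cancel_iff)
      moreover have "?v (a, b, c) \<in> cball 0 1 \<longleftrightarrow> a\<^sup>2 + (b\<^sup>2 + c\<^sup>2) \<le> 1"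
        unfolding mem_cball_0 nrm by simp
      moreover have "a\<^sup>2 + (b\<^sup>2 + c\<^sup>2) \<ge> 0" by simp
      ultimately show ?thesis unfolding Diff_iff singleton_iff greaterThanAtMost_iff by linarith
    qed
    moreover have "sgn (?v (a, b, c)) $ 1 = a / sqrt (a\<^sup>2 + (b\<^sup>2 + c\<^sup>2))"
      unfolding sgn_div_norm nrm by (simp add: divide_inverse)
    ultimately show ?thesis by (simp only: indicator_def)
  qed
  have "(\<integral>\<^sup>+\<xi>. g (\<xi> $ 1) \<partial>sphere_measure) =
      3 * (\<integral>\<^sup>+x. g (sgn x $ 1) * indicator (cball 0 1 - {0}) x \<partial>(distr lborel borel ?v))"
    unfolding lborel_vec3 by (rule nn_integral_sphere_measure[of "\<lambda>\<xi>. g (\<xi> $ 1)"]) measurable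
  also have "(\<integral>\<^sup>+x. g (sgn x $ 1) * indicator (cball 0 1 - {0}) x \<partial>(distr lborel borel ?v)) =
      (\<integral>\<^sup>+p. ?I (fst p) ((\<lambda>(b, c). b\<^sup>2 + c\<^sup>2) (snd p)) \<partial>lborel)"
  proof (subst nn_integral_distr)
    show "?v \<in> lborel \<rightarrow>\<^sub>M borel" using vm by simp
    show "(\<integral>\<^sup>+ x. g (sgn (?v x) $ 1) * indicator (cball 0 1 - {0}) (?v x) \<partial>lborel) =
        (\<integral>\<^sup>+p. ?I (fst p) ((\<lambda>(b, c). b\<^sup>2 + c\<^sup>2) (snd p)) \<partial>lborel)"
      by (rule nn_integral_cong) (use pt in \<open>auto split: prod.splits\<close>)
  qed auto
  also have "\<dots> = (\<integral>\<^sup>+p. ?I (fst p) ((\<lambda>(b, c). b\<^sup>2 + c\<^sup>2) (snd p)) \<partial>(lborel \<Otimes>\<^sub>M lborel))"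
    by (simp only: lborel_prod)
  also have "\<dots> = (\<integral>\<^sup>+a. \<integral>\<^sup>+q. ?I a ((\<lambda>(b, c). b\<^sup>2 + c\<^sup>2) q) \<partial>lborel \<partial>lborel)"
  proof (subst lborel.nn_integral_fst[symmetric])
    have [measurable]: "(\<lambda>(b, c). b\<^sup>2 + c\<^sup>2 :: real) \<in> borel_measurable (borel :: (real \<times> real) measure)"
      by (intro borel_measurable_continuous_onI) (auto simp: case_prod_unfold intro!: continuous_intros)
    show "(\<lambda>p. ?I (fst p) ((\<lambda>(b, c). b\<^sup>2 + c\<^sup>2) (snd p))) \<in> borel_measurable (lborel \<Otimes>\<^sub>M lborel)"
      by measurable
  qed simp
  also have "\<dots> = (\<integral>\<^sup>+a. \<integral>\<^sup>+\<rho>. ?I a \<rho> \<partial>(distr (lborel :: (real \<times> real) measure) borel (\<lambda>(b, c). b\<^sup>2 + c\<^sup>2)) \<partial>lborel)"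
    proof (subst nn_integral_distr)
    show "(\<lambda>(b, c). b\<^sup>2 + c\<^sup>2 :: real) \<in> (lborel :: (real \<times> real) measure) \<rightarrow>\<^sub>M borel"
      by (simp, intro borel_measurable_continuous_onI) (auto simp: case_prod_unfold intro!: continuous_intros)
  qed auto
  also have "\<dots> = (\<integral>\<^sup>+a. \<integral>\<^sup>+\<rho>. ennreal pi * (indicator {0..} \<rho> * ?I a \<rho>) \<partial>lborel \<partial>lborel)"
    unfolding distr_sum_squares by (subst nn_integral_density) (auto simp: mult.assoc)
  also have "\<dots> = (\<integral>\<^sup>+a. \<integral>\<^sup>+q. ennreal pi * (indicator {0..} (q - a\<^sup>2) * ?I a (q - a\<^sup>2)) \<partial>lborel \<partial>lborel)"
  proof (rule nn_integral_cong)
    fix a :: real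
    show "(\<integral>\<^sup>+\<rho>. ennreal pi * (indicator {0..} \<rho> * ?I a \<rho>) \<partial>lborel) =
        (\<integral>\<^sup>+q. ennreal pi * (indicator {0..} (q - a\<^sup>2) * ?I a (q - a\<^sup>2)) \<partial>lborel)"
      by (subst nn_integral_real_affine[where c = 1 and t = "- a\<^sup>2"]) auto
  qed
  also have "\<dots> = (\<integral>\<^sup>+q. \<integral>\<^sup>+a. ennreal pi * (indicator {0..} (q - a\<^sup>2) * ?I a (q - a\<^sup>2)) \<partial>lborel \<partial>lborel)"
    by (rule lborel_pair.Fubini'[symmetric]) measurable
  also have "\<dots> = (\<integral>\<^sup>+q. ennreal pi * (\<integral>\<^sup>+v. g v * indicator {-1..1} v \<partial>lborel) * (ennreal (sqrt q) * indicator {0..1} q) \<partial>lborel)"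
  proof (rule nn_integral_cong)
    fix q :: real
    show "(\<integral>\<^sup>+a. ennreal pi * (indicator {0..} (q - a\<^sup>2) * ?I a (q - a\<^sup>2)) \<partial>lborel) =
       ennreal pi * (\<integral>\<^sup>+v. g v * indicator {-1..1} v \<partial>lborel) * (ennreal (sqrt q) * indicator {0..1} q)"
    proof (cases "0 < q \<and> q \<le> 1")
      case True
      hence q: "sqrt q > 0" "sqrt q * sqrt q = q" by auto
      have ind: "q - (sqrt q * v)\<^sup>2 \<ge> 0 \<longleftrightarrow> v \<in> {-1..1}" for v
      proof -
        have "q - (sqrt q * v)\<^sup>2 = q * (1 - v\<^sup>2)" using q by (simp add: power_mult_distrib algebra_simps)
        also have "\<dots> \<ge> 0 \<longleftrightarrow> v\<^sup>2 \<le> 1" using True by (simp add: zero_le_mult_iff)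
        also have "\<dots> \<longleftrightarrow> v \<in> {-1..1}" by (simp add: abs_square_le_1 abs_le_iff) linarith
        finally show ?thesis .
      qed
      have "(\<integral>\<^sup>+a. ennreal pi * (indicator {0..} (q - a\<^sup>2) * ?I a (q - a\<^sup>2)) \<partial>lborel) =
         ennreal pi * (\<integral>\<^sup>+a. indicator {0..} (q - a\<^sup>2) * g (a / sqrt q) \<partial>lborel)"
        using True by (subst nn_integral_cmult) auto
      also have "(\<integral>\<^sup>+a. indicator {0..} (q - a\<^sup>2) * g (a / sqrt q) \<partial>lborel) =
          ennreal (sqrt q) * (\<integral>\<^sup>+v. indicator {0..} (q - (sqrt q * v)\<^sup>2) * g v \<partial>lborel)"
        using q by (subst nn_integral_real_affine[where c = "sqrt q" and t = 0]) auto
      also have "(\<lambda>v. indicator {0..} (q - (sqrt q * v)\<^sup>2) * g v) = (\<lambda>v. g v * indicator {-1..1} v)"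
        using ind by (auto simp: indicator_def fun_eq_iff)
      finally show ?thesis using True by (simp add: mult_ac)
    next
      case False
      hence "q \<le> 0 \<or> q > 1" by auto
      thus ?thesis by (auto simp: indicator_def)
    qed
  qed
  also have "\<dots> = ennreal pi * (\<integral>\<^sup>+v. g v * indicator {-1..1} v \<partial>lborel) * (\<integral>\<^sup>+q. ennreal (sqrt q) * indicator {0..1} q \<partial>lborel)"
    by (subst nn_integral_cmult) auto
  also have "(\<integral>\<^sup>+q. ennreal (sqrt q) * indicator {0..1} q \<partial>lborel) = ennreal (2 / 3)"
  proof -
    have "((\<lambda>q. sqrt q) has_integral (2/3 * 1 powr (3/2) - 2/3 * 0 powr (3/2))) {0..1}"
    proof (rule fundamental_theorem_of_calculus_interior)
      show "continuous_on {0..1} (\<lambda>q::real. 2/3 * q powr (3/2))" by (auto intro!: continuous_intros continuous_on_powr')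
      fix q :: real assume "q \<in> {0<..<1}"
      thus "((\<lambda>q. 2/3 * q powr (3/2)) has_vector_derivative sqrt q) (at q)"
        unfolding has_real_derivative_iff_has_vector_derivative[symmetric]
        by (auto intro!: derivative_eq_intros simp: powr_half_sqrt)
    qed auto
    from nn_integral_has_integral_lebesgue'[OF _ this] show ?thesis by simp
  qed
  finally have "(\<integral>\<^sup>+\<xi>. g (\<xi> $ 1) \<partial>sphere_measure) =
     ennreal 3 * (ennreal pi * (\<integral>\<^sup>+v. g v * indicator {-1..1} v \<partial>lborel) * ennreal (2 / 3))" by simp
  also have "\<dots> = ennreal 3 * ennreal pi * ennreal (2 / 3) * (\<integral>\<^sup>+v. g v * indicator {-1..1} v \<partial>lborel)"
    by (simp add: mult_ac)
  also have "ennreal 3 * ennreal pi * ennreal (2 / 3) = ennreal (2 * pi)"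
    by (simp flip: ennreal_mult del: ennreal_numeral)
  finally show ?thesis .
qed

lemma DERIV_integral:
  fixes f f' :: "real \<Rightarrow> 'a \<Rightarrow> real"
  assumes int: "\<And>t. integrable M (f t)" and meas: "f' t \<in> borel_measurable M"
    and der: "\<And>t \<omega>. \<omega> \<in> space M \<Longrightarrow> ((\<lambda>t. f t \<omega>) has_real_derivative f' t \<omega>) (at t)"
    and bound: "\<And>t \<omega>. \<omega> \<in> space M \<Longrightarrow> \<bar>f' t \<omega>\<bar> \<le> B \<omega>" and B: "integrable M B"
  shows "((\<lambda>t. \<integral>\<omega>. f t \<omega> \<partial>M) has_real_derivative (\<integral>\<omega>. f' t \<omega> \<partial>M)) (at t)"
  unfolding has_field_derivative_iff tendsto_at_iff_sequentially
proof (intro allI impI)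
  fix X :: "nat \<Rightarrow> real" assume X: "\<forall>i. X i \<in> UNIV - {t}" "X \<longlonglongrightarrow> t"
  have eq: "((\<lambda>s. ((\<integral>\<omega>. f s \<omega> \<partial>M) - (\<integral>\<omega>. f t \<omega> \<partial>M)) / (s - t)) \<circ> X) =
     (\<lambda>i. \<integral>\<omega>. (f (X i) \<omega> - f t \<omega>) / (X i - t) \<partial>M)"
    using int by (auto simp: fun_eq_iff)
  show "((\<lambda>s. ((\<integral>\<omega>. f s \<omega> \<partial>M) - (\<integral>\<omega>. f t \<omega> \<partial>M)) / (s - t)) \<circ> X) \<longlonglongrightarrow> (\<integral>\<omega>. f' t \<omega> \<partial>M)"
    unfolding eq
  proof (rule integral_dominated_convergence[where w = B])
    show "AE \<omega> in M. (\<lambda>i. (f (X i) \<omega> - f t \<omega>) / (X i - t)) \<longlonglongrightarrow> f' t \<omega>"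
    proof (rule AE_I2)
      fix \<omega> assume "\<omega> \<in> space M"
      from der[OF this, of t] X show "(\<lambda>i. (f (X i) \<omega> - f t \<omega>) / (X i - t)) \<longlonglongrightarrow> f' t \<omega>"
        unfolding has_field_derivative_iff tendsto_at_iff_sequentially o_def by auto
    qed
    show "AE \<omega> in M. norm ((f (X i) \<omega> - f t \<omega>) / (X i - t)) \<le> B \<omega>" for i
    proof (rule AE_I2)
      fix \<omega> assume \<omega>: "\<omega> \<in> space M"
      have "\<bar>f (X i) \<omega> - f t \<omega>\<bar> \<le> B \<omega> * \<bar>X i - t\<bar>"
        using field_differentiable_bound[of UNIV "\<lambda>t. f t \<omega>" "\<lambda>t. f' t \<omega>" "B \<omega>" "X i" t] der[OF \<omega>] bound[OF \<omega>]
        by auto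
      thus "norm ((f (X i) \<omega> - f t \<omega>) / (X i - t)) \<le> B \<omega>"
        using X(1) by (auto simp: abs_divide pos_divide_le_eq)
    qed
  qed (use int meas B in auto)
qed

lemma finite_measure_sphere_measure: "finite_measure sphere_measure"
  by standard (simp add: emeasure_sphere_measure)

interpretation sphere: finite_measure sphere_measure
  by (rule finite_measure_sphere_measure)

lemma continuous_integrable_sphere:
  fixes F :: "real ^ 3 \<Rightarrow> real"
  assumes "continuous_on UNIV F"
  shows "integrable sphere_measure F"
proof -
  have "compact (F ` sphere 0 1)"
    by (intro compact_continuous_image continuous_on_subset[OF assms]) auto
  then obtain K where "\<And>x. x \<in> sphere 0 1 \<Longrightarrow> \<bar>F x\<bar> \<le> K"
    by (force dest: compact_imp_bounded simp: bounded_iff)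
  thus ?thesis using assms
    by (intro sphere.integrable_const_bound[of _ K] measurable_sphere_measure borel_measurable_continuous_onI) auto
qed

lemma sphere_frame:
  fixes y e :: "real ^ 3"
  assumes "norm y = 1" "norm e = 1" "y \<bullet> e = 0"
  obtains f where "norm f = 1" "y \<bullet> f = 0" "e \<bullet> f = 0"
    "orthogonal_transformation (\<lambda>v :: real ^ 3. v $ 1 *\<^sub>R y + v $ 2 *\<^sub>R e + v $ 3 *\<^sub>R f)"
    "\<forall>v. (norm v)\<^sup>2 = (y \<bullet> v)\<^sup>2 + (e \<bullet> v)\<^sup>2 + (f \<bullet> v)\<^sup>2"
proof -
  define f where "f = cross3 y e"
  let ?S = "\<lambda>v :: real ^ 3. v $ 1 *\<^sub>R y + v $ 2 *\<^sub>R e + v $ 3 *\<^sub>R f"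
  have "(norm f)\<^sup>2 = 1" using norm_cross[of y e] assms by (simp add: f_def)
  hence f: "norm f = 1" by (simp add: power2_eq_1_iff) (use norm_ge_zero[of f] in linarith)
  have o: "y \<bullet> f = 0" "e \<bullet> f = 0" by (simp_all add: f_def dot_cross_self)
  have yy: "y \<bullet> y = 1" "e \<bullet> e = 1" "f \<bullet> f = 1" using assms f by (simp_all add: dot_square_norm)
  have nS: "norm (?S v) = norm v" for v
  proof -
    have "(norm (?S v))\<^sup>2 = (v $ 1)\<^sup>2 + (v $ 2)\<^sup>2 + (v $ 3)\<^sup>2"
      unfolding power2_norm_eq_inner using yy o assms(3)
      by (simp add: inner_add_left inner_add_right inner_commute power2_eq_square)
    also have "\<dots> = (norm v)\<^sup>2" by (simp add: norm_vec_def L2_set_def sum_3)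
    finally show ?thesis by (simp add: power2_eq_iff_nonneg)
  qed
  have "linear ?S" by (auto intro!: linearI simp: algebra_simps scaleR_add_left scaleR_add_right)
  hence S: "orthogonal_transformation ?S" unfolding orthogonal_transformation using nS by blast
  have "(norm v)\<^sup>2 = (y \<bullet> v)\<^sup>2 + (e \<bullet> v)\<^sup>2 + (f \<bullet> v)\<^sup>2" for v
  proof -
    obtain w where w: "v = ?S w" using orthogonal_transformation_surj[OF S] unfolding surj_def by blast
    have "(norm v)\<^sup>2 = (norm w)\<^sup>2" by (simp only: w nS)
    also have "\<dots> = (w $ 1)\<^sup>2 + (w $ 2)\<^sup>2 + (w $ 3)\<^sup>2" by (simp add: norm_vec_def L2_set_def sum_3)
    finally have "(norm v)\<^sup>2 = (w $ 1)\<^sup>2 + (w $ 2)\<^sup>2 + (w $ 3)\<^sup>2" .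
    moreover have "y \<bullet> v = w $ 1" "e \<bullet> v = w $ 2" "f \<bullet> v = w $ 3"
      using yy o assms(3) by (simp_all add: w inner_add_right inner_commute)
    ultimately show ?thesis by simp
  qed
  hence "\<forall>v. (norm v)\<^sup>2 = (y \<bullet> v)\<^sup>2 + (e \<bullet> v)\<^sup>2 + (f \<bullet> v)\<^sup>2" by blast
  with f o S show ?thesis by (rule that)
qed

lemma orthonormal_exists:
  obtains e :: "real ^ 3" where "norm e = 1" "y \<bullet> e = 0"
proof -
  obtain z :: "real ^ 3" where "z \<noteq> 0" "orthogonal y z"
    using orthogonal_to_vector_exists[of y] by auto
  thus ?thesis using that[of "sgn z"] by (simp add: norm_sgn orthogonal_def sgn_div_norm)
qed

lemma measurable_vec_nth3 [measurable]: "(\<lambda>x :: real ^ 3. x $ i) \<in> borel_measurable borel"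
  by (intro borel_measurable_continuous_onI continuous_intros)

lemma distr_sphere_orthonormal:
  fixes y e :: "real ^ 3"
  assumes "norm y = 1" "norm e = 1" "y \<bullet> e = 0"
  shows "distr sphere_measure borel (\<lambda>\<xi>. (y \<bullet> \<xi>, e \<bullet> \<xi>)) = distr sphere_measure borel (\<lambda>\<xi>. (\<xi> $ 1, \<xi> $ 2))"
proof (rule measure_eqI)
  fix A assume "A \<in> sets (distr sphere_measure borel (\<lambda>\<xi>. (y \<bullet> \<xi>, e \<bullet> \<xi>)))"
  hence [measurable]: "A \<in> sets borel" by simp
  have [measurable]: "(\<lambda>\<xi>. (y \<bullet> \<xi>, e \<bullet> \<xi>)) \<in> borel_measurable borel" "(\<lambda>\<xi> :: real ^ 3. (\<xi> $ 1, \<xi> $ 2)) \<in> borel_measurable borel"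
    by (intro borel_measurable_continuous_onI continuous_intros)+
  obtain f where f: "norm f = 1" "y \<bullet> f = 0" "e \<bullet> f = 0"
    "orthogonal_transformation (\<lambda>v :: real ^ 3. v $ 1 *\<^sub>R y + v $ 2 *\<^sub>R e + v $ 3 *\<^sub>R f)"
    "\<forall>v. (norm v)\<^sup>2 = (y \<bullet> v)\<^sup>2 + (e \<bullet> v)\<^sup>2 + (f \<bullet> v)\<^sup>2"
    by (rule sphere_frame[OF assms])
  let ?S = "\<lambda>v :: real ^ 3. v $ 1 *\<^sub>R y + v $ 2 *\<^sub>R e + v $ 3 *\<^sub>R f"
  have "(\<integral>\<^sup>+\<xi>. indicator A (y \<bullet> \<xi>, e \<bullet> \<xi>) \<partial>sphere_measure) = (\<integral>\<^sup>+\<xi>. indicator A (y \<bullet> ?S \<xi>, e \<bullet> ?S \<xi>) \<partial>sphere_measure)"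
    by (rule nn_integral_sphere_orthogonal[OF f(4), symmetric]) measurable
  also have "(\<lambda>\<xi>. (y \<bullet> ?S \<xi>, e \<bullet> ?S \<xi>)) = (\<lambda>\<xi>. (\<xi> $ 1, \<xi> $ 2))"
    using f assms by (auto simp: fun_eq_iff inner_add_right inner_commute dot_square_norm)
  hence "(\<lambda>\<xi>. indicator A (y \<bullet> ?S \<xi>, e \<bullet> ?S \<xi>) :: ennreal) = (\<lambda>\<xi>. indicator A (\<xi> $ 1, \<xi> $ 2))"
    by (simp add: fun_eq_iff)
  finally have eq: "(\<integral>\<^sup>+\<xi>. indicator A (y \<bullet> \<xi>, e \<bullet> \<xi>) \<partial>sphere_measure) = (\<integral>\<^sup>+\<xi>. indicator A (\<xi> $ 1, \<xi> $ 2) \<partial>sphere_measure)" .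
  have "emeasure (distr sphere_measure borel g) A = (\<integral>\<^sup>+\<xi>. indicator A (g \<xi>) \<partial>sphere_measure)"
    if [measurable]: "g \<in> borel_measurable borel" for g :: "real ^ 3 \<Rightarrow> real \<times> real"
    by (subst nn_integral_indicator[symmetric], simp, subst nn_integral_distr) auto
  with eq show "emeasure (distr sphere_measure borel (\<lambda>\<xi>. (y \<bullet> \<xi>, e \<bullet> \<xi>))) A = emeasure (distr sphere_measure borel (\<lambda>\<xi>. (\<xi> $ 1, \<xi> $ 2))) A"
    by simp
qed simp

lemma integral_sphere_orthonormal:
  fixes y e :: "real ^ 3" and F :: "real \<times> real \<Rightarrow> real"
  assumes "norm y = 1" "norm e = 1" "y \<bullet> e = 0" and F: "F \<in> borel_measurable borel"
  shows "(\<integral>\<xi>. F (y \<bullet> \<xi>, e \<bullet> \<xi>) \<partial>sphere_measure) = (\<integral>\<xi>. F (\<xi> $ 1, \<xi> $ 2) \<partial>sphere_measure)"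
proof -
  have [measurable]: "(\<lambda>\<xi>. (y \<bullet> \<xi>, e \<bullet> \<xi>)) \<in> borel_measurable borel" "(\<lambda>\<xi> :: real ^ 3. (\<xi> $ 1, \<xi> $ 2)) \<in> borel_measurable borel"
    by (intro borel_measurable_continuous_onI continuous_intros)+
  have "(\<integral>\<xi>. F (y \<bullet> \<xi>, e \<bullet> \<xi>) \<partial>sphere_measure) = (\<integral>q. F q \<partial>distr sphere_measure borel (\<lambda>\<xi>. (y \<bullet> \<xi>, e \<bullet> \<xi>)))"
    by (rule integral_distr[symmetric]) (use F in auto)
  also have "\<dots> = (\<integral>\<xi>. F (\<xi> $ 1, \<xi> $ 2) \<partial>sphere_measure)"
    unfolding distr_sphere_orthonormal[OF assms(1-3)] by (rule integral_distr) (use F in auto)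
  finally show ?thesis .
qed

lemma distr_sphere_marginal:
  "distr sphere_measure borel (\<lambda>\<xi>. \<xi> $ 1) = density lborel (\<lambda>v. ennreal (2 * pi * indicator {-1..1} v))"
proof (rule measure_eqI)
  fix A assume "A \<in> sets (distr sphere_measure borel (\<lambda>\<xi>. \<xi> $ 1))"
  hence [measurable]: "A \<in> sets borel" by simp
  have "emeasure (distr sphere_measure borel (\<lambda>\<xi>. \<xi> $ 1)) A = (\<integral>\<^sup>+\<xi>. indicator A (\<xi> $ 1) \<partial>sphere_measure)"
    by (subst nn_integral_indicator[symmetric], simp, subst nn_integral_distr) auto
  also have "\<dots> = (\<integral>\<^sup>+v. ennreal (2 * pi) * (indicator A v * indicator {-1..1} v) \<partial>lborel)"
    by (subst sphere_marginal_nn_integral, simp, subst nn_integral_cmult) auto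
  also have "\<dots> = emeasure (density lborel (\<lambda>v. ennreal (2 * pi * indicator {-1..1} v))) A"
    by (subst emeasure_density) (auto intro!: nn_integral_cong simp: indicator_def)
  finally show "emeasure (distr sphere_measure borel (\<lambda>\<xi>. \<xi> $ 1)) A = emeasure (density lborel (\<lambda>v. ennreal (2 * pi * indicator {-1..1} v))) A" .
qed simp

lemma integral_sphere_zonal:
  fixes g :: "real \<Rightarrow> real"
  assumes y: "norm y = 1" and g: "continuous_on UNIV g"
  shows "(\<integral>\<xi>. g (y \<bullet> \<xi>) \<partial>sphere_measure) = 2 * pi * integral {-1..1} g"
proof -
  have [measurable]: "g \<in> borel_measurable borel" using g by (rule borel_measurable_continuous_onI)
  obtain e where e: "norm e = 1" "y \<bullet> e = 0" using orthonormal_exists by blast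
  have "(\<integral>\<xi>. g (y \<bullet> \<xi>) \<partial>sphere_measure) = (\<integral>\<xi>. g (\<xi> $ 1) \<partial>sphere_measure)"
    using integral_sphere_orthonormal[OF y e, of "\<lambda>p. g (fst p)"]
    by (simp add: borel_measurable_continuous_onI continuous_on_compose2[OF g] continuous_intros)
  also have "\<dots> = (\<integral>v. g v \<partial>distr sphere_measure borel (\<lambda>\<xi>. \<xi> $ 1))"
    by (rule integral_distr[symmetric]) auto
  also have "\<dots> = (\<integral>v. (2 * pi * indicator {-1..1} v) *\<^sub>R g v \<partial>lborel)"
    unfolding distr_sphere_marginal by (rule integral_density) auto
  also have "\<dots> = 2 * pi * (LINT v:{-1..1}|lborel. g v)"
    by (simp add: set_lebesgue_integral_def mult.assoc)
  also have "(LINT v:{-1..1}|lborel. g v) = integral {-1..1} g"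
    by (intro set_borel_integral_eq_integral borel_integrable_atLeastAtMost' continuous_on_subset[OF g]) auto
  finally show ?thesis .
qed

section \<open>The reproducing property of the Legendre kernel\<close>

lemma norm_orthonormal_combination:
  fixes x b :: "'a :: real_inner"
  assumes "norm x = 1" "norm b = 1" "x \<bullet> b = 0"
  shows "(norm (s *\<^sub>R x + t *\<^sub>R b))\<^sup>2 = s\<^sup>2 + t\<^sup>2"
proof -
  have "x \<bullet> x = 1" "b \<bullet> b = 1" "b \<bullet> x = 0" using assms by (simp_all add: norm_eq_1 inner_commute)
  thus ?thesis unfolding power2_norm_eq_inner using assms(3)
    by (simp add: inner_add_left inner_add_right power2_eq_square)
qed

lemma integral_sphere_legendre_square:
  assumes "norm y = 1"
  shows "(\<integral>\<xi>. (poly (legendre n) (y \<bullet> \<xi>))\<^sup>2 \<partial>sphere_measure) = 4 * pi / (2 * real n + 1)"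
  by (subst integral_sphere_zonal[OF assms, of "\<lambda>v. (poly (legendre n) v)\<^sup>2"])
     (auto simp: integral_legendre_square intro!: continuous_intros)

lemma integral_sphere_legendre_cube:
  assumes "norm y = 1" "n \<ge> 1"
  shows "(\<integral>\<xi>. \<bar>poly (legendre n) (y \<bullet> \<xi>)\<bar> ^ 3 \<partial>sphere_measure) \<le> 32 * pi * (2 / (2 * real n + 1)) powr (3 / 2)"
proof -
  have "(\<integral>\<xi>. \<bar>poly (legendre n) (y \<bullet> \<xi>)\<bar> ^ 3 \<partial>sphere_measure) = 2 * pi * integral {-1..1} (\<lambda>x. \<bar>poly (legendre n) x\<bar> ^ 3)"
    by (rule integral_sphere_zonal[OF assms(1), of "\<lambda>v. \<bar>poly (legendre n) v\<bar> ^ 3"]) (intro continuous_intros)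
  also have "\<dots> \<le> 2 * pi * (16 * (2 / (2 * real n + 1)) powr (3 / 2))"
    using legendre_cube_integral[OF assms(2)] by (intro mult_left_mono) auto
  finally show ?thesis by simp
qed

lemma integral_sphere_legendre:
  assumes "norm y = 1" "n \<ge> 1"
  shows "(\<integral>\<xi>. poly (legendre n) (y \<bullet> \<xi>) \<partial>sphere_measure) = 0"
proof -
  have "(pderiv ^^ n) (1 :: real poly) = 0" using assms(2) by (intro pderiv_funpow_eq_0) auto
  from legendre_orthogonal[OF this] have "integral {-1..1} (poly (legendre n)) = 0" by simp
  thus ?thesis using integral_sphere_zonal[OF assms(1), of "poly (legendre n)"]
    by (simp add: continuous_intros)
qed

text \<open>
  Reflecting the second axis preserves the measure and changes the sign of the integrand.
\<close>

lemma sphere_moment_reflect: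
  fixes g :: "real \<Rightarrow> real"
  assumes g: "continuous_on UNIV g" and "odd j"
  shows "(\<integral>\<xi>. (\<xi> $ 1) ^ a * (\<xi> $ 2) ^ j * g (\<xi> $ 1) \<partial>sphere_measure) = 0"
proof -
  let ?y = "axis 1 1 :: real ^ 3" and ?e = "axis 2 1 :: real ^ 3"
  define F where "F = (\<lambda>p :: real \<times> real. fst p ^ a * snd p ^ j * g (fst p))"
  have Fc: "continuous_on UNIV F" unfolding F_def
    by (intro continuous_intros continuous_on_compose2[OF g]) auto
  have "(\<integral>\<xi>. F (?y \<bullet> \<xi>, (- ?e) \<bullet> \<xi>) \<partial>sphere_measure) = (\<integral>\<xi>. F (\<xi> $ 1, \<xi> $ 2) \<partial>sphere_measure)"
    by (rule integral_sphere_orthonormal) (use Fc in \<open>auto simp: inner_axis_axis intro: borel_measurable_continuous_onI\<close>)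
  also have "(\<lambda>\<xi>. F (?y \<bullet> \<xi>, (- ?e) \<bullet> \<xi>)) = (\<lambda>\<xi>. - F (\<xi> $ 1, \<xi> $ 2))"
    using \<open>odd j\<close> by (auto simp: F_def inner_axis' fun_eq_iff)
  finally show ?thesis by (simp add: F_def)
qed

text \<open>
  Split \<open>x = c y + \<sigma> e\<close> with a unit vector e orthogonal to y and \<open>\<sigma>\<^sup>2 = 1 - c\<^sup>2\<close>. The binomial
  theorem gives moments that depend on neither x nor y, with coefficients \<open>c ^ (m - j) \<sigma> ^ j\<close>. Those with odd j
  vanish, so only powers of \<open>1 - c\<^sup>2\<close> remain and the result is a polynomial in \<open>c = x \<bullet> y\<close>.
\<close>

lemma sphere_zonal_monomial:
  fixes g :: "real \<Rightarrow> real"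
  assumes g: "continuous_on UNIV g"
  shows "\<exists>k. \<forall>x y. norm x = 1 \<longrightarrow> norm y = 1 \<longrightarrow>
           (\<integral>\<xi>. (x \<bullet> \<xi>) ^ m * g (y \<bullet> \<xi>) \<partial>sphere_measure) = poly k (x \<bullet> y)"
proof -
  define mom where "mom = (\<lambda>a j. \<integral>\<xi>. (\<xi> $ 1) ^ a * (\<xi> $ 2) ^ j * g (\<xi> $ 1) \<partial>sphere_measure)"
  define k :: "real poly" where "k = (\<Sum>j\<le>m. if even j then
      smult (real (m choose j) * mom (m - j) j) ([:0, 1:] ^ (m - j) * [:1, 0, -1:] ^ (j div 2)) else 0)"
  have "(\<integral>\<xi>. (x \<bullet> \<xi>) ^ m * g (y \<bullet> \<xi>) \<partial>sphere_measure) = poly k (x \<bullet> y)" if x: "norm x = 1" and y: "norm y = 1" for x y :: "real ^ 3"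
  proof -
    define c where "c = x \<bullet> y"
    obtain e \<sigma> where e: "norm e = 1" "y \<bullet> e = 0" and xe: "x = c *\<^sub>R y + \<sigma> *\<^sub>R e"
    proof (cases "x - c *\<^sub>R y = 0")
      case True
      obtain e where "norm e = 1" "y \<bullet> e = 0" using orthonormal_exists by blast
      thus ?thesis using that[of e 0] True by simp
    next
      case False
      have "y \<bullet> (x - c *\<^sub>R y) = 0" using y by (simp add: c_def inner_diff_right inner_commute dot_square_norm)
      thus ?thesis using False that[of "sgn (x - c *\<^sub>R y)" "norm (x - c *\<^sub>R y)"]
        by (simp add: norm_sgn sgn_div_norm)
    qed
    have "(norm x)\<^sup>2 = c\<^sup>2 + \<sigma>\<^sup>2"
      unfolding xe by (rule norm_orthonormal_combination[OF y e])
    hence \<sigma>: "\<sigma>\<^sup>2 = 1 - c\<^sup>2" using x by simp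
    have int: "(\<integral>\<xi>. (y \<bullet> \<xi>) ^ a * (e \<bullet> \<xi>) ^ j * g (y \<bullet> \<xi>) \<partial>sphere_measure) = mom a j" for a j
    proof -
      define F where "F = (\<lambda>p :: real \<times> real. fst p ^ a * snd p ^ j * g (fst p))"
      have Fc: "continuous_on UNIV F" unfolding F_def
        by (intro continuous_intros continuous_on_compose2[OF g]) auto
      show ?thesis
        using integral_sphere_orthonormal[OF y e, of F] Fc by (simp add: F_def mom_def borel_measurable_continuous_onI)
    qed
    have "(\<integral>\<xi>. (x \<bullet> \<xi>) ^ m * g (y \<bullet> \<xi>) \<partial>sphere_measure) =
      (\<integral>\<xi>. (\<Sum>j\<le>m. (real (m choose j) * c ^ (m - j) * \<sigma> ^ j) * ((y \<bullet> \<xi>) ^ (m - j) * (e \<bullet> \<xi>) ^ j * g (y \<bullet> \<xi>))) \<partial>sphere_measure)"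
    proof (rule Bochner_Integration.integral_cong[OF refl])
      fix \<xi> :: "real ^ 3"
      have "x \<bullet> \<xi> = \<sigma> * (e \<bullet> \<xi>) + c * (y \<bullet> \<xi>)" by (simp add: xe inner_add_left)
      thus "(x \<bullet> \<xi>) ^ m * g (y \<bullet> \<xi>) = (\<Sum>j\<le>m. (real (m choose j) * c ^ (m - j) * \<sigma> ^ j) * ((y \<bullet> \<xi>) ^ (m - j) * (e \<bullet> \<xi>) ^ j * g (y \<bullet> \<xi>)))"
        by (simp only: binomial_ring sum_distrib_right) (auto intro!: sum.cong simp: power_mult_distrib mult_ac)
    qed
    also have "\<dots> = (\<Sum>j\<le>m. (real (m choose j) * c ^ (m - j) * \<sigma> ^ j) * mom (m - j) j)"
      by (subst Bochner_Integration.integral_sum)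
         (auto simp: int intro!: integrable_mult_right continuous_integrable_sphere continuous_intros continuous_on_compose2[OF g])
    also have "\<dots> = (\<Sum>j\<le>m. if even j then real (m choose j) * mom (m - j) j * (c ^ (m - j) * (1 - c\<^sup>2) ^ (j div 2)) else 0)"
    proof (rule sum.cong[OF refl])
      fix j
      show "(real (m choose j) * c ^ (m - j) * \<sigma> ^ j) * mom (m - j) j =
         (if even j then real (m choose j) * mom (m - j) j * (c ^ (m - j) * (1 - c\<^sup>2) ^ (j div 2)) else 0)"
      proof (cases "even j")
        case True
        hence "\<sigma> ^ j = (1 - c\<^sup>2) ^ (j div 2)" by (simp flip: \<sigma> power_mult)
        thus ?thesis using True by simp
      next
        case False
        hence "mom (m - j) j = 0" unfolding mom_def by (intro sphere_moment_reflect g)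
        thus ?thesis using False by simp
      qed
    qed
    also have "\<dots> = poly k c"
      unfolding k_def poly_sum by (intro sum.cong) (auto simp: poly_power power2_eq_square)
    finally show ?thesis by (simp add: c_def)
  qed
  thus ?thesis by blast
qed

lemma sphere_zonal_poly:
  fixes g :: "real \<Rightarrow> real" and p :: "real poly"
  assumes g: "continuous_on UNIV g"
  obtains k where "\<And>x y. norm x = 1 \<Longrightarrow> norm y = 1 \<Longrightarrow>
           (\<integral>\<xi>. poly p (x \<bullet> \<xi>) * g (y \<bullet> \<xi>) \<partial>sphere_measure) = poly k (x \<bullet> y)"
proof -
  obtain K where K: "\<And>m x y. norm x = 1 \<Longrightarrow> norm y = 1 \<Longrightarrow>
           (\<integral>\<xi>. (x \<bullet> \<xi>) ^ m * g (y \<bullet> \<xi>) \<partial>sphere_measure) = poly (K m) (x \<bullet> y)"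
    using sphere_zonal_monomial[OF g] by metis
  have "(\<integral>\<xi>. poly p (x \<bullet> \<xi>) * g (y \<bullet> \<xi>) \<partial>sphere_measure) = poly (\<Sum>m\<le>degree p. smult (coeff p m) (K m)) (x \<bullet> y)"
    if "norm x = 1" "norm y = 1" for x y
  proof -
    have "(\<integral>\<xi>. poly p (x \<bullet> \<xi>) * g (y \<bullet> \<xi>) \<partial>sphere_measure) =
       (\<integral>\<xi>. (\<Sum>m\<le>degree p. coeff p m * ((x \<bullet> \<xi>) ^ m * g (y \<bullet> \<xi>))) \<partial>sphere_measure)"
      by (simp only: poly_altdef sum_distrib_right mult.assoc)
    also have "\<dots> = (\<Sum>m\<le>degree p. coeff p m * poly (K m) (x \<bullet> y))"
      using that by (subst Bochner_Integration.integral_sum)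
         (auto simp: K intro!: integrable_mult_right continuous_integrable_sphere continuous_intros continuous_on_compose2[OF g])
    finally show ?thesis by (simp add: poly_sum)
  qed
  thus ?thesis using that by blast
qed

lemma poly_bounded_interval:
  fixes p :: "real poly"
  obtains K where "\<And>u. \<bar>u\<bar> \<le> c \<Longrightarrow> \<bar>poly p u\<bar> \<le> K"
proof -
  have "compact (poly p ` {-c..c})" by (intro compact_continuous_image continuous_intros) auto
  then obtain K where "\<And>u. u \<in> {-c..c} \<Longrightarrow> \<bar>poly p u\<bar> \<le> K"
    by (force dest: compact_imp_bounded simp: bounded_iff)
  thus ?thesis using that[of K] by (auto simp: abs_le_iff)
qed

text \<open>
  The assumption k, differentiated twice along the great circle through x in the direction b. The sum over
  two orthogonal directions b is the Laplace-Beltrami operator in x.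
\<close>

lemma sphere_great_circle_deriv:
  fixes g :: "real \<Rightarrow> real" and p k :: "real poly"
  assumes g: "continuous_on UNIV g"
    and k: "\<forall>x y. norm x = 1 \<longrightarrow> norm y = 1 \<longrightarrow>
           (\<integral>\<xi>. poly p (x \<bullet> \<xi>) * g (y \<bullet> \<xi>) \<partial>sphere_measure) = poly k (x \<bullet> y)"
    and x: "norm x = 1" and y: "norm y = 1" and b: "norm b = 1" and xb: "x \<bullet> b = 0"
  shows "(\<integral>\<xi>. (poly (pderiv (pderiv p)) (x \<bullet> \<xi>) * (b \<bullet> \<xi>)\<^sup>2 - poly (pderiv p) (x \<bullet> \<xi>) * (x \<bullet> \<xi>)) * g (y \<bullet> \<xi>) \<partial>sphere_measure)
     = poly (pderiv (pderiv k)) (x \<bullet> y) * (b \<bullet> y)\<^sup>2 - poly (pderiv k) (x \<bullet> y) * (x \<bullet> y)"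
proof -
  define w where "w = (\<lambda>s. cos s *\<^sub>R x + sin s *\<^sub>R b)"
  define w' where "w' = (\<lambda>s. (- sin s) *\<^sub>R x + cos s *\<^sub>R b)"
  have w: "norm (w s) = 1" for s
  proof -
    have "(norm (w s))\<^sup>2 = 1"
      unfolding w_def norm_orthonormal_combination[OF x b xb] by simp
    thus ?thesis by (simp add: power2_eq_1_iff) (use norm_ge_zero[of "w s"] in linarith)
  qed
  have dw: "((\<lambda>s. w s \<bullet> \<xi>) has_real_derivative w' s \<bullet> \<xi>) (at s)" for \<xi> s
    unfolding w_def w'_def inner_add_left inner_scaleR_left by (auto intro!: derivative_eq_intros)
  have dw': "((\<lambda>s. w' s \<bullet> \<xi>) has_real_derivative - (w s \<bullet> \<xi>)) (at s)" for \<xi> s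
    unfolding w_def w'_def inner_add_left inner_scaleR_left by (auto intro!: derivative_eq_intros)
  have d1: "((\<lambda>s. poly q (w s \<bullet> \<xi>)) has_real_derivative poly (pderiv q) (w s \<bullet> \<xi>) * (w' s \<bullet> \<xi>)) (at s)" for q \<xi> s
    by (rule DERIV_chain2[OF poly_DERIV dw])
  have d2: "((\<lambda>s. poly (pderiv q) (w s \<bullet> \<xi>) * (w' s \<bullet> \<xi>)) has_real_derivative
      poly (pderiv (pderiv q)) (w s \<bullet> \<xi>) * (w' s \<bullet> \<xi>)\<^sup>2 - poly (pderiv q) (w s \<bullet> \<xi>) * (w s \<bullet> \<xi>)) (at s)" for q \<xi> s
    using DERIV_mult[OF d1 dw'] by (simp add: power2_eq_square algebra_simps)
  have wb: "\<bar>w s \<bullet> \<xi>\<bar> \<le> 1" "\<bar>w' s \<bullet> \<xi>\<bar> \<le> 2" if "\<xi> \<in> sphere 0 1" for s \<xi>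
  proof -
    show "\<bar>w s \<bullet> \<xi>\<bar> \<le> 1" using Cauchy_Schwarz_ineq2[of "w s" \<xi>] that w by simp
    have "norm (w' s) \<le> \<bar>sin s\<bar> * norm x + \<bar>cos s\<bar> * norm b"
      unfolding w'_def using norm_triangle_ineq[of "(- sin s) *\<^sub>R x" "cos s *\<^sub>R b"] by simp
    also have "\<dots> \<le> 1 + 1" using x b by (intro add_mono) auto
    finally show "\<bar>w' s \<bullet> \<xi>\<bar> \<le> 2" using Cauchy_Schwarz_ineq2[of "w' s" \<xi>] that by simp
  qed
  obtain K0 where K0: "\<And>u. \<bar>u\<bar> \<le> 1 \<Longrightarrow> \<bar>g u\<bar> \<le> K0"
  proof -
    have "compact (g ` {-1..1})" by (intro compact_continuous_image continuous_on_subset[OF g]) auto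
    then obtain K where "\<And>u. u \<in> {-1..1} \<Longrightarrow> \<bar>g u\<bar> \<le> K"
      by (force dest: compact_imp_bounded simp: bounded_iff)
    thus ?thesis using that[of K] by (auto simp: abs_le_iff)
  qed
  obtain K1 where K1: "\<And>u. \<bar>u\<bar> \<le> 1 \<Longrightarrow> \<bar>poly (pderiv p) u\<bar> \<le> K1" using poly_bounded_interval by blast
  obtain K2 where K2: "\<And>u. \<bar>u\<bar> \<le> 1 \<Longrightarrow> \<bar>poly (pderiv (pderiv p)) u\<bar> \<le> K2" using poly_bounded_interval by blast
  have K0': "K0 \<ge> 0" "K1 \<ge> 0" "K2 \<ge> 0" using K0[of 0] K1[of 0] K2[of 0] by auto
  have gb: "\<bar>g (y \<bullet> \<xi>)\<bar> \<le> K0" if "\<xi> \<in> sphere 0 1" for \<xi>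
    using Cauchy_Schwarz_ineq2[of y \<xi>] that y by (intro K0) simp
  note cont = continuous_intros continuous_on_compose2[OF g]
  have A1: "((\<lambda>s. \<integral>\<xi>. poly p (w s \<bullet> \<xi>) * g (y \<bullet> \<xi>) \<partial>sphere_measure) has_real_derivative
      (\<integral>\<xi>. (poly (pderiv p) (w s \<bullet> \<xi>) * (w' s \<bullet> \<xi>)) * g (y \<bullet> \<xi>) \<partial>sphere_measure)) (at s)" for s
  proof (rule DERIV_integral[where B = "\<lambda>_. K1 * 2 * K0"])
    show "\<bar>poly (pderiv p) (w s \<bullet> \<xi>) * (w' s \<bullet> \<xi>) * g (y \<bullet> \<xi>)\<bar> \<le> K1 * 2 * K0" if "\<xi> \<in> space sphere_measure" for s \<xi>
      unfolding abs_mult using that wb gb K1 K0' by (intro mult_mono) auto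
    show "((\<lambda>s. poly p (w s \<bullet> \<xi>) * g (y \<bullet> \<xi>)) has_real_derivative poly (pderiv p) (w s \<bullet> \<xi>) * (w' s \<bullet> \<xi>) * g (y \<bullet> \<xi>)) (at s)" for s \<xi>
      by (rule DERIV_cmult_right[OF d1])
    show "integrable sphere_measure (\<lambda>\<xi>. poly p (w s \<bullet> \<xi>) * g (y \<bullet> \<xi>))" for s
      by (intro continuous_integrable_sphere cont) auto
    show "(\<lambda>\<xi>. poly (pderiv p) (w s \<bullet> \<xi>) * (w' s \<bullet> \<xi>) * g (y \<bullet> \<xi>)) \<in> borel_measurable sphere_measure"
      by (intro measurable_sphere_measure borel_measurable_continuous_onI cont) auto
  qed simp
  have A2: "((\<lambda>s. \<integral>\<xi>. (poly (pderiv p) (w s \<bullet> \<xi>) * (w' s \<bullet> \<xi>)) * g (y \<bullet> \<xi>) \<partial>sphere_measure) has_real_derivative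
      (\<integral>\<xi>. (poly (pderiv (pderiv p)) (w s \<bullet> \<xi>) * (w' s \<bullet> \<xi>)\<^sup>2 - poly (pderiv p) (w s \<bullet> \<xi>) * (w s \<bullet> \<xi>)) * g (y \<bullet> \<xi>) \<partial>sphere_measure)) (at s)" for s
  proof (rule DERIV_integral[where B = "\<lambda>_. (K2 * 2\<^sup>2 + K1 * 1) * K0"])
    show "\<bar>(poly (pderiv (pderiv p)) (w s \<bullet> \<xi>) * (w' s \<bullet> \<xi>)\<^sup>2 - poly (pderiv p) (w s \<bullet> \<xi>) * (w s \<bullet> \<xi>)) * g (y \<bullet> \<xi>)\<bar> \<le> (K2 * 2\<^sup>2 + K1 * 1) * K0"
      if "\<xi> \<in> space sphere_measure" for s \<xi>
    proof -
      have "\<bar>poly (pderiv (pderiv p)) (w s \<bullet> \<xi>) * (w' s \<bullet> \<xi>)\<^sup>2\<bar> \<le> K2 * 2\<^sup>2"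
        unfolding abs_mult power_abs using that wb K2 K0' by (intro mult_mono power_mono) auto
      moreover have "\<bar>poly (pderiv p) (w s \<bullet> \<xi>) * (w s \<bullet> \<xi>)\<bar> \<le> K1 * 1"
        unfolding abs_mult using that wb K1 K0' by (intro mult_mono) auto
      ultimately have "\<bar>poly (pderiv (pderiv p)) (w s \<bullet> \<xi>) * (w' s \<bullet> \<xi>)\<^sup>2 - poly (pderiv p) (w s \<bullet> \<xi>) * (w s \<bullet> \<xi>)\<bar> \<le> K2 * 2\<^sup>2 + K1 * 1"
        by linarith
      thus ?thesis unfolding abs_mult[of _ "g _"] using that gb K0' by (intro mult_mono) auto
    qed
    show "((\<lambda>s. poly (pderiv p) (w s \<bullet> \<xi>) * (w' s \<bullet> \<xi>) * g (y \<bullet> \<xi>)) has_real_derivative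
       (poly (pderiv (pderiv p)) (w s \<bullet> \<xi>) * (w' s \<bullet> \<xi>)\<^sup>2 - poly (pderiv p) (w s \<bullet> \<xi>) * (w s \<bullet> \<xi>)) * g (y \<bullet> \<xi>)) (at s)" for s \<xi>
      by (rule DERIV_cmult_right[OF d2])
    show "integrable sphere_measure (\<lambda>\<xi>. poly (pderiv p) (w s \<bullet> \<xi>) * (w' s \<bullet> \<xi>) * g (y \<bullet> \<xi>))" for s
      by (intro continuous_integrable_sphere cont) auto
    show "(\<lambda>\<xi>. (poly (pderiv (pderiv p)) (w s \<bullet> \<xi>) * (w' s \<bullet> \<xi>)\<^sup>2 - poly (pderiv p) (w s \<bullet> \<xi>) * (w s \<bullet> \<xi>)) * g (y \<bullet> \<xi>)) \<in> borel_measurable sphere_measure"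
      by (intro measurable_sphere_measure borel_measurable_continuous_onI cont) auto
  qed simp
  have "(\<lambda>s. \<integral>\<xi>. poly p (w s \<bullet> \<xi>) * g (y \<bullet> \<xi>) \<partial>sphere_measure) = (\<lambda>s. poly k (w s \<bullet> y))"
    using k w y by simp
  from A1[unfolded this] have "(\<integral>\<xi>. (poly (pderiv p) (w s \<bullet> \<xi>) * (w' s \<bullet> \<xi>)) * g (y \<bullet> \<xi>) \<partial>sphere_measure) = poly (pderiv k) (w s \<bullet> y) * (w' s \<bullet> y)" for s
    using d1 by (rule DERIV_unique)
  from A2[unfolded this] have "(\<integral>\<xi>. (poly (pderiv (pderiv p)) (w 0 \<bullet> \<xi>) * (w' 0 \<bullet> \<xi>)\<^sup>2 - poly (pderiv p) (w 0 \<bullet> \<xi>) * (w 0 \<bullet> \<xi>)) * g (y \<bullet> \<xi>) \<partial>sphere_measure) =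
     poly (pderiv (pderiv k)) (w 0 \<bullet> y) * (w' 0 \<bullet> y)\<^sup>2 - poly (pderiv k) (w 0 \<bullet> y) * (w 0 \<bullet> y)"
    using d2 by (rule DERIV_unique)
  thus ?thesis by (simp add: w_def w'_def)
qed

text \<open>
  The integral is a polynomial k in \<open>x \<bullet> y\<close>. Applying the Laplace-Beltrami operator in x under the
  integral shows that k solves the Legendre equation with the eigenvalue of P, so k is a multiple
  of P. The factor is found at \<open>x = y\<close>.
\<close>

theorem legendre_reproducing:
  assumes n: "n \<ge> 1" and x: "norm x = 1" and y: "norm y = 1"
  shows "(\<integral>\<xi>. poly (legendre n) (x \<bullet> \<xi>) * poly (legendre n) (y \<bullet> \<xi>) \<partial>sphere_measure)
    = 4 * pi / (2 * real n + 1) * poly (legendre n) (x \<bullet> y)"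
proof -
  let ?P = "legendre n"
  have g: "continuous_on UNIV (poly ?P)" by (intro continuous_intros)
  obtain k where k: "\<And>x y. norm x = 1 \<Longrightarrow> norm y = 1 \<Longrightarrow>
           (\<integral>\<xi>. poly ?P (x \<bullet> \<xi>) * poly ?P (y \<bullet> \<xi>) \<partial>sphere_measure) = poly k (x \<bullet> y)"
    using sphere_zonal_poly[OF g, of ?P] by blast
  have "(1 - c\<^sup>2) * poly (pderiv (pderiv k)) c - 2 * c * poly (pderiv k) c + real (n * Suc n) * poly k c = 0"
    if c: "\<bar>c\<bar> \<le> 1" for c
  proof -
    obtain b :: "real ^ 3" where b: "norm b = 1" "axis 1 1 \<bullet> b = 0" using orthonormal_exists by blast
    define x :: "real ^ 3" where "x = axis 1 1"
    have x: "norm x = 1" and xb: "x \<bullet> b = 0" using b by (auto simp: x_def)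
    define y where "y = c *\<^sub>R x + sqrt (1 - c\<^sup>2) *\<^sub>R b"
    have c2: "c\<^sup>2 \<le> 1" using c by (simp add: abs_square_le_1)
    have y: "norm y = 1"
    proof -
      have "(norm y)\<^sup>2 = c\<^sup>2 + (sqrt (1 - c\<^sup>2))\<^sup>2"
        unfolding y_def by (rule norm_orthonormal_combination[OF x b(1) xb])
      hence "(norm y)\<^sup>2 = 1" using c2 by simp
      thus ?thesis by (simp add: power2_eq_1_iff) (use norm_ge_zero[of y] in linarith)
    qed
    have xy: "x \<bullet> y = c" using x xb by (simp add: y_def inner_add_right dot_square_norm)
    obtain f where f: "norm f = 1" "x \<bullet> f = 0" "b \<bullet> f = 0"
      "orthogonal_transformation (\<lambda>v :: real ^ 3. v $ 1 *\<^sub>R x + v $ 2 *\<^sub>R b + v $ 3 *\<^sub>R f)"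
      "\<forall>v. (norm v)\<^sup>2 = (x \<bullet> v)\<^sup>2 + (b \<bullet> v)\<^sup>2 + (f \<bullet> v)\<^sup>2"
      by (rule sphere_frame[OF x b(1) xb])
    have pyth: "(b \<bullet> v)\<^sup>2 + (f \<bullet> v)\<^sup>2 = 1 - (x \<bullet> v)\<^sup>2" if "norm v = 1" for v
      using f(5)[rule_format, of v] that by simp
    let ?T = "\<lambda>b \<xi>. (poly (pderiv (pderiv ?P)) (x \<bullet> \<xi>) * (b \<bullet> \<xi>)\<^sup>2 - poly (pderiv ?P) (x \<bullet> \<xi>) * (x \<bullet> \<xi>)) * poly ?P (y \<bullet> \<xi>)"
    have int: "integrable sphere_measure (?T b)" for b :: "real ^ 3"
      by (intro continuous_integrable_sphere continuous_intros)
    have "\<forall>x y. norm x = 1 \<longrightarrow> norm y = 1 \<longrightarrow>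
           (\<integral>\<xi>. poly ?P (x \<bullet> \<xi>) * poly ?P (y \<bullet> \<xi>) \<partial>sphere_measure) = poly k (x \<bullet> y)" using k by blast
    note d = sphere_great_circle_deriv[OF g this x y]
    have "(\<integral>\<xi>. ?T b \<xi> + ?T f \<xi> \<partial>sphere_measure) =
       (poly (pderiv (pderiv k)) c * (b \<bullet> y)\<^sup>2 - poly (pderiv k) c * c) + (poly (pderiv (pderiv k)) c * (f \<bullet> y)\<^sup>2 - poly (pderiv k) c * c)"
      using int d[OF b(1) xb] d[OF f(1,2)] xy by (subst Bochner_Integration.integral_add) auto
    also have "\<dots> = (1 - c\<^sup>2) * poly (pderiv (pderiv k)) c - 2 * c * poly (pderiv k) c"
    proof -
      have "(poly (pderiv (pderiv k)) c * (b \<bullet> y)\<^sup>2 - poly (pderiv k) c * c) + (poly (pderiv (pderiv k)) c * (f \<bullet> y)\<^sup>2 - poly (pderiv k) c * c)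
        = ((b \<bullet> y)\<^sup>2 + (f \<bullet> y)\<^sup>2) * poly (pderiv (pderiv k)) c - 2 * c * poly (pderiv k) c" by (simp add: algebra_simps)
      thus ?thesis using pyth[OF y] xy by simp
    qed
    also have "(\<integral>\<xi>. ?T b \<xi> + ?T f \<xi> \<partial>sphere_measure) =
       (\<integral>\<xi>. - real (n * Suc n) * (poly ?P (x \<bullet> \<xi>) * poly ?P (y \<bullet> \<xi>)) \<partial>sphere_measure)"
    proof (rule Bochner_Integration.integral_cong[OF refl])
      fix \<xi> assume "\<xi> \<in> space sphere_measure"
      hence \<xi>: "norm \<xi> = 1" by simp
      have "?T b \<xi> + ?T f \<xi> = (((b \<bullet> \<xi>)\<^sup>2 + (f \<bullet> \<xi>)\<^sup>2) * poly (pderiv (pderiv ?P)) (x \<bullet> \<xi>) - 2 * (x \<bullet> \<xi>) * poly (pderiv ?P) (x \<bullet> \<xi>)) * poly ?P (y \<bullet> \<xi>)"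
        by (simp add: algebra_simps)
      also have "\<dots> = - real (n * Suc n) * poly ?P (x \<bullet> \<xi>) * poly ?P (y \<bullet> \<xi>)"
      proof -
        have "(1 - (x \<bullet> \<xi>)\<^sup>2) * poly (pderiv (pderiv ?P)) (x \<bullet> \<xi>) - 2 * (x \<bullet> \<xi>) * poly (pderiv ?P) (x \<bullet> \<xi>) = - real (n * Suc n) * poly ?P (x \<bullet> \<xi>)"
          using legendre_ode[of "x \<bullet> \<xi>" n] by linarith
        thus ?thesis unfolding pyth[OF \<xi>] by simp
      qed
      finally show "?T b \<xi> + ?T f \<xi> = - real (n * Suc n) * (poly ?P (x \<bullet> \<xi>) * poly ?P (y \<bullet> \<xi>))" by simp
    qed
    also have "\<dots> = - real (n * Suc n) * poly k c"
      by (subst integral_mult_right_zero) (simp only: k[OF x y] xy)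
    finally show ?thesis by linarith
  qed
  from legendre_ode_unique[OF this n] have k': "k = smult (poly k 1) ?P" .
  have "poly k 1 = (\<integral>\<xi>. (poly ?P (x \<bullet> \<xi>))\<^sup>2 \<partial>sphere_measure)"
    using k[OF x x] x by (simp add: dot_square_norm power2_eq_square)
  also have "\<dots> = 4 * pi / (2 * real n + 1)" by (rule integral_sphere_legendre_square[OF x])
  finally have "poly k (x \<bullet> y) = 4 * pi / (2 * real n + 1) * poly ?P (x \<bullet> y)"
    by (subst k') simp
  thus ?thesis using k[OF x y] by simp
qed

section \<open>Functions of finitely many coordinates and the normal distribution\<close>

lemma tendsto_fun_iff:
  fixes f :: "'b \<Rightarrow> 'i \<Rightarrow> 'a :: topological_space"
  shows "(f \<longlongrightarrow> l) F \<longleftrightarrow> (\<forall>i. ((\<lambda>x. f x i) \<longlongrightarrow> l i) F)"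
  using limitin_componentwise[of "\<lambda>_. euclidean" UNIV f l F]
  by (simp add: euclidean_product_topology limitin_canonical_iff)

lemma mvt_symmetric:
  fixes f f' :: "real \<Rightarrow> real"
  assumes "\<And>x. (f has_real_derivative f' x) (at x)"
  shows "\<exists>z. \<bar>z - a\<bar> \<le> \<bar>b - a\<bar> \<and> f b - f a = (b - a) * f' z"
proof (cases a b rule: linorder_cases)
  case less
  obtain z where "a < z" "z < b" "f b - f a = (b - a) * f' z" using MVT2[OF less, of f f'] assms by blast
  thus ?thesis by (intro exI[of _ z]) auto
next
  case greater
  obtain z where "b < z" "z < a" "f a - f b = (a - b) * f' z" using MVT2[OF greater, of f f'] assms by blast
  thus ?thesis by (intro exI[of _ z]) (auto simp: algebra_simps)
qed auto

text \<open>
  Functions on d-dimensional space are represented by functions of infinite sequences that ignore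
  the coordinates from d on. Unlike functions on \<^term>\<open>Rd d\<close>, these can be composed with affine maps
  of sequences without restricting anything.
\<close>

definition C1_on :: "nat \<Rightarrow> ((nat \<Rightarrow> real) \<Rightarrow> real) \<Rightarrow> (nat \<Rightarrow> (nat \<Rightarrow> real) \<Rightarrow> real) \<Rightarrow> bool" where
  "C1_on d F F' \<longleftrightarrow>
     (\<forall>x y. (\<forall>i<d. x i = y i) \<longrightarrow> F x = F y) \<and> continuous_on UNIV F \<and>
     (\<forall>i<d. continuous_on UNIV (F' i) \<and> (\<forall>x. ((\<lambda>s. F (x(i := s))) has_real_derivative F' i x) (at (x i))))"

text \<open>
  The coordinates of \<open>\<gamma> t\<close> are moved one at a time, each by the mean value theorem in that
  coordinate; continuity of the partial derivatives gives the limit.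
\<close>

lemma C1_on_chain:
  assumes F: "C1_on d F F'"
    and \<gamma>: "\<And>i. i < d \<Longrightarrow> ((\<lambda>t. \<gamma> t i) has_real_derivative \<gamma>' i) (at t)"
  shows "((\<lambda>t. F (\<gamma> t)) has_real_derivative (\<Sum>i<d. \<gamma>' i * F' i (\<gamma> t))) (at t)"
proof -
  define mix where "mix = (\<lambda>k s i. if i < k then \<gamma> s i else \<gamma> t i)"
  have Fc: "continuous_on UNIV (F' i)" if "i < d" for i using F that by (auto simp: C1_on_def)
  have Fd: "((\<lambda>u. F (x(i := u))) has_real_derivative F' i (x(i := u))) (at u)" if "i < d" for i x u
  proof -
    have "((\<lambda>s. F ((x(i := u))(i := s))) has_real_derivative F' i (x(i := u))) (at ((x(i := u)) i))"
      using F that unfolding C1_on_def by blast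
    thus ?thesis by simp
  qed
  have "((\<lambda>s. F (mix k s)) has_real_derivative (\<Sum>i<k. \<gamma>' i * F' i (\<gamma> t))) (at t)" if "k \<le> d" for k
    using that
  proof (induction k)
    case 0
    show ?case by (simp add: mix_def)
  next
    case (Suc k)
    hence k: "k < d" by simp
    have mixS: "mix (Suc k) s = (mix k s)(k := \<gamma> s k)" for s by (auto simp: mix_def fun_eq_iff)
    have mixt: "mix k t = \<gamma> t" "(mix k s)(k := \<gamma> t k) = mix k s" for k s by (auto simp: mix_def fun_eq_iff)
    have "\<exists>z. \<bar>z - \<gamma> t k\<bar> \<le> \<bar>\<gamma> s k - \<gamma> t k\<bar> \<and>
       F ((mix k s)(k := \<gamma> s k)) - F ((mix k s)(k := \<gamma> t k)) = (\<gamma> s k - \<gamma> t k) * F' k ((mix k s)(k := z))" for s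
      by (rule mvt_symmetric[OF Fd[OF k]])
    then obtain Z where Z: "\<And>s. \<bar>Z s - \<gamma> t k\<bar> \<le> \<bar>\<gamma> s k - \<gamma> t k\<bar>"
       "\<And>s. F (mix (Suc k) s) - F (mix k s) = (\<gamma> s k - \<gamma> t k) * F' k ((mix k s)(k := Z s))"
      unfolding mixS mixt by metis
    have \<gamma>c: "((\<lambda>s. \<gamma> s i) \<longlongrightarrow> \<gamma> t i) (at t)" if "i < d" for i
      using DERIV_isCont[OF \<gamma>[OF that]] by (simp add: isCont_def)
    have "((\<lambda>s. Z s - \<gamma> t k) \<longlongrightarrow> 0) (at t)"
      by (rule Lim_null_comparison[of _ "\<lambda>s. \<bar>\<gamma> s k - \<gamma> t k\<bar>"])
         (use Z(1) tendsto_rabs_zero[OF LIM_zero[OF \<gamma>c[OF k]]] in auto)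
    hence Zc: "(Z \<longlongrightarrow> \<gamma> t k) (at t)" by (simp add: LIM_zero_iff)
    have pc: "((\<lambda>s. (mix k s)(k := Z s)) \<longlongrightarrow> \<gamma> t) (at t)"
      unfolding tendsto_fun_iff
    proof
      fix i
      consider "i = k" | "i < k" | "i > k" by linarith
      thus "((\<lambda>s. ((mix k s)(k := Z s)) i) \<longlongrightarrow> \<gamma> t i) (at t)"
        using Zc \<gamma>c[of i] k by cases (auto simp: mix_def)
    qed
    have "isCont (F' k) (\<gamma> t)" using Fc[OF k] by (simp add: continuous_on_eq_continuous_at)
    from isCont_tendsto_compose[OF this pc]
    have 1: "((\<lambda>s. F' k ((mix k s)(k := Z s))) \<longlongrightarrow> F' k (\<gamma> t)) (at t)" .
    have "((\<lambda>s. (\<gamma> s k - \<gamma> t k) / (s - t) * F' k ((mix k s)(k := Z s))) \<longlongrightarrow> \<gamma>' k * F' k (\<gamma> t)) (at t)"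
      using \<gamma>[OF k] unfolding has_field_derivative_iff by (intro tendsto_mult 1)
    hence 2: "((\<lambda>s. F (mix (Suc k) s) - F (mix k s)) has_real_derivative \<gamma>' k * F' k (\<gamma> t)) (at t)"
      unfolding has_field_derivative_iff by (simp add: Z(2) mixt(1))
    show ?case using DERIV_add[OF Suc.IH 2] Suc.prems by (simp add: add.commute)
  qed
  from this[OF order.refl] have "((\<lambda>s. F (mix d s)) has_real_derivative (\<Sum>i<d. \<gamma>' i * F' i (\<gamma> t))) (at t)" .
  moreover have "F (mix d s) = F (\<gamma> s)" for s
    using F unfolding C1_on_def by (auto simp: mix_def)
  ultimately show ?thesis by simp
qed

lemma C1_on_lipschitz:
  assumes F: "C1_on d F F'" and B: "\<And>i x. i < d \<Longrightarrow> \<bar>F' i x\<bar> \<le> B"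
  shows "\<bar>F x - F y\<bar> \<le> B * (\<Sum>i<d. \<bar>x i - y i\<bar>)"
proof -
  define \<gamma> where "\<gamma> = (\<lambda>t i. y i + t * (x i - y i))"
  have d: "((\<lambda>t. F (\<gamma> t)) has_real_derivative (\<Sum>i<d. (x i - y i) * F' i (\<gamma> t))) (at t)" for t
    by (rule C1_on_chain[OF F]) (auto simp: \<gamma>_def intro!: derivative_eq_intros)
  have "norm (F (\<gamma> 1) - F (\<gamma> 0)) \<le> (B * (\<Sum>i<d. \<bar>x i - y i\<bar>)) * norm (1 - 0 :: real)"
  proof (rule field_differentiable_bound[of UNIV, OF _ d])
    fix t :: real
    have "\<bar>\<Sum>i<d. (x i - y i) * F' i (\<gamma> t)\<bar> \<le> (\<Sum>i<d. \<bar>x i - y i\<bar> * B)"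
      by (rule order_trans[OF sum_abs]) (auto simp: abs_mult intro!: sum_mono mult_left_mono B)
    thus "norm (\<Sum>i<d. (x i - y i) * F' i (\<gamma> t)) \<le> B * (\<Sum>i<d. \<bar>x i - y i\<bar>)"
      by (simp add: sum_distrib_left mult.commute)
  qed auto
  thus ?thesis by (simp add: \<gamma>_def)
qed

lemma normal_density_at_top_tendsto_0:
  assumes "\<sigma> > 0"
  shows "((\<lambda>x. (c + b * \<bar>x\<bar>) * normal_density 0 \<sigma> x) \<longlongrightarrow> 0) at_top"
    and "((\<lambda>x. (c + b * \<bar>x\<bar>) * normal_density 0 \<sigma> x) \<longlongrightarrow> 0) at_bot"
proof -
  define K where "K = 1 / sqrt (2 * pi * \<sigma>\<^sup>2)"
  have nd: "normal_density 0 \<sigma> x = K * exp (- x\<^sup>2 / (2 * \<sigma>\<^sup>2))" for x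
    by (simp add: normal_density_def K_def)
  have e: "normal_density 0 \<sigma> x \<le> \<bar>K\<bar> * (1 / (1 + x\<^sup>2 / (2 * \<sigma>\<^sup>2)))" for x
  proof -
    have "exp (- x\<^sup>2 / (2 * \<sigma>\<^sup>2)) = 1 / exp (x\<^sup>2 / (2 * \<sigma>\<^sup>2))" using exp_minus'[of "x\<^sup>2 / (2 * \<sigma>\<^sup>2)"] by simp
    also have "\<dots> \<le> 1 / (1 + x\<^sup>2 / (2 * \<sigma>\<^sup>2))"
      by (intro divide_left_mono mult_pos_pos) (auto intro!: add_pos_nonneg)
    finally show ?thesis unfolding nd by (intro mult_mono) auto
  qed
  have *: "norm ((c + b * \<bar>x\<bar>) * normal_density 0 \<sigma> x) \<le> (\<bar>c\<bar> + \<bar>b\<bar> * \<bar>x\<bar>) * (\<bar>K\<bar> * (1 / (1 + x\<^sup>2 / (2 * \<sigma>\<^sup>2))))" for x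
  proof -
    have "norm ((c + b * \<bar>x\<bar>) * normal_density 0 \<sigma> x) = \<bar>c + b * \<bar>x\<bar>\<bar> * normal_density 0 \<sigma> x"
      by (simp add: abs_mult)
    also have "\<dots> \<le> (\<bar>c\<bar> + \<bar>b\<bar> * \<bar>x\<bar>) * (\<bar>K\<bar> * (1 / (1 + x\<^sup>2 / (2 * \<sigma>\<^sup>2))))"
      using e[of x] by (intro mult_mono) (auto simp: abs_mult intro: order_trans[OF abs_triangle_ineq])
    finally show ?thesis .
  qed
  have t: "((\<lambda>x. (\<bar>c\<bar> + \<bar>b\<bar> * \<bar>x\<bar>) * (\<bar>K\<bar> * (1 / (1 + x\<^sup>2 / (2 * \<sigma>\<^sup>2))))) \<longlongrightarrow> 0) at_top"
          "((\<lambda>x. (\<bar>c\<bar> + \<bar>b\<bar> * \<bar>x\<bar>) * (\<bar>K\<bar> * (1 / (1 + x\<^sup>2 / (2 * \<sigma>\<^sup>2))))) \<longlongrightarrow> 0) at_bot"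
    using assms by real_asymp+
  show "((\<lambda>x. (c + b * \<bar>x\<bar>) * normal_density 0 \<sigma> x) \<longlongrightarrow> 0) at_top"
       "((\<lambda>x. (c + b * \<bar>x\<bar>) * normal_density 0 \<sigma> x) \<longlongrightarrow> 0) at_bot"
    by (rule Lim_null_comparison[OF always_eventually t(1)], use * in blast,
        rule Lim_null_comparison[OF always_eventually t(2)], use * in blast)
qed

text \<open>
  Stein's identity: the derivative of the normal density at x is the density times \<open>- x / \<sigma>\<^sup>2\<close>, and
  the boundary terms vanish because \<open>\<psi>\<close> grows at most linearly.
\<close>

lemma normal_integration_by_parts:
  fixes \<psi> \<psi>' :: "real \<Rightarrow> real"
  assumes \<sigma>: "\<sigma> > 0" and der: "\<And>x. (\<psi> has_real_derivative \<psi>' x) (at x)"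
    and cont: "continuous_on UNIV \<psi>'" and B: "\<And>x. \<bar>\<psi>' x\<bar> \<le> B"
  defines "N \<equiv> density lborel (\<lambda>x. ennreal (normal_density 0 \<sigma> x))"
  shows "(\<integral>x. x * \<psi> x \<partial>N) = \<sigma>\<^sup>2 * (\<integral>x. \<psi>' x \<partial>N)"
proof -
  let ?\<phi> = "normal_density 0 \<sigma>"
  have \<psi>c: "continuous_on UNIV \<psi>" using der by (meson DERIV_isCont continuous_at_imp_continuous_on)
  have [measurable]: "\<psi> \<in> borel_measurable borel" "\<psi>' \<in> borel_measurable borel"
    using \<psi>c cont by (auto intro: borel_measurable_continuous_onI)
  have \<psi>b: "\<bar>\<psi> x\<bar> \<le> \<bar>\<psi> 0\<bar> + B * \<bar>x\<bar>" for x
    using field_differentiable_bound[of UNIV \<psi> \<psi>' B x 0] der B by auto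
  have d\<phi>: "(?\<phi> has_real_derivative - x / \<sigma>\<^sup>2 * ?\<phi> x) (at x)" for x
    unfolding normal_density_def using \<sigma> by (auto intro!: derivative_eq_intros simp: field_simps)
  have \<phi>c: "continuous_on UNIV ?\<phi>" using d\<phi> by (meson DERIV_isCont continuous_at_imp_continuous_on)
  have i0: "integrable lborel ?\<phi>" and i1: "integrable lborel (\<lambda>x. ?\<phi> x * \<bar>x\<bar>)" and i2: "integrable lborel (\<lambda>x. ?\<phi> x * x ^ 2)"
    using integrable_normal_moment[OF \<sigma>, of 0 0] integrable_normal_moment_abs[OF \<sigma>, of 0 1] integrable_normal_moment[OF \<sigma>, of 0 2]
    by simp_all
  have I1: "integrable lborel (\<lambda>x. ?\<phi> x * \<psi>' x)"
    by (rule Bochner_Integration.integrable_bound[OF integrable_mult_left[OF i0, of B]])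
       (auto simp: abs_mult intro!: mult_left_mono order_trans[OF B] AE_I2)
  have I2: "integrable lborel (\<lambda>x. ?\<phi> x * (x * \<psi> x))"
  proof (rule Bochner_Integration.integrable_bound)
    show "integrable lborel (\<lambda>x. \<bar>\<psi> 0\<bar> * (?\<phi> x * \<bar>x\<bar>) + B * (?\<phi> x * x ^ 2))"
      by (intro Bochner_Integration.integrable_add integrable_mult_right i1 i2)
    show "AE x in lborel. norm (?\<phi> x * (x * \<psi> x)) \<le> norm (\<bar>\<psi> 0\<bar> * (?\<phi> x * \<bar>x\<bar>) + B * (?\<phi> x * x ^ 2))"
    proof (rule AE_I2)
      fix x
      have "norm (?\<phi> x * (x * \<psi> x)) \<le> ?\<phi> x * (\<bar>x\<bar> * (\<bar>\<psi> 0\<bar> + B * \<bar>x\<bar>))"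
        using \<psi>b[of x] by (auto simp: abs_mult intro!: mult_left_mono)
      also have "\<dots> = \<bar>\<psi> 0\<bar> * (?\<phi> x * \<bar>x\<bar>) + B * (?\<phi> x * x ^ 2)"
        by (simp add: algebra_simps power2_eq_square)
      finally show "norm (?\<phi> x * (x * \<psi> x)) \<le> norm (\<bar>\<psi> 0\<bar> * (?\<phi> x * \<bar>x\<bar>) + B * (?\<phi> x * x ^ 2))" by simp
    qed
  qed auto
  define f where "f = (\<lambda>x. ?\<phi> x * \<psi>' x - (1 / \<sigma>\<^sup>2) * (?\<phi> x * (x * \<psi> x)))"
  have If: "integrable lborel f" unfolding f_def by (intro Bochner_Integration.integrable_diff integrable_mult_right I1 I2)
  have dF: "((\<lambda>x. ?\<phi> x * \<psi> x) has_real_derivative f x) (at x)" for x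
    using DERIV_mult[OF d\<phi>[of x] der[of x]] by (simp add: f_def field_simps)
  have lim: "((\<lambda>x. ?\<phi> x * \<psi> x) \<longlongrightarrow> 0) at_top" "((\<lambda>x. ?\<phi> x * \<psi> x) \<longlongrightarrow> 0) at_bot"
  proof -
    have "norm (?\<phi> x * \<psi> x) \<le> (\<bar>\<psi> 0\<bar> + B * \<bar>x\<bar>) * ?\<phi> x" for x
      using mult_right_mono[OF \<psi>b[of x], of "?\<phi> x"] by (simp add: abs_mult mult.commute)
    hence *: "\<forall>x. norm (?\<phi> x * \<psi> x) \<le> (\<bar>\<psi> 0\<bar> + B * \<bar>x\<bar>) * ?\<phi> x" by blast
    show "((\<lambda>x. ?\<phi> x * \<psi> x) \<longlongrightarrow> 0) at_top"
      by (rule Lim_null_comparison[OF always_eventually[OF *] normal_density_at_top_tendsto_0(1)[OF \<sigma>]])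
    show "((\<lambda>x. ?\<phi> x * \<psi> x) \<longlongrightarrow> 0) at_bot"
      by (rule Lim_null_comparison[OF always_eventually[OF *] normal_density_at_top_tendsto_0(2)[OF \<sigma>]])
  qed
  have "(LBINT x=-\<infinity>..\<infinity>. f x) = 0 - 0"
  proof (rule interval_integral_FTC_integrable[where F = "\<lambda>x. ?\<phi> x * \<psi> x"])
    show "((\<lambda>x. ?\<phi> x * \<psi> x) has_vector_derivative f x) (at x)" for x
      using dF by (simp add: has_real_derivative_iff_has_vector_derivative)
    have "continuous_on UNIV f" unfolding f_def by (intro continuous_intros \<phi>c \<psi>c cont) (use \<sigma> in auto)
    thus "isCont f x" for x by (simp add: continuous_on_eq_continuous_at)
    show "set_integrable lborel (einterval (-\<infinity>) \<infinity>) f" using If by (simp add: set_integrable_def einterval_eq)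
    show "(((\<lambda>x. ?\<phi> x * \<psi> x) \<circ> real_of_ereal) \<longlongrightarrow> 0) (at_right (-\<infinity>))"
      using lim(2) by (simp add: ereal_tendsto_simps)
    show "(((\<lambda>x. ?\<phi> x * \<psi> x) \<circ> real_of_ereal) \<longlongrightarrow> 0) (at_left \<infinity>)"
      using lim(1) by (simp add: ereal_tendsto_simps)
  qed auto
  hence "(\<integral>x. f x \<partial>lborel) = 0"
    by (simp add: interval_lebesgue_integral_def einterval_eq set_lebesgue_integral_def)
  hence "(\<integral>x. ?\<phi> x * \<psi>' x \<partial>lborel) = (1 / \<sigma>\<^sup>2) * (\<integral>x. ?\<phi> x * (x * \<psi> x) \<partial>lborel)"
    unfolding f_def by (subst (asm) Bochner_Integration.integral_diff) (auto intro: I1 integrable_mult_right I2)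
  moreover have "(\<integral>x. h x \<partial>N) = (\<integral>x. ?\<phi> x * h x \<partial>lborel)" if "h \<in> borel_measurable borel" for h :: "real \<Rightarrow> real"
    unfolding N_def using that by (subst integral_density) auto
  ultimately show ?thesis using \<sigma> by (simp add: field_simps)
qed

section \<open>Gaussian vectors\<close>

text \<open>
  For large k, the functions 1 and \<open>1 + W / k\<close> are densities of two probability measures under
  which Y has the same characteristic function. Levy's uniqueness theorem says that Y has the same
  law under both.
\<close>

lemma (in prob_space) char_weighted_unique_real:
  fixes W :: "'a \<Rightarrow> real"
  assumes [measurable]: "Y \<in> borel_measurable M" "W \<in> borel_measurable M" and A: "A \<in> sets borel"
    and W: "\<And>\<omega>. \<bar>W \<omega>\<bar> \<le> K"
    and eq: "\<And>t. (CLINT \<omega>|M. complex_of_real (W \<omega>) * iexp (t * Y \<omega>)) = 0"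
  shows "(\<integral>\<omega>. W \<omega> * indicator A (Y \<omega>) \<partial>M) = 0"
proof -
  define k where "k = \<bar>K\<bar> + 1"
  have k: "k > 0" "\<And>\<omega>. \<bar>W \<omega>\<bar> \<le> k" using W by (auto simp: k_def intro: order_trans[OF W])
  define D where "D = (\<lambda>c. density M (\<lambda>\<omega>. ennreal (1 + c * W \<omega> / k)))"
  have nn: "1 + c * W \<omega> / k \<ge> 0" if "c \<in> {0, 1}" for c \<omega>
    using that k(1) k(2)[of \<omega>] by (auto simp: field_simps abs_le_iff)
  have Wi: "integrable M W" using W by (intro integrable_const_bound[of _ K]) auto
  have "(CLINT \<omega>|M. complex_of_real (W \<omega>)) = 0" using eq[of 0] by simp
  hence W0: "(\<integral>\<omega>. W \<omega> \<partial>M) = 0" by (simp add: integral_complex_of_real)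
  have pD: "prob_space (D c)" if c: "c \<in> {0, 1}" for c
  proof
    have "emeasure (D c) (space (D c)) = (\<integral>\<^sup>+\<omega>. ennreal (1 + c * W \<omega> / k) \<partial>M)"
      unfolding D_def by (subst emeasure_density) (auto intro!: nn_integral_cong)
    also have "\<dots> = ennreal (\<integral>\<omega>. 1 + c * W \<omega> / k \<partial>M)"
      using nn[OF c] Wi by (intro nn_integral_eq_integral) auto
    also have "(\<integral>\<omega>. 1 + c * W \<omega> / k \<partial>M) = 1" using Wi W0 by (simp add: prob_space)
    finally show "emeasure (D c) (space (D c)) = 1" by simp
  qed
  have mD: "borel_measurable (D c) = (borel_measurable M :: ('a \<Rightarrow> 'b :: topological_space) set)" for c
    by (intro measurable_cong_sets) (simp_all add: D_def)
  have Dint: "(\<integral>\<omega>. f \<omega> \<partial>D c) = (\<integral>\<omega>. (1 + c * W \<omega> / k) *\<^sub>R f \<omega> \<partial>M)"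
    if "c \<in> {0, 1}" and [measurable]: "f \<in> borel_measurable M" for c and f :: "'a \<Rightarrow> 'b :: {banach, second_countable_topology}"
    unfolding D_def using nn[OF that(1)] by (intro integral_density) auto
  have rd: "real_distribution (distr (D c) borel Y)" if "c \<in> {0, 1}" for c
    by (rule prob_space.real_distribution_distr[OF pD[OF that]]) (simp add: D_def)
  have "char (distr (D 1) borel Y) = char (distr (D 0) borel Y)"
  proof
    fix t
    have ch: "char (distr (D c) borel Y) t = (CLINT \<omega>|M. (1 + c * W \<omega> / k) *\<^sub>R iexp (t * Y \<omega>))" if "c \<in> {0, 1}" for c
    proof -
      have "char (distr (D c) borel Y) t = (CLINT \<omega>|D c. iexp (t * Y \<omega>))"
        unfolding char_def by (rule integral_distr) (simp_all add: mD)
      also have "\<dots> = (CLINT \<omega>|M. (1 + c * W \<omega> / k) *\<^sub>R iexp (t * Y \<omega>))"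
        by (rule Dint[OF that]) simp
      finally show ?thesis .
    qed
    have "char (distr (D 1) borel Y) t = (CLINT \<omega>|M. iexp (t * Y \<omega>) + (1 / k) * (complex_of_real (W \<omega>) * iexp (t * Y \<omega>)))"
      by (subst ch, simp) (auto intro!: Bochner_Integration.integral_cong simp: scaleR_conv_of_real algebra_simps)
    also have "\<dots> = (CLINT \<omega>|M. iexp (t * Y \<omega>)) + (1 / k) * (CLINT \<omega>|M. complex_of_real (W \<omega>) * iexp (t * Y \<omega>))"
    proof (subst Bochner_Integration.integral_add)
      show "complex_integrable M (\<lambda>\<omega>. iexp (t * Y \<omega>))" by (intro integrable_const_bound[of _ 1]) auto
      show "complex_integrable M (\<lambda>\<omega>. (1 / k) * (complex_of_real (W \<omega>) * iexp (t * Y \<omega>)))"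
        using W by (intro integrable_mult_right integrable_const_bound[of _ K]) (auto simp: norm_mult)
    qed auto
    also have "\<dots> = char (distr (D 0) borel Y) t" unfolding eq by (subst ch) simp_all
    finally show "char (distr (D 1) borel Y) t = char (distr (D 0) borel Y) t" .
  qed
  hence eqD: "distr (D 1) borel Y = distr (D 0) borel Y" using rd by (intro Levy_uniqueness) auto
  have "(\<integral>\<omega>. (1 + c * W \<omega> / k) *\<^sub>R (indicator A (Y \<omega>) :: real) \<partial>M) = (\<integral>y. indicator A y \<partial>distr (D c) borel Y)" if "c \<in> {0, 1}" for c :: real
  proof -
    have "(\<integral>y. (indicator A y :: real) \<partial>distr (D c) borel Y) = (\<integral>\<omega>. indicator A (Y \<omega>) \<partial>D c)"
      using A by (intro integral_distr) (simp_all add: mD)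
    also have "\<dots> = (\<integral>\<omega>. (1 + c * W \<omega> / k) *\<^sub>R (indicator A (Y \<omega>) :: real) \<partial>M)"
      using A by (intro Dint[OF that]) simp
    finally show ?thesis by simp
  qed
  from this[of 0] this[of 1] eqD
  have "(\<integral>\<omega>. (1 + W \<omega> / k) * indicator A (Y \<omega>) \<partial>M) = (\<integral>\<omega>. indicator A (Y \<omega>) \<partial>M)" by simp
  also have "(\<integral>\<omega>. (1 + W \<omega> / k) * indicator A (Y \<omega>) \<partial>M) = (\<integral>\<omega>. indicator A (Y \<omega>) + (1 / k) * (W \<omega> * indicator A (Y \<omega>)) \<partial>M)"
    by (intro Bochner_Integration.integral_cong) (auto simp: algebra_simps)
  also have "\<dots> = (\<integral>\<omega>. indicator A (Y \<omega>) \<partial>M) + (1 / k) * (\<integral>\<omega>. W \<omega> * indicator A (Y \<omega>) \<partial>M)"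
  proof (subst Bochner_Integration.integral_add)
    show "integrable M (\<lambda>\<omega>. indicator A (Y \<omega>) :: real)" using A by (intro integrable_const_bound[of _ 1]) (auto simp: indicator_def)
    show "integrable M (\<lambda>\<omega>. 1 / k * (W \<omega> * indicator A (Y \<omega>)))"
      using A order_trans[OF W abs_ge_self] by (intro integrable_mult_right integrable_const_bound[of _ "\<bar>K\<bar>"]) (auto simp: indicator_def intro!: AE_I2)
  qed auto
  finally show ?thesis using k by simp
qed

text \<open>
  The hypothesis at -t, conjugated, shows that real and imaginary part of W satisfy it separately.
\<close>

lemma (in prob_space) char_weighted_unique:
  fixes W :: "'a \<Rightarrow> complex"
  assumes [measurable]: "Y \<in> borel_measurable M" "W \<in> borel_measurable M" and A[measurable]: "A \<in> sets borel"
    and W: "\<And>\<omega>. norm (W \<omega>) \<le> K"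
    and eq: "\<And>t. (CLINT \<omega>|M. W \<omega> * iexp (t * Y \<omega>)) = 0"
  shows "(CLINT \<omega>|M. W \<omega> * complex_of_real (indicator A (Y \<omega>))) = 0"
proof -
  have [measurable]: "(\<lambda>\<omega>. cnj (W \<omega>)) \<in> borel_measurable M"
    by (rule measurable_compose[OF assms(2) borel_measurable_continuous_onI]) (intro continuous_intros)
  have I: "complex_integrable M (\<lambda>\<omega>. W \<omega> * iexp (t * Y \<omega>))" "complex_integrable M (\<lambda>\<omega>. cnj (W \<omega>) * iexp (t * Y \<omega>))" for t
    using W by (intro integrable_const_bound[of _ K]; simp add: norm_mult)+
  have cnj: "(CLINT \<omega>|M. cnj (W \<omega>) * iexp (t * Y \<omega>)) = 0" for t
  proof -
    have "(CLINT \<omega>|M. cnj (W \<omega>) * iexp (t * Y \<omega>)) = (CLINT \<omega>|M. cnj (W \<omega> * iexp (- t * Y \<omega>)))"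
      by (intro Bochner_Integration.integral_cong) (auto simp: exp_cnj)
    also have "\<dots> = cnj (CLINT \<omega>|M. W \<omega> * iexp (- t * Y \<omega>))" by (rule Bochner_Integration.integral_cnj)
    finally show ?thesis by (simp only: eq complex_cnj_zero)
  qed
  have re: "(CLINT \<omega>|M. complex_of_real (Re (W \<omega>)) * iexp (t * Y \<omega>)) = 0" for t
  proof -
    have "(CLINT \<omega>|M. complex_of_real (Re (W \<omega>)) * iexp (t * Y \<omega>)) = (CLINT \<omega>|M. (1 / 2) * (W \<omega> * iexp (t * Y \<omega>) + cnj (W \<omega>) * iexp (t * Y \<omega>)))"
      by (intro Bochner_Integration.integral_cong) (auto simp: distrib_right[symmetric] complex_add_cnj)
    also have "\<dots> = 0" by (subst integral_mult_right_zero, subst Bochner_Integration.integral_add) (use I eq cnj in auto)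
    finally show ?thesis .
  qed
  have im: "(CLINT \<omega>|M. complex_of_real (Im (W \<omega>)) * iexp (t * Y \<omega>)) = 0" for t
  proof -
    have "(CLINT \<omega>|M. complex_of_real (Im (W \<omega>)) * iexp (t * Y \<omega>)) = (CLINT \<omega>|M. (1 / (2 * \<i>)) * (W \<omega> * iexp (t * Y \<omega>) - cnj (W \<omega>) * iexp (t * Y \<omega>)))"
    proof (rule Bochner_Integration.integral_cong[OF refl])
      fix \<omega>
      have "complex_of_real (Im (W \<omega>)) = 1 / (2 * \<i>) * (W \<omega> - cnj (W \<omega>))" by (simp add: complex_eq_iff)
      thus "complex_of_real (Im (W \<omega>)) * iexp (t * Y \<omega>) = 1 / (2 * \<i>) * (W \<omega> * iexp (t * Y \<omega>) - cnj (W \<omega>) * iexp (t * Y \<omega>))"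
        by (simp only: left_diff_distrib[symmetric] mult.assoc)
    qed
    also have "\<dots> = 0" by (subst integral_mult_right_zero, subst Bochner_Integration.integral_diff) (use I eq cnj in auto)
    finally show ?thesis .
  qed
  have 1: "(\<integral>\<omega>. Re (W \<omega>) * indicator A (Y \<omega>) \<partial>M) = 0" "(\<integral>\<omega>. Im (W \<omega>) * indicator A (Y \<omega>) \<partial>M) = 0"
    using W by (intro char_weighted_unique_real[where K = K] re im; simp; meson abs_Re_le_cmod abs_Im_le_cmod order_trans)+
  have Ii: "complex_integrable M (\<lambda>\<omega>. W \<omega> * complex_of_real (indicator A (Y \<omega>)))"
    using order_trans[OF W abs_ge_self] by (intro integrable_const_bound[of _ "\<bar>K\<bar>"]) (auto simp: norm_mult indicator_def intro!: AE_I2)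
  show ?thesis
  proof (rule complex_eqI)
    show "Re (CLINT \<omega>|M. W \<omega> * complex_of_real (indicator A (Y \<omega>))) = Re 0"
      using 1 by (subst integral_Re[OF Ii, symmetric]) simp
    show "Im (CLINT \<omega>|M. W \<omega> * complex_of_real (indicator A (Y \<omega>))) = Im 0"
      using 1 by (subst integral_Im[OF Ii, symmetric]) simp
  qed
qed

lemma (in prob_space) gaussian_rv_cases:
  assumes "gaussian_rv M X" and "expectation X = 0"
  shows "integrable M X" "integrable M (\<lambda>\<omega>. (X \<omega>)\<^sup>2)"
    "(CLINT \<omega>|M. iexp (X \<omega>)) = exp (- expectation (\<lambda>\<omega>. (X \<omega>)\<^sup>2) / 2)"
    "expectation (\<lambda>\<omega>. (X \<omega>)\<^sup>2) = 0 \<and> (AE \<omega> in M. X \<omega> = 0) \<or>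
     expectation (\<lambda>\<omega>. (X \<omega>)\<^sup>2) > 0 \<and>
       distr M borel X = density lborel (\<lambda>y. ennreal (normal_density 0 (sqrt (expectation (\<lambda>\<omega>. (X \<omega>)\<^sup>2))) y))"
proof -
  have Xm [measurable]: "X \<in> borel_measurable M" using assms by (simp add: gaussian_rv_def)
  obtain m \<sigma> where \<sigma>: "\<sigma> \<ge> 0" and D: "distr M borel X =
          (if \<sigma> = 0 then return borel m else density lborel (\<lambda>y. ennreal (normal_density m \<sigma> y)))"
    using assms by (auto simp: gaussian_rv_def)
  have "integrable M X \<and> integrable M (\<lambda>\<omega>. (X \<omega>)\<^sup>2) \<and>
      (CLINT \<omega>|M. iexp (X \<omega>)) = exp (- expectation (\<lambda>\<omega>. (X \<omega>)\<^sup>2) / 2) \<and>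
      (expectation (\<lambda>\<omega>. (X \<omega>)\<^sup>2) = 0 \<and> (AE \<omega> in M. X \<omega> = 0) \<or>
        expectation (\<lambda>\<omega>. (X \<omega>)\<^sup>2) > 0 \<and>
       distr M borel X = density lborel (\<lambda>y. ennreal (normal_density 0 (sqrt (expectation (\<lambda>\<omega>. (X \<omega>)\<^sup>2))) y)))"
  proof (cases "\<sigma> = 0")
    case True
    have D0: "distr M borel X = return borel m" using D True by simp
    have "AE y in distr M borel X. y = m" unfolding D0 by (subst AE_return) auto
    hence ae: "AE \<omega> in M. X \<omega> = m" by (rule AE_distrD[OF Xm])
    have "expectation X = m" using ae by (subst integral_cong_AE[where g = "\<lambda>_. m"]) (auto simp: prob_space)
    hence "m = 0" using assms(2) by simp
    hence ae0: "AE \<omega> in M. X \<omega> = 0" using ae by simp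
    have 1: "integrable M X" using ae0 by (subst integrable_cong_AE[where g = "\<lambda>_. 0"]) auto
    have 2: "integrable M (\<lambda>\<omega>. (X \<omega>)\<^sup>2)" using ae0 by (subst integrable_cong_AE[where g = "\<lambda>_. 0"]) auto
    have 3: "expectation (\<lambda>\<omega>. (X \<omega>)\<^sup>2) = 0" using ae0 by (subst integral_cong_AE[where g = "\<lambda>_. 0"]) auto
    have "(CLINT \<omega>|M. iexp (X \<omega>)) = (CLINT \<omega>|M. 1)" using ae0 by (intro integral_cong_AE) auto
    thus ?thesis using 1 2 3 ae0 by (simp add: prob_space)
  next
    case False
    hence \<sigma>0: "\<sigma> > 0" using \<sigma> by simp
    have "distr M lborel X = distr M borel X" by (intro distr_cong) auto
    hence dist: "distributed M lborel X (normal_density m \<sigma>)"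
      using D False by (simp add: distributed_def)
    have "m = 0" using normal_distributed_expectation[OF \<sigma>0 dist] assms(2) by simp
    note dist = dist[unfolded this] and D = D[unfolded this]
    have 1: "integrable M X"
      using distributed_integrable[OF dist, of "\<lambda>x. x"] integrable_normal_moment[OF \<sigma>0, of 0 1] by simp
    have 2: "integrable M (\<lambda>\<omega>. (X \<omega>)\<^sup>2)"
      using distributed_integrable[OF dist, of "\<lambda>x. x\<^sup>2"] integrable_normal_moment[OF \<sigma>0, of 0 2] by simp
    have 3: "expectation (\<lambda>\<omega>. (X \<omega>)\<^sup>2) = \<sigma>\<^sup>2"
      using normal_distributed_variance[OF \<sigma>0 dist] assms(2) by simp
    have "distributed M lborel (\<lambda>\<omega>. (X \<omega> - 0) / \<sigma>) std_normal_density"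
      using normal_standard_normal_convert[OF \<sigma>0, of X 0] dist by simp
    hence "distr M lborel (\<lambda>\<omega>. X \<omega> / \<sigma>) = std_normal_distribution" by (simp add: distributed_def)
    moreover have "distr M lborel (\<lambda>\<omega>. X \<omega> / \<sigma>) = distr M borel (\<lambda>\<omega>. X \<omega> / \<sigma>)" by (intro distr_cong) auto
    ultimately have "char (distr M borel (\<lambda>\<omega>. X \<omega> / \<sigma>)) \<sigma> = complex_of_real (exp (- \<sigma>\<^sup>2 / 2))"
      by (simp add: char_std_normal_distribution)
    moreover have "char (distr M borel (\<lambda>\<omega>. X \<omega> / \<sigma>)) \<sigma> = (CLINT \<omega>|M. iexp (\<sigma> * (X \<omega> / \<sigma>)))"
      unfolding char_def by (rule integral_distr) auto
    ultimately have 4: "(CLINT \<omega>|M. iexp (X \<omega>)) = complex_of_real (exp (- \<sigma>\<^sup>2 / 2))" using \<sigma>0 by simp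
    have "exp (- complex_of_real (\<sigma>\<^sup>2) / 2) = complex_of_real (exp (- \<sigma>\<^sup>2 / 2))"
      by (simp flip: exp_of_real)
    thus ?thesis using 1 2 3 4 D False \<sigma>0 by simp
  qed
  thus "integrable M X" "integrable M (\<lambda>\<omega>. (X \<omega>)\<^sup>2)"
    "(CLINT \<omega>|M. iexp (X \<omega>)) = exp (- expectation (\<lambda>\<omega>. (X \<omega>)\<^sup>2) / 2)"
    "expectation (\<lambda>\<omega>. (X \<omega>)\<^sup>2) = 0 \<and> (AE \<omega> in M. X \<omega> = 0) \<or>
     expectation (\<lambda>\<omega>. (X \<omega>)\<^sup>2) > 0 \<and>
       distr M borel X = density lborel (\<lambda>y. ennreal (normal_density 0 (sqrt (expectation (\<lambda>\<omega>. (X \<omega>)\<^sup>2))) y))"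
    by blast+
qed

lemma integrable_product_of_squares:
  fixes X Y :: "'a \<Rightarrow> real"
  assumes [measurable]: "X \<in> borel_measurable M" "Y \<in> borel_measurable M"
    and "integrable M (\<lambda>\<omega>. (X \<omega>)\<^sup>2)" "integrable M (\<lambda>\<omega>. (Y \<omega>)\<^sup>2)"
  shows "integrable M (\<lambda>\<omega>. X \<omega> * Y \<omega>)"
proof (rule Bochner_Integration.integrable_bound[OF Bochner_Integration.integrable_add[OF assms(3,4)]])
  show "AE \<omega> in M. norm (X \<omega> * Y \<omega>) \<le> norm ((X \<omega>)\<^sup>2 + (Y \<omega>)\<^sup>2)"
  proof (rule AE_I2)
    fix \<omega>
    have "2 * (\<bar>X \<omega>\<bar> * \<bar>Y \<omega>\<bar>) \<le> (X \<omega>)\<^sup>2 + (Y \<omega>)\<^sup>2" using sum_squares_bound[of "\<bar>X \<omega>\<bar>" "\<bar>Y \<omega>\<bar>"] by simp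
    moreover have "\<bar>X \<omega>\<bar> * \<bar>Y \<omega>\<bar> \<ge> 0" by simp
    ultimately have "\<bar>X \<omega>\<bar> * \<bar>Y \<omega>\<bar> \<le> (X \<omega>)\<^sup>2 + (Y \<omega>)\<^sup>2" by linarith
    thus "norm (X \<omega> * Y \<omega>) \<le> norm ((X \<omega>)\<^sup>2 + (Y \<omega>)\<^sup>2)" by (simp add: abs_mult)
  qed
qed simp

text \<open>
  Setting the coordinates from d on to 0 makes Z a random sequence, to which functions of the kind
  \<open>C1_on d\<close> apply.
\<close>

locale gaussian_vector = prob_space P for P :: "'v measure" +
  fixes d :: nat and S :: "nat \<Rightarrow> nat \<Rightarrow> real" and Z :: "nat \<Rightarrow> 'v \<Rightarrow> real"
  assumes cgv: "centred_gaussian_vector P d S Z"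
    and Z_outside: "\<And>i. i \<ge> d \<Longrightarrow> Z i = (\<lambda>_. 0)"
begin

lemma Z_measurable [measurable]: "Z i \<in> borel_measurable P"
  using cgv Z_outside[of i] by (cases "i < d") (auto simp: centred_gaussian_vector_def)

definition L :: "(nat \<Rightarrow> real) \<Rightarrow> 'v \<Rightarrow> real" where
  "L u \<omega> = (\<Sum>i<d. u i * Z i \<omega>)"

definition V :: "(nat \<Rightarrow> real) \<Rightarrow> (nat \<Rightarrow> real) \<Rightarrow> real" where
  "V u v = (\<Sum>i<d. \<Sum>j<d. u i * v j * S i j)"

lemma L_measurable [measurable]: "L u \<in> borel_measurable P"
  unfolding L_def[abs_def] by measurable

lemma Z_eq_L: "i < d \<Longrightarrow> Z i = L (\<lambda>j. if j = i then 1 else 0)"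
proof
  fix \<omega> assume "i < d"
  have "(if j = i then 1 else 0) * Z j \<omega> = (if j = i then Z j \<omega> else 0)" for j by simp
  thus "Z i \<omega> = L (\<lambda>j. if j = i then 1 else 0) \<omega>" using \<open>i < d\<close> by (simp add: L_def)
qed

lemma gaussian_L: "gaussian_rv P (L u)"
  using cgv unfolding centred_gaussian_vector_def L_def[abs_def] by blast

lemma Z_integrable [simp]: "integrable P (Z i)" and Z_sq_integrable [simp]: "integrable P (\<lambda>\<omega>. (Z i \<omega>)\<^sup>2)"
proof -
  have "integrable P (Z i) \<and> integrable P (\<lambda>\<omega>. (Z i \<omega>)\<^sup>2)"
  proof (cases "i < d")
    case True
    have "expectation (Z i) = 0" using True cgv by (simp add: centred_gaussian_vector_def)
    moreover have "gaussian_rv P (Z i)" using gaussian_L Z_eq_L[OF True] by simp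
    ultimately show ?thesis using gaussian_rv_cases(1,2) by blast
  qed (simp add: Z_outside)
  thus "integrable P (Z i)" "integrable P (\<lambda>\<omega>. (Z i \<omega>)\<^sup>2)" by auto
qed

lemma ZZ_integrable [simp]: "integrable P (\<lambda>\<omega>. Z i \<omega> * Z j \<omega>)"
  by (rule integrable_product_of_squares) auto

lemma expectation_ZZ: "i < d \<Longrightarrow> j < d \<Longrightarrow> expectation (\<lambda>\<omega>. Z i \<omega> * Z j \<omega>) = S i j"
  using cgv by (simp add: centred_gaussian_vector_def)

lemma S_sym: "i < d \<Longrightarrow> j < d \<Longrightarrow> S i j = S j i"
  using expectation_ZZ[of i j] expectation_ZZ[of j i] by (simp add: mult.commute)

lemma L_product: "L u \<omega> * L v \<omega> = (\<Sum>i<d. \<Sum>j<d. u i * v j * (Z i \<omega> * Z j \<omega>))"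
  unfolding L_def sum_product by (intro sum.cong) auto

lemma LL_integrable [simp]: "integrable P (\<lambda>\<omega>. L u \<omega> * L v \<omega>)"
  unfolding L_product by (intro Bochner_Integration.integrable_sum integrable_mult_right ZZ_integrable)

lemma expectation_LL: "expectation (\<lambda>\<omega>. L u \<omega> * L v \<omega>) = V u v"
proof -
  have "expectation (\<lambda>\<omega>. L u \<omega> * L v \<omega>) = (\<Sum>i<d. \<Sum>j<d. u i * v j * expectation (\<lambda>\<omega>. Z i \<omega> * Z j \<omega>))"
    unfolding L_product by (subst Bochner_Integration.integral_sum, simp)+ simp
  thus ?thesis by (simp add: V_def expectation_ZZ)
qed

lemma expectation_L: "expectation (L u) = 0"
  unfolding L_def[abs_def] using cgv
  by (subst Bochner_Integration.integral_sum) (auto simp: centred_gaussian_vector_def)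

lemma L_integrable [simp]: "integrable P (L u)"
  using gaussian_rv_cases(1)[OF gaussian_L expectation_L] .

lemma V_nonneg: "V u u \<ge> 0"
  unfolding expectation_LL[symmetric] by (rule Bochner_Integration.integral_nonneg) simp

lemma char_L: "(CLINT \<omega>|P. iexp (L u \<omega>)) = exp (- V u u / 2)"
  using gaussian_rv_cases(3)[OF gaussian_L expectation_L, of u]
  by (simp add: power2_eq_square expectation_LL)

lemma L_degenerate: "V u u = 0 \<Longrightarrow> AE \<omega> in P. L u \<omega> = 0"
  using gaussian_rv_cases(4)[OF gaussian_L expectation_L, of u]
  by (auto simp: power2_eq_square expectation_LL)

lemma distr_L: "V u u \<noteq> 0 \<Longrightarrow> distr P borel (L u) = density lborel (\<lambda>y. ennreal (normal_density 0 (sqrt (V u u)) y))"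
  using gaussian_rv_cases(4)[OF gaussian_L expectation_L, of u]
  by (auto simp: power2_eq_square expectation_LL)

end

lemma measurable_fun_space:
  fixes f :: "'a \<Rightarrow> nat \<Rightarrow> real"
  assumes "\<And>i. (\<lambda>x. f x i) \<in> borel_measurable M"
  shows "f \<in> borel_measurable M"
  using assms by (rule measurable_coordinatewise_then_product)

lemma measurable_fun_apply: "(\<lambda>w :: nat \<Rightarrow> real. w i) \<in> borel_measurable borel"
  by (rule measurable_product_then_coordinatewise) simp

context gaussian_vector
begin

context
  fixes a :: "nat \<Rightarrow> real"
  assumes a: "V a a \<noteq> 0"
begin

text \<open>
  q is the regression coefficient of Z on \<open>L a\<close>, so that the residual W is uncorrelated with \<open>L a\<close>.
\<close>

definition q :: "nat \<Rightarrow> real" where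
  "q i = (if i < d then (\<Sum>j<d. S i j * a j) / V a a else 0)"

definition W :: "nat \<Rightarrow> 'v \<Rightarrow> real" where
  "W i \<omega> = Z i \<omega> - q i * L a \<omega>"

lemma W_measurable [measurable]: "W i \<in> borel_measurable P"
  unfolding W_def[abs_def] by measurable

lemma V_q: "V u a = V a a * (\<Sum>i<d. u i * q i)"
proof -
  have "V a a * (u i * q i) = (\<Sum>j<d. u i * a j * S i j)" if "i < d" for i
  proof -
    have "V a a * (u i * q i) = u i * (\<Sum>j<d. S i j * a j)" using that a by (simp add: q_def)
    thus ?thesis by (simp add: sum_distrib_left mult_ac)
  qed
  thus ?thesis by (simp add: V_def[of u a] sum_distrib_left[of "V a a"])
qed

lemma L_add_scale: "L (\<lambda>i. u i + s * v i) \<omega> = L u \<omega> + s * L v \<omega>"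
  by (simp add: L_def sum_distrib_left distrib_right mult.assoc sum.distrib)

lemma V_add_scale: "V (\<lambda>i. u i + s * a i) (\<lambda>i. u i + s * a i) = V u u + 2 * s * V u a + s\<^sup>2 * V a a"
proof -
  have "V (\<lambda>i. u i + s * a i) (\<lambda>i. u i + s * a i) =
     expectation (\<lambda>\<omega>. L u \<omega> * L u \<omega> + 2 * s * (L u \<omega> * L a \<omega>) + s\<^sup>2 * (L a \<omega> * L a \<omega>))"
    unfolding expectation_LL[symmetric] L_add_scale
    by (intro Bochner_Integration.integral_cong) (auto simp: algebra_simps power2_eq_square)
  also have "\<dots> = V u u + 2 * s * V u a + s\<^sup>2 * V a a"
    by (subst Bochner_Integration.integral_add, simp, simp)+ (simp add: expectation_LL)
  finally show ?thesis .
qed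

lemma char_joint:
  "(CLINT \<omega>|P. iexp (t * L a \<omega> + (\<Sum>i<d. u i * W i \<omega>)))
     = exp (- (t\<^sup>2 * V a a) / 2) * exp (- (V u u - V a a * (\<Sum>i<d. u i * q i)\<^sup>2) / 2)"
proof -
  define r where "r = (\<Sum>i<d. u i * q i)"
  let ?b = "\<lambda>i. u i + (t - r) * a i"
  have "t * L a \<omega> + (\<Sum>i<d. u i * W i \<omega>) = L ?b \<omega>" for \<omega>
  proof -
    have "(\<Sum>i<d. u i * W i \<omega>) = L u \<omega> - r * L a \<omega>"
      by (simp add: W_def L_def[of u] r_def right_diff_distrib sum_subtractf sum_distrib_right mult.assoc)
    moreover have "L ?b \<omega> = L u \<omega> + (t - r) * L a \<omega>"
      by (rule L_add_scale)
    ultimately show ?thesis by (simp add: algebra_simps)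
  qed
  hence "(CLINT \<omega>|P. iexp (t * L a \<omega> + (\<Sum>i<d. u i * W i \<omega>))) = exp (- V ?b ?b / 2)"
    by (simp only: char_L)
  also have "V ?b ?b = t\<^sup>2 * V a a + (V u u - V a a * r\<^sup>2)"
    unfolding V_add_scale V_q[of u] r_def[symmetric] by (simp add: algebra_simps power2_eq_square)
  finally show ?thesis by (simp add: r_def add_divide_distrib flip: exp_add of_real_mult)
qed

lemma char_joint_factor:
  "(CLINT \<omega>|P. iexp (\<Sum>i<d. u i * W i \<omega>) * iexp (t * L a \<omega>))
     = (CLINT \<omega>|P. iexp (\<Sum>i<d. u i * W i \<omega>)) * (CLINT \<omega>|P. iexp (t * L a \<omega>))"
proof -
  have "(CLINT \<omega>|P. iexp (\<Sum>i<d. u i * W i \<omega>) * iexp (t * L a \<omega>)) = (CLINT \<omega>|P. iexp (t * L a \<omega> + (\<Sum>i<d. u i * W i \<omega>)))"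
    by (intro Bochner_Integration.integral_cong) (auto simp: exp_add algebra_simps)
  also have "\<dots> = (CLINT \<omega>|P. iexp (0 * L a \<omega> + (\<Sum>i<d. u i * W i \<omega>))) * (CLINT \<omega>|P. iexp (t * L a \<omega> + (\<Sum>i<d. (\<lambda>_. 0) i * W i \<omega>)))"
    unfolding char_joint by (simp add: V_def)
  finally show ?thesis by simp
qed

text \<open>
  Uncorrelated implies independent: the joint characteristic function of \<open>L a\<close> and W factorises.
  The uniqueness lemma turns this into a statement about events one coordinate at a time: the
  first application introduces the indicator of A, each further one replaces an exponential of
  \<open>W k\<close> by an indicator of \<open>B k\<close>.
\<close>

lemma independent_rectangles:
  assumes A[measurable]: "A \<in> sets borel" and B[measurable]: "\<And>j. B j \<in> sets borel"
  shows "(CLINT \<omega>|P. complex_of_real ((indicator A (L a \<omega>) - measure P {\<omega> \<in> space P. L a \<omega> \<in> A}) * (\<Prod>j<k. indicator (B j) (W j \<omega>)))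
            * iexp (\<Sum>j\<in>{k..<d}. u j * W j \<omega>)) = 0"
proof (induction k arbitrary: u)
  case 0
  define p where "p = measure P {\<omega> \<in> space P. L a \<omega> \<in> A}"
  have p: "(CLINT \<omega>|P. complex_of_real (indicator A (L a \<omega>))) = complex_of_real p"
  proof -
    have "(\<integral>\<omega>. indicator A (L a \<omega>) \<partial>P) = (\<integral>\<omega>. indicator {\<omega> \<in> space P. L a \<omega> \<in> A} \<omega> \<partial>P)"
      by (intro Bochner_Integration.integral_cong) (auto simp: indicator_def)
    also have "\<dots> = p"
      unfolding p_def by (subst Bochner_Integration.integral_indicator) (auto intro!: arg_cong[where f = "measure P"])
    finally show ?thesis by (simp add: integral_complex_of_real)
  qed
  define c where "c = (CLINT \<omega>|P. iexp (\<Sum>i<d. u i * W i \<omega>))"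
  have I: "complex_integrable P (\<lambda>\<omega>. iexp (\<Sum>i<d. u i * W i \<omega>) * iexp (t * L a \<omega>))"
    "complex_integrable P (\<lambda>\<omega>. iexp (t * L a \<omega>))" "complex_integrable P (\<lambda>\<omega>. iexp (\<Sum>i<d. u i * W i \<omega>))"
    "complex_integrable P (\<lambda>\<omega>. iexp (\<Sum>i<d. u i * W i \<omega>) * complex_of_real (indicator A (L a \<omega>)))"
    "complex_integrable P (\<lambda>\<omega>. complex_of_real (indicator A (L a \<omega>)))" for t
  proof -
    have ind: "norm (complex_of_real (indicator A x)) \<le> 1" for x by (simp add: indicator_def)
    show "complex_integrable P (\<lambda>\<omega>. iexp (\<Sum>i<d. u i * W i \<omega>) * iexp (t * L a \<omega>))"
      by (rule integrable_const_bound[of _ 1]) (rule AE_I2, simp only: norm_mult norm_exp_i_times, simp, measurable)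
    show "complex_integrable P (\<lambda>\<omega>. iexp (t * L a \<omega>))" "complex_integrable P (\<lambda>\<omega>. iexp (\<Sum>i<d. u i * W i \<omega>))"
      by (rule integrable_const_bound[of _ 1], rule AE_I2, simp only: norm_exp_i_times, simp, measurable)+
    show "complex_integrable P (\<lambda>\<omega>. iexp (\<Sum>i<d. u i * W i \<omega>) * complex_of_real (indicator A (L a \<omega>)))"
      by (rule integrable_const_bound[of _ 1]) (rule AE_I2, simp only: norm_mult norm_exp_i_times mult_1_left ind, measurable)
    show "complex_integrable P (\<lambda>\<omega>. complex_of_real (indicator A (L a \<omega>)))"
      by (rule integrable_const_bound[of _ 1]) (rule AE_I2, simp only: ind, measurable)
  qed
  have "(CLINT \<omega>|P. (iexp (\<Sum>i<d. u i * W i \<omega>) - c) * complex_of_real (indicator A (L a \<omega>))) = 0"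
  proof (rule char_weighted_unique[where K = "1 + norm c"])
    show "norm (iexp (\<Sum>i<d. u i * W i \<omega>) - c) \<le> 1 + norm c" for \<omega>
      by (rule order_trans[OF norm_triangle_ineq4]) (simp del: of_real_sum of_real_mult)
    show "(CLINT \<omega>|P. (iexp (\<Sum>i<d. u i * W i \<omega>) - c) * iexp (t * L a \<omega>)) = 0" for t
    proof -
      have "(CLINT \<omega>|P. (iexp (\<Sum>i<d. u i * W i \<omega>) - c) * iexp (t * L a \<omega>)) =
        (CLINT \<omega>|P. iexp (\<Sum>i<d. u i * W i \<omega>) * iexp (t * L a \<omega>) - c * iexp (t * L a \<omega>))"
        by (simp only: left_diff_distrib)
      also have "\<dots> = (CLINT \<omega>|P. iexp (\<Sum>i<d. u i * W i \<omega>) * iexp (t * L a \<omega>)) - c * (CLINT \<omega>|P. iexp (t * L a \<omega>))"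
        using I by (subst Bochner_Integration.integral_diff) (auto simp del: of_real_sum of_real_mult)
      finally show ?thesis by (simp only: char_joint_factor c_def) simp
    qed
  qed measurable
  also have "(CLINT \<omega>|P. (iexp (\<Sum>i<d. u i * W i \<omega>) - c) * complex_of_real (indicator A (L a \<omega>))) =
    (CLINT \<omega>|P. iexp (\<Sum>i<d. u i * W i \<omega>) * complex_of_real (indicator A (L a \<omega>))) - c * complex_of_real p"
    unfolding left_diff_distrib p[symmetric] using I
    by (subst Bochner_Integration.integral_diff) (auto simp del: of_real_sum of_real_mult)
  finally have eq: "(CLINT \<omega>|P. iexp (\<Sum>i<d. u i * W i \<omega>) * complex_of_real (indicator A (L a \<omega>))) = c * complex_of_real p" by simp
  have "(CLINT \<omega>|P. complex_of_real (indicator A (L a \<omega>) - p) * iexp (\<Sum>i<d. u i * W i \<omega>)) =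
     (CLINT \<omega>|P. iexp (\<Sum>i<d. u i * W i \<omega>) * complex_of_real (indicator A (L a \<omega>)) - complex_of_real p * iexp (\<Sum>i<d. u i * W i \<omega>))"
    by (intro Bochner_Integration.integral_cong) (simp_all add: algebra_simps)
  also have "\<dots> = (CLINT \<omega>|P. iexp (\<Sum>i<d. u i * W i \<omega>) * complex_of_real (indicator A (L a \<omega>))) - complex_of_real p * c"
    unfolding c_def using I by (subst Bochner_Integration.integral_diff) (auto simp del: of_real_sum of_real_mult)
  finally have "(CLINT \<omega>|P. complex_of_real (indicator A (L a \<omega>) - p) * iexp (\<Sum>i<d. u i * W i \<omega>)) = 0"
    unfolding eq by simp
  thus ?case by (simp add: p_def lessThan_atLeast0 del: of_real_sum of_real_mult of_real_diff)
next
  case (Suc k)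
  let ?p = "measure P {\<omega> \<in> space P. L a \<omega> \<in> A}"
  let ?F = "\<lambda>\<omega>. (indicator A (L a \<omega>) - ?p) * (\<Prod>j<k. indicator (B j) (W j \<omega>)) :: real"
  have Fb: "\<bar>?F \<omega>\<bar> \<le> 1" for \<omega>
  proof -
    have p01: "0 \<le> ?p" "?p \<le> 1" by (simp_all add: prob_le_1)
    have "\<bar>?F \<omega>\<bar> \<le> 1 * 1"
      unfolding abs_mult abs_prod
    proof (intro mult_mono prod_le_1)
      show "\<bar>indicator A (L a \<omega>) - ?p\<bar> \<le> 1" using p01 by (auto simp: indicator_def)
    qed (auto simp: indicator_def intro: prod_nonneg)
    thus ?thesis by simp
  qed
  show ?case
  proof (cases "k < d")
    case True
    have split: "(\<Sum>j\<in>{k..<d}. f j) = f k + (\<Sum>j\<in>{Suc k..<d}. f j)" for f :: "nat \<Rightarrow> real"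
      using True by (simp add: sum.atLeast_Suc_lessThan)
    have "(CLINT \<omega>|P. (complex_of_real (?F \<omega>) * iexp (\<Sum>j\<in>{Suc k..<d}. u j * W j \<omega>)) * complex_of_real (indicator (B k) (W k \<omega>))) = 0"
    proof (rule char_weighted_unique[where K = 1])
      show "norm (complex_of_real (?F \<omega>) * iexp (\<Sum>j\<in>{Suc k..<d}. u j * W j \<omega>)) \<le> 1" for \<omega>
        using Fb[of \<omega>] by (simp add: norm_mult del: of_real_sum of_real_mult)
      show "(CLINT \<omega>|P. complex_of_real (?F \<omega>) * iexp (\<Sum>j\<in>{Suc k..<d}. u j * W j \<omega>) * iexp (t * W k \<omega>)) = 0" for t
      proof -
        have "complex_of_real (?F \<omega>) * iexp (\<Sum>j\<in>{Suc k..<d}. u j * W j \<omega>) * iexp (t * W k \<omega>) =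
          complex_of_real (?F \<omega>) * iexp (\<Sum>j\<in>{k..<d}. (u(k := t)) j * W j \<omega>)" for \<omega>
        proof -
          have "(\<Sum>j\<in>{k..<d}. (u(k := t)) j * W j \<omega>) = t * W k \<omega> + (\<Sum>j\<in>{Suc k..<d}. u j * W j \<omega>)"
            unfolding split by (auto intro!: sum.cong)
          thus ?thesis by (simp only: of_real_add distrib_left exp_add mult_ac)
        qed
        thus ?thesis by (simp only: Suc.IH)
      qed
    qed measurable
    also have "(\<lambda>\<omega>. (complex_of_real (?F \<omega>) * iexp (\<Sum>j\<in>{Suc k..<d}. u j * W j \<omega>)) * complex_of_real (indicator (B k) (W k \<omega>))) =
      (\<lambda>\<omega>. complex_of_real ((indicator A (L a \<omega>) - ?p) * (\<Prod>j<Suc k. indicator (B j) (W j \<omega>))) * iexp (\<Sum>j\<in>{Suc k..<d}. u j * W j \<omega>))"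
      by (simp add: mult_ac fun_eq_iff del: of_real_sum)
    finally show ?thesis .
  next
    case False
    hence W0: "W k \<omega> = 0" for \<omega> by (simp add: W_def Z_outside q_def)
    have "(CLINT \<omega>|P. complex_of_real ((indicator A (L a \<omega>) - ?p) * (\<Prod>j<Suc k. indicator (B j) (W j \<omega>))) * iexp (\<Sum>j\<in>{Suc k..<d}. u j * W j \<omega>))
      = (CLINT \<omega>|P. complex_of_real (indicator (B k) (0 :: real)) * (complex_of_real (?F \<omega>) * iexp (\<Sum>j\<in>{k..<d}. u j * W j \<omega>)))"
      using False by (intro Bochner_Integration.integral_cong) (auto simp: W0)
    also have "\<dots> = complex_of_real (indicator (B k) (0 :: real)) * (CLINT \<omega>|P. complex_of_real (?F \<omega>) * iexp (\<Sum>j\<in>{k..<d}. u j * W j \<omega>))"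
      by (rule integral_mult_right_zero)
    finally show ?thesis by (simp only: Suc.IH mult_zero_right)
  qed
qed

lemma joint_law:
  "distr P (borel \<Otimes>\<^sub>M borel) (\<lambda>\<omega>. (L a \<omega>, \<lambda>i. W i \<omega>)) = distr P borel (L a) \<Otimes>\<^sub>M distr P borel (\<lambda>\<omega> i. W i \<omega>)"
proof (rule pair_measure_eqI[symmetric])
  have Wm [measurable]: "(\<lambda>\<omega> i. W i \<omega>) \<in> borel_measurable P" by (rule measurable_fun_space) simp
  show "sigma_finite_measure (distr P borel (L a))"
    using prob_space_distr[of "L a" borel] by (simp add: prob_space_imp_sigma_finite)
  show "sigma_finite_measure (distr P borel (\<lambda>\<omega> i. W i \<omega>))"
    using prob_space_distr[OF Wm] by (simp add: prob_space_imp_sigma_finite)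
  show "sets (distr P borel (L a) \<Otimes>\<^sub>M distr P borel (\<lambda>\<omega> i. W i \<omega>)) = sets (distr P (borel \<Otimes>\<^sub>M borel) (\<lambda>\<omega>. (L a \<omega>, \<lambda>i. W i \<omega>)))"
    by (simp cong: sets_pair_measure_cong)
  fix A B assume "A \<in> sets (distr P borel (L a))" and "B \<in> sets (distr P borel (\<lambda>\<omega> i. W i \<omega>))"
  hence A [measurable]: "A \<in> sets borel" and B [measurable]: "B \<in> sets borel" by auto
  define p where "p = measure P {\<omega> \<in> space P. L a \<omega> \<in> A}"
  define Q1 where "Q1 = distr (density P (\<lambda>\<omega>. indicator A (L a \<omega>))) borel (\<lambda>\<omega> i. W i \<omega>)"
  define Q2 where "Q2 = scale_measure (ennreal p) (distr P borel (\<lambda>\<omega> i. W i \<omega>))"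
  have Q1: "emeasure Q1 C = emeasure P {\<omega> \<in> space P. L a \<omega> \<in> A \<and> (\<lambda>i. W i \<omega>) \<in> C}" if [measurable]: "C \<in> sets borel" for C
  proof -
    have "emeasure Q1 C = emeasure (density P (\<lambda>\<omega>. indicator A (L a \<omega>))) ((\<lambda>\<omega> i. W i \<omega>) -` C \<inter> space P)"
      unfolding Q1_def by (subst emeasure_distr) auto
    also have "\<dots> = (\<integral>\<^sup>+\<omega>. indicator A (L a \<omega>) * indicator ((\<lambda>\<omega> i. W i \<omega>) -` C \<inter> space P) \<omega> \<partial>P)"
      by (subst emeasure_density) auto
    also have "\<dots> = (\<integral>\<^sup>+\<omega>. indicator {\<omega> \<in> space P. L a \<omega> \<in> A \<and> (\<lambda>i. W i \<omega>) \<in> C} \<omega> \<partial>P)"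
      by (intro nn_integral_cong) (auto simp: indicator_def)
    also have "\<dots> = emeasure P {\<omega> \<in> space P. L a \<omega> \<in> A \<and> (\<lambda>i. W i \<omega>) \<in> C}"
      by (subst nn_integral_indicator) auto
    finally show ?thesis .
  qed
  have Q2: "emeasure Q2 C = ennreal p * emeasure P {\<omega> \<in> space P. (\<lambda>i. W i \<omega>) \<in> C}" if [measurable]: "C \<in> sets borel" for C
    unfolding Q2_def by (auto simp: emeasure_distr emeasure_scale_measure intro!: arg_cong2[where f = "(*)"] arg_cong[where f = "emeasure P"])
  have "Q1 = Q2"
  proof (rule measure_eqI_PiM_infinite[where I = UNIV and M = "\<lambda>_. borel"])
    show "sets Q1 = sets (Pi\<^sub>M UNIV (\<lambda>_. borel))" "sets Q2 = sets (Pi\<^sub>M UNIV (\<lambda>_. borel))"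
      by (simp_all add: Q1_def Q2_def sets_PiM_equal_borel)
    show "finite_measure Q1"
    proof
      have "emeasure Q1 (space Q1) \<le> 1" using Q1[of UNIV] by (simp add: Q1_def emeasure_eq_measure)
      thus "emeasure Q1 (space Q1) \<noteq> \<infinity>" by (auto simp: top_unique)
    qed
  next
    fix E :: "nat \<Rightarrow> real set" and J :: "nat set"
    assume J: "finite J" and E: "\<And>i. i \<in> J \<Longrightarrow> E i \<in> sets borel"
    define C where "C = prod_emb UNIV (\<lambda>_. borel :: real measure) J (Pi\<^sub>E J E)"
    have C: "w \<in> C \<longleftrightarrow> (\<forall>j\<in>J. w j \<in> E j)" for w
      by (auto simp: C_def prod_emb_def PiE_iff extensional_def)
    have "C \<in> sets (Pi\<^sub>M UNIV (\<lambda>_. borel))" unfolding C_def using J E by (intro sets_PiM_I) auto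
    hence Cm [measurable]: "C \<in> sets borel" by (simp add: sets_PiM_equal_borel)
    obtain k where k: "J \<subseteq> {..<k}" using finite_nat_iff_bounded J by blast
    define B' where "B' = (\<lambda>j. if j \<in> J then E j else UNIV)"
    have B'm: "B' j \<in> sets borel" for j using E by (auto simp: B'_def)
    have prod: "(\<Prod>j<k + d. indicator (B' j) (W j \<omega>)) = (indicator C (\<lambda>i. W i \<omega>) :: real)" for \<omega>
    proof (cases "(\<lambda>i. W i \<omega>) \<in> C")
      case True
      thus ?thesis by (auto simp: B'_def C indicator_def intro!: prod.neutral)
    next
      case False
      then obtain j where "j \<in> J" "W j \<omega> \<notin> E j" by (auto simp: C)
      thus ?thesis using k False by (auto simp: B'_def indicator_def intro!: prod_zero bexI[of _ j])
    qed
    have "(CLINT \<omega>|P. complex_of_real ((indicator A (L a \<omega>) - p) * (\<Prod>j<k + d. indicator (B' j) (W j \<omega>)))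
            * iexp (\<Sum>j\<in>{k + d..<d}. (\<lambda>_. 0) j * W j \<omega>)) = 0"
      unfolding p_def by (rule independent_rectangles[OF A B'm])
    hence "(CLINT \<omega>|P. complex_of_real ((indicator A (L a \<omega>) - p) * indicator C (\<lambda>i. W i \<omega>))) = 0"
      unfolding prod by simp
    hence "(\<integral>\<omega>. (indicator A (L a \<omega>) - p) * indicator C (\<lambda>i. W i \<omega>) \<partial>P) = 0"
      by (simp only: integral_complex_of_real of_real_eq_0_iff)
    also have "(\<integral>\<omega>. (indicator A (L a \<omega>) - p) * indicator C (\<lambda>i. W i \<omega>) \<partial>P) =
      (\<integral>\<omega>. indicator {\<omega> \<in> space P. L a \<omega> \<in> A \<and> (\<lambda>i. W i \<omega>) \<in> C} \<omega> - p * indicator {\<omega> \<in> space P. (\<lambda>i. W i \<omega>) \<in> C} \<omega> \<partial>P)"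
      by (intro Bochner_Integration.integral_cong) (auto simp: indicator_def)
    also have "\<dots> = measure P {\<omega> \<in> space P. L a \<omega> \<in> A \<and> (\<lambda>i. W i \<omega>) \<in> C} - p * measure P {\<omega> \<in> space P. (\<lambda>i. W i \<omega>) \<in> C}"
      by (subst Bochner_Integration.integral_diff) (auto simp: emeasure_eq_measure intro!: integrable_real_indicator)
    finally have "measure P {\<omega> \<in> space P. L a \<omega> \<in> A \<and> (\<lambda>i. W i \<omega>) \<in> C} = p * measure P {\<omega> \<in> space P. (\<lambda>i. W i \<omega>) \<in> C}"
      by simp
    thus "emeasure Q1 (prod_emb UNIV (\<lambda>_. borel) J (Pi\<^sub>E J E)) = emeasure Q2 (prod_emb UNIV (\<lambda>_. borel) J (Pi\<^sub>E J E))"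
      unfolding C_def[symmetric] Q1[OF Cm] Q2[OF Cm] by (simp add: emeasure_eq_measure p_def ennreal_mult)
  qed
  hence "emeasure Q1 B = emeasure Q2 B" by simp
  hence "emeasure P {\<omega> \<in> space P. L a \<omega> \<in> A \<and> (\<lambda>i. W i \<omega>) \<in> B} = ennreal p * emeasure P {\<omega> \<in> space P. (\<lambda>i. W i \<omega>) \<in> B}"
    unfolding Q1[OF B] Q2[OF B] .
  moreover have "emeasure (distr P borel (L a)) A = ennreal p"
    by (subst emeasure_distr) (auto simp: p_def emeasure_eq_measure intro!: arg_cong[where f = "measure P"])
  moreover have "emeasure (distr P borel (\<lambda>\<omega> i. W i \<omega>)) B = emeasure P {\<omega> \<in> space P. (\<lambda>i. W i \<omega>) \<in> B}"
    by (subst emeasure_distr) (auto intro!: arg_cong[where f = "emeasure P"])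
  moreover have "emeasure (distr P (borel \<Otimes>\<^sub>M borel) (\<lambda>\<omega>. (L a \<omega>, \<lambda>i. W i \<omega>))) (A \<times> B) =
      emeasure P {\<omega> \<in> space P. L a \<omega> \<in> A \<and> (\<lambda>i. W i \<omega>) \<in> B}"
    by (subst emeasure_distr) (auto intro!: arg_cong[where f = "emeasure P"])
  ultimately show "emeasure (distr P borel (L a)) A * emeasure (distr P borel (\<lambda>\<omega> i. W i \<omega>)) B =
     emeasure (distr P (borel \<Otimes>\<^sub>M borel) (\<lambda>\<omega>. (L a \<omega>, \<lambda>i. W i \<omega>))) (A \<times> B)" by simp
qed

end

end

section \<open>Gaussian integration by parts\<close>

context gaussian_vector
begin

lemma Zvec_measurable [measurable]: "(\<lambda>\<omega> i. Z i \<omega>) \<in> borel_measurable P"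
  by (rule measurable_fun_space) simp

lemma expectation_L_Z: "j < d \<Longrightarrow> expectation (\<lambda>\<omega>. L a \<omega> * Z j \<omega>) = (\<Sum>i<d. a i * S i j)"
  unfolding L_def sum_distrib_right
  by (subst Bochner_Integration.integral_sum) (simp_all add: mult.assoc expectation_ZZ)

lemma L_Z_integrable [simp]: "integrable P (\<lambda>\<omega>. L a \<omega> * Z j \<omega>)"
  unfolding L_def sum_distrib_right
  by (intro Bochner_Integration.integrable_sum) (simp add: mult.assoc)

lemma L_abs_Z_integrable [simp]: "integrable P (\<lambda>\<omega>. \<bar>L a \<omega>\<bar> * \<bar>Z j \<omega>\<bar>)"
  using integrable_abs[OF L_Z_integrable[of a j]] by (simp add: abs_mult)

lemma L_times_C1_integrable:
  assumes F: "C1_on d F F'" and B: "\<And>i x. i < d \<Longrightarrow> \<bar>F' i x\<bar> \<le> B"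
  shows "integrable P (\<lambda>\<omega>. L a \<omega> * F (\<lambda>i. Z i \<omega>))"
proof (rule Bochner_Integration.integrable_bound)
  have [measurable]: "F \<in> borel_measurable borel" using F by (auto simp: C1_on_def intro: borel_measurable_continuous_onI)
  show "integrable P (\<lambda>\<omega>. \<bar>F (\<lambda>_. 0)\<bar> * \<bar>L a \<omega>\<bar> + B * (\<Sum>i<d. \<bar>L a \<omega>\<bar> * \<bar>Z i \<omega>\<bar>))"
    by (intro Bochner_Integration.integrable_add integrable_mult_right Bochner_Integration.integrable_sum integrable_abs L_abs_Z_integrable L_integrable)
  show "AE \<omega> in P. norm (L a \<omega> * F (\<lambda>i. Z i \<omega>)) \<le> norm (\<bar>F (\<lambda>_. 0)\<bar> * \<bar>L a \<omega>\<bar> + B * (\<Sum>i<d. \<bar>L a \<omega>\<bar> * \<bar>Z i \<omega>\<bar>))"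
  proof (rule AE_I2)
    fix \<omega>
    have "\<bar>F (\<lambda>i. Z i \<omega>)\<bar> \<le> \<bar>F (\<lambda>_. 0)\<bar> + B * (\<Sum>i<d. \<bar>Z i \<omega>\<bar>)"
      using C1_on_lipschitz[OF F B, of "\<lambda>i. Z i \<omega>" "\<lambda>_. 0"] by simp
    hence "\<bar>L a \<omega>\<bar> * \<bar>F (\<lambda>i. Z i \<omega>)\<bar> \<le> \<bar>L a \<omega>\<bar> * (\<bar>F (\<lambda>_. 0)\<bar> + B * (\<Sum>i<d. \<bar>Z i \<omega>\<bar>))"
      by (intro mult_left_mono) auto
    also have "\<dots> = \<bar>F (\<lambda>_. 0)\<bar> * \<bar>L a \<omega>\<bar> + B * (\<Sum>i<d. \<bar>L a \<omega>\<bar> * \<bar>Z i \<omega>\<bar>)"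
      by (simp add: algebra_simps sum_distrib_left)
    finally show "norm (L a \<omega> * F (\<lambda>i. Z i \<omega>)) \<le> norm (\<bar>F (\<lambda>_. 0)\<bar> * \<bar>L a \<omega>\<bar> + B * (\<Sum>i<d. \<bar>L a \<omega>\<bar> * \<bar>Z i \<omega>\<bar>))"
      by (simp add: abs_mult order_trans[OF _ abs_ge_self])
  qed
  have "(\<lambda>\<omega>. F (\<lambda>i. Z i \<omega>)) \<in> borel_measurable P"
    by (rule measurable_compose[OF Zvec_measurable]) simp
  thus "(\<lambda>\<omega>. L a \<omega> * F (\<lambda>i. Z i \<omega>)) \<in> borel_measurable P" by simp
qed

lemma C1_deriv_integrable:
  assumes F: "C1_on d F F'" and B: "\<And>i x. i < d \<Longrightarrow> \<bar>F' i x\<bar> \<le> B" and "i < d"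
  shows "integrable P (\<lambda>\<omega>. F' i (\<lambda>i. Z i \<omega>))"
proof -
  have [measurable]: "F' i \<in> borel_measurable borel" using F \<open>i < d\<close> by (auto simp: C1_on_def intro: borel_measurable_continuous_onI)
  show ?thesis using B[OF \<open>i < d\<close>] by (intro integrable_const_bound[of _ B]) auto
qed

text \<open>
  If \<open>L a\<close> is degenerate, both sides vanish. Otherwise \<open>Z = W + q L a\<close> with W independent of \<open>L a\<close>, and
  the one-dimensional formula applies to \<open>L a\<close> with W frozen.
\<close>

theorem gaussian_integration_by_parts:
  assumes F: "C1_on d F F'" and B: "\<And>i x. i < d \<Longrightarrow> \<bar>F' i x\<bar> \<le> B"
  shows "expectation (\<lambda>\<omega>. L a \<omega> * F (\<lambda>i. Z i \<omega>)) =
           (\<Sum>j<d. (\<Sum>i<d. a i * S i j) * expectation (\<lambda>\<omega>. F' j (\<lambda>i. Z i \<omega>)))"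
proof (cases "V a a = 0")
  case True
  have ae: "AE \<omega> in P. L a \<omega> = 0" by (rule L_degenerate[OF True])
  have [measurable]: "F \<in> borel_measurable borel" using F by (auto simp: C1_on_def intro: borel_measurable_continuous_onI)
  have "expectation (\<lambda>\<omega>. L a \<omega> * F (\<lambda>i. Z i \<omega>)) = expectation (\<lambda>_. 0)"
    using ae by (intro integral_cong_AE) auto
  moreover have "(\<Sum>i<d. a i * S i j) = 0" if "j < d" for j
  proof -
    have "expectation (\<lambda>\<omega>. L a \<omega> * Z j \<omega>) = expectation (\<lambda>_. 0)"
      using ae by (intro integral_cong_AE) auto
    thus ?thesis using expectation_L_Z[OF that] by simp
  qed
  ultimately show ?thesis by simp
next
  case a: False
  note [measurable] = W_measurable[OF a]
  define \<sigma> where "\<sigma> = sqrt (V a a)"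
  have \<sigma>: "\<sigma> > 0" "\<sigma>\<^sup>2 = V a a" using a V_nonneg[of a] by (auto simp: \<sigma>_def less_le)
  define NN where "NN = density lborel (\<lambda>x. ennreal (normal_density 0 \<sigma> x))"
  define MW where "MW = distr P borel (\<lambda>\<omega> i. W a i \<omega>)"
  have Wm [measurable]: "(\<lambda>\<omega> i. W a i \<omega>) \<in> borel_measurable P" by (rule measurable_fun_space) simp
  have law: "distr P (borel \<Otimes>\<^sub>M borel) (\<lambda>\<omega>. (L a \<omega>, \<lambda>i. W a i \<omega>)) = NN \<Otimes>\<^sub>M MW"
    using joint_law[OF a] distr_L[OF a] by (simp add: NN_def MW_def \<sigma>_def)
  interpret NN: prob_space NN unfolding NN_def using \<sigma> by (intro prob_space_normal_density)
  interpret MW: prob_space MW unfolding MW_def by (rule prob_space_distr) simp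
  interpret NM: pair_sigma_finite NN MW ..
  have sets_NN: "sets NN = sets borel" and sets_MW: "sets MW = sets borel" by (simp_all add: NN_def MW_def)
  define T where "T = (\<lambda>(x, w) i. w i + q a i * x :: real)"
  have T_Z: "T (L a \<omega>, \<lambda>i. W a i \<omega>) = (\<lambda>i. Z i \<omega>)" for \<omega>
    using a by (auto simp: T_def W_def)
  have Tm [measurable]: "T \<in> borel \<Otimes>\<^sub>M borel \<rightarrow>\<^sub>M borel"
  proof (rule measurable_fun_space)
    fix i
    have [measurable]: "(\<lambda>p :: real \<times> (nat \<Rightarrow> real). snd p i) \<in> borel_measurable (borel \<Otimes>\<^sub>M borel)"
      by (rule measurable_compose[OF measurable_snd measurable_fun_apply])
    show "(\<lambda>p. T p i) \<in> borel_measurable (borel \<Otimes>\<^sub>M borel)"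
      unfolding T_def case_prod_unfold by measurable
  qed
  have transfer: "integrable P (\<lambda>\<omega>. f (L a \<omega>) (\<lambda>i. Z i \<omega>)) \<Longrightarrow>
      expectation (\<lambda>\<omega>. f (L a \<omega>) (\<lambda>i. Z i \<omega>)) = (\<integral>w. (\<integral>x. f x (T (x, w)) \<partial>NN) \<partial>MW)"
    if fm: "(\<lambda>p. f (fst p) (snd p)) \<in> borel_measurable (borel \<Otimes>\<^sub>M borel)" for f :: "real \<Rightarrow> (nat \<Rightarrow> real) \<Rightarrow> real"
  proof -
    assume int: "integrable P (\<lambda>\<omega>. f (L a \<omega>) (\<lambda>i. Z i \<omega>))"
    have gm: "(\<lambda>p. f (fst p) (T p)) \<in> borel_measurable (borel \<Otimes>\<^sub>M borel)"
      using measurable_compose[OF _ fm, of "\<lambda>p. (fst p, T p)" "borel \<Otimes>\<^sub>M borel"] by simp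
    have im: "(\<lambda>\<omega>. (L a \<omega>, \<lambda>i. W a i \<omega>)) \<in> P \<rightarrow>\<^sub>M borel \<Otimes>\<^sub>M borel" by measurable
    have "integrable (distr P (borel \<Otimes>\<^sub>M borel) (\<lambda>\<omega>. (L a \<omega>, \<lambda>i. W a i \<omega>))) (\<lambda>p. f (fst p) (T p))"
      using int by (subst integrable_distr_eq[OF im gm]) (simp add: T_Z)
    hence int': "integrable (NN \<Otimes>\<^sub>M MW) (\<lambda>(x, w). f x (T (x, w)))" unfolding law by (simp add: case_prod_unfold)
    have "expectation (\<lambda>\<omega>. f (L a \<omega>) (\<lambda>i. Z i \<omega>)) = (\<integral>p. f (fst p) (T p) \<partial>distr P (borel \<Otimes>\<^sub>M borel) (\<lambda>\<omega>. (L a \<omega>, \<lambda>i. W a i \<omega>)))"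
      by (subst integral_distr[OF im gm]) (simp add: T_Z)
    also have "\<dots> = (\<integral>p. (\<lambda>(x, w). f x (T (x, w))) p \<partial>(NN \<Otimes>\<^sub>M MW))" unfolding law by (simp add: case_prod_unfold)
    also have "\<dots> = (\<integral>w. (\<integral>x. f x (T (x, w)) \<partial>NN) \<partial>MW)"
      using NM.integral_snd[OF int'] by simp
    finally show ?thesis .
  qed
  have Fm [measurable]: "F \<in> borel_measurable borel" using F by (auto simp: C1_on_def intro: borel_measurable_continuous_onI)
  have F'm: "F' i \<in> borel_measurable borel" if "i < d" for i using F that by (auto simp: C1_on_def intro: borel_measurable_continuous_onI)
  have Gm: "(\<lambda>p. (\<Sum>i<d. q a i * F' i (snd p))) \<in> borel_measurable (borel \<Otimes>\<^sub>M borel)"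
    by (intro borel_measurable_sum borel_measurable_times borel_measurable_const measurable_compose[OF measurable_snd F'm]) simp
  have "expectation (\<lambda>\<omega>. L a \<omega> * F (\<lambda>i. Z i \<omega>)) = (\<integral>w. (\<integral>x. x * F (T (x, w)) \<partial>NN) \<partial>MW)"
    by (rule transfer[OF _ L_times_C1_integrable[OF F B]]) measurable
  also have "\<dots> = (\<integral>w. \<sigma>\<^sup>2 * (\<integral>x. (\<Sum>i<d. q a i * F' i (T (x, w))) \<partial>NN) \<partial>MW)"
  proof (rule Bochner_Integration.integral_cong[OF refl])
    fix w
    have Tc: "continuous_on UNIV (\<lambda>x. T (x, w))"
      unfolding T_def by (intro continuous_on_coordinatewise_then_product) (auto intro!: continuous_intros)
    show "(\<integral>x. x * F (T (x, w)) \<partial>NN) = \<sigma>\<^sup>2 * (\<integral>x. (\<Sum>i<d. q a i * F' i (T (x, w))) \<partial>NN)"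
      unfolding NN_def
    proof (rule normal_integration_by_parts[OF \<sigma>(1), where B = "\<Sum>i<d. \<bar>q a i\<bar> * B"])
      show "((\<lambda>x. F (T (x, w))) has_real_derivative (\<Sum>i<d. q a i * F' i (T (x, w)))) (at x)" for x
        by (rule C1_on_chain[OF F]) (auto simp: T_def intro!: derivative_eq_intros)
      show "continuous_on UNIV (\<lambda>x. \<Sum>i<d. q a i * F' i (T (x, w)))"
        using F by (intro continuous_intros continuous_on_compose2[OF _ Tc, of UNIV]) (auto simp: C1_on_def)
      show "\<bar>\<Sum>i<d. q a i * F' i (T (x, w))\<bar> \<le> (\<Sum>i<d. \<bar>q a i\<bar> * B)" for x
        by (rule order_trans[OF sum_abs]) (auto simp: abs_mult intro!: sum_mono mult_left_mono B)
    qed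
  qed
  also have "\<dots> = V a a * expectation (\<lambda>\<omega>. \<Sum>i<d. q a i * F' i (\<lambda>i. Z i \<omega>))"
  proof -
    have GI: "integrable P (\<lambda>\<omega>. \<Sum>i<d. q a i * F' i (\<lambda>i. Z i \<omega>))"
      by (intro Bochner_Integration.integrable_sum integrable_mult_right C1_deriv_integrable[OF F B]) auto
    show ?thesis unfolding transfer[OF Gm GI] \<sigma> by (rule integral_mult_right_zero)
  qed
  also have "\<dots> = V a a * (\<Sum>i<d. q a i * expectation (\<lambda>\<omega>. F' i (\<lambda>i. Z i \<omega>)))"
    using C1_deriv_integrable[OF F B] by (subst Bochner_Integration.integral_sum) auto
  also have "\<dots> = (\<Sum>j<d. (\<Sum>i<d. a i * S i j) * expectation (\<lambda>\<omega>. F' j (\<lambda>i. Z i \<omega>)))"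
    unfolding sum_distrib_left
  proof (rule sum.cong[OF refl])
    fix j assume j: "j \<in> {..<d}"
    have "V a a * q a j = (\<Sum>i<d. S j i * a i)" using a j by (simp add: q_def)
    also have "\<dots> = (\<Sum>i<d. a i * S i j)" using j by (intro sum.cong) (auto simp: S_sym)
    finally show "V a a * (q a j * expectation (\<lambda>\<omega>. F' j (\<lambda>i. Z i \<omega>))) = (\<Sum>i<d. a i * S i j) * expectation (\<lambda>\<omega>. F' j (\<lambda>i. Z i \<omega>))"
      by (simp flip: mult.assoc)
  qed
  finally show ?thesis .
qed

end

section \<open>Poisson random measures\<close>

locale finite_poisson = prob_space M for M :: "'w measure" +
  fixes \<Lambda> :: "'a measure" and N :: "'w \<Rightarrow> 'a measure"
  assumes prm: "poisson_random_measure M \<Lambda> N"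
    and finite_intensity: "emeasure \<Lambda> (space \<Lambda>) \<noteq> \<infinity>"
begin

sublocale \<Lambda>: finite_measure \<Lambda>
  by standard (rule finite_intensity)

lemma sets_N: "\<omega> \<in> space M \<Longrightarrow> sets (N \<omega>) = sets \<Lambda>"
  using prm by (simp add: poisson_random_measure_def)

lemma space_N: "\<omega> \<in> space M \<Longrightarrow> space (N \<omega>) = space \<Lambda>"
  by (rule sets_eq_imp_space_eq[OF sets_N])

lemma emeasure_N_measurable: "A \<in> sets \<Lambda> \<Longrightarrow> (\<lambda>\<omega>. emeasure (N \<omega>) A) \<in> borel_measurable M"
  using prm by (simp add: poisson_random_measure_def)

lemma N_integer: "\<omega> \<in> space M \<Longrightarrow> A \<in> sets \<Lambda> \<Longrightarrow> emeasure (N \<omega>) A \<noteq> \<infinity> \<Longrightarrow> \<exists>k::nat. emeasure (N \<omega>) A = of_nat k"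
  using prm unfolding poisson_random_measure_def by blast

definition count :: "'a set \<Rightarrow> 'w \<Rightarrow> real" where
  "count A \<omega> = enn2real (emeasure (N \<omega>) A)"

definition pois :: "'a set \<Rightarrow> nat \<Rightarrow> real" where
  "pois A k = exp (- measure \<Lambda> A) * measure \<Lambda> A ^ k / fact k"

lemma count_measurable: "A \<in> sets \<Lambda> \<Longrightarrow> count A \<in> borel_measurable M"
  unfolding count_def[abs_def] using emeasure_N_measurable by measurable

lemma prob_N:
  assumes "A \<in> sets \<Lambda>"
  shows "prob {\<omega> \<in> space M. emeasure (N \<omega>) A = of_nat k} = pois A k"
proof -
  have "emeasure \<Lambda> A < \<infinity>" unfolding infinity_ennreal_def less_top[symmetric] by (rule \<Lambda>.emeasure_finite)
  thus ?thesis using prm assms unfolding poisson_random_measure_def pois_def by blast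
qed

lemma pois_sums: "pois A sums 1"
proof -
  have "(\<lambda>k. measure \<Lambda> A ^ k /\<^sub>R fact k) sums exp (measure \<Lambda> A)" by (rule exp_converges)
  from sums_mult[OF this, of "exp (- measure \<Lambda> A)"]
  show ?thesis by (simp add: pois_def[abs_def] divide_inverse mult_ac flip: exp_add)
qed

lemma pois_nonneg: "pois A k \<ge> 0" by (simp add: pois_def)

lemma pois_Suc: "real (Suc k) * pois A (Suc k) = measure \<Lambda> A * pois A k"
  by (simp add: pois_def field_simps del: of_nat_Suc)

lemma pois_mean_summable: "summable (\<lambda>k. real k * pois A k)"
proof -
  have "summable (\<lambda>k. real (Suc k) * pois A (Suc k))"
    unfolding pois_Suc using pois_sums[of A] by (intro summable_mult) (auto simp: sums_iff)
  thus ?thesis by (subst (asm) summable_Suc_iff)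
qed

lemma pois_sum_shift:
  assumes "\<And>k. \<bar>e k\<bar> \<le> C"
  shows "(\<Sum>k. real k * pois A k * e k) = measure \<Lambda> A * (\<Sum>k. pois A k * e (Suc k))"
proof -
  have C: "C \<ge> 0" using assms[of 0] by simp
  have s: "summable (\<lambda>k. real k * pois A k * e k)"
    by (rule summable_comparison_test'[OF summable_mult[OF pois_mean_summable, of C]])
       (auto simp: abs_mult pois_nonneg mult.commute[of C] intro!: mult_left_mono assms)
  have "(\<Sum>k. real k * pois A k * e k) = (\<Sum>k. real (Suc k) * pois A (Suc k) * e (Suc k))"
    using suminf_split_head[OF s] by simp
  also have "\<dots> = (\<Sum>k. measure \<Lambda> A * (pois A k * e (Suc k)))" by (simp only: pois_Suc mult.assoc)
  also have "\<dots> = measure \<Lambda> A * (\<Sum>k. pois A k * e (Suc k))"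
  proof (rule suminf_mult)
    show "summable (\<lambda>k. pois A k * e (Suc k))"
      by (rule summable_comparison_test'[OF summable_mult[of "pois A" C]])
         (use pois_sums[of A] in \<open>auto simp: sums_iff abs_mult pois_nonneg mult.commute[of C] intro!: mult_left_mono assms\<close>)
  qed
  finally show ?thesis .
qed

lemma N_finite_AE:
  assumes A: "A \<in> sets \<Lambda>"
  shows "AE \<omega> in M. emeasure (N \<omega>) A \<noteq> \<infinity>"
proof -
  note [measurable] = emeasure_N_measurable[OF A]
  let ?E = "\<lambda>k::nat. {\<omega> \<in> space M. emeasure (N \<omega>) A = of_nat k}"
  have "(\<lambda>k. prob (?E k)) sums prob (\<Union>k. ?E k)"
    by (rule finite_measure_UNION) (auto simp: disjoint_family_on_def)
  hence "prob (\<Union>k. ?E k) = 1" unfolding prob_N[OF A] using pois_sums sums_unique2 by blast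
  hence "AE \<omega> in M. \<omega> \<in> (\<Union>k. ?E k)" by (rule AE_prob_1)
  thus ?thesis by eventually_elim auto
qed

lemma count_eq_AE:
  assumes A: "A \<in> sets \<Lambda>"
  shows "AE \<omega> in M. \<exists>k::nat. emeasure (N \<omega>) A = of_nat k \<and> count A \<omega> = real k"
  using N_finite_AE[OF A] AE_space
proof eventually_elim
  case (elim \<omega>)
  then obtain k where "emeasure (N \<omega>) A = of_nat k" using N_integer[OF _ A] by blast
  thus ?case by (auto simp: count_def simp flip: ennreal_of_nat_eq_real_of_nat)
qed

definition cells :: "nat \<Rightarrow> (nat \<Rightarrow> 'a set) \<Rightarrow> 'w \<Rightarrow> nat \<Rightarrow> real" where
  "cells n A \<omega> j = (if j < n then count (A j) \<omega> else 0)"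

lemma cells_measurable:
  assumes "\<And>i. i < n \<Longrightarrow> A i \<in> sets \<Lambda>"
  shows "cells n A \<in> borel_measurable M"
proof (rule measurable_coordinatewise_then_product)
  fix j show "(\<lambda>\<omega>. cells n A \<omega> j) \<in> borel_measurable M"
    using assms count_measurable by (cases "j < n") (auto simp: cells_def)
qed

lemma fun_upd_measurable:
  "(\<lambda>v. v(k := c)) \<in> borel \<rightarrow>\<^sub>M (borel :: (nat \<Rightarrow> real) measure)"
proof (rule measurable_coordinatewise_then_product)
  fix j show "(\<lambda>v. (v(k := c)) j) \<in> borel_measurable (borel :: (nat \<Rightarrow> real) measure)"
    by (cases "j = k") (auto intro: measurable_product_then_coordinatewise)
qed

lemma cell_independence:
  assumes A: "\<And>i. i < n \<Longrightarrow> A i \<in> sets \<Lambda>" and disj: "disjoint_family_on A {..<n}" and k: "k < n"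
    and \<psi>[measurable]: "\<psi> \<in> borel_measurable borel" and C: "\<And>v. \<bar>\<psi> v\<bar> \<le> C"
  shows "expectation (\<lambda>\<omega>. indicator {\<omega> \<in> space M. emeasure (N \<omega>) (A k) = of_nat m} \<omega> * \<psi> ((cells n A \<omega>)(k := c)))
     = pois (A k) m * expectation (\<lambda>\<omega>. \<psi> ((cells n A \<omega>)(k := c)))"
proof -
  have ind: "indep_vars (\<lambda>_. borel) (\<lambda>i \<omega>. emeasure (N \<omega>) (A i)) {..<n}"
    using prm A disj unfolding poisson_random_measure_def by blast
  let ?J = "{..<n} - {k}"
  define Y1 where "Y1 = (\<lambda>g :: nat \<Rightarrow> ennreal. indicator {of_nat m} (g k) :: real)"
  define emb where "emb = (\<lambda>(g :: nat \<Rightarrow> ennreal) j. if j = k then c else if j < n then enn2real (g j) else 0)"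
  have emb: "emb \<in> PiM ?J (\<lambda>_. borel) \<rightarrow>\<^sub>M borel"
  proof (rule measurable_coordinatewise_then_product)
    fix j
    show "(\<lambda>g. emb g j) \<in> borel_measurable (PiM ?J (\<lambda>_. borel))"
    proof (cases "j \<in> ?J")
      case True
      hence "(\<lambda>g. enn2real (g j)) \<in> borel_measurable (PiM ?J (\<lambda>_. borel))"
        using measurable_component_singleton[OF True, of "\<lambda>_. borel"] by (intro borel_measurable_enn2real)
      thus ?thesis using True by (simp add: emb_def)
    next
      case False
      thus ?thesis by (cases "j = k") (auto simp: emb_def)
    qed
  qed
  have "indep_var (PiM {k} (\<lambda>_. borel)) (\<lambda>\<omega>. \<lambda>i\<in>{k}. emeasure (N \<omega>) (A i)) (PiM ?J (\<lambda>_. borel)) (\<lambda>\<omega>. \<lambda>i\<in>?J. emeasure (N \<omega>) (A i))"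
    by (rule indep_var_restrict[OF ind]) (use k in auto)
  hence "indep_var borel (Y1 \<circ> (\<lambda>\<omega>. \<lambda>i\<in>{k}. emeasure (N \<omega>) (A i))) borel ((\<lambda>g. \<psi> (emb g)) \<circ> (\<lambda>\<omega>. \<lambda>i\<in>?J. emeasure (N \<omega>) (A i)))"
  proof (rule indep_var_compose)
    show "Y1 \<in> borel_measurable (PiM {k} (\<lambda>_. borel))"
      unfolding Y1_def by (rule measurable_compose[OF measurable_component_singleton[of k "{k}" "\<lambda>_. borel"]]) auto
    show "(\<lambda>g. \<psi> (emb g)) \<in> borel_measurable (PiM ?J (\<lambda>_. borel))"
      by (rule measurable_compose[OF emb \<psi>])
  qed
  moreover have "Y1 \<circ> (\<lambda>\<omega>. \<lambda>i\<in>{k}. emeasure (N \<omega>) (A i)) = (\<lambda>\<omega>. indicator {of_nat m} (emeasure (N \<omega>) (A k)))"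
    by (auto simp: Y1_def)
  moreover have "(\<lambda>g. \<psi> (emb g)) \<circ> (\<lambda>\<omega>. \<lambda>i\<in>?J. emeasure (N \<omega>) (A i)) = (\<lambda>\<omega>. \<psi> ((cells n A \<omega>)(k := c)))"
    by (auto simp: emb_def cells_def count_def fun_eq_iff fun_upd_def intro!: arg_cong[where f = \<psi>])
  ultimately have iv: "indep_var borel (\<lambda>\<omega>. indicator {of_nat m} (emeasure (N \<omega>) (A k)) :: real) borel (\<lambda>\<omega>. \<psi> ((cells n A \<omega>)(k := c)))"
    by simp
  note [measurable] = emeasure_N_measurable[OF A[OF k]] measurable_compose[OF cells_measurable[OF A] fun_upd_measurable]
  have "expectation (\<lambda>\<omega>. indicator {of_nat m} (emeasure (N \<omega>) (A k)) * \<psi> ((cells n A \<omega>)(k := c))) =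
     expectation (\<lambda>\<omega>. indicator {of_nat m} (emeasure (N \<omega>) (A k))) * expectation (\<lambda>\<omega>. \<psi> ((cells n A \<omega>)(k := c)))"
  proof (rule indep_var_lebesgue_integral[OF iv])
    show "integrable M (\<lambda>\<omega>. indicator {of_nat m} (emeasure (N \<omega>) (A k)) :: real)"
      by (rule integrable_const_bound[of _ 1]) (auto simp: indicator_def)
    show "integrable M (\<lambda>\<omega>. \<psi> ((cells n A \<omega>)(k := c)))"
      by (rule integrable_const_bound[of _ C]) (use C measurable_compose[OF measurable_compose[OF cells_measurable[OF A] fun_upd_measurable] \<psi>] in auto)
  qed
  also have "expectation (\<lambda>\<omega>. indicator {of_nat m} (emeasure (N \<omega>) (A k)) :: real) =
       expectation (indicator {\<omega> \<in> space M. emeasure (N \<omega>) (A k) = of_nat m})"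
    by (intro Bochner_Integration.integral_cong) (auto simp: indicator_def)
  also have "\<dots> = pois (A k) m"
    using prob_N[OF A[OF k], of m] by (subst Bochner_Integration.integral_indicator) (auto intro!: arg_cong[where f = prob])
  also have "expectation (\<lambda>\<omega>. indicator {of_nat m} (emeasure (N \<omega>) (A k)) * \<psi> ((cells n A \<omega>)(k := c))) =
     expectation (\<lambda>\<omega>. indicator {\<omega> \<in> space M. emeasure (N \<omega>) (A k) = of_nat m} \<omega> * \<psi> ((cells n A \<omega>)(k := c)))"
    by (intro Bochner_Integration.integral_cong) (auto simp: indicator_def)
  finally show ?thesis .
qed

end

context finite_poisson
begin

text \<open>
  The k-th count is independent of the other ones and Poisson distributed, and Poisson weights
  satisfy \<open>m p(m) = \<lambda> p(m - 1)\<close>. Hence weighting by the count has the same effect as adding one point.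
\<close>

lemma cell_mecke:
  assumes A: "\<And>i. i < n \<Longrightarrow> A i \<in> sets \<Lambda>" and disj: "disjoint_family_on A {..<n}" and k: "k < n"
    and \<psi>[measurable]: "\<psi> \<in> borel_measurable borel" and C: "\<And>v. \<bar>\<psi> v\<bar> \<le> C"
  shows "expectation (\<lambda>\<omega>. cells n A \<omega> k * \<psi> (cells n A \<omega>))
     = measure \<Lambda> (A k) * expectation (\<lambda>\<omega>. \<psi> ((cells n A \<omega>)(k := cells n A \<omega> k + 1)))"
proof -
  note [measurable] = emeasure_N_measurable[OF A[OF k]]
  define E where "E = (\<lambda>m::nat. {\<omega> \<in> space M. emeasure (N \<omega>) (A k) = of_nat m})"
  have Em [measurable]: "E m \<in> sets M" for m unfolding E_def by measurable
  define e where "e = (\<lambda>m::nat. expectation (\<lambda>\<omega>. \<psi> ((cells n A \<omega>)(k := real m))))"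
  have \<psi>m [measurable]: "(\<lambda>\<omega>. \<psi> ((cells n A \<omega>)(k := c))) \<in> borel_measurable M" for c
    using measurable_compose[OF measurable_compose[OF cells_measurable[OF A] fun_upd_measurable] \<psi>] by simp
  have C0: "C \<ge> 0" using C[of "\<lambda>_. 0"] by simp
  have eb: "\<bar>e m\<bar> \<le> C" for m
  proof -
    have "\<bar>e m\<bar> \<le> expectation (\<lambda>\<omega>. \<bar>\<psi> ((cells n A \<omega>)(k := real m))\<bar>)" unfolding e_def by (rule integral_abs_bound)
    also have "\<dots> \<le> expectation (\<lambda>_. C)"
      by (rule integral_mono) (auto intro!: C integrable_const_bound[of _ C] AE_I2)
    finally show ?thesis by (simp add: prob_space)
  qed
  have pE: "prob (E m) = pois (A k) m" for m unfolding E_def by (rule prob_N[OF A[OF k]])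
  \<comment> \<open>the series over the values m of the k-th count; g and h cover both sides of the claim\<close>
  have expand: "expectation (\<lambda>\<omega>. g (cells n A \<omega> k) * \<psi> ((cells n A \<omega>)(k := h (cells n A \<omega> k)))) =
      (\<Sum>m. g (real m) * pois (A k) m * expectation (\<lambda>\<omega>. \<psi> ((cells n A \<omega>)(k := h (real m)))))"
    if g: "\<And>m. \<bar>g (real m)\<bar> \<le> 1 + real m" and gm [measurable]: "g \<in> borel_measurable borel" and hm [measurable]: "h \<in> borel_measurable borel" for g h :: "real \<Rightarrow> real"
  proof -
    define T where "T = (\<lambda>m \<omega>. g (real m) * (indicator (E m) \<omega> * \<psi> ((cells n A \<omega>)(k := h (real m)))))"
    have Tb: "\<bar>T m \<omega>\<bar> \<le> (1 + real m) * C * indicator (E m) \<omega>" for m \<omega>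
      unfolding T_def using mult_mono[OF g[of m] C[of "(cells n A \<omega>)(k := h (real m))"]]
      by (auto simp: abs_mult indicator_def)
    have Ti: "integrable M (T m)" for m
    proof (rule integrable_const_bound[of _ "(1 + real m) * C"])
      show "AE \<omega> in M. norm (T m \<omega>) \<le> (1 + real m) * C"
      proof (rule AE_I2)
        fix \<omega>
        have "(1 + real m) * C * indicator (E m) \<omega> \<le> (1 + real m) * C" using C0 by (auto simp: indicator_def)
        thus "norm (T m \<omega>) \<le> (1 + real m) * C" using order_trans[OF Tb[of m \<omega>]] by simp
      qed
    qed (simp add: T_def)
    have sums: "(\<lambda>m. T m \<omega>) sums (g (cells n A \<omega> k) * \<psi> ((cells n A \<omega>)(k := h (cells n A \<omega> k))))"
      if \<omega>: "\<omega> \<in> space M" and l: "emeasure (N \<omega>) (A k) = of_nat l" "count (A k) \<omega> = real l" for \<omega> l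
    proof -
      have "T m \<omega> = (if m = l then g (cells n A \<omega> k) * \<psi> ((cells n A \<omega>)(k := h (cells n A \<omega> k))) else 0)" for m
        using l k \<omega> by (auto simp: T_def E_def cells_def indicator_def)
      thus ?thesis using sums_single[of l "\<lambda>_. g (cells n A \<omega> k) * \<psi> ((cells n A \<omega>)(k := h (cells n A \<omega> k)))"] by (simp cong: if_cong)
    qed
    have ae: "AE \<omega> in M. \<exists>l. emeasure (N \<omega>) (A k) = of_nat l \<and> count (A k) \<omega> = real l" by (rule count_eq_AE[OF A[OF k]])
    have "expectation (\<lambda>\<omega>. \<Sum>m. T m \<omega>) = (\<Sum>m. expectation (T m))"
    proof (rule integral_suminf[OF Ti])
      show "AE \<omega> in M. summable (\<lambda>m. norm (T m \<omega>))"
        using ae AE_space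
      proof eventually_elim
        case (elim \<omega>)
        then obtain l where l: "emeasure (N \<omega>) (A k) = of_nat l" "count (A k) \<omega> = real l" by blast
        have "norm (T m \<omega>) = 0" if "m \<notin> {l}" for m using that l by (auto simp: T_def E_def)
        thus ?case by (intro summable_finite[of "{l}"]) auto
      qed
      have bnd: "expectation (\<lambda>\<omega>. norm (T m \<omega>)) \<le> C * (pois (A k) m + real m * pois (A k) m)" for m
      proof -
        have "expectation (\<lambda>\<omega>. norm (T m \<omega>)) \<le> expectation (\<lambda>\<omega>. (1 + real m) * C * indicator (E m) \<omega>)"
          using Tb by (intro integral_mono integrable_norm Ti integrable_mult_right integrable_real_indicator) (auto simp: less_top[symmetric])
        also have "\<dots> = (1 + real m) * C * prob (E m)" by simp
        also have "\<dots> = C * (pois (A k) m + real m * pois (A k) m)" by (simp add: pE algebra_simps)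
        finally show ?thesis .
      qed
      have smm: "summable (\<lambda>m. C * (pois (A k) m + real m * pois (A k) m))"
        using pois_sums[of "A k"] by (intro summable_mult summable_add pois_mean_summable) (auto simp: sums_iff)
      have nn: "0 \<le> expectation (\<lambda>\<omega>. norm (T m \<omega>))" for m
        by (rule Bochner_Integration.integral_nonneg) (rule norm_ge_zero)
      show "summable (\<lambda>m. expectation (\<lambda>\<omega>. norm (T m \<omega>)))"
        by (rule summable_comparison_test'[OF smm, of 0]) (simp only: real_norm_def abs_of_nonneg[OF nn[unfolded real_norm_def]] bnd[unfolded real_norm_def])
    qed
    moreover have "expectation (\<lambda>\<omega>. \<Sum>m. T m \<omega>) = expectation (\<lambda>\<omega>. g (cells n A \<omega> k) * \<psi> ((cells n A \<omega>)(k := h (cells n A \<omega> k))))"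
    proof (rule integral_cong_AE)
      show ae': "AE \<omega> in M. (\<Sum>m. T m \<omega>) = g (cells n A \<omega> k) * \<psi> ((cells n A \<omega>)(k := h (cells n A \<omega> k)))"
        using ae AE_space by eventually_elim (use sums in \<open>auto simp: sums_iff\<close>)
      show "(\<lambda>\<omega>. \<Sum>m. T m \<omega>) \<in> borel_measurable M"
        using Ti by (intro borel_measurable_suminf) auto
      show "(\<lambda>\<omega>. g (cells n A \<omega> k) * \<psi> ((cells n A \<omega>)(k := h (cells n A \<omega> k)))) \<in> borel_measurable M"
      proof -
        have cm: "(\<lambda>\<omega>. cells n A \<omega> j) \<in> borel_measurable M" for j
          using cells_measurable[OF A] by (rule measurable_product_then_coordinatewise)
        have "(\<lambda>\<omega>. (cells n A \<omega>)(k := h (cells n A \<omega> k))) \<in> borel_measurable M"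
        proof (rule measurable_coordinatewise_then_product)
          fix j show "(\<lambda>\<omega>. ((cells n A \<omega>)(k := h (cells n A \<omega> k))) j) \<in> borel_measurable M"
            using cm measurable_compose[OF cm hm] by (cases "j = k") auto
        qed
        from measurable_compose[OF this \<psi>] measurable_compose[OF cm gm] show ?thesis by simp
      qed
    qed
    moreover have "expectation (T m) = g (real m) * pois (A k) m * expectation (\<lambda>\<omega>. \<psi> ((cells n A \<omega>)(k := h (real m))))" for m
      using cell_independence[OF A disj k \<psi> C, of m "h (real m)"] by (simp add: T_def E_def)
    ultimately show ?thesis by simp
  qed
  have "expectation (\<lambda>\<omega>. cells n A \<omega> k * \<psi> (cells n A \<omega>)) = (\<Sum>m. real m * pois (A k) m * e m)"
    using expand[of "\<lambda>x. x" "\<lambda>x. x"] by (simp add: e_def)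
  also have "\<dots> = measure \<Lambda> (A k) * (\<Sum>m. pois (A k) m * e (Suc m))"
    by (rule pois_sum_shift[OF eb])
  also have "(\<Sum>m. pois (A k) m * e (Suc m)) = expectation (\<lambda>\<omega>. \<psi> ((cells n A \<omega>)(k := cells n A \<omega> k + 1)))"
    using expand[of "\<lambda>_. 1" "\<lambda>x. x + 1"] by (simp add: e_def add.commute)
  finally show ?thesis .
qed

lemma nn_integral_N_measurable:
  assumes "h \<in> borel_measurable \<Lambda>"
  shows "(\<lambda>\<omega>. \<integral>\<^sup>+\<xi>. h \<xi> \<partial>N \<omega>) \<in> borel_measurable M"
  using assms
proof (induction h rule: borel_measurable_induct)
  case (cong f g)
  have "(\<lambda>\<omega>. \<integral>\<^sup>+\<xi>. f \<xi> \<partial>N \<omega>) \<in> borel_measurable M \<longleftrightarrow> (\<lambda>\<omega>. \<integral>\<^sup>+\<xi>. g \<xi> \<partial>N \<omega>) \<in> borel_measurable M"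
    by (intro measurable_cong nn_integral_cong) (auto simp: space_N cong.hyps)
  thus ?case using cong by simp
next
  case (set A)
  have "(\<lambda>\<omega>. \<integral>\<^sup>+\<xi>. indicator A \<xi> \<partial>N \<omega>) \<in> borel_measurable M \<longleftrightarrow> (\<lambda>\<omega>. emeasure (N \<omega>) A) \<in> borel_measurable M"
    using set by (intro measurable_cong nn_integral_indicator) (auto simp: sets_N)
  thus ?case using emeasure_N_measurable[OF set] by simp
next
  case (mult u c)
  have "(\<lambda>\<omega>. \<integral>\<^sup>+\<xi>. c * u \<xi> \<partial>N \<omega>) \<in> borel_measurable M \<longleftrightarrow> (\<lambda>\<omega>. c * (\<integral>\<^sup>+\<xi>. u \<xi> \<partial>N \<omega>)) \<in> borel_measurable M"
    using mult.hyps by (intro measurable_cong nn_integral_cmult) (simp cong: measurable_cong_sets add: sets_N)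
  thus ?case using mult by simp
next
  case (add u v)
  have "(\<lambda>\<omega>. \<integral>\<^sup>+\<xi>. v \<xi> + u \<xi> \<partial>N \<omega>) \<in> borel_measurable M \<longleftrightarrow> (\<lambda>\<omega>. (\<integral>\<^sup>+\<xi>. v \<xi> \<partial>N \<omega>) + (\<integral>\<^sup>+\<xi>. u \<xi> \<partial>N \<omega>)) \<in> borel_measurable M"
    using add.hyps by (intro measurable_cong nn_integral_add) (simp_all cong: measurable_cong_sets add: sets_N)
  thus ?case using add by simp
next
  case (seq U)
  have "(\<lambda>\<omega>. \<integral>\<^sup>+\<xi>. (SUP i. U i) \<xi> \<partial>N \<omega>) \<in> borel_measurable M \<longleftrightarrow> (\<lambda>\<omega>. SUP i. \<integral>\<^sup>+\<xi>. U i \<xi> \<partial>N \<omega>) \<in> borel_measurable M"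
  proof (rule measurable_cong)
    fix \<omega> assume "\<omega> \<in> space M"
    hence "U i \<in> borel_measurable (N \<omega>)" for i using seq.hyps by (simp cong: measurable_cong_sets add: sets_N)
    thus "(\<integral>\<^sup>+\<xi>. (SUP i. U i) \<xi> \<partial>N \<omega>) = (SUP i. \<integral>\<^sup>+\<xi>. U i \<xi> \<partial>N \<omega>)"
      unfolding SUP_apply using seq.hyps by (intro nn_integral_monotone_convergence_SUP) auto
  qed
  thus ?case using seq by simp
qed

lemma integral_N_measurable:
  fixes f :: "'a \<Rightarrow> real"
  assumes [measurable]: "f \<in> borel_measurable \<Lambda>"
  shows "(\<lambda>\<omega>. \<integral>\<xi>. f \<xi> \<partial>N \<omega>) \<in> borel_measurable M"
proof -
  note m = nn_integral_N_measurable
  \<comment> \<open>the else branch is the default value of an integral that does not exist\<close>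
  define G where "G = (\<lambda>\<omega>. if (\<integral>\<^sup>+\<xi>. ennreal \<bar>f \<xi>\<bar> \<partial>N \<omega>) < \<infinity>
      then enn2real (\<integral>\<^sup>+\<xi>. ennreal (f \<xi>) \<partial>N \<omega>) - enn2real (\<integral>\<^sup>+\<xi>. ennreal (- f \<xi>) \<partial>N \<omega>) else 0)"
  have [measurable]: "(\<lambda>\<omega>. \<integral>\<^sup>+\<xi>. ennreal \<bar>f \<xi>\<bar> \<partial>N \<omega>) \<in> borel_measurable M" by (rule m) measurable
  have [measurable]: "(\<lambda>\<omega>. \<integral>\<^sup>+\<xi>. ennreal (f \<xi>) \<partial>N \<omega>) \<in> borel_measurable M" by (rule m) measurable
  have [measurable]: "(\<lambda>\<omega>. \<integral>\<^sup>+\<xi>. ennreal (- f \<xi>) \<partial>N \<omega>) \<in> borel_measurable M" by (rule m) measurable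
  have "G \<in> borel_measurable M" unfolding G_def by measurable
  moreover have "(\<integral>\<xi>. f \<xi> \<partial>N \<omega>) = G \<omega>" if "\<omega> \<in> space M" for \<omega>
  proof -
    have [measurable]: "f \<in> borel_measurable (N \<omega>)" using assms by (simp cong: measurable_cong_sets add: sets_N[OF that])
    show ?thesis
    proof (cases "integrable (N \<omega>) f")
      case True
      hence "(\<integral>\<^sup>+\<xi>. ennreal \<bar>f \<xi>\<bar> \<partial>N \<omega>) < \<infinity>" by (simp add: integrable_iff_bounded)
      thus ?thesis using real_lebesgue_integral_def[OF True] by (simp add: G_def)
    next
      case False
      hence "\<not> (\<integral>\<^sup>+\<xi>. ennreal \<bar>f \<xi>\<bar> \<partial>N \<omega>) < \<infinity>" by (simp add: integrable_iff_bounded)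
      thus ?thesis using False by (simp add: G_def not_integrable_integral_eq)
    qed
  qed
  ultimately show ?thesis by (subst measurable_cong) auto
qed

lemma count_integrable:
  assumes A: "A \<in> sets \<Lambda>"
  shows "integrable M (count A)"
proof (rule integrableI_bounded)
  show "count A \<in> borel_measurable M" using A by (rule count_measurable)
  have "(\<integral>\<^sup>+\<omega>. ennreal (norm (count A \<omega>)) \<partial>M) = (\<integral>\<^sup>+\<omega>. (\<Sum>m. ennreal (real m) * indicator {\<omega> \<in> space M. emeasure (N \<omega>) A = of_nat m} \<omega>) \<partial>M)"
  proof (rule nn_integral_cong_AE)
    show "AE \<omega> in M. ennreal (norm (count A \<omega>)) = (\<Sum>m. ennreal (real m) * indicator {\<omega> \<in> space M. emeasure (N \<omega>) A = of_nat m} \<omega>)"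
      using count_eq_AE[OF A] AE_space
    proof eventually_elim
      case (elim \<omega>)
      then obtain l where l: "emeasure (N \<omega>) A = of_nat l" "count A \<omega> = real l" by blast
      have "(\<Sum>m. ennreal (real m) * indicator {\<omega> \<in> space M. emeasure (N \<omega>) A = of_nat m} \<omega>) =
         (\<Sum>m\<in>{l}. ennreal (real m) * indicator {\<omega> \<in> space M. emeasure (N \<omega>) A = of_nat m} \<omega>)"
        using l by (intro suminf_finite) (auto simp: indicator_def)
      thus ?case using l elim by simp
    qed
  qed
  also have "\<dots> = (\<Sum>m. ennreal (real m * pois A m))"
  proof (subst nn_integral_suminf)
    note [measurable] = emeasure_N_measurable[OF A]
    show "(\<lambda>\<omega>. ennreal (real m) * indicator {\<omega> \<in> space M. emeasure (N \<omega>) A = of_nat m} \<omega>) \<in> borel_measurable M" for m by measurable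
    have "(\<integral>\<^sup>+\<omega>. ennreal (real m) * indicator {\<omega> \<in> space M. emeasure (N \<omega>) A = of_nat m} \<omega> \<partial>M) = ennreal (real m * pois A m)" for m
      using prob_N[OF A, of m] by (subst nn_integral_cmult_indicator) (simp_all add: emeasure_eq_measure ennreal_mult pois_nonneg)
    thus "(\<Sum>m. \<integral>\<^sup>+\<omega>. ennreal (real m) * indicator {\<omega> \<in> space M. emeasure (N \<omega>) A = of_nat m} \<omega> \<partial>M) = (\<Sum>m. ennreal (real m * pois A m))"
      by simp
  qed
  also have "\<dots> < \<infinity>"
    using pois_mean_summable[of A] by (subst suminf_ennreal2) (auto simp: pois_nonneg)
  finally show "(\<integral>\<^sup>+\<omega>. ennreal (norm (count A \<omega>)) \<partial>M) < \<infinity>" .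
qed

end

section \<open>The Mecke formula\<close>

context finite_poisson
begin

text \<open>
  The integrands take finitely many values: the i-th one is \<open>c j i\<close> on the cell \<open>g = j\<close>. All integrals
  are linear functions G of the counts of these cells, and one more point in the cell j adds \<open>c j i\<close>
  to the i-th integral.
\<close>

lemma mecke_simple:
  fixes g :: "'a \<Rightarrow> nat" and c :: "nat \<Rightarrow> nat \<Rightarrow> real" and \<phi> :: "(nat \<Rightarrow> real) \<Rightarrow> real"
  assumes gm: "\<And>j. {\<xi> \<in> space \<Lambda>. g \<xi> = j} \<in> sets \<Lambda>" and gn: "\<And>\<xi>. \<xi> \<in> space \<Lambda> \<Longrightarrow> g \<xi> < n"
    and \<phi>[measurable]: "\<phi> \<in> borel_measurable borel" and C: "\<And>v. \<bar>\<phi> v\<bar> \<le> C"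
  shows "expectation (\<lambda>\<omega>. (\<integral>\<xi>. c (g \<xi>) i0 \<partial>N \<omega>) * \<phi> (\<lambda>i. \<integral>\<xi>. c (g \<xi>) i \<partial>N \<omega>)) =
     (\<integral>\<xi>. c (g \<xi>) i0 * expectation (\<lambda>\<omega>. \<phi> (\<lambda>i. (\<integral>\<xi>. c (g \<xi>) i \<partial>N \<omega>) + c (g \<xi>) i)) \<partial>\<Lambda>)"
proof -
  define A where "A = (\<lambda>j. {\<xi> \<in> space \<Lambda>. g \<xi> = j})"
  have A: "A j \<in> sets \<Lambda>" for j unfolding A_def by (rule gm)
  have disj: "disjoint_family_on A {..<n}" by (auto simp: A_def disjoint_family_on_def)
  have decomp: "h (g \<xi>) = (\<Sum>j<n. h j * indicator (A j) \<xi>)" if "\<xi> \<in> space \<Lambda>" for h :: "nat \<Rightarrow> real" and \<xi>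
  proof -
    have "(\<Sum>j<n. h j * indicator (A j) \<xi>) = (\<Sum>j<n. if j = g \<xi> then h j else 0)"
      using that by (intro sum.cong) (auto simp: A_def indicator_def)
    thus ?thesis using gn[OF that] by simp
  qed
  define G where "G = (\<lambda>v i. \<Sum>j<n. c j i * v j :: real)"
  have Gm: "G \<in> borel_measurable borel"
    unfolding G_def by (intro measurable_fun_space borel_measurable_sum borel_measurable_times borel_measurable_const measurable_fun_apply)
  note Cm = cells_measurable[of n A, OF A]
  have cjm: "(\<lambda>\<omega>. cells n A \<omega> j) \<in> borel_measurable M" for j
    using Cm by (rule measurable_product_then_coordinatewise)
  have \<phi>Gm: "(\<lambda>v. \<phi> (G v)) \<in> borel_measurable borel" by (rule measurable_compose[OF Gm \<phi>])
  have \<phi>GC: "(\<lambda>\<omega>. \<phi> (G (cells n A \<omega>))) \<in> borel_measurable M" by (rule measurable_compose[OF Cm \<phi>Gm])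
  have XG: "AE \<omega> in M. (\<lambda>i. \<integral>\<xi>. c (g \<xi>) i \<partial>N \<omega>) = G (cells n A \<omega>)"
    using N_finite_AE[OF sets.top] AE_space
  proof eventually_elim
    case (elim \<omega>)
    have fin: "emeasure (N \<omega>) (A j) < \<infinity>" for j
    proof -
      have "emeasure (N \<omega>) (A j) \<le> emeasure (N \<omega>) (space \<Lambda>)"
        using elim by (intro emeasure_mono) (auto simp: sets_N A_def)
      also have "\<dots> < \<infinity>" using elim by (simp add: top.not_eq_extremum)
      finally show ?thesis .
    qed
    show ?case
    proof
      fix i
      have "(\<integral>\<xi>. c (g \<xi>) i \<partial>N \<omega>) = (\<integral>\<xi>. (\<Sum>j<n. c j i * indicator (A j) \<xi>) \<partial>N \<omega>)"
        using decomp[of _ "\<lambda>j. c j i"] elim by (intro Bochner_Integration.integral_cong) (auto simp: space_N)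
      also have "\<dots> = (\<Sum>j<n. c j i * measure (N \<omega>) (A j))"
      proof (subst Bochner_Integration.integral_sum)
        have AN: "A j \<in> sets (N \<omega>)" for j using A elim by (simp add: sets_N)
        show "integrable (N \<omega>) (\<lambda>\<xi>. c j i * indicator (A j) \<xi>)" for j
          by (intro integrable_mult_right integrable_real_indicator AN fin)
        show "(\<Sum>j<n. \<integral>\<xi>. c j i * indicator (A j) \<xi> \<partial>N \<omega>) = (\<Sum>j<n. c j i * measure (N \<omega>) (A j))"
          using AN by (simp add: sets.Int_space_eq2)
      qed
      also have "\<dots> = G (cells n A \<omega>) i"
        by (simp add: G_def cells_def count_def measure_def)
      finally show "(\<integral>\<xi>. c (g \<xi>) i \<partial>N \<omega>) = G (cells n A \<omega>) i" .
    qed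
  qed
  define h where "h = (\<lambda>j. expectation (\<lambda>\<omega>. \<phi> (\<lambda>i. G (cells n A \<omega>) i + c j i)))"
  have cm: "(\<lambda>\<xi>. c (g \<xi>) i) \<in> borel_measurable \<Lambda>" for i
  proof -
    have "(\<lambda>\<xi>. \<Sum>j<n. c j i * indicator (A j) \<xi>) \<in> borel_measurable \<Lambda>" using A by measurable
    thus ?thesis using decomp[of _ "\<lambda>j. c j i"] by (subst measurable_cong) auto
  qed
  have Xm: "(\<lambda>\<omega>. \<integral>\<xi>. c (g \<xi>) i \<partial>N \<omega>) \<in> borel_measurable M" for i by (rule integral_N_measurable[OF cm])
  have Xv: "(\<lambda>\<omega> i. (\<integral>\<xi>. c (g \<xi>) i \<partial>N \<omega>) + b i) \<in> borel_measurable M" for b :: "nat \<Rightarrow> real"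
    by (intro measurable_coordinatewise_then_product borel_measurable_add Xm borel_measurable_const)
  have Gb: "(\<lambda>\<omega> i. G (cells n A \<omega>) i + b i) \<in> borel_measurable M" for b :: "nat \<Rightarrow> real"
    by (intro measurable_coordinatewise_then_product borel_measurable_add borel_measurable_const
         measurable_product_then_coordinatewise[OF measurable_compose[OF Cm Gm]])
  have "expectation (\<lambda>\<omega>. (\<integral>\<xi>. c (g \<xi>) i0 \<partial>N \<omega>) * \<phi> (\<lambda>i. \<integral>\<xi>. c (g \<xi>) i \<partial>N \<omega>)) =
      expectation (\<lambda>\<omega>. G (cells n A \<omega>) i0 * \<phi> (G (cells n A \<omega>)))"
  proof (rule integral_cong_AE)
    show "AE \<omega> in M. (\<integral>\<xi>. c (g \<xi>) i0 \<partial>N \<omega>) * \<phi> (\<lambda>i. \<integral>\<xi>. c (g \<xi>) i \<partial>N \<omega>) = G (cells n A \<omega>) i0 * \<phi> (G (cells n A \<omega>))"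
      using XG
    proof eventually_elim
      case (elim \<omega>)
      have "(\<integral>\<xi>. c (g \<xi>) i0 \<partial>N \<omega>) = G (cells n A \<omega>) i0" using fun_cong[OF elim, of i0] .
      thus ?case by (simp only: elim)
    qed
    show "(\<lambda>\<omega>. (\<integral>\<xi>. c (g \<xi>) i0 \<partial>N \<omega>) * \<phi> (\<lambda>i. \<integral>\<xi>. c (g \<xi>) i \<partial>N \<omega>)) \<in> borel_measurable M"
      using Xm[of i0] measurable_compose[OF Xv[of "\<lambda>_. 0"] \<phi>] by simp
    show "(\<lambda>\<omega>. G (cells n A \<omega>) i0 * \<phi> (G (cells n A \<omega>))) \<in> borel_measurable M"
      using measurable_product_then_coordinatewise[OF measurable_compose[OF Cm Gm], of i0] \<phi>GC by simp
  qed
  also have "\<dots> = expectation (\<lambda>\<omega>. \<Sum>j<n. c j i0 * (cells n A \<omega> j * \<phi> (G (cells n A \<omega>))))"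
    by (intro Bochner_Integration.integral_cong) (auto simp: G_def sum_distrib_right mult.assoc)
  also have "\<dots> = (\<Sum>j<n. c j i0 * expectation (\<lambda>\<omega>. cells n A \<omega> j * \<phi> (G (cells n A \<omega>))))"
  proof (subst Bochner_Integration.integral_sum)
    fix j assume "j \<in> {..<n}"
    have "integrable M (\<lambda>\<omega>. cells n A \<omega> j * \<phi> (G (cells n A \<omega>)))"
    proof (rule Bochner_Integration.integrable_bound)
      show "integrable M (\<lambda>\<omega>. C * count (A j) \<omega>)" by (intro integrable_mult_right count_integrable A)
      show "AE \<omega> in M. norm (cells n A \<omega> j * \<phi> (G (cells n A \<omega>))) \<le> norm (C * count (A j) \<omega>)"
      proof (rule AE_I2)
        fix \<omega>
        have "\<bar>\<phi> (G (cells n A \<omega>))\<bar> * \<bar>cells n A \<omega> j\<bar> \<le> C * \<bar>count (A j) \<omega>\<bar>"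
          using C order_trans[OF abs_ge_zero C] by (intro mult_mono) (auto simp: cells_def)
        thus "norm (cells n A \<omega> j * \<phi> (G (cells n A \<omega>))) \<le> norm (C * count (A j) \<omega>)"
          using order_trans[OF abs_ge_zero C] by (simp add: abs_mult mult.commute)
      qed
    qed (use \<phi>GC cjm in simp)
    thus "integrable M (\<lambda>\<omega>. c j i0 * (cells n A \<omega> j * \<phi> (G (cells n A \<omega>))))" by simp
  qed simp
  also have "\<dots> = (\<Sum>j<n. c j i0 * (measure \<Lambda> (A j) * h j))"
  proof (intro sum.cong refl)
    fix j assume j: "j \<in> {..<n}"
    have upd: "G ((cells n A \<omega>)(j := cells n A \<omega> j + 1)) = (\<lambda>i. G (cells n A \<omega>) i + c j i)" for \<omega>
    proof
      fix i
      have "G ((cells n A \<omega>)(j := cells n A \<omega> j + 1)) i = (\<Sum>l<n. c l i * cells n A \<omega> l + (if l = j then c j i else 0))"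
        unfolding G_def by (intro sum.cong) (auto simp: algebra_simps)
      thus "G ((cells n A \<omega>)(j := cells n A \<omega> j + 1)) i = G (cells n A \<omega>) i + c j i"
        using j by (simp add: sum.distrib G_def)
    qed
    show "c j i0 * expectation (\<lambda>\<omega>. cells n A \<omega> j * \<phi> (G (cells n A \<omega>))) = c j i0 * (measure \<Lambda> (A j) * h j)"
      using cell_mecke[OF A disj _ \<phi>Gm C, of j] j by (simp add: upd h_def)
  qed
  also have "\<dots> = (\<integral>\<xi>. (\<Sum>j<n. (c j i0 * h j) * indicator (A j) \<xi>) \<partial>\<Lambda>)"
  proof (subst Bochner_Integration.integral_sum)
    have "emeasure \<Lambda> (A j) < \<infinity>" for j
      unfolding infinity_ennreal_def less_top[symmetric] by (rule \<Lambda>.emeasure_finite)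
    thus "integrable \<Lambda> (\<lambda>\<xi>. c j i0 * h j * indicator (A j) \<xi>)" for j
      by (intro integrable_mult_right integrable_real_indicator A)
    show "(\<Sum>j<n. c j i0 * (measure \<Lambda> (A j) * h j)) = (\<Sum>j<n. \<integral>\<xi>. c j i0 * h j * indicator (A j) \<xi> \<partial>\<Lambda>)"
      using A by (simp add: sets.Int_space_eq2 mult_ac)
  qed
  also have "\<dots> = (\<integral>\<xi>. c (g \<xi>) i0 * h (g \<xi>) \<partial>\<Lambda>)"
    using decomp[of _ "\<lambda>j. c j i0 * h j"] by (intro Bochner_Integration.integral_cong) auto
  also have "\<dots> = (\<integral>\<xi>. c (g \<xi>) i0 * expectation (\<lambda>\<omega>. \<phi> (\<lambda>i. (\<integral>\<xi>. c (g \<xi>) i \<partial>N \<omega>) + c (g \<xi>) i)) \<partial>\<Lambda>)"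
  proof -
    have "h j = expectation (\<lambda>\<omega>. \<phi> (\<lambda>i. (\<integral>\<xi>. c (g \<xi>) i \<partial>N \<omega>) + c j i))" for j
      unfolding h_def
    proof (rule integral_cong_AE)
      show "AE \<omega> in M. \<phi> (\<lambda>i. G (cells n A \<omega>) i + c j i) = \<phi> (\<lambda>i. (\<integral>\<xi>. c (g \<xi>) i \<partial>N \<omega>) + c j i)"
        using XG
      proof eventually_elim
        case (elim \<omega>)
        have "(\<integral>\<xi>. c (g \<xi>) i \<partial>N \<omega>) = G (cells n A \<omega>) i" for i using fun_cong[OF elim, of i] .
        thus ?case by simp
      qed
    qed (use measurable_compose[OF Xv \<phi>] measurable_compose[OF Gb \<phi>] in auto)
    thus ?thesis by simp
  qed
  finally show ?thesis .
qed

text \<open>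
  Rounding d bounded functions down to multiples of 1/m leaves finitely many vectors of values;
  g numbers them.
\<close>

lemma finite_valued_approximation:
  fixes f :: "nat \<Rightarrow> 'a \<Rightarrow> real"
  assumes fm: "\<And>i. f i \<in> borel_measurable \<Lambda>" and K: "\<And>i \<xi>. \<xi> \<in> space \<Lambda> \<Longrightarrow> \<bar>f i \<xi>\<bar> \<le> K" and m: "m > 0"
  shows "\<exists>g n c. (\<forall>j. {\<xi> \<in> space \<Lambda>. g \<xi> = j} \<in> sets \<Lambda>) \<and> (\<forall>\<xi>\<in>space \<Lambda>. g \<xi> < (n :: nat)) \<and>
           (\<forall>\<xi>\<in>space \<Lambda>. \<forall>i<d. \<bar>(c :: nat \<Rightarrow> nat \<Rightarrow> real) (g \<xi>) i - f i \<xi>\<bar> \<le> 1 / real m)"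
proof -
  define \<tau> where "\<tau> = (\<lambda>\<xi>. \<lambda>i\<in>{..<d}. \<lfloor>real m * f i \<xi>\<rfloor>)"
  define T where "T = \<tau> ` space \<Lambda>"
  have "T \<subseteq> (\<Pi>\<^sub>E i\<in>{..<d}. {\<lfloor>- (real m * K)\<rfloor>..\<lfloor>real m * K\<rfloor>})"
  proof -
    have "\<lfloor>- (real m * K)\<rfloor> \<le> \<lfloor>real m * f i \<xi>\<rfloor> \<and> \<lfloor>real m * f i \<xi>\<rfloor> \<le> \<lfloor>real m * K\<rfloor>" if "\<xi> \<in> space \<Lambda>" for i \<xi>
    proof -
      have "- K \<le> f i \<xi>" "f i \<xi> \<le> K" using K[OF that, of i] by (auto simp: abs_le_iff)
      hence "real m * (- K) \<le> real m * f i \<xi>" "real m * f i \<xi> \<le> real m * K"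
        by (blast intro: mult_left_mono of_nat_0_le_iff)+
      hence "\<lfloor>real m * (- K)\<rfloor> \<le> \<lfloor>real m * f i \<xi>\<rfloor>" "\<lfloor>real m * f i \<xi>\<rfloor> \<le> \<lfloor>real m * K\<rfloor>"
        by (blast intro: floor_mono)+
      thus ?thesis by simp
    qed
    thus ?thesis unfolding T_def \<tau>_def by (intro image_subsetI PiE_I) auto
  qed
  hence finT: "finite T" by (rule finite_subset) (auto intro!: finite_PiE)
  then obtain h where h: "bij_betw h T {0..<card T}" using ex_bij_betw_finite_nat by blast
  define hi where "hi = the_inv_into T h"
  have hi: "hi (h t) = t" if "t \<in> T" for t
    unfolding hi_def using h that by (intro the_inv_into_f_f) (auto simp: bij_betw_def)
  define g where "g = (\<lambda>\<xi>. h (\<tau> \<xi>))"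
  define c where "c = (\<lambda>j i. real_of_int (hi j i) / real m)"
  have \<tau>T: "\<tau> \<xi> \<in> T" if "\<xi> \<in> space \<Lambda>" for \<xi> using that by (auto simp: T_def)
  have "{\<xi> \<in> space \<Lambda>. g \<xi> = j} \<in> sets \<Lambda>" for j
  proof (cases "j \<in> h ` T")
    case False
    hence "{\<xi> \<in> space \<Lambda>. g \<xi> = j} = {}" using \<tau>T by (auto simp: g_def)
    thus ?thesis by (simp only: sets.empty_sets)
  next
    case True
    then obtain t where t: "t \<in> T" "j = h t" by auto
    have "{\<xi> \<in> space \<Lambda>. g \<xi> = j} = {\<xi> \<in> space \<Lambda>. \<forall>i\<in>{..<d}. \<lfloor>real m * f i \<xi>\<rfloor> = t i}"
    proof -
      have "g \<xi> = j \<longleftrightarrow> (\<forall>i\<in>{..<d}. \<lfloor>real m * f i \<xi>\<rfloor> = t i)" if \<xi>: "\<xi> \<in> space \<Lambda>" for \<xi>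
      proof -
        have "g \<xi> = j \<longleftrightarrow> \<tau> \<xi> = t" unfolding g_def t(2) by (metis hi[OF \<tau>T[OF \<xi>]] hi[OF t(1)])
        also have "\<dots> \<longleftrightarrow> (\<forall>i\<in>{..<d}. \<lfloor>real m * f i \<xi>\<rfloor> = t i)"
        proof -
          have "t \<in> extensional {..<d}" using t(1) by (auto simp: T_def \<tau>_def)
          thus ?thesis by (auto simp: \<tau>_def fun_eq_iff extensional_def)
        qed
        finally show ?thesis .
      qed
      thus ?thesis by blast
    qed
    also have "\<dots> \<in> sets \<Lambda>"
    proof (intro sets.sets_Collect_finite_All)
      fix i
      have "(\<lambda>\<xi>. real_of_int \<lfloor>real m * f i \<xi>\<rfloor>) \<in> borel_measurable \<Lambda>" using fm[of i] by measurable
      hence "{\<xi> \<in> space \<Lambda>. real_of_int \<lfloor>real m * f i \<xi>\<rfloor> = real_of_int (t i)} \<in> sets \<Lambda>" by measurable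
      thus "{\<xi> \<in> space \<Lambda>. \<lfloor>real m * f i \<xi>\<rfloor> = t i} \<in> sets \<Lambda>" by simp
    qed simp
    finally show ?thesis .
  qed
  moreover have "g \<xi> < card T" if "\<xi> \<in> space \<Lambda>" for \<xi> using bij_betwE[OF h] \<tau>T[OF that] by (auto simp: g_def)
  moreover have "\<bar>c (g \<xi>) i - f i \<xi>\<bar> \<le> 1 / real m" if "\<xi> \<in> space \<Lambda>" "i < d" for \<xi> i
  proof -
    have "c (g \<xi>) i = real_of_int \<lfloor>real m * f i \<xi>\<rfloor> / real m"
      using hi[OF \<tau>T[OF that(1)]] that(2) by (simp add: c_def g_def \<tau>_def)
    hence "c (g \<xi>) i - f i \<xi> = (real_of_int \<lfloor>real m * f i \<xi>\<rfloor> - real m * f i \<xi>) / real m" using m by (simp add: field_simps)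
    moreover have "\<bar>real_of_int \<lfloor>real m * f i \<xi>\<rfloor> - real m * f i \<xi>\<bar> \<le> 1" by linarith
    ultimately show ?thesis using m by (simp add: abs_divide divide_right_mono)
  qed
  ultimately show ?thesis by blast
qed

text \<open>
  Weighting by the integral of \<open>f i0\<close> amounts to adding one point according to the intensity measure
  weighted by \<open>f i0\<close>. The case
  of finitely many values passes to the limit by dominated convergence, with the total number of
  points as majorant. The Lipschitz condition makes \<open>\<phi>\<close> continuous in the first d coordinates, in
  which the approximation takes place.
\<close>

theorem mecke:
  fixes f :: "nat \<Rightarrow> 'a \<Rightarrow> real" and \<phi> :: "(nat \<Rightarrow> real) \<Rightarrow> real"
  assumes fm: "\<And>i. f i \<in> borel_measurable \<Lambda>" and K: "\<And>i \<xi>. \<xi> \<in> space \<Lambda> \<Longrightarrow> \<bar>f i \<xi>\<bar> \<le> K"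
    and \<phi>: "\<phi> \<in> borel_measurable borel" and C: "\<And>v. \<bar>\<phi> v\<bar> \<le> C"
    and lip: "\<And>x y. \<bar>\<phi> x - \<phi> y\<bar> \<le> B * (\<Sum>i<d. \<bar>x i - y i\<bar>)" and i0: "i0 < d"
  shows "expectation (\<lambda>\<omega>. (\<integral>\<xi>. f i0 \<xi> \<partial>N \<omega>) * \<phi> (\<lambda>i. \<integral>\<xi>. f i \<xi> \<partial>N \<omega>)) =
     (\<integral>\<xi>. f i0 \<xi> * expectation (\<lambda>\<omega>. \<phi> (\<lambda>i. (\<integral>\<xi>. f i \<xi> \<partial>N \<omega>) + f i \<xi>)) \<partial>\<Lambda>)"
proof -
  define Q where "Q = (\<lambda>m (g :: 'a \<Rightarrow> nat) n (c :: nat \<Rightarrow> nat \<Rightarrow> real). (\<forall>j. {\<xi> \<in> space \<Lambda>. g \<xi> = j} \<in> sets \<Lambda>) \<and> (\<forall>\<xi>\<in>space \<Lambda>. g \<xi> < (n :: nat)) \<and>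
           (\<forall>\<xi>\<in>space \<Lambda>. \<forall>i<d. \<bar>c (g \<xi>) i - f i \<xi>\<bar> \<le> 1 / real (Suc m)))"
  have "\<exists>g n c. Q m g n c" for m
    unfolding Q_def by (rule finite_valued_approximation[OF fm K]) simp_all
  then obtain g n c where Q: "\<And>m. Q m (g m) (n m) (c m)" by metis
  have gm: "\<And>m j. {\<xi> \<in> space \<Lambda>. g m \<xi> = j} \<in> sets \<Lambda>"
    and gn: "\<And>m \<xi>. \<xi> \<in> space \<Lambda> \<Longrightarrow> g m \<xi> < (n m :: nat)"
    and gc: "\<And>m \<xi> i. \<xi> \<in> space \<Lambda> \<Longrightarrow> i < d \<Longrightarrow> \<bar>(c m :: nat \<Rightarrow> nat \<Rightarrow> real) (g m \<xi>) i - f i \<xi>\<bar> \<le> 1 / real (Suc m)"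
    using Q unfolding Q_def by blast+
  define s where "s = (\<lambda>m i \<xi>. c m (g m \<xi>) i)"
  have C0: "C \<ge> 0" using C[of undefined] by linarith
  have lim1: "(\<lambda>m. 1 / real (Suc m)) \<longlonglongrightarrow> 0" by (rule LIMSEQ_Suc[OF lim_inverse_n'])
  have gcount: "g m \<in> measurable \<Lambda> (count_space UNIV)" for m
  proof (rule measurableI)
    fix A :: "nat set"
    have "g m -` A \<inter> space \<Lambda> = (\<Union>j\<in>A. {\<xi> \<in> space \<Lambda>. g m \<xi> = j})" by auto
    thus "g m -` A \<inter> space \<Lambda> \<in> sets \<Lambda>" using gm by (simp add: sets.countable_UN'')
  qed simp
  have hg: "(\<lambda>\<xi>. h (g m \<xi>)) \<in> borel_measurable \<Lambda>" for m and h :: "nat \<Rightarrow> real"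
    by (rule measurable_compose[OF gcount]) simp
  have sm: "s m i \<in> borel_measurable \<Lambda>" for m i unfolding s_def by (rule hg)
  define X where "X = (\<lambda>\<omega> i. \<integral>\<xi>. f i \<xi> \<partial>N \<omega>)"
  define Y where "Y = (\<lambda>m \<omega> i. \<integral>\<xi>. s m i \<xi> \<partial>N \<omega>)"
  have Xm: "(\<lambda>\<omega>. X \<omega> i) \<in> borel_measurable M" for i unfolding X_def by (rule integral_N_measurable[OF fm])
  have Ym: "(\<lambda>\<omega>. Y m \<omega> i) \<in> borel_measurable M" for m i unfolding Y_def by (rule integral_N_measurable[OF sm])
  have \<phi>X: "(\<lambda>\<omega>. \<phi> (\<lambda>i. X \<omega> i + b i)) \<in> borel_measurable M" for b
    by (intro measurable_compose[OF _ \<phi>] measurable_fun_space borel_measurable_add Xm borel_measurable_const)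
  have \<phi>Y: "(\<lambda>\<omega>. \<phi> (\<lambda>i. Y m \<omega> i + b i)) \<in> borel_measurable M" for m b
    by (intro measurable_compose[OF _ \<phi>] measurable_fun_space borel_measurable_add Ym borel_measurable_const)
  have \<phi>lim: "(\<lambda>m. \<phi> (x m)) \<longlonglongrightarrow> \<phi> y" if "\<And>i. i < d \<Longrightarrow> (\<lambda>m. x m i) \<longlonglongrightarrow> y i" for x y
  proof -
    have "(\<lambda>m. B * (\<Sum>i<d. \<bar>x m i - y i\<bar>)) \<longlonglongrightarrow> B * (\<Sum>i<d. 0)"
    proof (intro tendsto_mult tendsto_const tendsto_sum)
      fix i assume "i \<in> {..<d}"
      hence "(\<lambda>m. x m i) \<longlonglongrightarrow> y i" using that by simp
      thus "(\<lambda>m. \<bar>x m i - y i\<bar>) \<longlonglongrightarrow> 0" by (intro tendsto_rabs_zero LIM_zero)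
    qed
    hence lim0: "(\<lambda>m. B * (\<Sum>i<d. \<bar>x m i - y i\<bar>)) \<longlonglongrightarrow> 0" by simp
    have "\<forall>m. norm (\<phi> (x m) - \<phi> y) \<le> B * (\<Sum>i<d. \<bar>x m i - y i\<bar>)" using lip by simp
    hence "(\<lambda>m. \<phi> (x m) - \<phi> y) \<longlonglongrightarrow> 0"
      by (rule Lim_null_comparison[OF always_eventually lim0])
    thus ?thesis by (rule LIM_zero_cancel)
  qed
  have slim: "(\<lambda>m. s m i \<xi>) \<longlonglongrightarrow> f i \<xi>" if "\<xi> \<in> space \<Lambda>" "i < d" for \<xi> i
  proof -
    have "(\<lambda>m. s m i \<xi> - f i \<xi>) \<longlonglongrightarrow> 0"
    proof (rule Lim_null_comparison[OF always_eventually lim1])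
      show "\<forall>m. norm (s m i \<xi> - f i \<xi>) \<le> 1 / real (Suc m)" using gc[OF that] by (simp add: s_def)
    qed
    thus ?thesis by (rule LIM_zero_cancel)
  qed
  have sb: "\<bar>s m i \<xi>\<bar> \<le> K + 1" if "\<xi> \<in> space \<Lambda>" "i < d" for m i \<xi>
  proof -
    have "1 / real (Suc m) \<le> 1" by simp
    thus ?thesis using gc[OF that, of m] K[OF that(1), of i] unfolding s_def by linarith
  qed
  have Nfin: "AE \<omega> in M. emeasure (N \<omega>) (space \<Lambda>) \<noteq> \<infinity>" by (rule N_finite_AE) simp
  have Ylim: "(\<lambda>m. Y m \<omega> i) \<longlonglongrightarrow> X \<omega> i" and Yb: "\<bar>Y m \<omega> i\<bar> \<le> (K + 1) * count (space \<Lambda>) \<omega>"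
    if \<omega>: "\<omega> \<in> space M" "emeasure (N \<omega>) (space \<Lambda>) \<noteq> \<infinity>" and i: "i < d" for \<omega> i m
  proof -
    interpret N\<omega>: finite_measure "N \<omega>" by standard (use \<omega> in \<open>simp add: space_N\<close>)
    have mN: "h \<in> borel_measurable \<Lambda> \<Longrightarrow> h \<in> borel_measurable (N \<omega>)" for h :: "'a \<Rightarrow> real"
      using \<omega> by (simp cong: measurable_cong_sets add: sets_N)
    have "K + 1 \<ge> 0 \<or> space \<Lambda> = {}" using K[of _ 0] by (metis abs_ge_zero add_nonneg_nonneg all_not_in_conv order_trans zero_le_one)
    show "(\<lambda>m. Y m \<omega> i) \<longlonglongrightarrow> X \<omega> i"
      unfolding X_def Y_def
      by (rule integral_dominated_convergence[where w = "\<lambda>_. K + 1"])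
         (use slim sb i \<omega> in \<open>auto intro!: AE_I2 mN fm sm simp: space_N\<close>)
    have "\<bar>Y m \<omega> i\<bar> \<le> (\<integral>\<xi>. \<bar>s m i \<xi>\<bar> \<partial>N \<omega>)" unfolding Y_def by (rule integral_abs_bound)
    also have "\<dots> \<le> (\<integral>\<xi>. K + 1 \<partial>N \<omega>)"
    proof (rule integral_mono)
      show "integrable (N \<omega>) (\<lambda>\<xi>. \<bar>s m i \<xi>\<bar>)"
        using sb i \<omega> mN[OF sm[of m i]] by (intro integrable_abs N\<omega>.integrable_const_bound[of _ "K + 1"]) (auto intro!: AE_I2 simp: space_N)
    qed (use sb i \<omega> in \<open>auto simp: space_N\<close>)
    also have "\<dots> = (K + 1) * count (space \<Lambda>) \<omega>" using \<omega> by (simp add: count_def measure_def space_N)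
    finally show "\<bar>Y m \<omega> i\<bar> \<le> (K + 1) * count (space \<Lambda>) \<omega>" .
  qed
  define \<Psi> where "\<Psi> = (\<lambda>\<xi>. expectation (\<lambda>\<omega>. \<phi> (\<lambda>i. X \<omega> i + f i \<xi>)))"
  define \<Psi>' where "\<Psi>' = (\<lambda>m \<xi>. expectation (\<lambda>\<omega>. \<phi> (\<lambda>i. Y m \<omega> i + s m i \<xi>)))"
  have \<Psi>'b: "\<bar>\<Psi>' m \<xi>\<bar> \<le> C" for m \<xi>
  proof -
    have "\<bar>\<Psi>' m \<xi>\<bar> \<le> expectation (\<lambda>\<omega>. \<bar>\<phi> (\<lambda>i. Y m \<omega> i + s m i \<xi>)\<bar>)" unfolding \<Psi>'_def by (rule integral_abs_bound)
    also have "\<dots> \<le> expectation (\<lambda>_. C)"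
    proof (rule integral_mono)
      have "integrable M (\<lambda>\<omega>. \<phi> (\<lambda>i. Y m \<omega> i + s m i \<xi>))"
        by (rule integrable_const_bound[of _ C]) (use C \<phi>Y[of m "\<lambda>i. s m i \<xi>"] in auto)
      thus "integrable M (\<lambda>\<omega>. \<bar>\<phi> (\<lambda>i. Y m \<omega> i + s m i \<xi>)\<bar>)" by (rule integrable_abs)
    qed (use C in auto)
    finally show ?thesis by (simp add: prob_space)
  qed
  have \<Psi>lim: "(\<lambda>m. \<Psi>' m \<xi>) \<longlonglongrightarrow> \<Psi> \<xi>" if \<xi>: "\<xi> \<in> space \<Lambda>" for \<xi>
    unfolding \<Psi>_def \<Psi>'_def
  proof (rule integral_dominated_convergence[where w = "\<lambda>_. C"])
    show "AE \<omega> in M. (\<lambda>m. \<phi> (\<lambda>i. Y m \<omega> i + s m i \<xi>)) \<longlonglongrightarrow> \<phi> (\<lambda>i. X \<omega> i + f i \<xi>)"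
      using Nfin AE_space by eventually_elim (intro \<phi>lim tendsto_add Ylim slim \<xi>; simp)
    show "(\<lambda>\<omega>. \<phi> (\<lambda>i. X \<omega> i + f i \<xi>)) \<in> borel_measurable M" by (rule \<phi>X)
    show "(\<lambda>\<omega>. \<phi> (\<lambda>i. Y m \<omega> i + s m i \<xi>)) \<in> borel_measurable M" for m by (rule \<phi>Y)
  qed (use C in auto)
  have \<Psi>'m: "\<Psi>' m \<in> borel_measurable \<Lambda>" for m
    unfolding \<Psi>'_def s_def using hg[of "\<lambda>j. expectation (\<lambda>\<omega>. \<phi> (\<lambda>i. Y m \<omega> i + c m j i))" m] by simp
  have \<Psi>m: "\<Psi> \<in> borel_measurable \<Lambda>" by (rule borel_measurable_LIMSEQ_real[OF \<Psi>lim \<Psi>'m])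
  have L: "(\<lambda>m. expectation (\<lambda>\<omega>. Y m \<omega> i0 * \<phi> (Y m \<omega>))) \<longlonglongrightarrow> expectation (\<lambda>\<omega>. X \<omega> i0 * \<phi> (X \<omega>))"
  proof (rule integral_dominated_convergence[where w = "\<lambda>\<omega>. (K + 1) * count (space \<Lambda>) \<omega> * C"])
    show "AE \<omega> in M. (\<lambda>m. Y m \<omega> i0 * \<phi> (Y m \<omega>)) \<longlonglongrightarrow> X \<omega> i0 * \<phi> (X \<omega>)"
      using Nfin AE_space by eventually_elim (intro \<phi>lim tendsto_mult Ylim i0; simp)
    show "AE \<omega> in M. norm (Y m \<omega> i0 * \<phi> (Y m \<omega>)) \<le> (K + 1) * count (space \<Lambda>) \<omega> * C" for m
      using Nfin AE_space
    proof eventually_elim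
      case (elim \<omega>)
      from Yb[OF elim(2,1) i0, of m] C[of "Y m \<omega>"] show ?case
        unfolding real_norm_def abs_mult by (intro mult_mono) auto
    qed
    show "integrable M (\<lambda>\<omega>. (K + 1) * count (space \<Lambda>) \<omega> * C)"
      using count_integrable[of "space \<Lambda>"] by simp
    show "(\<lambda>\<omega>. X \<omega> i0 * \<phi> (X \<omega>)) \<in> borel_measurable M" using \<phi>X[of "\<lambda>_. 0"] Xm[of i0] by simp
    show "(\<lambda>\<omega>. Y m \<omega> i0 * \<phi> (Y m \<omega>)) \<in> borel_measurable M" for m using \<phi>Y[of m "\<lambda>_. 0"] Ym[of m i0] by simp
  qed
  have R: "(\<lambda>m. \<integral>\<xi>. s m i0 \<xi> * \<Psi>' m \<xi> \<partial>\<Lambda>) \<longlonglongrightarrow> (\<integral>\<xi>. f i0 \<xi> * \<Psi> \<xi> \<partial>\<Lambda>)"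
  proof (rule integral_dominated_convergence[where w = "\<lambda>_. (K + 1) * C"])
    show "AE \<xi> in \<Lambda>. (\<lambda>m. s m i0 \<xi> * \<Psi>' m \<xi>) \<longlonglongrightarrow> f i0 \<xi> * \<Psi> \<xi>"
      by (intro AE_I2 tendsto_mult slim \<Psi>lim i0)
    show "AE \<xi> in \<Lambda>. norm (s m i0 \<xi> * \<Psi>' m \<xi>) \<le> (K + 1) * C" for m
      unfolding real_norm_def abs_mult using sb[OF _ i0, of _ m] \<Psi>'b[of m]
      by (intro AE_I2 mult_mono) (auto intro: order_trans[OF abs_ge_zero])
    show "(\<lambda>\<xi>. f i0 \<xi> * \<Psi> \<xi>) \<in> borel_measurable \<Lambda>" using fm \<Psi>m by simp
    show "(\<lambda>\<xi>. s m i0 \<xi> * \<Psi>' m \<xi>) \<in> borel_measurable \<Lambda>" for m using sm \<Psi>'m by simp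
  qed simp
  have "expectation (\<lambda>\<omega>. Y m \<omega> i0 * \<phi> (Y m \<omega>)) = (\<integral>\<xi>. s m i0 \<xi> * \<Psi>' m \<xi> \<partial>\<Lambda>)" for m
    unfolding Y_def s_def \<Psi>'_def by (rule mecke_simple[OF gm gn \<phi> C])
  with L R have "expectation (\<lambda>\<omega>. X \<omega> i0 * \<phi> (X \<omega>)) = (\<integral>\<xi>. f i0 \<xi> * \<Psi> \<xi> \<partial>\<Lambda>)"
    using LIMSEQ_unique by simp
  thus ?thesis by (simp add: X_def \<Psi>_def)
qed

end

section \<open>Interpolation between a Poisson functional and a Gaussian vector\<close>

lemma lipschitz_continuous_fun:
  fixes \<phi> :: "(nat \<Rightarrow> real) \<Rightarrow> real"
  assumes "\<And>x y. \<bar>\<phi> x - \<phi> y\<bar> \<le> B * (\<Sum>i<d. \<bar>x i - y i\<bar>)"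
  shows "continuous_on UNIV \<phi>"
  unfolding continuous_on_def
proof
  fix x :: "nat \<Rightarrow> real"
  have "((\<lambda>y. B * (\<Sum>i<d. \<bar>y i - x i\<bar>)) \<longlongrightarrow> B * (\<Sum>i<d. 0)) (at x)"
  proof (intro tendsto_mult tendsto_const tendsto_sum)
    fix i
    have "((\<lambda>y. y i) \<longlongrightarrow> x i) (at x)"
      using tendsto_fun_iff[of "\<lambda>y. y" x "at x"] by simp
    thus "((\<lambda>y. \<bar>y i - x i\<bar>) \<longlongrightarrow> 0) (at x)" by (intro tendsto_rabs_zero LIM_zero)
  qed
  hence lim0: "((\<lambda>y. B * (\<Sum>i<d. \<bar>y i - x i\<bar>)) \<longlongrightarrow> 0) (at x)" by simp
  have "\<forall>y. norm (\<phi> y - \<phi> x) \<le> B * (\<Sum>i<d. \<bar>y i - x i\<bar>)" using assms by simp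
  hence "((\<lambda>y. \<phi> y - \<phi> x) \<longlongrightarrow> 0) (at x)" by (rule Lim_null_comparison[OF always_eventually lim0])
  thus "(\<phi> \<longlongrightarrow> \<phi> x) (at x within UNIV)" by (simp add: LIM_zero_iff)
qed

lemma second_order_bound:
  fixes Q Q' Q'' :: "real \<Rightarrow> real"
  assumes d1: "\<And>t. (Q has_real_derivative Q' t) (at t)" and d2: "\<And>t. (Q' has_real_derivative Q'' t) (at t)"
    and B: "\<And>t. \<bar>Q'' t\<bar> \<le> B" and s: "s \<ge> 0"
  shows "\<bar>Q s - Q 0 - s * Q' 0\<bar> \<le> s\<^sup>2 * B"
proof -
  have 1: "\<bar>Q' t - Q' 0\<bar> \<le> B * s" if "0 \<le> t" "t \<le> s" for t
  proof -
    have "\<bar>Q' t - Q' 0\<bar> \<le> B * \<bar>t\<bar>" using field_differentiable_bound[of UNIV Q' Q'' B t 0] d2 B by auto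
    also have "\<dots> \<le> B * s" using that order_trans[OF abs_ge_zero B] by (intro mult_left_mono) auto
    finally show ?thesis .
  qed
  have "norm ((Q s - s * Q' 0) - (Q 0 - 0 * Q' 0)) \<le> (B * s) * norm (s - 0)"
  proof (rule field_differentiable_bound[of "{0..s}" "\<lambda>t. Q t - t * Q' 0" "\<lambda>t. Q' t - Q' 0"])
    show "((\<lambda>t. Q t - t * Q' 0) has_real_derivative Q' t - Q' 0) (at t within {0..s})" for t
      by (rule DERIV_subset[OF _ subset_UNIV]) (auto intro!: derivative_eq_intros d1)
  qed (use 1 s in auto)
  thus ?thesis using s by (simp add: power2_eq_square algebra_simps)
qed

lemma (in finite_poisson) integral_N_integrable:
  fixes f :: "'a \<Rightarrow> real"
  assumes fm: "f \<in> borel_measurable \<Lambda>" and K: "\<And>\<xi>. \<xi> \<in> space \<Lambda> \<Longrightarrow> \<bar>f \<xi>\<bar> \<le> K"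
  shows "integrable M (\<lambda>\<omega>. \<integral>\<xi>. f \<xi> \<partial>N \<omega>)"
proof (rule Bochner_Integration.integrable_bound)
  show "integrable M (\<lambda>\<omega>. K * count (space \<Lambda>) \<omega>)" by (intro integrable_mult_right count_integrable) simp
  show "(\<lambda>\<omega>. \<integral>\<xi>. f \<xi> \<partial>N \<omega>) \<in> borel_measurable M" by (rule integral_N_measurable[OF fm])
  show "AE \<omega> in M. norm (\<integral>\<xi>. f \<xi> \<partial>N \<omega>) \<le> norm (K * count (space \<Lambda>) \<omega>)"
    using N_finite_AE[OF sets.top] AE_space
  proof eventually_elim
    case (elim \<omega>)
    interpret N\<omega>: finite_measure "N \<omega>" by standard (use elim in \<open>simp add: space_N\<close>)
    have mN: "f \<in> borel_measurable (N \<omega>)" using fm elim by (simp cong: measurable_cong_sets add: sets_N)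
    have "\<bar>\<integral>\<xi>. f \<xi> \<partial>N \<omega>\<bar> \<le> (\<integral>\<xi>. \<bar>f \<xi>\<bar> \<partial>N \<omega>)" by (rule integral_abs_bound)
    also have "\<dots> \<le> (\<integral>\<xi>. K \<partial>N \<omega>)"
    proof (rule integral_mono)
      show "integrable (N \<omega>) (\<lambda>\<xi>. \<bar>f \<xi>\<bar>)"
        using K mN elim by (intro integrable_abs N\<omega>.integrable_const_bound[of _ K]) (auto intro!: AE_I2 simp: space_N)
    qed (use K elim in \<open>auto simp: space_N\<close>)
    also have "\<dots> = K * count (space \<Lambda>) \<omega>" using elim by (simp add: count_def measure_def space_N)
    finally show ?case by (simp add: order_trans[OF _ abs_ge_self])
  qed
qed

lemma C1_on_measurable: "C1_on d F F' \<Longrightarrow> F \<in> borel_measurable borel"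
  by (auto simp: C1_on_def intro: borel_measurable_continuous_onI)

lemma C1_on_affine:
  assumes F: "C1_on d F F'"
  shows "C1_on d (\<lambda>z. F (\<lambda>l. y l + c * z l)) (\<lambda>j z. c * F' j (\<lambda>l. y l + c * z l))"
  unfolding C1_on_def
proof (intro conjI allI impI)
  fix x z :: "nat \<Rightarrow> real" assume "\<forall>i<d. x i = z i"
  thus "F (\<lambda>l. y l + c * x l) = F (\<lambda>l. y l + c * z l)" using F unfolding C1_on_def by auto
next
  have tc: "continuous_on UNIV (\<lambda>z :: nat \<Rightarrow> real. \<lambda>l. y l + c * z l)"
    by (intro continuous_on_coordinatewise_then_product continuous_intros continuous_on_product_coordinates)
  show "continuous_on UNIV (\<lambda>z. F (\<lambda>l. y l + c * z l))"
    using F by (intro continuous_on_compose2[OF _ tc, of UNIV]) (auto simp: C1_on_def)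
  fix j assume j: "j < d"
  show "continuous_on UNIV (\<lambda>z. c * F' j (\<lambda>l. y l + c * z l))"
    using F j by (intro continuous_intros continuous_on_compose2[OF _ tc, of UNIV]) (auto simp: C1_on_def)
  fix x :: "nat \<Rightarrow> real"
  have "((\<lambda>s. F (\<lambda>l. y l + c * (x(j := s)) l)) has_real_derivative (\<Sum>i<d. (if i = j then c else 0) * F' i (\<lambda>l. y l + c * (x(j := x j)) l))) (at (x j))"
    by (rule C1_on_chain[OF F]) (auto intro!: derivative_eq_intros)
  moreover have "(\<Sum>i<d. (if i = j then c else 0) * F' i z) = c * F' j z" for z
  proof -
    have "(\<Sum>i<d. (if i = j then c else 0) * F' i z) = (\<Sum>i<d. if i = j then c * F' j z else 0)"
      by (intro sum.cong) auto
    thus ?thesis using j by simp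
  qed
  ultimately show "((\<lambda>s. F (\<lambda>l. y l + c * (x(j := s)) l)) has_real_derivative c * F' j (\<lambda>l. y l + c * x l)) (at (x j))"
    by simp
qed

text \<open>
  The vector X of the integrals of the weights w with respect to N is compared with Z through a test function H
  with derivatives H1, H2, H3. Because of \<open>w_mean\<close> and \<open>w_cov\<close> both vectors are centred with
  covariance matrix S.
\<close>

locale comparison = pois: finite_poisson M \<Lambda> N + gauss: gaussian_vector P d S Z
  for M :: "'w measure" and \<Lambda> :: "'a measure" and N :: "'w \<Rightarrow> 'a measure"
    and P :: "'v measure" and d :: nat and S :: "nat \<Rightarrow> nat \<Rightarrow> real" and Z :: "nat \<Rightarrow> 'v \<Rightarrow> real" +
  fixes w :: "nat \<Rightarrow> 'a \<Rightarrow> real" and K :: real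
    and H :: "(nat \<Rightarrow> real) \<Rightarrow> real" and H1 :: "nat \<Rightarrow> (nat \<Rightarrow> real) \<Rightarrow> real"
    and H2 :: "nat \<Rightarrow> nat \<Rightarrow> (nat \<Rightarrow> real) \<Rightarrow> real" and H3 :: "nat \<Rightarrow> nat \<Rightarrow> nat \<Rightarrow> (nat \<Rightarrow> real) \<Rightarrow> real"
  assumes wm: "\<And>i. w i \<in> borel_measurable \<Lambda>" and wK: "\<And>i \<xi>. \<xi> \<in> space \<Lambda> \<Longrightarrow> \<bar>w i \<xi>\<bar> \<le> K"
    and w_mean: "\<And>i. i < d \<Longrightarrow> (\<integral>\<xi>. w i \<xi> \<partial>\<Lambda>) = 0"
    and w_cov: "\<And>i j. i < d \<Longrightarrow> j < d \<Longrightarrow> (\<integral>\<xi>. w i \<xi> * w j \<xi> \<partial>\<Lambda>) = S i j"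
    and H: "C1_on d H H1" and H1: "\<And>i. i < d \<Longrightarrow> C1_on d (H1 i) (H2 i)"
    and H2: "\<And>i j. i < d \<Longrightarrow> j < d \<Longrightarrow> C1_on d (H2 i j) (H3 i j)"
    and b1: "\<And>i x. i < d \<Longrightarrow> \<bar>H1 i x\<bar> \<le> 1" and b2: "\<And>i j x. i < d \<Longrightarrow> j < d \<Longrightarrow> \<bar>H2 i j x\<bar> \<le> 1"
    and b3: "\<And>i j k x. i < d \<Longrightarrow> j < d \<Longrightarrow> k < d \<Longrightarrow> \<bar>H3 i j k x\<bar> \<le> 1"
begin

definition X :: "'w \<Rightarrow> nat \<Rightarrow> real" where "X \<omega> i = (\<integral>\<xi>. w i \<xi> \<partial>N \<omega>)"

lemma X_measurable: "(\<lambda>\<omega>. X \<omega> i) \<in> borel_measurable M"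
  unfolding X_def by (rule pois.integral_N_measurable[OF wm])

lemma Xv_measurable: "X \<in> borel_measurable M"
  by (rule measurable_fun_space[OF X_measurable])

lemma X_integrable: "integrable M (\<lambda>\<omega>. X \<omega> i)"
  unfolding X_def by (rule pois.integral_N_integrable[OF wm wK])

lemma H3m: "i < d \<Longrightarrow> j < d \<Longrightarrow> k < d \<Longrightarrow> H3 i j k \<in> borel_measurable borel"
  using H2[of i j] by (auto simp: C1_on_def intro: borel_measurable_continuous_onI)

lemma smooth_measurable:
  assumes "F \<in> borel_measurable borel"
  shows "(\<lambda>\<omega>. F (\<lambda>l. y l + c * Z l \<omega>)) \<in> borel_measurable P"
  by (intro measurable_compose[OF _ assms] measurable_fun_space borel_measurable_add borel_measurable_const borel_measurable_times gauss.Z_measurable)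

lemma smooth_integrable:
  assumes "F \<in> borel_measurable borel" and "\<And>x. \<bar>F x\<bar> \<le> (b :: real)"
  shows "integrable P (\<lambda>\<omega>. F (\<lambda>l. y l + c * Z l \<omega>))"
  by (rule gauss.integrable_const_bound[of _ b]) (use assms smooth_measurable in auto)

text \<open>
  The average over the Gaussian part of the interpolated vector, the Poisson part being frozen
  at y.
\<close>

definition smooth :: "real \<Rightarrow> ((nat \<Rightarrow> real) \<Rightarrow> real) \<Rightarrow> (nat \<Rightarrow> real) \<Rightarrow> real" where
  "smooth c F y = (\<integral>\<omega>. F (\<lambda>l. y l + c * Z l \<omega>) \<partial>P)"

lemma smooth_bound:
  assumes "F \<in> borel_measurable borel" and b: "\<And>x. \<bar>F x\<bar> \<le> b"
  shows "\<bar>smooth c F y\<bar> \<le> b"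
proof -
  have "\<bar>smooth c F y\<bar> \<le> (\<integral>\<omega>. \<bar>F (\<lambda>l. y l + c * Z l \<omega>)\<bar> \<partial>P)" unfolding smooth_def by (rule integral_abs_bound)
  also have "\<dots> \<le> (\<integral>\<omega>. b \<partial>P)"
    by (rule integral_mono[OF integrable_abs[OF smooth_integrable[OF assms]]]) (use b in auto)
  finally show ?thesis by (simp add: gauss.prob_space)
qed

lemma smooth_lipschitz:
  assumes F: "C1_on d F F'" and bF: "\<And>x. \<bar>F x\<bar> \<le> b" and b: "\<And>i x. i < d \<Longrightarrow> \<bar>F' i x\<bar> \<le> 1"
  shows "\<bar>smooth c F x - smooth c F y\<bar> \<le> 1 * (\<Sum>i<d. \<bar>x i - y i\<bar>)"
proof -
  note I = smooth_integrable[OF C1_on_measurable[OF F] bF]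
  have "smooth c F x - smooth c F y = (\<integral>\<omega>. F (\<lambda>l. x l + c * Z l \<omega>) - F (\<lambda>l. y l + c * Z l \<omega>) \<partial>P)"
    unfolding smooth_def by (rule Bochner_Integration.integral_diff[symmetric]) (rule I)+
  also have "\<bar>\<dots>\<bar> \<le> (\<integral>\<omega>. \<bar>F (\<lambda>l. x l + c * Z l \<omega>) - F (\<lambda>l. y l + c * Z l \<omega>)\<bar> \<partial>P)" by (rule integral_abs_bound)
  also have "\<dots> \<le> (\<integral>\<omega>. 1 * (\<Sum>i<d. \<bar>x i - y i\<bar>) \<partial>P)"
  proof (rule integral_mono)
    show "integrable P (\<lambda>\<omega>. \<bar>F (\<lambda>l. x l + c * Z l \<omega>) - F (\<lambda>l. y l + c * Z l \<omega>)\<bar>)"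
      by (intro integrable_abs Bochner_Integration.integrable_diff I)
    show "\<bar>F (\<lambda>l. x l + c * Z l \<omega>) - F (\<lambda>l. y l + c * Z l \<omega>)\<bar> \<le> 1 * (\<Sum>i<d. \<bar>x i - y i\<bar>)" for \<omega>
      using C1_on_lipschitz[OF F b, of "\<lambda>l. x l + c * Z l \<omega>" "\<lambda>l. y l + c * Z l \<omega>"] by simp
  qed simp
  finally show ?thesis by (simp add: gauss.prob_space)
qed

lemma smooth_deriv:
  assumes F: "C1_on d F F'" and bF: "\<And>x. \<bar>F x\<bar> \<le> b" and b: "\<And>i x. i < d \<Longrightarrow> \<bar>F' i x\<bar> \<le> 1"
  shows "((\<lambda>t. smooth c F (\<lambda>l. y l + t * v l)) has_real_derivative (\<Sum>j<d. v j * smooth c (F' j) (\<lambda>l. y l + t * v l))) (at t)"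
proof -
  have F'm: "F' j \<in> borel_measurable borel" if "j < d" for j
    using F that by (auto simp: C1_on_def intro: borel_measurable_continuous_onI)
  have "((\<lambda>t. \<integral>\<omega>. F (\<lambda>l. y l + t * v l + c * Z l \<omega>) \<partial>P) has_real_derivative
      (\<integral>\<omega>. (\<Sum>j<d. v j * F' j (\<lambda>l. y l + t * v l + c * Z l \<omega>)) \<partial>P)) (at t)"
  proof (rule DERIV_integral[where B = "\<lambda>_. \<Sum>j<d. \<bar>v j\<bar>"])
    show "integrable P (\<lambda>\<omega>. F (\<lambda>l. y l + t * v l + c * Z l \<omega>))" for t
      by (rule smooth_integrable[OF C1_on_measurable[OF F] bF])
    show "(\<lambda>\<omega>. \<Sum>j<d. v j * F' j (\<lambda>l. y l + t * v l + c * Z l \<omega>)) \<in> borel_measurable P"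
      by (intro borel_measurable_sum borel_measurable_times borel_measurable_const smooth_measurable F'm) simp
    show "((\<lambda>t. F (\<lambda>l. y l + t * v l + c * Z l \<omega>)) has_real_derivative (\<Sum>j<d. v j * F' j (\<lambda>l. y l + t * v l + c * Z l \<omega>))) (at t)" for \<omega> t
      by (rule C1_on_chain[OF F]) (auto intro!: derivative_eq_intros)
    show "\<bar>\<Sum>j<d. v j * F' j (\<lambda>l. y l + t * v l + c * Z l \<omega>)\<bar> \<le> (\<Sum>j<d. \<bar>v j\<bar>)" for \<omega> t
    proof (rule order_trans[OF sum_abs], rule sum_mono)
      fix j assume "j \<in> {..<d}"
      thus "\<bar>v j * F' j (\<lambda>l. y l + t * v l + c * Z l \<omega>)\<bar> \<le> \<bar>v j\<bar>"
        using mult_left_mono[OF b, of j "\<bar>v j\<bar>"] by (simp add: abs_mult)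
    qed
  qed simp
  also have "(\<integral>\<omega>. (\<Sum>j<d. v j * F' j (\<lambda>l. y l + t * v l + c * Z l \<omega>)) \<partial>P) = (\<Sum>j<d. v j * smooth c (F' j) (\<lambda>l. y l + t * v l))"
    unfolding smooth_def
    by (subst Bochner_Integration.integral_sum) (auto intro!: integrable_mult_right smooth_integrable[OF F'm b])
  finally show ?thesis unfolding smooth_def .
qed

text \<open>
  Taylor's formula for the derivative of the smoothed H in the direction v: the increment of the
  gradient from y to \<open>y + s v\<close> minus its linear part, both paired with v.
\<close>

lemma taylor_smooth:
  assumes s: "s \<ge> 0"
    and B: "\<And>y. \<bar>\<Sum>i<d. \<Sum>j<d. \<Sum>k<d. v i * v j * v k * smooth c (H3 i j k) y\<bar> \<le> B"
  shows "\<bar>(\<Sum>i<d. v i * (smooth c (H1 i) (\<lambda>l. y l + s * v l) - smooth c (H1 i) y))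
           - s * (\<Sum>i<d. \<Sum>j<d. v i * v j * smooth c (H2 i j) y)\<bar> \<le> s\<^sup>2 * B"
proof -
  define Q where "Q = (\<lambda>t. \<Sum>i<d. v i * smooth c (H1 i) (\<lambda>l. y l + t * v l))"
  define Q' where "Q' = (\<lambda>t. \<Sum>i<d. \<Sum>j<d. v i * v j * smooth c (H2 i j) (\<lambda>l. y l + t * v l))"
  define Q'' where "Q'' = (\<lambda>t. \<Sum>i<d. \<Sum>j<d. \<Sum>k<d. v i * v j * v k * smooth c (H3 i j k) (\<lambda>l. y l + t * v l))"
  have "(Q has_real_derivative (\<Sum>i<d. v i * (\<Sum>j<d. v j * smooth c (H2 i j) (\<lambda>l. y l + t * v l)))) (at t)" for t
    unfolding Q_def by (intro DERIV_sum DERIV_cmult smooth_deriv[OF H1 b1 b2]) auto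
  hence d1: "(Q has_real_derivative Q' t) (at t)" for t
    by (simp add: Q'_def sum_distrib_left mult.assoc)
  have "(Q' has_real_derivative (\<Sum>i<d. \<Sum>j<d. v i * v j * (\<Sum>k<d. v k * smooth c (H3 i j k) (\<lambda>l. y l + t * v l)))) (at t)" for t
    unfolding Q'_def by (intro DERIV_sum DERIV_cmult smooth_deriv[OF H2 b2 b3]) auto
  hence d2: "(Q' has_real_derivative Q'' t) (at t)" for t
    by (simp add: Q''_def sum_distrib_left mult.assoc)
  have "\<bar>Q s - Q 0 - s * Q' 0\<bar> \<le> s\<^sup>2 * B"
    by (rule second_order_bound[OF d1 d2 _ s]) (use B in \<open>simp add: Q''_def\<close>)
  thus ?thesis by (simp add: Q_def Q'_def right_diff_distrib sum_subtractf)
qed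

end

context comparison
begin

sublocale MP: pair_prob_space M P ..

lemma mecke_smooth:
  assumes i: "i < d" and s: "s > 0"
  shows "(\<integral>\<omega>. X \<omega> i * smooth c (H1 i) (\<lambda>l. s * X \<omega> l) \<partial>M) =
     (\<integral>\<xi>. w i \<xi> * (\<integral>\<omega>. smooth c (H1 i) (\<lambda>l. s * X \<omega> l + s * w l \<xi>) \<partial>M) \<partial>\<Lambda>)"
proof -
  have lip: "\<bar>smooth c (H1 i) (\<lambda>l. s * x l) - smooth c (H1 i) (\<lambda>l. s * y l)\<bar> \<le> s * (\<Sum>l<d. \<bar>x l - y l\<bar>)" for x y
  proof -
    have "\<bar>smooth c (H1 i) (\<lambda>l. s * x l) - smooth c (H1 i) (\<lambda>l. s * y l)\<bar> \<le> 1 * (\<Sum>l<d. \<bar>s * x l - s * y l\<bar>)"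
      by (rule smooth_lipschitz[OF H1[OF i] b1[OF i] b2[OF i]])
    also have "\<dots> = s * (\<Sum>l<d. \<bar>x l - y l\<bar>)"
      using s by (simp add: sum_distrib_left abs_mult flip: right_diff_distrib)
    finally show ?thesis .
  qed
  have "(\<integral>\<omega>. X \<omega> i * smooth c (H1 i) (\<lambda>l. s * X \<omega> l) \<partial>M) =
     (\<integral>\<xi>. w i \<xi> * (\<integral>\<omega>. smooth c (H1 i) (\<lambda>l. s * (X \<omega> l + w l \<xi>)) \<partial>M) \<partial>\<Lambda>)"
    unfolding X_def
  proof (rule pois.mecke[OF wm wK _ _ lip i])
    show "(\<lambda>x. smooth c (H1 i) (\<lambda>l. s * x l)) \<in> borel_measurable borel"
      by (rule borel_measurable_continuous_onI[OF lipschitz_continuous_fun[OF lip]])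
    show "\<bar>smooth c (H1 i) (\<lambda>l. s * v l)\<bar> \<le> 1" for v
      by (rule smooth_bound[OF C1_on_measurable[OF H1[OF i]] b1[OF i]])
  qed
  thus ?thesis by (simp add: distrib_left)
qed

text \<open>
  With \<open>s = sin \<theta>\<close> and \<open>c = cos \<theta>\<close> the covariance matrix of this vector does not depend on \<open>\<theta>\<close>.
\<close>

definition Y :: "real \<Rightarrow> real \<Rightarrow> 'w \<times> 'v \<Rightarrow> nat \<Rightarrow> real" where
  "Y s c p i = s * X (fst p) i + c * Z i (snd p)"

lemma Y_measurable: "Y s c \<in> borel_measurable (M \<Otimes>\<^sub>M P)"
proof (rule measurable_fun_space)
  fix i
  have "(\<lambda>p. X (fst p) i) \<in> borel_measurable (M \<Otimes>\<^sub>M P)" "(\<lambda>p. Z i (snd p)) \<in> borel_measurable (M \<Otimes>\<^sub>M P)"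
    by (rule measurable_compose[OF measurable_fst X_measurable], rule measurable_compose[OF measurable_snd gauss.Z_measurable])
  thus "(\<lambda>p. Y s c p i) \<in> borel_measurable (M \<Otimes>\<^sub>M P)" unfolding Y_def by simp
qed

lemma pair_integrable:
  fixes f :: "'w \<Rightarrow> real" and g :: "'v \<Rightarrow> real"
  shows "integrable M f \<Longrightarrow> integrable (M \<Otimes>\<^sub>M P) (\<lambda>p. f (fst p))"
    and "integrable P g \<Longrightarrow> integrable (M \<Otimes>\<^sub>M P) (\<lambda>p. g (snd p))"
proof -
  have "distr (M \<Otimes>\<^sub>M P) M fst = M" by (rule gauss.distr_pair_fst)
  thus "integrable (M \<Otimes>\<^sub>M P) (\<lambda>p. f (fst p))" if "integrable M f"
    using that integrable_distr[of fst "M \<Otimes>\<^sub>M P" M f] by simp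
  interpret PM: pair_prob_space P M ..
  have "distr (P \<Otimes>\<^sub>M M) P fst = P" by (rule pois.distr_pair_fst)
  hence "integrable (P \<Otimes>\<^sub>M M) (\<lambda>p. g (fst p))" if "integrable P g"
    using that integrable_distr[of fst "P \<Otimes>\<^sub>M M" P g] by simp
  thus "integrable (M \<Otimes>\<^sub>M P) (\<lambda>p. g (snd p))" if "integrable P g"
    using PM.integrable_product_swap[of "\<lambda>p. g (fst p)"] that by (simp add: case_prod_unfold)
qed

lemma X_term_integrable:
  assumes "F \<in> borel_measurable borel" "\<And>x. \<bar>F x\<bar> \<le> (1 :: real)"
  shows "integrable (M \<Otimes>\<^sub>M P) (\<lambda>p. X (fst p) i * F (Y s c p))"
    and "integrable (M \<Otimes>\<^sub>M P) (\<lambda>p. Z i (snd p) * F (Y s c p))"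
proof -
  have FY: "(\<lambda>p. F (Y s c p)) \<in> borel_measurable (M \<Otimes>\<^sub>M P)" by (rule measurable_compose[OF Y_measurable assms(1)])
  note I = pair_integrable(1)[OF X_integrable[of i]] pair_integrable(2)[OF gauss.Z_integrable[of i]]
  have *: "\<bar>a * F x\<bar> \<le> \<bar>a\<bar>" for a x using mult_left_mono[OF assms(2), of "\<bar>a\<bar>" x] by (simp add: abs_mult)
  show "integrable (M \<Otimes>\<^sub>M P) (\<lambda>p. X (fst p) i * F (Y s c p))"
    by (rule Bochner_Integration.integrable_bound[OF I(1)]) (use I(1) FY * in auto)
  show "integrable (M \<Otimes>\<^sub>M P) (\<lambda>p. Z i (snd p) * F (Y s c p))"
    by (rule Bochner_Integration.integrable_bound[OF I(2)]) (use I(2) FY * in auto)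
qed

text \<open>
  The Mecke formula, applied with the Gaussian part averaged out.
\<close>

lemma X_term:
  assumes i: "i < d" and s: "s > 0"
  shows "(\<integral>p. X (fst p) i * H1 i (Y s c p) \<partial>(M \<Otimes>\<^sub>M P)) =
     (\<integral>\<xi>. w i \<xi> * (\<integral>\<omega>. smooth c (H1 i) (\<lambda>l. s * X \<omega> l + s * w l \<xi>) \<partial>M) \<partial>\<Lambda>)"
proof -
  have int: "integrable (M \<Otimes>\<^sub>M P) (\<lambda>(\<omega>, \<omega>'). X \<omega> i * H1 i (Y s c (\<omega>, \<omega>')))"
    using X_term_integrable(1)[OF C1_on_measurable[OF H1[OF i]] b1[OF i]] by (simp add: case_prod_unfold)
  have "(\<integral>p. X (fst p) i * H1 i (Y s c p) \<partial>(M \<Otimes>\<^sub>M P)) = (\<integral>\<omega>. (\<integral>\<omega>'. X \<omega> i * H1 i (Y s c (\<omega>, \<omega>')) \<partial>P) \<partial>M)"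
    using MP.integral_fst'[OF int] by (simp add: case_prod_unfold)
  also have "\<dots> = (\<integral>\<omega>. X \<omega> i * smooth c (H1 i) (\<lambda>l. s * X \<omega> l) \<partial>M)"
    by (simp add: smooth_def Y_def[abs_def])
  finally show ?thesis using mecke_smooth[OF i s] by simp
qed

text \<open>
  Gaussian integration by parts, with the Poisson part frozen.
\<close>

lemma Z_term:
  assumes i: "i < d"
  shows "(\<integral>p. Z i (snd p) * H1 i (Y s c p) \<partial>(M \<Otimes>\<^sub>M P)) =
     c * (\<integral>\<omega>. (\<Sum>j<d. S i j * smooth c (H2 i j) (\<lambda>l. s * X \<omega> l)) \<partial>M)"
proof -
  have int: "integrable (M \<Otimes>\<^sub>M P) (\<lambda>(\<omega>, \<omega>'). Z i \<omega>' * H1 i (Y s c (\<omega>, \<omega>')))"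
    using X_term_integrable(2)[OF C1_on_measurable[OF H1[OF i]] b1[OF i]] by (simp add: case_prod_unfold)
  have "(\<integral>p. Z i (snd p) * H1 i (Y s c p) \<partial>(M \<Otimes>\<^sub>M P)) = (\<integral>\<omega>. (\<integral>\<omega>'. Z i \<omega>' * H1 i (Y s c (\<omega>, \<omega>')) \<partial>P) \<partial>M)"
    using MP.integral_fst'[OF int] by (simp add: case_prod_unfold)
  also have "\<dots> = (\<integral>\<omega>. c * (\<Sum>j<d. S i j * smooth c (H2 i j) (\<lambda>l. s * X \<omega> l)) \<partial>M)"
  proof (rule Bochner_Integration.integral_cong[OF refl])
    fix \<omega>
    let ?a = "\<lambda>j. if j = i then 1 else 0 :: real"
    have cb: "\<bar>c * H2 i j (\<lambda>l. s * X \<omega> l + c * z l)\<bar> \<le> \<bar>c\<bar>" if "j < d" for j z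
      using mult_left_mono[OF b2[OF i that], of "\<bar>c\<bar>"] by (simp add: abs_mult)
    have "(\<integral>\<omega>'. Z i \<omega>' * H1 i (Y s c (\<omega>, \<omega>')) \<partial>P) = (\<integral>\<omega>'. gauss.L ?a \<omega>' * H1 i (\<lambda>l. s * X \<omega> l + c * Z l \<omega>') \<partial>P)"
      using gauss.Z_eq_L[OF i] by (simp add: Y_def[abs_def])
    also have "\<dots> = (\<Sum>j<d. (\<Sum>k<d. ?a k * S k j) * (\<integral>\<omega>'. c * H2 i j (\<lambda>l. s * X \<omega> l + c * Z l \<omega>') \<partial>P))"
      by (rule gauss.gaussian_integration_by_parts[OF C1_on_affine[OF H1[OF i]] cb])
    also have "\<dots> = c * (\<Sum>j<d. S i j * smooth c (H2 i j) (\<lambda>l. s * X \<omega> l))"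
    proof -
      have "(\<Sum>k<d. ?a k * S k j) = S i j" for j
      proof -
        have "(\<Sum>k<d. ?a k * S k j) = (\<Sum>k<d. if k = i then S k j else 0)" by (intro sum.cong) auto
        thus ?thesis using i by simp
      qed
      thus ?thesis by (simp add: smooth_def sum_distrib_left mult_ac)
    qed
    finally show "(\<integral>\<omega>'. Z i \<omega>' * H1 i (Y s c (\<omega>, \<omega>')) \<partial>P) = c * (\<Sum>j<d. S i j * smooth c (H2 i j) (\<lambda>l. s * X \<omega> l))" .
  qed
  also have "\<dots> = c * (\<integral>\<omega>. (\<Sum>j<d. S i j * smooth c (H2 i j) (\<lambda>l. s * X \<omega> l)) \<partial>M)"
    by (rule integral_mult_right_zero)
  finally show ?thesis .
qed

definition \<Phi> :: "real \<Rightarrow> real" where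
  "\<Phi> \<theta> = (\<integral>p. H (Y (sin \<theta>) (cos \<theta>) p) \<partial>(M \<Otimes>\<^sub>M P))"

definition \<Phi>' :: "real \<Rightarrow> real" where
  "\<Phi>' \<theta> = (\<integral>p. (\<Sum>i<d. (cos \<theta> * X (fst p) i - sin \<theta> * Z i (snd p)) * H1 i (Y (sin \<theta>) (cos \<theta>) p)) \<partial>(M \<Otimes>\<^sub>M P))"

lemma \<Phi>_deriv: "(\<Phi> has_real_derivative \<Phi>' \<theta>) (at \<theta>)"
  unfolding \<Phi>_def[abs_def] \<Phi>'_def
proof (rule DERIV_integral[where B = "\<lambda>p. \<Sum>i<d. \<bar>X (fst p) i\<bar> + \<bar>Z i (snd p)\<bar>"])
  have I: "integrable (M \<Otimes>\<^sub>M P) (\<lambda>p. \<bar>X (fst p) i\<bar>)" "integrable (M \<Otimes>\<^sub>M P) (\<lambda>p. \<bar>Z i (snd p)\<bar>)" for i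
    by (intro integrable_abs pair_integrable(1)[OF X_integrable], intro integrable_abs pair_integrable(2)[OF gauss.Z_integrable])
  have IB: "integrable (M \<Otimes>\<^sub>M P) (\<lambda>p. \<Sum>i<d. \<bar>X (fst p) i\<bar> + \<bar>Z i (snd p)\<bar>)"
    by (intro Bochner_Integration.integrable_sum Bochner_Integration.integrable_add I)
  thus "integrable (M \<Otimes>\<^sub>M P) (\<lambda>p. \<Sum>i<d. \<bar>X (fst p) i\<bar> + \<bar>Z i (snd p)\<bar>)" .
  have sc: "\<bar>sin \<theta> * x + cos \<theta> * z\<bar> \<le> \<bar>x\<bar> + \<bar>z\<bar>" "\<bar>cos \<theta> * x - sin \<theta> * z\<bar> \<le> \<bar>x\<bar> + \<bar>z\<bar>" for \<theta> x z :: real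
  proof -
    have "\<bar>sin \<theta>\<bar> * \<bar>x\<bar> \<le> 1 * \<bar>x\<bar>" "\<bar>cos \<theta>\<bar> * \<bar>z\<bar> \<le> 1 * \<bar>z\<bar>" "\<bar>sin \<theta>\<bar> * \<bar>z\<bar> \<le> 1 * \<bar>z\<bar>" "\<bar>cos \<theta>\<bar> * \<bar>x\<bar> \<le> 1 * \<bar>x\<bar>"
      by (intro mult_right_mono abs_sin_le_one abs_cos_le_one abs_ge_zero)+
    thus "\<bar>sin \<theta> * x + cos \<theta> * z\<bar> \<le> \<bar>x\<bar> + \<bar>z\<bar>" "\<bar>cos \<theta> * x - sin \<theta> * z\<bar> \<le> \<bar>x\<bar> + \<bar>z\<bar>"
      using abs_triangle_ineq[of "sin \<theta> * x" "cos \<theta> * z"] abs_triangle_ineq4[of "cos \<theta> * x" "sin \<theta> * z"]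
      unfolding abs_mult by linarith+
  qed
  show "integrable (M \<Otimes>\<^sub>M P) (\<lambda>p. H (Y (sin \<theta>) (cos \<theta>) p))" for \<theta>
  proof (rule Bochner_Integration.integrable_bound)
    show "integrable (M \<Otimes>\<^sub>M P) (\<lambda>p. \<bar>H (\<lambda>_. 0)\<bar> + (\<Sum>i<d. \<bar>X (fst p) i\<bar> + \<bar>Z i (snd p)\<bar>))"
      by (intro Bochner_Integration.integrable_add IB) simp
    show "(\<lambda>p. H (Y (sin \<theta>) (cos \<theta>) p)) \<in> borel_measurable (M \<Otimes>\<^sub>M P)"
      by (rule measurable_compose[OF Y_measurable C1_on_measurable[OF H]])
    show "AE p in M \<Otimes>\<^sub>M P. norm (H (Y (sin \<theta>) (cos \<theta>) p)) \<le> norm (\<bar>H (\<lambda>_. 0)\<bar> + (\<Sum>i<d. \<bar>X (fst p) i\<bar> + \<bar>Z i (snd p)\<bar>))"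
    proof (rule AE_I2)
      fix p
      have "\<bar>H (Y (sin \<theta>) (cos \<theta>) p) - H (\<lambda>_. 0)\<bar> \<le> 1 * (\<Sum>i<d. \<bar>Y (sin \<theta>) (cos \<theta>) p i - 0\<bar>)"
        by (rule C1_on_lipschitz[OF H b1])
      also have "\<dots> \<le> (\<Sum>i<d. \<bar>X (fst p) i\<bar> + \<bar>Z i (snd p)\<bar>)"
        using sc(1) by (auto simp: Y_def intro!: sum_mono)
      finally show "norm (H (Y (sin \<theta>) (cos \<theta>) p)) \<le> norm (\<bar>H (\<lambda>_. 0)\<bar> + (\<Sum>i<d. \<bar>X (fst p) i\<bar> + \<bar>Z i (snd p)\<bar>))"
        by simp
    qed
  qed
  have "integrable (M \<Otimes>\<^sub>M P) (\<lambda>p. (\<Sum>i<d. cos \<theta> * (X (fst p) i * H1 i (Y (sin \<theta>) (cos \<theta>) p)) - sin \<theta> * (Z i (snd p) * H1 i (Y (sin \<theta>) (cos \<theta>) p))))"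
    by (intro Bochner_Integration.integrable_sum Bochner_Integration.integrable_diff integrable_mult_right
         X_term_integrable C1_on_measurable[OF H1] b1) auto
  thus "(\<lambda>p. (\<Sum>i<d. (cos \<theta> * X (fst p) i - sin \<theta> * Z i (snd p)) * H1 i (Y (sin \<theta>) (cos \<theta>) p))) \<in> borel_measurable (M \<Otimes>\<^sub>M P)"
    by (simp add: left_diff_distrib mult.assoc borel_measurable_integrable)
  show "((\<lambda>\<theta>. H (Y (sin \<theta>) (cos \<theta>) p)) has_real_derivative (\<Sum>i<d. (cos \<theta> * X (fst p) i - sin \<theta> * Z i (snd p)) * H1 i (Y (sin \<theta>) (cos \<theta>) p))) (at \<theta>)" for \<theta> p
    by (rule C1_on_chain[OF H]) (auto simp: Y_def intro!: derivative_eq_intros)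
  show "\<bar>\<Sum>i<d. (cos \<theta> * X (fst p) i - sin \<theta> * Z i (snd p)) * H1 i (Y (sin \<theta>) (cos \<theta>) p)\<bar> \<le> (\<Sum>i<d. \<bar>X (fst p) i\<bar> + \<bar>Z i (snd p)\<bar>)" for \<theta> p
  proof (rule order_trans[OF sum_abs], rule sum_mono)
    fix i assume "i \<in> {..<d}"
    hence "\<bar>(cos \<theta> * X (fst p) i - sin \<theta> * Z i (snd p)) * H1 i (Y (sin \<theta>) (cos \<theta>) p)\<bar> \<le> (\<bar>X (fst p) i\<bar> + \<bar>Z i (snd p)\<bar>) * 1"
      unfolding abs_mult[of "_ - _"] using sc(2) b1 by (intro mult_mono) auto
    thus "\<bar>(cos \<theta> * X (fst p) i - sin \<theta> * Z i (snd p)) * H1 i (Y (sin \<theta>) (cos \<theta>) p)\<bar> \<le> \<bar>X (fst p) i\<bar> + \<bar>Z i (snd p)\<bar>" by simp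
  qed
qed

lemma shifted_smooth_measurable:
  assumes i: "i < d"
  shows "(\<lambda>\<xi>. \<integral>\<omega>. smooth c (H1 i) (\<lambda>l. s * X \<omega> l + s * w l \<xi>) \<partial>M) \<in> borel_measurable \<Lambda>"
proof -
  let ?G = "\<lambda>v. \<integral>\<omega>. smooth c (H1 i) (\<lambda>l. s * X \<omega> l + v l) \<partial>M"
  have lip: "\<bar>smooth c (H1 i) x - smooth c (H1 i) y\<bar> \<le> 1 * (\<Sum>l<d. \<bar>x l - y l\<bar>)" for x y
    by (rule smooth_lipschitz[OF H1[OF i] b1[OF i] b2[OF i]])
  have sm: "smooth c (H1 i) \<in> borel_measurable borel"
    by (rule borel_measurable_continuous_onI[OF lipschitz_continuous_fun[OF lip]])
  have I: "integrable M (\<lambda>\<omega>. smooth c (H1 i) (\<lambda>l. s * X \<omega> l + v l))" for v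
    by (rule pois.integrable_const_bound[of _ 1])
       (use smooth_bound[OF C1_on_measurable[OF H1[OF i]] b1[OF i]] in
         \<open>auto intro!: measurable_compose[OF _ sm] measurable_fun_space borel_measurable_add borel_measurable_times borel_measurable_const X_measurable\<close>)
  have "\<bar>?G x - ?G y\<bar> \<le> 1 * (\<Sum>l<d. \<bar>x l - y l\<bar>)" for x y
  proof -
    have eq: "?G x - ?G y = (\<integral>\<omega>. smooth c (H1 i) (\<lambda>l. s * X \<omega> l + x l) - smooth c (H1 i) (\<lambda>l. s * X \<omega> l + y l) \<partial>M)"
      by (rule Bochner_Integration.integral_diff[symmetric]) (rule I)+
    have "\<bar>?G x - ?G y\<bar> \<le> (\<integral>\<omega>. \<bar>smooth c (H1 i) (\<lambda>l. s * X \<omega> l + x l) - smooth c (H1 i) (\<lambda>l. s * X \<omega> l + y l)\<bar> \<partial>M)"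
      unfolding eq by (rule integral_abs_bound)
    also have "\<dots> \<le> (\<integral>\<omega>. (\<Sum>l<d. \<bar>x l - y l\<bar>) \<partial>M)"
    proof -
      have le: "\<bar>smooth c (H1 i) (\<lambda>l. s * X \<omega> l + x l) - smooth c (H1 i) (\<lambda>l. s * X \<omega> l + y l)\<bar> \<le> (\<Sum>l<d. \<bar>x l - y l\<bar>)" for \<omega>
        using lip[of "\<lambda>l. s * X \<omega> l + x l" "\<lambda>l. s * X \<omega> l + y l"] by simp
      have int: "integrable M (\<lambda>\<omega>. \<bar>smooth c (H1 i) (\<lambda>l. s * X \<omega> l + x l) - smooth c (H1 i) (\<lambda>l. s * X \<omega> l + y l)\<bar>)"
        by (rule integrable_abs[OF Bochner_Integration.integrable_diff[OF I I]])
      show ?thesis by (rule integral_mono[OF int pois.integrable_const le])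
    qed
    finally show ?thesis by (simp add: pois.prob_space)
  qed
  hence "?G \<in> borel_measurable borel"
    by (intro borel_measurable_continuous_onI lipschitz_continuous_fun)
  thus ?thesis
    by (rule measurable_compose[rotated]) (intro measurable_fun_space borel_measurable_times borel_measurable_const wm)
qed

text \<open>
  Write s and c for sine and cosine of \<open>\<theta>\<close>. By \<open>X_term\<close> and \<open>w_mean\<close>, the Poisson part of the
  derivative is c times an integral over \<open>\<xi>\<close> of increments of the gradient by the step \<open>s w(\<xi>)\<close>, paired with
  \<open>w(\<xi>)\<close>. By \<open>Z_term\<close> and \<open>w_cov\<close>, the Gaussian part is the integral of the linear parts of these
  increments. The difference is a Taylor remainder, controlled by the third derivative in the
  direction \<open>w(\<xi>)\<close>. The factor c is kept in the hypothesis because it pays for an integration by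
  parts.
\<close>

lemma \<Phi>'_bound:
  assumes \<theta>: "0 < \<theta>" "\<theta> < pi / 2" and Di: "integrable \<Lambda> D"
    and D: "\<And>c \<xi> y. 0 < c \<Longrightarrow> c \<le> 1 \<Longrightarrow> \<xi> \<in> space \<Lambda> \<Longrightarrow>
       c * \<bar>\<Sum>i<d. \<Sum>j<d. \<Sum>k<d. w i \<xi> * w j \<xi> * w k \<xi> * smooth c (H3 i j k) y\<bar> \<le> D \<xi>"
  shows "\<bar>\<Phi>' \<theta>\<bar> \<le> (\<integral>\<xi>. D \<xi> \<partial>\<Lambda>)"
proof -
  define s c where "s = sin \<theta>" and "c = cos \<theta>"
  have s: "0 < s" "s \<le> 1" and c: "0 < c" "c \<le> 1"
    using \<theta> by (auto simp: s_def c_def intro: sin_gt_zero cos_gt_zero)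
  note I1 = X_term_integrable(1)[OF C1_on_measurable[OF H1] b1] and I2 = X_term_integrable(2)[OF C1_on_measurable[OF H1] b1]
  define g where "g = (\<lambda>i v. \<integral>\<omega>. smooth c (H1 i) (\<lambda>l. s * X \<omega> l + s * v l) \<partial>M)"
  define h where "h = (\<lambda>i j. \<integral>\<omega>. smooth c (H2 i j) (\<lambda>l. s * X \<omega> l) \<partial>M)"
  have H2m: "H2 i j \<in> borel_measurable borel" if "i < d" "j < d" for i j using C1_on_measurable[OF H2[OF that]] .
  have U1m: "smooth c (H1 i) \<in> borel_measurable borel" if "i < d" for i
    by (rule borel_measurable_continuous_onI[OF lipschitz_continuous_fun[OF smooth_lipschitz[OF H1[OF that] b1[OF that] b2[OF that]]]])
  have U2m: "smooth c (H2 i j) \<in> borel_measurable borel" if "i < d" "j < d" for i j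
    by (rule borel_measurable_continuous_onI[OF lipschitz_continuous_fun[OF smooth_lipschitz[OF H2[OF that] b2[OF that] b3[OF that]]]])
  have U1i: "integrable M (\<lambda>\<omega>. smooth c (H1 i) (\<lambda>l. s * X \<omega> l + s * v l))" if "i < d" for i v
    by (rule pois.integrable_const_bound[of _ 1])
       (use smooth_bound[OF C1_on_measurable[OF H1[OF that]] b1[OF that]] in
         \<open>auto intro!: measurable_compose[OF _ U1m[OF that]] measurable_fun_space borel_measurable_add borel_measurable_times borel_measurable_const X_measurable\<close>)
  have U1i0: "integrable M (\<lambda>\<omega>. smooth c (H1 i) (\<lambda>l. s * X \<omega> l))" if "i < d" for i
    using U1i[OF that, of "\<lambda>_. 0"] by simp
  have U2i: "integrable M (\<lambda>\<omega>. smooth c (H2 i j) (\<lambda>l. s * X \<omega> l))" if "i < d" "j < d" for i j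
    by (rule pois.integrable_const_bound[of _ 1])
       (use smooth_bound[OF H2m[OF that] b2[OF that]] in
         \<open>auto intro!: measurable_compose[OF _ U2m[OF that]] measurable_fun_space borel_measurable_times borel_measurable_const X_measurable\<close>)
  have gb: "\<bar>g i v\<bar> \<le> 1" if "i < d" for i v
  proof -
    have "\<bar>g i v\<bar> \<le> (\<integral>\<omega>. \<bar>smooth c (H1 i) (\<lambda>l. s * X \<omega> l + s * v l)\<bar> \<partial>M)" unfolding g_def by (rule integral_abs_bound)
    also have "\<dots> \<le> (\<integral>\<omega>. 1 \<partial>M)"
      by (rule integral_mono[OF integrable_abs[OF U1i[OF that]]]) (use smooth_bound[OF C1_on_measurable[OF H1[OF that]] b1[OF that]] in auto)
    finally show ?thesis by (simp add: pois.prob_space)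
  qed
  have wi: "integrable \<Lambda> (w i)" for i
    by (rule pois.\<Lambda>.integrable_const_bound[of _ K]) (use wK wm in auto)
  have K0: "K \<ge> 0" if "\<xi> \<in> space \<Lambda>" for \<xi> using order_trans[OF abs_ge_zero wK[OF that]] .
  have wgi: "integrable \<Lambda> (\<lambda>\<xi>. w i \<xi> * g i (\<lambda>l. w l \<xi>))" if "i < d" for i
  proof (rule pois.\<Lambda>.integrable_const_bound[of _ "K * 1"])
    show "AE \<xi> in \<Lambda>. norm (w i \<xi> * g i (\<lambda>l. w l \<xi>)) \<le> K * 1"
      unfolding real_norm_def abs_mult using wK K0 gb[OF that] by (intro AE_I2 mult_mono) auto
    show "(\<lambda>\<xi>. w i \<xi> * g i (\<lambda>l. w l \<xi>)) \<in> borel_measurable \<Lambda>"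
      unfolding g_def by (intro borel_measurable_times wm shifted_smooth_measurable that)
  qed
  have wwi: "integrable \<Lambda> (\<lambda>\<xi>. w i \<xi> * w j \<xi>)" for i j
  proof (rule pois.\<Lambda>.integrable_const_bound[of _ "K * K"])
    show "AE \<xi> in \<Lambda>. norm (w i \<xi> * w j \<xi>) \<le> K * K"
      unfolding real_norm_def abs_mult using wK K0 by (intro AE_I2 mult_mono) auto
  qed (use wm in simp)
  have "\<Phi>' \<theta> = (\<integral>p. (\<Sum>i<d. c * (X (fst p) i * H1 i (Y s c p)) - s * (Z i (snd p) * H1 i (Y s c p))) \<partial>(M \<Otimes>\<^sub>M P))"
    by (simp add: \<Phi>'_def s_def c_def left_diff_distrib mult.assoc)
  also have "\<dots> = (\<Sum>i<d. c * (\<integral>p. X (fst p) i * H1 i (Y s c p) \<partial>(M \<Otimes>\<^sub>M P)) - s * (\<integral>p. Z i (snd p) * H1 i (Y s c p) \<partial>(M \<Otimes>\<^sub>M P)))"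
  proof (subst Bochner_Integration.integral_sum)
    fix i assume i: "i \<in> {..<d}"
    show "integrable (M \<Otimes>\<^sub>M P) (\<lambda>p. c * (X (fst p) i * H1 i (Y s c p)) - s * (Z i (snd p) * H1 i (Y s c p)))"
      using i by (intro Bochner_Integration.integrable_diff integrable_mult_right I1 I2) auto
  next
    show "(\<Sum>i<d. \<integral>p. c * (X (fst p) i * H1 i (Y s c p)) - s * (Z i (snd p) * H1 i (Y s c p)) \<partial>(M \<Otimes>\<^sub>M P)) =
       (\<Sum>i<d. c * (\<integral>p. X (fst p) i * H1 i (Y s c p) \<partial>(M \<Otimes>\<^sub>M P)) - s * (\<integral>p. Z i (snd p) * H1 i (Y s c p) \<partial>(M \<Otimes>\<^sub>M P)))"
      by (intro sum.cong refl, subst Bochner_Integration.integral_diff) (auto intro!: integrable_mult_right I1 I2)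
  qed
  also have "\<dots> = (\<Sum>i<d. c * (\<integral>\<xi>. w i \<xi> * g i (\<lambda>l. w l \<xi>) \<partial>\<Lambda>) - s * (c * (\<Sum>j<d. S i j * h i j)))"
  proof (intro sum.cong refl)
    fix i assume "i \<in> {..<d}"
    hence i: "i < d" by simp
    have "(\<integral>\<omega>. (\<Sum>j<d. S i j * smooth c (H2 i j) (\<lambda>l. s * X \<omega> l)) \<partial>M) = (\<Sum>j<d. S i j * h i j)"
      unfolding h_def using i by (subst Bochner_Integration.integral_sum) (auto intro!: integrable_mult_right U2i)
    thus "c * (\<integral>p. X (fst p) i * H1 i (Y s c p) \<partial>(M \<Otimes>\<^sub>M P)) - s * (\<integral>p. Z i (snd p) * H1 i (Y s c p) \<partial>(M \<Otimes>\<^sub>M P))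
       = c * (\<integral>\<xi>. w i \<xi> * g i (\<lambda>l. w l \<xi>) \<partial>\<Lambda>) - s * (c * (\<Sum>j<d. S i j * h i j))"
      using X_term[OF i s(1), of c] Z_term[OF i, of s c] by (simp add: g_def)
  qed
  also have "\<dots> = c * (\<Sum>i<d. (\<integral>\<xi>. w i \<xi> * g i (\<lambda>l. w l \<xi>) \<partial>\<Lambda>) - s * (\<Sum>j<d. S i j * h i j))"
    by (simp add: sum_distrib_left right_diff_distrib mult_ac)
  also have "(\<Sum>i<d. (\<integral>\<xi>. w i \<xi> * g i (\<lambda>l. w l \<xi>) \<partial>\<Lambda>) - s * (\<Sum>j<d. S i j * h i j)) =
      (\<integral>\<xi>. (\<Sum>i<d. (w i \<xi> * g i (\<lambda>l. w l \<xi>) - g i (\<lambda>_. 0) * w i \<xi>) - s * (\<Sum>j<d. h i j * (w i \<xi> * w j \<xi>))) \<partial>\<Lambda>)"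
  proof (subst Bochner_Integration.integral_sum)
    fix i assume "i \<in> {..<d}"
    thus "integrable \<Lambda> (\<lambda>\<xi>. (w i \<xi> * g i (\<lambda>l. w l \<xi>) - g i (\<lambda>_. 0) * w i \<xi>) - s * (\<Sum>j<d. h i j * (w i \<xi> * w j \<xi>)))"
      by (intro Bochner_Integration.integrable_diff wgi integrable_mult_right wi Bochner_Integration.integrable_sum wwi) auto
  next
    show "(\<Sum>i<d. (\<integral>\<xi>. w i \<xi> * g i (\<lambda>l. w l \<xi>) \<partial>\<Lambda>) - s * (\<Sum>j<d. S i j * h i j)) =
       (\<Sum>i<d. \<integral>\<xi>. (w i \<xi> * g i (\<lambda>l. w l \<xi>) - g i (\<lambda>_. 0) * w i \<xi>) - s * (\<Sum>j<d. h i j * (w i \<xi> * w j \<xi>)) \<partial>\<Lambda>)"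
    proof (intro sum.cong refl)
      fix i assume "i \<in> {..<d}"
      hence i: "i < d" by simp
      have "(\<integral>\<xi>. (w i \<xi> * g i (\<lambda>l. w l \<xi>) - g i (\<lambda>_. 0) * w i \<xi>) - s * (\<Sum>j<d. h i j * (w i \<xi> * w j \<xi>)) \<partial>\<Lambda>) =
         (\<integral>\<xi>. w i \<xi> * g i (\<lambda>l. w l \<xi>) - g i (\<lambda>_. 0) * w i \<xi> \<partial>\<Lambda>) - (\<integral>\<xi>. s * (\<Sum>j<d. h i j * (w i \<xi> * w j \<xi>)) \<partial>\<Lambda>)"
        using i by (intro Bochner_Integration.integral_diff Bochner_Integration.integrable_diff wgi integrable_mult_right wi Bochner_Integration.integrable_sum wwi)
      also have "(\<integral>\<xi>. w i \<xi> * g i (\<lambda>l. w l \<xi>) - g i (\<lambda>_. 0) * w i \<xi> \<partial>\<Lambda>) = (\<integral>\<xi>. w i \<xi> * g i (\<lambda>l. w l \<xi>) \<partial>\<Lambda>) - g i (\<lambda>_. 0) * (\<integral>\<xi>. w i \<xi> \<partial>\<Lambda>)"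
        using i by (subst Bochner_Integration.integral_diff) (auto intro!: wgi integrable_mult_right wi)
      also have "(\<integral>\<xi>. s * (\<Sum>j<d. h i j * (w i \<xi> * w j \<xi>)) \<partial>\<Lambda>) = s * (\<Sum>j<d. S i j * h i j)"
      proof -
        have e: "(\<integral>\<xi>. h i j * (w i \<xi> * w j \<xi>) \<partial>\<Lambda>) = S i j * h i j" if "j < d" for j
          unfolding integral_mult_right_zero w_cov[OF i that] by (rule mult.commute)
        have "(\<integral>\<xi>. s * (\<Sum>j<d. h i j * (w i \<xi> * w j \<xi>)) \<partial>\<Lambda>) = s * (\<integral>\<xi>. (\<Sum>j<d. h i j * (w i \<xi> * w j \<xi>)) \<partial>\<Lambda>)"
          by (rule integral_mult_right_zero)
        also have "(\<integral>\<xi>. (\<Sum>j<d. h i j * (w i \<xi> * w j \<xi>)) \<partial>\<Lambda>) = (\<Sum>j<d. \<integral>\<xi>. h i j * (w i \<xi> * w j \<xi>) \<partial>\<Lambda>)"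
          by (rule Bochner_Integration.integral_sum) (intro integrable_mult_right wwi)
        also have "\<dots> = (\<Sum>j<d. S i j * h i j)" by (intro sum.cong refl e) simp
        finally show ?thesis .
      qed
      finally show "(\<integral>\<xi>. w i \<xi> * g i (\<lambda>l. w l \<xi>) \<partial>\<Lambda>) - s * (\<Sum>j<d. S i j * h i j) =
         (\<integral>\<xi>. (w i \<xi> * g i (\<lambda>l. w l \<xi>) - g i (\<lambda>_. 0) * w i \<xi>) - s * (\<Sum>j<d. h i j * (w i \<xi> * w j \<xi>)) \<partial>\<Lambda>)"
        using w_mean[OF i] by simp
    qed
  qed
  finally have eq: "\<Phi>' \<theta> = c * (\<integral>\<xi>. (\<Sum>i<d. (w i \<xi> * g i (\<lambda>l. w l \<xi>) - g i (\<lambda>_. 0) * w i \<xi>) - s * (\<Sum>j<d. h i j * (w i \<xi> * w j \<xi>))) \<partial>\<Lambda>)" .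
  \<comment> \<open>\<open>R \<xi>\<close> is the expectation of the Taylor remainder T at the random point \<open>s X\<close>\<close>
  define R where "R = (\<lambda>\<xi>. (\<Sum>i<d. (w i \<xi> * g i (\<lambda>l. w l \<xi>) - g i (\<lambda>_. 0) * w i \<xi>) - s * (\<Sum>j<d. h i j * (w i \<xi> * w j \<xi>))))"
  have Ri: "integrable \<Lambda> R"
    unfolding R_def by (intro Bochner_Integration.integrable_sum Bochner_Integration.integrable_diff wgi integrable_mult_right wi wwi) auto
  have Rb: "\<bar>c * R \<xi>\<bar> \<le> D \<xi>" if \<xi>: "\<xi> \<in> space \<Lambda>" for \<xi>
  proof -
    define T where "T = (\<lambda>\<omega>. (\<Sum>i<d. w i \<xi> * (smooth c (H1 i) (\<lambda>l. s * X \<omega> l + s * w l \<xi>) - smooth c (H1 i) (\<lambda>l. s * X \<omega> l)))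
             - s * (\<Sum>i<d. \<Sum>j<d. w i \<xi> * w j \<xi> * smooth c (H2 i j) (\<lambda>l. s * X \<omega> l)))"
    have Ti: "integrable M T"
      unfolding T_def by (intro Bochner_Integration.integrable_diff Bochner_Integration.integrable_sum integrable_mult_right U1i U1i0 U2i) auto
    have "R \<xi> = (\<Sum>i<d. w i \<xi> * (g i (\<lambda>l. w l \<xi>) - g i (\<lambda>_. 0))) - s * (\<Sum>i<d. \<Sum>j<d. w i \<xi> * w j \<xi> * h i j)"
      by (simp add: R_def right_diff_distrib sum_subtractf sum_distrib_left mult_ac)
    also have "\<dots> = (\<integral>\<omega>. T \<omega> \<partial>M)"
    proof -
      have e1: "(\<integral>\<omega>. (\<Sum>i<d. w i \<xi> * (smooth c (H1 i) (\<lambda>l. s * X \<omega> l + s * w l \<xi>) - smooth c (H1 i) (\<lambda>l. s * X \<omega> l))) \<partial>M)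
         = (\<Sum>i<d. w i \<xi> * (g i (\<lambda>l. w l \<xi>) - g i (\<lambda>_. 0)))"
      proof (subst Bochner_Integration.integral_sum)
        show "(\<Sum>i<d. \<integral>\<omega>. w i \<xi> * (smooth c (H1 i) (\<lambda>l. s * X \<omega> l + s * w l \<xi>) - smooth c (H1 i) (\<lambda>l. s * X \<omega> l)) \<partial>M) =
          (\<Sum>i<d. w i \<xi> * (g i (\<lambda>l. w l \<xi>) - g i (\<lambda>_. 0)))"
          by (intro sum.cong refl, subst integral_mult_right_zero, subst Bochner_Integration.integral_diff) (auto simp: g_def U1i U1i0)
      qed (auto intro!: integrable_mult_right Bochner_Integration.integrable_diff U1i U1i0)
      have e2: "(\<integral>\<omega>. (\<Sum>i<d. \<Sum>j<d. w i \<xi> * w j \<xi> * smooth c (H2 i j) (\<lambda>l. s * X \<omega> l)) \<partial>M) = (\<Sum>i<d. \<Sum>j<d. w i \<xi> * w j \<xi> * h i j)"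
      proof (subst Bochner_Integration.integral_sum)
        show "(\<Sum>i<d. \<integral>\<omega>. (\<Sum>j<d. w i \<xi> * w j \<xi> * smooth c (H2 i j) (\<lambda>l. s * X \<omega> l)) \<partial>M) = (\<Sum>i<d. \<Sum>j<d. w i \<xi> * w j \<xi> * h i j)"
          by (intro sum.cong refl, subst Bochner_Integration.integral_sum) (auto simp: h_def intro!: integrable_mult_right U2i)
      qed (auto intro!: Bochner_Integration.integrable_sum integrable_mult_right U2i)
      show ?thesis unfolding T_def e1[symmetric] e2[symmetric]
        by (subst Bochner_Integration.integral_diff)
           (auto intro!: Bochner_Integration.integrable_sum integrable_mult_right Bochner_Integration.integrable_diff U1i U1i0 U2i)
    qed
    finally have RT: "R \<xi> = (\<integral>\<omega>. T \<omega> \<partial>M)" .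
    have Tb: "\<bar>T \<omega>\<bar> \<le> D \<xi> / c" for \<omega>
    proof -
      have "\<bar>T \<omega>\<bar> \<le> s\<^sup>2 * (D \<xi> / c)"
        unfolding T_def
      proof (rule taylor_smooth)
        show "\<bar>\<Sum>i<d. \<Sum>j<d. \<Sum>k<d. w i \<xi> * w j \<xi> * w k \<xi> * smooth c (H3 i j k) y\<bar> \<le> D \<xi> / c" for y
          using D[OF c \<xi>, of y] c by (simp add: pos_le_divide_eq mult.commute)
      qed (use s in simp)
      also have "\<dots> \<le> 1 * (D \<xi> / c)"
      proof (rule mult_right_mono)
        show "s\<^sup>2 \<le> 1" using s by (intro power_le_one) auto
        have "0 \<le> D \<xi>" using D[OF c \<xi>, of undefined] c by (smt (verit) mult_nonneg_nonneg abs_ge_zero)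
        thus "0 \<le> D \<xi> / c" using c by simp
      qed
      finally show ?thesis by simp
    qed
    have "\<bar>R \<xi>\<bar> \<le> (\<integral>\<omega>. \<bar>T \<omega>\<bar> \<partial>M)" unfolding RT by (rule integral_abs_bound)
    also have "\<dots> \<le> (\<integral>\<omega>. D \<xi> / c \<partial>M)" by (rule integral_mono[OF integrable_abs[OF Ti]]) (use Tb in auto)
    finally have "\<bar>R \<xi>\<bar> \<le> D \<xi> / c" by (simp add: pois.prob_space)
    thus ?thesis using c by (simp add: abs_mult pos_le_divide_eq mult.commute)
  qed
  have "\<bar>\<Phi>' \<theta>\<bar> = \<bar>\<integral>\<xi>. c * R \<xi> \<partial>\<Lambda>\<bar>" unfolding eq R_def by simp
  also have "\<dots> \<le> (\<integral>\<xi>. \<bar>c * R \<xi>\<bar> \<partial>\<Lambda>)" by (rule integral_abs_bound)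
  also have "\<dots> \<le> (\<integral>\<xi>. D \<xi> \<partial>\<Lambda>)"
    by (rule integral_mono[OF integrable_abs[OF integrable_mult_right[OF Ri]] Di Rb])
  finally show ?thesis .
qed

text \<open>
  The mean value theorem for \<open>\<Phi>\<close> between the angles 0, which gives Z, and \<open>\<pi>/2\<close>, which gives X.
\<close>

theorem gaussian_comparison:
  assumes Di: "integrable \<Lambda> D"
    and D: "\<And>c \<xi> y. 0 < c \<Longrightarrow> c \<le> 1 \<Longrightarrow> \<xi> \<in> space \<Lambda> \<Longrightarrow>
       c * \<bar>\<Sum>i<d. \<Sum>j<d. \<Sum>k<d. w i \<xi> * w j \<xi> * w k \<xi> * smooth c (H3 i j k) y\<bar> \<le> D \<xi>"
  shows "\<bar>(\<integral>\<omega>. H (X \<omega>) \<partial>M) - (\<integral>\<omega>. H (\<lambda>i. Z i \<omega>) \<partial>P)\<bar> \<le> 2 * (\<integral>\<xi>. D \<xi> \<partial>\<Lambda>)"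
proof -
  obtain z where z: "0 < z" "z < pi / 2" "\<Phi> (pi / 2) - \<Phi> 0 = (pi / 2 - 0) * \<Phi>' z"
    using MVT2[of 0 "pi / 2" \<Phi> \<Phi>'] \<Phi>_deriv by auto
  have b: "\<bar>\<Phi>' z\<bar> \<le> (\<integral>\<xi>. D \<xi> \<partial>\<Lambda>)" by (rule \<Phi>'_bound[OF z(1,2) Di D])
  have "\<bar>\<Phi> (pi / 2) - \<Phi> 0\<bar> = pi / 2 * \<bar>\<Phi>' z\<bar>" unfolding z(3) by (simp add: abs_mult)
  also have "\<dots> \<le> 2 * (\<integral>\<xi>. D \<xi> \<partial>\<Lambda>)" using b pi_less_4 by (intro mult_mono) auto
  finally have "\<bar>\<Phi> (pi / 2) - \<Phi> 0\<bar> \<le> 2 * (\<integral>\<xi>. D \<xi> \<partial>\<Lambda>)" .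
  moreover have "\<Phi> (pi / 2) = (\<integral>\<omega>. H (X \<omega>) \<partial>M)"
  proof -
    have "\<Phi> (pi / 2) = (\<integral>p. H (X (fst p)) \<partial>(M \<Otimes>\<^sub>M P))" by (simp add: \<Phi>_def Y_def[abs_def])
    also have "\<dots> = (\<integral>\<omega>. H (X \<omega>) \<partial>distr (M \<Otimes>\<^sub>M P) M fst)"
      by (rule integral_distr[symmetric]) (use measurable_compose[OF Xv_measurable C1_on_measurable[OF H]] in auto)
    finally show ?thesis by (simp add: gauss.distr_pair_fst)
  qed
  moreover have "\<Phi> 0 = (\<integral>\<omega>. H (\<lambda>i. Z i \<omega>) \<partial>P)"
  proof -
    have hm: "(\<lambda>\<omega>. H (\<lambda>i. Z i \<omega>)) \<in> borel_measurable P" by (rule measurable_compose[OF gauss.Zvec_measurable C1_on_measurable[OF H]])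
    have "\<Phi> 0 = (\<integral>p. H (\<lambda>i. Z i (snd p)) \<partial>(M \<Otimes>\<^sub>M P))" by (simp add: \<Phi>_def Y_def[abs_def])
    also have "\<dots> = (\<integral>p. H (\<lambda>i. Z i (fst p)) \<partial>(P \<Otimes>\<^sub>M M))"
      using MP.integral_product_swap[of "\<lambda>p. H (\<lambda>i. Z i (snd p))"] measurable_compose[OF measurable_snd hm, of M]
      by (simp add: case_prod_unfold)
    also have "\<dots> = (\<integral>\<omega>. H (\<lambda>i. Z i \<omega>) \<partial>distr (P \<Otimes>\<^sub>M M) P fst)"
      by (rule integral_distr[symmetric]) (use hm in auto)
    finally show ?thesis by (simp add: pois.distr_pair_fst)
  qed
  ultimately show ?thesis by simp
qed

end

section \<open>Two bounds on the smoothed third derivative\<close>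

lemma C1_on_sum:
  assumes "finite I" "\<And>i. i \<in> I \<Longrightarrow> C1_on d (F i) (F' i)"
  shows "C1_on d (\<lambda>x. \<Sum>i\<in>I. F i x) (\<lambda>k x. \<Sum>i\<in>I. F' i k x)"
  unfolding C1_on_def
proof (intro conjI allI impI)
  fix x y :: "nat \<Rightarrow> real" assume eq: "\<forall>i<d. x i = y i"
  show "(\<Sum>i\<in>I. F i x) = (\<Sum>i\<in>I. F i y)"
  proof (intro sum.cong refl)
    fix i assume "i \<in> I"
    thus "F i x = F i y" using assms(2)[of i] eq by (simp add: C1_on_def)
  qed
next
  show "continuous_on UNIV (\<lambda>x. \<Sum>i\<in>I. F i x)"
    using assms(2) by (intro continuous_on_sum) (simp add: C1_on_def)
next
  fix k assume "k < d"
  thus "continuous_on UNIV (\<lambda>x. \<Sum>i\<in>I. F' i k x)"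
    using assms(2) by (intro continuous_on_sum) (simp add: C1_on_def)
next
  fix k x assume "k < d"
  thus "((\<lambda>s. \<Sum>i\<in>I. F i (x(k := s))) has_real_derivative (\<Sum>i\<in>I. F' i k x)) (at (x k))"
    using assms(2) by (intro DERIV_sum) (simp add: C1_on_def)
qed

lemma C1_on_cmult:
  assumes "C1_on d F F'"
  shows "C1_on d (\<lambda>x. c * F x) (\<lambda>k x. c * F' k x)"
  unfolding C1_on_def
proof (intro conjI allI impI)
  fix x y :: "nat \<Rightarrow> real" assume eq: "\<forall>i<d. x i = y i"
  hence "F x = F y" using assms unfolding C1_on_def by blast
  thus "c * F x = c * F y" by simp
next
  show "continuous_on UNIV (\<lambda>x. c * F x)"
    using assms by (intro continuous_intros) (simp add: C1_on_def)
next
  fix k assume "k < d"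
  thus "continuous_on UNIV (\<lambda>x. c * F' k x)"
    using assms by (intro continuous_intros) (simp add: C1_on_def)
next
  fix k x assume "k < d"
  thus "((\<lambda>s. c * F (x(k := s))) has_real_derivative c * F' k x) (at (x k))"
    using assms by (intro DERIV_cmult) (simp add: C1_on_def)
qed

context comparison
begin

lemma smooth_form_cube:
  assumes cube: "\<And>x. \<bar>\<Sum>i<d. \<Sum>j<d. \<Sum>k<d. v i * v j * v k * H3 i j k x\<bar> \<le> B"
  shows "\<bar>\<Sum>i<d. \<Sum>j<d. \<Sum>k<d. v i * v j * v k * smooth c (H3 i j k) y\<bar> \<le> B"
proof -
  define F where "F = (\<lambda>x. \<Sum>i<d. \<Sum>j<d. \<Sum>k<d. v i * v j * v k * H3 i j k x)"
  have Fm: "F \<in> borel_measurable borel"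
    unfolding F_def by (intro borel_measurable_sum borel_measurable_times borel_measurable_const H3m) auto
  have "smooth c F y = (\<Sum>i<d. \<Sum>j<d. \<Sum>k<d. v i * v j * v k * smooth c (H3 i j k) y)"
    unfolding smooth_def F_def
    by (subst Bochner_Integration.integral_sum; (intro sum.cong refl | intro Bochner_Integration.integrable_sum integrable_mult_right smooth_integrable[OF H3m b3]; simp)?)+ simp
  moreover have "\<bar>smooth c F y\<bar> \<le> B" by (rule smooth_bound[OF Fm]) (use cube in \<open>simp add: F_def\<close>)
  ultimately show ?thesis by simp
qed

text \<open>
  A third derivative in a direction v of the form \<open>\<kappa> S a\<close> costs no more than a second one. Gaussian
  integration by parts, applied to the function \<open>z \<mapsto> D\<^sup>2H(y + c z)[v, v]\<close> with the linear form \<open>a \<bullet> Z\<close>,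
  turns c times the derivative along \<open>S a\<close> into multiplication by \<open>a \<bullet> Z\<close>, whose first absolute
  moment is at most \<open>(1 + V a a) / 2\<close>.
\<close>

lemma smooth_form_square:
  assumes square: "\<And>x. \<bar>\<Sum>i<d. \<Sum>j<d. v i * v j * H2 i j x\<bar> \<le> B"
    and v: "\<And>i. i < d \<Longrightarrow> v i = \<kappa> * (\<Sum>j<d. a j * S j i)" and \<kappa>: "\<kappa> \<ge> 0"
    and a: "gauss.V a a \<le> 1"
  shows "\<bar>c * (\<Sum>i<d. \<Sum>j<d. \<Sum>k<d. v i * v j * v k * smooth c (H3 i j k) y)\<bar> \<le> \<kappa> * B"
proof -
  define F where "F = (\<lambda>z :: nat \<Rightarrow> real. \<Sum>i<d. \<Sum>j<d. v i * v j * H2 i j (\<lambda>l. y l + c * z l))"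
  define F' where "F' = (\<lambda>k (z :: nat \<Rightarrow> real). \<Sum>i<d. \<Sum>j<d. v i * v j * (c * H3 i j k (\<lambda>l. y l + c * z l)))"
  have F: "C1_on d F F'"
    unfolding F_def F'_def by (intro C1_on_sum C1_on_cmult C1_on_affine H2) auto
  have FB: "\<bar>F z\<bar> \<le> B" for z unfolding F_def by (rule square)
  have B: "B \<ge> 0" using order_trans[OF abs_ge_zero FB] .
  have F'B: "\<bar>F' k z\<bar> \<le> (\<Sum>i<d. \<Sum>j<d. \<bar>v i * v j\<bar> * \<bar>c\<bar>)" if "k < d" for k z
    unfolding F'_def
  proof (rule order_trans[OF sum_abs], rule sum_mono, rule order_trans[OF sum_abs], rule sum_mono)
    fix i j assume "i \<in> {..<d}" "j \<in> {..<d}"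
    hence "\<bar>c\<bar> * \<bar>H3 i j k (\<lambda>l. y l + c * z l)\<bar> \<le> \<bar>c\<bar> * 1" using b3 that by (intro mult_left_mono) auto
    thus "\<bar>v i * v j * (c * H3 i j k (\<lambda>l. y l + c * z l))\<bar> \<le> \<bar>v i * v j\<bar> * \<bar>c\<bar>"
      unfolding abs_mult[of "v i * v j"] by (intro mult_left_mono) (auto simp: abs_mult)
  qed
  have F'E: "(\<integral>\<omega>. F' k (\<lambda>i. Z i \<omega>) \<partial>P) = (\<Sum>i<d. \<Sum>j<d. v i * v j * (c * smooth c (H3 i j k) y))" if k: "k < d" for k
  proof -
    have i1: "integrable P (\<lambda>\<omega>. H3 i j k (\<lambda>l. y l + c * Z l \<omega>))" if "i < d" "j < d" for i j
      by (rule smooth_integrable[OF H3m b3]) (use k that in auto)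
    have "(\<integral>\<omega>. F' k (\<lambda>i. Z i \<omega>) \<partial>P) = (\<Sum>i<d. \<integral>\<omega>. (\<Sum>j<d. v i * v j * (c * H3 i j k (\<lambda>l. y l + c * Z l \<omega>))) \<partial>P)"
      unfolding F'_def by (rule Bochner_Integration.integral_sum) (intro Bochner_Integration.integrable_sum integrable_mult_right i1; simp)
    also have "\<dots> = (\<Sum>i<d. \<Sum>j<d. \<integral>\<omega>. v i * v j * (c * H3 i j k (\<lambda>l. y l + c * Z l \<omega>)) \<partial>P)"
      by (intro sum.cong refl, rule Bochner_Integration.integral_sum) (intro integrable_mult_right i1; simp)
    finally show ?thesis by (simp add: smooth_def)
  qed
  have sw: "(\<Sum>i<d. \<Sum>j<d. \<Sum>k<d. v i * v j * v k * smooth c (H3 i j k) y) = (\<Sum>k<d. v k * (\<Sum>i<d. \<Sum>j<d. v i * v j * smooth c (H3 i j k) y))"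
  proof -
    have "(\<Sum>k<d. v k * (\<Sum>i<d. \<Sum>j<d. v i * v j * smooth c (H3 i j k) y)) = (\<Sum>k<d. \<Sum>i<d. \<Sum>j<d. v i * v j * v k * smooth c (H3 i j k) y)"
      unfolding sum_distrib_left by (intro sum.cong refl) (simp only: mult_ac)
    also have "\<dots> = (\<Sum>i<d. \<Sum>k<d. \<Sum>j<d. v i * v j * v k * smooth c (H3 i j k) y)" by (rule sum.swap)
    also have "\<dots> = (\<Sum>i<d. \<Sum>j<d. \<Sum>k<d. v i * v j * v k * smooth c (H3 i j k) y)"
      by (rule sum.cong[OF refl], rule sum.swap)
    finally show ?thesis by simp
  qed
  have eq0: "c * (\<Sum>k<d. v k * (\<Sum>i<d. \<Sum>j<d. v i * v j * smooth c (H3 i j k) y))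
      = \<kappa> * (\<Sum>k<d. (\<Sum>j<d. a j * S j k) * (\<integral>\<omega>. F' k (\<lambda>i. Z i \<omega>) \<partial>P))"
    unfolding sum_distrib_left[of c] sum_distrib_left[of \<kappa>]
  proof (intro sum.cong refl)
    fix k assume "k \<in> {..<d}"
    hence k: "k < d" by simp
    have "(\<integral>\<omega>. F' k (\<lambda>i. Z i \<omega>) \<partial>P) = c * (\<Sum>i<d. \<Sum>j<d. v i * v j * smooth c (H3 i j k) y)"
      by (simp add: F'E[OF k] sum_distrib_left mult_ac)
    thus "c * (v k * (\<Sum>i<d. \<Sum>j<d. v i * v j * smooth c (H3 i j k) y)) = \<kappa> * ((\<Sum>j<d. a j * S j k) * (\<integral>\<omega>. F' k (\<lambda>i. Z i \<omega>) \<partial>P))"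
      by (simp only: v[OF k] mult_ac)
  qed
  also have "(\<Sum>k<d. (\<Sum>j<d. a j * S j k) * (\<integral>\<omega>. F' k (\<lambda>i. Z i \<omega>) \<partial>P)) = (\<integral>\<omega>. gauss.L a \<omega> * F (\<lambda>i. Z i \<omega>) \<partial>P)"
    by (rule gauss.gaussian_integration_by_parts[OF F F'B, symmetric])
  finally have eq: "c * (\<Sum>i<d. \<Sum>j<d. \<Sum>k<d. v i * v j * v k * smooth c (H3 i j k) y) = \<kappa> * (\<integral>\<omega>. gauss.L a \<omega> * F (\<lambda>i. Z i \<omega>) \<partial>P)" unfolding sw .
  have LLi: "integrable P (\<lambda>\<omega>. gauss.L a \<omega> * gauss.L a \<omega>)" by (rule gauss.LL_integrable)
  have "\<bar>\<integral>\<omega>. gauss.L a \<omega> * F (\<lambda>i. Z i \<omega>) \<partial>P\<bar> \<le> (\<integral>\<omega>. \<bar>gauss.L a \<omega> * F (\<lambda>i. Z i \<omega>)\<bar> \<partial>P)" by (rule integral_abs_bound)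
  also have "\<dots> \<le> (\<integral>\<omega>. B * ((1 + gauss.L a \<omega> * gauss.L a \<omega>) / 2) \<partial>P)"
  proof (rule integral_mono)
    show "integrable P (\<lambda>\<omega>. \<bar>gauss.L a \<omega> * F (\<lambda>i. Z i \<omega>)\<bar>)"
      by (rule integrable_abs[OF gauss.L_times_C1_integrable[OF F F'B]])
    show "integrable P (\<lambda>\<omega>. B * ((1 + gauss.L a \<omega> * gauss.L a \<omega>) / 2))" using LLi by simp
    fix \<omega>
    have "2 * \<bar>gauss.L a \<omega>\<bar> \<le> 1 + gauss.L a \<omega> * gauss.L a \<omega>"
      using sum_squares_bound[of 1 "\<bar>gauss.L a \<omega>\<bar>"] by (simp add: power2_eq_square)
    hence "\<bar>gauss.L a \<omega>\<bar> \<le> (1 + gauss.L a \<omega> * gauss.L a \<omega>) / 2" by simp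
    hence "\<bar>F (\<lambda>i. Z i \<omega>)\<bar> * \<bar>gauss.L a \<omega>\<bar> \<le> B * ((1 + gauss.L a \<omega> * gauss.L a \<omega>) / 2)"
      using FB B by (intro mult_mono) auto
    thus "\<bar>gauss.L a \<omega> * F (\<lambda>i. Z i \<omega>)\<bar> \<le> B * ((1 + gauss.L a \<omega> * gauss.L a \<omega>) / 2)"
      by (simp add: abs_mult mult.commute)
  qed
  also have "\<dots> = B * ((1 + gauss.V a a) / 2)"
    using LLi by (simp add: gauss.expectation_LL gauss.prob_space)
  also have "\<dots> \<le> B * 1" using a B by (intro mult_left_mono) auto
  finally show ?thesis unfolding eq abs_mult using \<kappa> by (simp add: mult_left_mono)
qed

end

section \<open>Solving the covariance system of the Legendre kernel\<close>

definition L2 :: "'a measure \<Rightarrow> ('a \<Rightarrow> real) \<Rightarrow> bool" where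
  "L2 M f \<longleftrightarrow> f \<in> borel_measurable M \<and> integrable M (\<lambda>x. (f x)\<^sup>2)"

lemma L2_mult_integrable:
  assumes "L2 M f" "L2 M g"
  shows "integrable M (\<lambda>x. f x * g x)"
  using assms unfolding L2_def by (intro integrable_product_of_squares) auto

lemma L2_cmult: "L2 M f \<Longrightarrow> L2 M (\<lambda>x. c * f x)"
  unfolding L2_def by (auto intro!: borel_measurable_times simp: power_mult_distrib)

lemma L2_add:
  assumes "L2 M f" "L2 M g"
  shows "L2 M (\<lambda>x. f x + g x)"
proof -
  have "integrable M (\<lambda>x. (f x)\<^sup>2 + (g x)\<^sup>2 + 2 * (f x * g x))"
    using assms L2_mult_integrable[OF assms] by (simp add: L2_def)
  moreover have "(\<lambda>x. f x + g x) \<in> borel_measurable M" using assms by (intro borel_measurable_add) (auto simp: L2_def)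
  ultimately show ?thesis by (simp add: L2_def power2_sum mult.assoc)
qed

lemma L2_diff: "L2 M f \<Longrightarrow> L2 M g \<Longrightarrow> L2 M (\<lambda>x. f x - g x)"
  using L2_add[of M f "\<lambda>x. (- 1) * g x"] L2_cmult[of M g "- 1"] by simp

lemma L2_sum:
  assumes "finite I" "\<And>i. i \<in> I \<Longrightarrow> L2 M (f i)"
  shows "L2 M (\<lambda>x. \<Sum>i\<in>I. f i x)"
  using assms
proof (induction I rule: finite_induct)
  case empty
  show ?case by (simp add: L2_def)
qed (auto intro!: L2_add)

text \<open>
  Gram-Schmidt: u is the part of the last function orthogonal to the previous ones, and the residual
  r of z is corrected by a multiple t of u. If \<open>u = 0\<close> almost everywhere, then \<open>\<rho> = 0\<close>, and the value
  \<open>t = 0\<close> of the division by zero is a correct choice.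
\<close>

lemma L2_projection:
  fixes v :: "nat \<Rightarrow> 'a \<Rightarrow> real"
  assumes v: "\<And>i. i < n \<Longrightarrow> L2 M (v i)" and z: "L2 M z"
  shows "\<exists>a. \<forall>i<n. (\<integral>x. v i x * (z x - (\<Sum>j<n. a j * v j x)) \<partial>M) = 0"
  using assms
proof (induction n arbitrary: z)
  case (Suc n)
  have vL: "L2 M (v i)" if "i \<le> n" for i using Suc.prems(1) that by simp
  note IH = Suc.IH[OF vL[OF less_imp_le]]
  obtain a where a: "\<And>i. i < n \<Longrightarrow> (\<integral>x. v i x * (z x - (\<Sum>j<n. a j * v j x)) \<partial>M) = 0"
    using IH[OF _ Suc.prems(2)] by blast
  obtain b where b: "\<And>i. i < n \<Longrightarrow> (\<integral>x. v i x * (v n x - (\<Sum>j<n. b j * v j x)) \<partial>M) = 0"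
    using IH[OF _ vL[OF order.refl]] by blast
  define r where "r = (\<lambda>x. z x - (\<Sum>j<n. a j * v j x))"
  define u where "u = (\<lambda>x. v n x - (\<Sum>j<n. b j * v j x))"
  have rL: "L2 M r" unfolding r_def by (intro L2_diff L2_sum L2_cmult Suc.prems(2) vL) auto
  have uL: "L2 M u" unfolding u_def by (intro L2_diff L2_sum L2_cmult vL) auto
  define \<rho> where "\<rho> = (\<integral>x. u x * u x \<partial>M)"
  define t where "t = (\<integral>x. u x * r x \<partial>M) / \<rho>"
  define a' where "a' = (\<lambda>j. if j < n then a j - t * b j else t)"
  have t: "(\<integral>x. u x * r x \<partial>M) = t * \<rho>"
  proof (cases "\<rho> = 0")
    case True
    have "AE x in M. (u x)\<^sup>2 = 0"
      using integral_nonneg_eq_0_iff_AE[of M "\<lambda>x. (u x)\<^sup>2"] uL True by (simp add: L2_def \<rho>_def power2_eq_square)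
    hence "(\<integral>x. u x * r x \<partial>M) = (\<integral>x. 0 \<partial>M)"
      using uL rL by (intro integral_cong_AE) (auto simp: L2_def)
    thus ?thesis using True by simp
  qed (simp add: t_def)
  define r' where "r' = (\<lambda>x. r x - t * u x)"
  have r'L: "L2 M r'" unfolding r'_def by (intro L2_diff L2_cmult rL uL)
  have r': "z x - (\<Sum>j<Suc n. a' j * v j x) = r' x" for x
  proof -
    have "(\<Sum>j<n. a' j * v j x) = (\<Sum>j<n. a j * v j x) - t * (\<Sum>j<n. b j * v j x)"
      by (simp add: a'_def left_diff_distrib sum_subtractf sum_distrib_left mult.assoc)
    thus ?thesis by (simp add: a'_def r'_def r_def u_def algebra_simps)
  qed
  have split: "(\<integral>x. f x * r' x \<partial>M) = (\<integral>x. f x * r x \<partial>M) - t * (\<integral>x. f x * u x \<partial>M)" if "L2 M f" for f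
  proof -
    have "(\<integral>x. f x * r' x \<partial>M) = (\<integral>x. f x * r x - t * (f x * u x) \<partial>M)"
      by (simp add: r'_def algebra_simps)
    also have "\<dots> = (\<integral>x. f x * r x \<partial>M) - (\<integral>x. t * (f x * u x) \<partial>M)"
      by (intro Bochner_Integration.integral_diff integrable_mult_right L2_mult_integrable that rL uL)
    finally show ?thesis by simp
  qed
  have orth: "(\<integral>x. v i x * r' x \<partial>M) = 0" if "i < n" for i
    using split[OF vL, of i] a[OF that] b[OF that] that by (simp add: r_def u_def)
  have "(\<integral>x. v n x * r' x \<partial>M) = 0"
  proof -
    have "(\<integral>x. v n x * r' x \<partial>M) = (\<integral>x. u x * r' x + (\<Sum>j<n. b j * (v j x * r' x)) \<partial>M)"
      by (simp add: u_def left_diff_distrib sum_distrib_right mult.assoc)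
    also have "\<dots> = (\<integral>x. u x * r' x \<partial>M) + (\<integral>x. (\<Sum>j<n. b j * (v j x * r' x)) \<partial>M)"
      by (intro Bochner_Integration.integral_add Bochner_Integration.integrable_sum integrable_mult_right L2_mult_integrable uL r'L vL) auto
    also have "(\<integral>x. (\<Sum>j<n. b j * (v j x * r' x)) \<partial>M) = (\<Sum>j<n. \<integral>x. b j * (v j x * r' x) \<partial>M)"
      by (intro Bochner_Integration.integral_sum integrable_mult_right L2_mult_integrable r'L vL) auto
    also have "\<dots> = 0" using orth by simp
    also have "(\<integral>x. u x * r' x \<partial>M) = 0" using split[OF uL] t by (simp add: \<rho>_def)
    finally show ?thesis by simp
  qed
  with orth have "\<forall>i<Suc n. (\<integral>x. v i x * (z x - (\<Sum>j<Suc n. a' j * v j x)) \<partial>M) = 0"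
    unfolding r' by (auto simp: less_Suc_eq)
  thus ?case by blast
qed simp

text \<open>
  The coefficients of the orthogonal projection of z solve the normal equations even for a singular
  Gram matrix; the inequality is Bessel's.
\<close>

lemma gram_solve:
  fixes v :: "nat \<Rightarrow> 'a \<Rightarrow> real"
  assumes v: "\<And>i. i < n \<Longrightarrow> L2 M (v i)" and z: "L2 M z"
  obtains a where "\<And>i. i < n \<Longrightarrow> (\<Sum>j<n. a j * (\<integral>x. v j x * v i x \<partial>M)) = (\<integral>x. v i x * z x \<partial>M)"
    and "(\<Sum>i<n. \<Sum>j<n. a i * a j * (\<integral>x. v i x * v j x \<partial>M)) \<le> (\<integral>x. z x * z x \<partial>M)"
proof -
  obtain a where a: "\<And>i. i < n \<Longrightarrow> (\<integral>x. v i x * (z x - (\<Sum>j<n. a j * v j x)) \<partial>M) = 0"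
    using L2_projection[of n M v z] v z by blast
  define c where "c = (\<lambda>x. \<Sum>j<n. a j * v j x)"
  have cL: "L2 M c" unfolding c_def by (intro L2_sum L2_cmult v) auto
  have vc: "(\<integral>x. f x * c x \<partial>M) = (\<Sum>j<n. a j * (\<integral>x. v j x * f x \<partial>M))" if "L2 M f" for f
  proof -
    have "(\<integral>x. f x * c x \<partial>M) = (\<integral>x. (\<Sum>j<n. a j * (v j x * f x)) \<partial>M)"
      by (simp add: c_def sum_distrib_left mult_ac)
    also have "\<dots> = (\<Sum>j<n. \<integral>x. a j * (v j x * f x) \<partial>M)"
      by (intro Bochner_Integration.integral_sum integrable_mult_right L2_mult_integrable v that) auto
    finally show ?thesis by simp
  qed
  have 1: "(\<Sum>j<n. a j * (\<integral>x. v j x * v i x \<partial>M)) = (\<integral>x. v i x * z x \<partial>M)" if i: "i < n" for i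
  proof -
    have "(\<integral>x. v i x * z x \<partial>M) - (\<integral>x. v i x * c x \<partial>M) = (\<integral>x. v i x * z x - v i x * c x \<partial>M)"
      by (intro Bochner_Integration.integral_diff[symmetric] L2_mult_integrable v z cL i)
    also have "\<dots> = 0" using a[OF i] by (simp add: c_def right_diff_distrib)
    finally show ?thesis using vc[OF v[OF i]] by simp
  qed
  have cc: "(\<integral>x. c x * c x \<partial>M) = (\<Sum>i<n. \<Sum>j<n. a i * a j * (\<integral>x. v i x * v j x \<partial>M))"
  proof -
    have "(\<integral>x. c x * c x \<partial>M) = (\<Sum>j<n. a j * (\<integral>x. c x * v j x \<partial>M))"
      using vc[OF cL] by (simp add: mult.commute)
    also have "\<dots> = (\<Sum>j<n. a j * (\<Sum>i<n. a i * (\<integral>x. v i x * v j x \<partial>M)))"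
      by (intro sum.cong refl arg_cong2[of _ _ _ _ "(*)"]) (simp add: vc v mult.commute[of "c _"])
    also have "\<dots> = (\<Sum>i<n. \<Sum>j<n. a i * a j * (\<integral>x. v i x * v j x \<partial>M))"
      unfolding sum_distrib_left by (subst sum.swap) (simp add: mult_ac)
    finally show ?thesis .
  qed
  have zc: "(\<integral>x. z x * c x \<partial>M) = (\<integral>x. c x * c x \<partial>M)"
  proof -
    have "(\<integral>x. z x * c x \<partial>M) = (\<Sum>j<n. a j * (\<integral>x. v j x * z x \<partial>M))" by (rule vc[OF z])
    also have "\<dots> = (\<Sum>j<n. a j * (\<integral>x. v j x * c x \<partial>M))"
      by (intro sum.cong refl arg_cong2[of _ _ _ _ "(*)"]) (simp add: 1[symmetric] vc v)
    also have "\<dots> = (\<integral>x. c x * c x \<partial>M)" by (rule vc[OF cL, symmetric])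
    finally show ?thesis .
  qed
  have "0 \<le> (\<integral>x. (z x - c x) * (z x - c x) \<partial>M)" by (intro Bochner_Integration.integral_nonneg) simp
  also have "\<dots> = (\<integral>x. z x * z x - 2 * (z x * c x) + c x * c x \<partial>M)" by (simp add: algebra_simps)
  also have "\<dots> = (\<integral>x. z x * z x \<partial>M) - 2 * (\<integral>x. z x * c x \<partial>M) + (\<integral>x. c x * c x \<partial>M)"
    using L2_mult_integrable[OF z z] L2_mult_integrable[OF z cL] L2_mult_integrable[OF cL cL] by simp
  finally have "(\<Sum>i<n. \<Sum>j<n. a i * a j * (\<integral>x. v i x * v j x \<partial>M)) \<le> (\<integral>x. z x * z x \<partial>M)"
    unfolding zc cc by simp
  with 1 that show ?thesis by blast
qed

text \<open>
  Up to the factor \<open>4 pi / (2 n + 1)\<close>, S is the Gram matrix of the functions \<open>P(x\<^sub>i \<bullet> \<zeta>)\<close> of \<open>\<zeta>\<close> and the right-hand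
  side consists of their inner products with \<open>P(\<xi> \<bullet> \<zeta>)\<close>, a function of squared norm 1 in the same scale. So
  the vector of the weights at \<open>\<xi>\<close> is S a, up to a scalar factor, with \<open>a \<bullet> Z\<close> of variance at most 1.
\<close>

lemma legendre_kernel_solve:
  fixes x :: "nat \<Rightarrow> real ^ 3"
  assumes n: "n \<ge> 1" and x: "\<And>i. i < d \<Longrightarrow> norm (x i) = 1" and \<xi>: "norm \<xi> = 1"
  defines "S \<equiv> \<lambda>i j. poly (legendre n) (x i \<bullet> x j)"
  shows "\<exists>a. (\<forall>i<d. (\<Sum>j<d. a j * S j i) = poly (legendre n) (x i \<bullet> \<xi>)) \<and>
             (\<Sum>i<d. \<Sum>j<d. a i * a j * S i j) \<le> 1"
proof -
  define \<gamma> where "\<gamma> = 4 * pi / (2 * real n + 1)"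
  have \<gamma>: "\<gamma> > 0" by (simp add: \<gamma>_def)
  have L: "L2 sphere_measure (\<lambda>\<zeta>. poly (legendre n) (y \<bullet> \<zeta>))" for y :: "real ^ 3"
    unfolding L2_def
  proof
    have "continuous_on UNIV (\<lambda>\<zeta>. poly (legendre n) (y \<bullet> \<zeta>))" by (intro continuous_intros)
    thus "(\<lambda>\<zeta>. poly (legendre n) (y \<bullet> \<zeta>)) \<in> borel_measurable sphere_measure"
      by (intro measurable_sphere_measure borel_measurable_continuous_onI)
    show "integrable sphere_measure (\<lambda>\<zeta>. (poly (legendre n) (y \<bullet> \<zeta>))\<^sup>2)"
      by (intro continuous_integrable_sphere continuous_intros)
  qed
  obtain a where a: "\<And>i. i < d \<Longrightarrow> (\<Sum>j<d. a j * (\<integral>\<zeta>. poly (legendre n) (x j \<bullet> \<zeta>) * poly (legendre n) (x i \<bullet> \<zeta>) \<partial>sphere_measure))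
        = (\<integral>\<zeta>. poly (legendre n) (x i \<bullet> \<zeta>) * poly (legendre n) (\<xi> \<bullet> \<zeta>) \<partial>sphere_measure)"
    and a1: "(\<Sum>i<d. \<Sum>j<d. a i * a j * (\<integral>\<zeta>. poly (legendre n) (x i \<bullet> \<zeta>) * poly (legendre n) (x j \<bullet> \<zeta>) \<partial>sphere_measure))
        \<le> (\<integral>\<zeta>. poly (legendre n) (\<xi> \<bullet> \<zeta>) * poly (legendre n) (\<xi> \<bullet> \<zeta>) \<partial>sphere_measure)"
    by (rule gram_solve[of d sphere_measure "\<lambda>i \<zeta>. poly (legendre n) (x i \<bullet> \<zeta>)" "\<lambda>\<zeta>. poly (legendre n) (\<xi> \<bullet> \<zeta>)"]) (use L in blast)+
  note rep = legendre_reproducing[OF n]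
  show ?thesis
  proof (intro exI[of _ a] conjI allI impI)
    fix i assume i: "i < d"
    have "(\<Sum>j<d. a j * (\<gamma> * S j i)) = \<gamma> * poly (legendre n) (x i \<bullet> \<xi>)"
      using a[OF i] x i \<xi> by (simp add: rep S_def \<gamma>_def)
    moreover have "(\<Sum>j<d. a j * (\<gamma> * S j i)) = \<gamma> * (\<Sum>j<d. a j * S j i)"
      by (simp add: sum_distrib_left mult_ac)
    ultimately show "(\<Sum>j<d. a j * S j i) = poly (legendre n) (x i \<bullet> \<xi>)" using \<gamma> by simp
  next
    have "\<xi> \<bullet> \<xi> = 1" using \<xi> by (simp add: norm_eq_1)
    hence "(\<Sum>i<d. \<Sum>j<d. a i * a j * (\<gamma> * S i j)) \<le> \<gamma>"
      using a1 x \<xi> by (simp add: rep S_def \<gamma>_def legendre_1)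
    moreover have "(\<Sum>i<d. \<Sum>j<d. a i * a j * (\<gamma> * S i j)) = \<gamma> * (\<Sum>i<d. \<Sum>j<d. a i * a j * S i j)"
      by (simp add: sum_distrib_left mult_ac)
    ultimately have "\<gamma> * (\<Sum>i<d. \<Sum>j<d. a i * a j * S i j) \<le> \<gamma> * 1" by simp
    thus "(\<Sum>i<d. \<Sum>j<d. a i * a j * S i j) \<le> 1" using \<gamma> by (simp add: mult_le_cancel_left_pos del: mult_1_right)
  qed
qed

section \<open>Test functions of class $C^3$\<close>

lemma continuous_on_restrict: "continuous_on UNIV (\<lambda>x :: nat \<Rightarrow> real. restrict x {..<d})"
proof (rule continuous_on_coordinatewise_then_product)
  fix i
  show "continuous_on UNIV (\<lambda>x :: nat \<Rightarrow> real. restrict x {..<d} i)"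
    by (cases "i < d") (auto simp: restrict_def intro: continuous_on_product_coordinates)
qed

lemma restrict_in_Rd: "restrict x {..<d} \<in> Rd d"
  by (simp add: Rd_def)

lemma continuous_on_Rd_restrict:
  assumes "continuous_on (Rd d) h"
  shows "continuous_on UNIV (\<lambda>x. h (restrict x {..<d}))"
  by (rule continuous_on_compose2[OF assms continuous_on_restrict]) (use restrict_in_Rd in auto)

lemma Ck_continuous: "Ck d k h \<Longrightarrow> continuous_on (Rd d) h"
  by (cases k) auto

lemma Ck_C1_on:
  assumes "Ck d (Suc k) h"
  shows "C1_on d (\<lambda>x. h (restrict x {..<d})) (\<lambda>i x. partial_deriv i h (restrict x {..<d}))"
  unfolding C1_on_def
proof (intro conjI allI impI)
  fix x y :: "nat \<Rightarrow> real" assume "\<forall>i<d. x i = y i"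
  hence "restrict x {..<d} = restrict y {..<d}" by (auto simp: restrict_def)
  thus "h (restrict x {..<d}) = h (restrict y {..<d})" by simp
next
  show "continuous_on UNIV (\<lambda>x. h (restrict x {..<d}))"
    using assms by (intro continuous_on_Rd_restrict) simp
next
  fix i assume "i < d"
  thus "continuous_on UNIV (\<lambda>x. partial_deriv i h (restrict x {..<d}))"
    using assms by (intro continuous_on_Rd_restrict Ck_continuous[of d k]) simp
next
  fix i and x :: "nat \<Rightarrow> real" assume i: "i < d"
  have upd: "(restrict x {..<d})(i := s) = restrict (x(i := s)) {..<d}" for s using i by (auto simp: restrict_def fun_eq_iff)
  have "(\<lambda>s. h ((restrict x {..<d})(i := s))) differentiable (at (restrict x {..<d} i))"
    using assms i restrict_in_Rd[of x d] unfolding Ck.simps by blast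
  hence "((\<lambda>s. h ((restrict x {..<d})(i := s))) has_real_derivative partial_deriv i h (restrict x {..<d})) (at (restrict x {..<d} i))"
    unfolding partial_deriv_def by (simp add: DERIV_deriv_iff_real_differentiable)
  thus "((\<lambda>s. h (restrict (x(i := s)) {..<d})) has_real_derivative partial_deriv i h (restrict x {..<d})) (at (x i))"
    using i by (simp add: upd)
qed

lemma C3_norm_deriv_form:
  assumes h: "C3_norm d h < 1" and us: "length us \<in> {1, 2, 3}" and unit: "\<And>u. u \<in> set us \<Longrightarrow> L2_set u {..<d} = 1"
    and x: "x \<in> Rd d"
  shows "\<bar>deriv_form d us h x\<bar> \<le> 1"
proof -
  define vs where "vs = map (\<lambda>u. restrict u {..<d}) us"
  have "deriv_form d vs h x = deriv_form d us h x"
    unfolding vs_def by (induction us arbitrary: h) auto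
  moreover have "ereal \<bar>deriv_form d vs h x\<bar> \<le> deriv_op_norm d (length us) h x"
    unfolding deriv_op_norm_def
  proof (rule SUP_upper)
    have "L2_set (restrict u {..<d}) {..<d} = L2_set u {..<d}" for u by (intro L2_set_cong) auto
    thus "vs \<in> {vs. length vs = length us \<and> (\<forall>v\<in>set vs. v \<in> Rd d \<and> L2_set v {..<d} = 1)}"
      using unit by (auto simp: vs_def Rd_def)
  qed
  moreover have "deriv_op_norm d (length us) h x \<le> C3_norm d h"
    unfolding C3_norm_def by (rule SUP_upper2[OF us SUP_upper[OF x]])
  ultimately have "ereal \<bar>deriv_form d us h x\<bar> < 1" using h by (metis order_le_less_trans)
  thus ?thesis by (simp add: one_ereal_def)
qed

lemma sum_delta_left:
  fixes d i :: nat
  assumes "i < d" shows "(\<Sum>j<d. (if j = i then 1 else 0) * f j) = (f i :: real)"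
proof -
  have "(\<Sum>j<d. (if j = i then 1 else 0) * f j) = (\<Sum>j<d. if j = i then f j else 0)" by (intro sum.cong) auto
  thus ?thesis using assms by simp
qed

lemma L2_set_unit:
  fixes d i :: nat
  assumes "i < d" shows "L2_set (\<lambda>j. if j = i then 1 else 0) {..<d} = 1"
proof -
  have "(\<Sum>j<d. (if j = i then 1 else 0)\<^sup>2) = (\<Sum>j<d. if j = i then 1 else 0 :: real)" by (intro sum.cong) auto
  thus ?thesis using assms by (simp add: L2_set_def)
qed

lemma L2_set_normalize:
  fixes d :: nat
  obtains u where "L2_set u {..<d} = 1" and "\<And>i. i < d \<Longrightarrow> v i = L2_set v {..<d} * u i"
  | "\<And>i. i < d \<Longrightarrow> v i = 0"
proof (cases "L2_set v {..<d} = 0")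
  case True
  hence "\<forall>i\<in>{..<d}. v i = 0" by (subst (asm) L2_set_eq_0_iff) auto
  thus ?thesis by (intro that(2)) simp
next
  case False
  hence "L2_set v {..<d} > 0" using L2_set_nonneg[of v "{..<d}"] by (metis less_le)
  moreover from this have "L2_set (\<lambda>i. v i / L2_set v {..<d}) {..<d} = 1"
    using L2_set_left_distrib[of "1 / L2_set v {..<d}" v "{..<d}"] by simp
  ultimately show ?thesis by (intro that(1)[of "\<lambda>i. v i / L2_set v {..<d}"]) auto
qed

text \<open>
  Entries of the derivatives are their values at unit coordinate vectors; the diagonal forms follow
  by scaling v to length 1.
\<close>

lemma C3_norm_bounds:
  assumes h: "C3_norm d h < 1" and x: "x \<in> Rd d"
  shows "i < d \<Longrightarrow> \<bar>partial_deriv i h x\<bar> \<le> 1"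
    and "i < d \<Longrightarrow> j < d \<Longrightarrow> \<bar>partial_deriv j (partial_deriv i h) x\<bar> \<le> 1"
    and "i < d \<Longrightarrow> j < d \<Longrightarrow> k < d \<Longrightarrow> \<bar>partial_deriv k (partial_deriv j (partial_deriv i h)) x\<bar> \<le> 1"
    and "\<bar>\<Sum>i<d. \<Sum>j<d. v i * v j * partial_deriv j (partial_deriv i h) x\<bar> \<le> (L2_set v {..<d})\<^sup>2"
    and "\<bar>\<Sum>i<d. \<Sum>j<d. \<Sum>k<d. v i * v j * v k * partial_deriv k (partial_deriv j (partial_deriv i h)) x\<bar> \<le> L2_set v {..<d} ^ 3"
proof -
  let ?e = "\<lambda>i j :: nat. if j = i then 1 else 0 :: real"
  note B = C3_norm_deriv_form[OF h _ _ x]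
  show "\<bar>partial_deriv i h x\<bar> \<le> 1" if "i < d"
    using B[of "[?e i]"] that by (simp add: sum_delta_left L2_set_unit)
  show "\<bar>partial_deriv j (partial_deriv i h) x\<bar> \<le> 1" if "i < d" "j < d"
    using B[of "[?e i, ?e j]"] that by (force simp: sum_delta_left L2_set_unit)
  show "\<bar>partial_deriv k (partial_deriv j (partial_deriv i h)) x\<bar> \<le> 1" if "i < d" "j < d" "k < d"
    using B[of "[?e i, ?e j, ?e k]"] that by (force simp: sum_delta_left L2_set_unit)
  show "\<bar>\<Sum>i<d. \<Sum>j<d. v i * v j * partial_deriv j (partial_deriv i h) x\<bar> \<le> (L2_set v {..<d})\<^sup>2"
  proof (cases rule: L2_set_normalize[of d v])
    case (1 u)
    let ?r = "L2_set v {..<d}"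
    have "(\<Sum>i<d. \<Sum>j<d. v i * v j * partial_deriv j (partial_deriv i h) x) = ?r\<^sup>2 * deriv_form d [u, u] h x"
      by (simp add: sum_distrib_left, intro sum.cong refl) (simp add: 1(2) power2_eq_square)
    moreover have "\<bar>deriv_form d [u, u] h x\<bar> \<le> 1" by (rule B) (use 1 in auto)
    ultimately show ?thesis
      using mult_left_mono[of "\<bar>deriv_form d [u, u] h x\<bar>" 1 "?r\<^sup>2"] by (simp add: abs_mult)
  qed simp
  show "\<bar>\<Sum>i<d. \<Sum>j<d. \<Sum>k<d. v i * v j * v k * partial_deriv k (partial_deriv j (partial_deriv i h)) x\<bar> \<le> L2_set v {..<d} ^ 3"
  proof (cases rule: L2_set_normalize[of d v])
    case (1 u)
    let ?r = "L2_set v {..<d}"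
    have "(\<Sum>i<d. \<Sum>j<d. \<Sum>k<d. v i * v j * v k * partial_deriv k (partial_deriv j (partial_deriv i h)) x) = ?r ^ 3 * deriv_form d [u, u, u] h x"
      by (simp add: sum_distrib_left, intro sum.cong refl) (simp add: 1(2) power3_eq_cube)
    moreover have "\<bar>deriv_form d [u, u, u] h x\<bar> \<le> 1" by (rule B) (use 1 in auto)
    ultimately show ?thesis
      using mult_left_mono[of "\<bar>deriv_form d [u, u, u] h x\<bar>" 1 "?r ^ 3"] by (simp add: abs_mult L2_set_nonneg)
  qed simp
qed

section \<open>Poisson spherical random waves\<close>

lemma integral_scale_measure:
  fixes f :: "'a \<Rightarrow> real"
  assumes "r \<ge> 0" and f: "integrable M f"
  shows "integrable (scale_measure (ennreal r) M) f" and "(\<integral>x. f x \<partial>scale_measure (ennreal r) M) = r * (\<integral>x. f x \<partial>M)"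
proof -
  have "scale_measure (ennreal r) M = density M (\<lambda>_. ennreal r)"
    by (intro measure_eqI) (simp_all add: emeasure_density_const)
  thus "integrable (scale_measure (ennreal r) M) f" "(\<integral>x. f x \<partial>scale_measure (ennreal r) M) = r * (\<integral>x. f x \<partial>M)"
    using assms by (simp_all add: integrable_density integral_density)
qed

text \<open>
  \<open>\<parallel>v\<parallel> ^ 3 \<le> (\<Sum> v\<^sub>i\<^sup>2) (\<Sum> \<bar>v\<^sub>j\<bar>)\<close>, followed by Young's inequality \<open>a\<^sup>2 b \<le> (2 a ^ 3 + b ^ 3) / 3\<close>.
\<close>

lemma L2_set_cube_le:
  fixes v :: "nat \<Rightarrow> real"
  shows "L2_set v {..<d} ^ 3 \<le> real d * (\<Sum>i<d. \<bar>v i\<bar> ^ 3)"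
proof -
  have young: "a\<^sup>2 * b \<le> (2 * a ^ 3 + b ^ 3) / 3" if "a \<ge> 0" "b \<ge> 0" for a b :: real
  proof -
    have "0 \<le> (a - b)\<^sup>2 * (2 * a + b)" using that by (intro mult_nonneg_nonneg) auto
    also have "\<dots> = 2 * a ^ 3 + b ^ 3 - 3 * (a\<^sup>2 * b)" by (simp add: power2_eq_square power3_eq_cube algebra_simps)
    finally show ?thesis by simp
  qed
  have "L2_set v {..<d} ^ 3 = (L2_set v {..<d})\<^sup>2 * L2_set v {..<d}" by (simp add: power2_eq_square power3_eq_cube)
  also have "\<dots> \<le> (\<Sum>i<d. \<bar>v i\<bar>\<^sup>2) * (\<Sum>j<d. \<bar>v j\<bar>)"
    by (intro mult_mono L2_set_le_sum_abs) (auto simp: L2_set_def sum_nonneg)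
  also have "\<dots> = (\<Sum>i<d. \<Sum>j<d. \<bar>v i\<bar>\<^sup>2 * \<bar>v j\<bar>)" by (rule sum_product)
  also have "\<dots> \<le> (\<Sum>i<d. \<Sum>j<d. (2 * \<bar>v i\<bar> ^ 3 + \<bar>v j\<bar> ^ 3) / 3)"
    by (intro sum_mono young) auto
  also have "\<dots> = real d * (\<Sum>i<d. \<bar>v i\<bar> ^ 3)"
    by (simp add: sum.distrib add_divide_distrib sum_divide_distrib[symmetric] sum_distrib_left[symmetric])
  finally show ?thesis .
qed

text \<open>
  For \<open>m = 2 l + 1\<close> this is the bound on the third absolute moment of one weight: the powers of m
  cancel, so the moment does not grow with l.
\<close>

lemma third_moment_constant:
  fixes r m :: real
  assumes r: "r > 0" and m: "m > 0"
  shows "r * ((sqrt (m / (4 * pi)) / sqrt r) ^ 3 * (32 * pi * (2 / m) powr (3 / 2))) \<le> 16 / sqrt r"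
proof -
  have "(2 / m) powr (3 / 2) = ((2 / m) powr (1 / 2)) powr 3" by (simp add: powr_powr)
  also have "\<dots> = sqrt (2 / m) ^ 3"
    using m by (simp add: powr_half_sqrt powr_numeral)
  finally have p: "(2 / m) powr (3 / 2) = sqrt (2 / m) ^ 3" .
  have "sqrt (m / (4 * pi)) / sqrt r * sqrt (2 / m) = 1 / sqrt (2 * pi * r)"
    using m r by (simp add: real_sqrt_divide[symmetric] real_sqrt_mult[symmetric] field_simps)
  hence "r * ((sqrt (m / (4 * pi)) / sqrt r) ^ 3 * (32 * pi * (2 / m) powr (3 / 2))) = r * (32 * pi * (1 / sqrt (2 * pi * r)) ^ 3)"
    unfolding p by (simp add: power_mult_distrib[symmetric] mult_ac)
  also have "\<dots> = 16 / sqrt (2 * pi * r)"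
  proof -
    have "(1 / sqrt (2 * pi * r)) ^ 3 = 1 / (2 * pi * r * sqrt (2 * pi * r))"
      using r by (simp add: power3_eq_cube field_simps)
    thus ?thesis using r by simp
  qed
  also have "\<dots> \<le> 16 / sqrt r"
  proof -
    have "1 * r \<le> 2 * pi * r" using pi_gt3 r by (intro mult_right_mono) auto
    thus ?thesis using r by (intro divide_left_mono) auto
  qed
  finally show ?thesis .
qed

text \<open>
  Both bounds are instances of \<open>gaussian_comparison\<close>: the first one with the third power of the
  length of the weight vector, by \<open>smooth_form_cube\<close>, the second one with \<open>\<kappa>\<close> times its square, by
  \<open>smooth_form_square\<close>. The square integrates to the trace of S, which is d.
\<close>

lemma poisson_wave_gaussian_distance:
  fixes x :: "nat \<Rightarrow> real ^ 3" and Z :: "nat \<Rightarrow> 'v \<Rightarrow> real"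
  assumes M: "prob_space M" and r: "r > 0" and N: "poisson_random_measure M (scale_measure (ennreal r) sphere_measure) N"
    and l: "l \<ge> 1" and x: "\<And>i. i < d \<Longrightarrow> norm (x i) = 1"
    and P: "prob_space P" and Z: "centred_gaussian_vector P d (\<lambda>i j. poly (legendre l) (x i \<bullet> x j)) Z"
    and h: "Ck d 3 h" "C3_norm d h < 1"
  defines "\<Delta> \<equiv> \<bar>(\<integral>\<omega>. h (\<lambda>i\<in>{..<d}. poisson_wave r (N \<omega>) l (x i)) \<partial>M) - (\<integral>\<omega>. h (\<lambda>i\<in>{..<d}. Z i \<omega>) \<partial>P)\<bar>"
  shows "\<Delta> \<le> 32 * (real d)\<^sup>2 / sqrt r" and "\<Delta> \<le> 2 * real d * sqrt ((2 * real l + 1) / (4 * pi)) / sqrt r"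
proof -
  define \<Lambda> where "\<Lambda> = scale_measure (ennreal r) sphere_measure"
  define S where "S = (\<lambda>i j. poly (legendre l) (x i \<bullet> x j))"
  define p where "p = (\<lambda>i \<xi>. poly (legendre l) (x i \<bullet> \<xi>))"
  define \<kappa> where "\<kappa> = sqrt ((2 * real l + 1) / (4 * pi)) / sqrt r"
  define w where "w = (\<lambda>i \<xi>. if i < d then \<kappa> * p i \<xi> else 0)"
  define Z' where "Z' = (\<lambda>i. if i < d then Z i else (\<lambda>_. 0))"
  define H where "H = (\<lambda>y :: nat \<Rightarrow> real. h (restrict y {..<d}))"
  define H1 where "H1 = (\<lambda>i (y :: nat \<Rightarrow> real). partial_deriv i h (restrict y {..<d}))"
  define H2 where "H2 = (\<lambda>i j (y :: nat \<Rightarrow> real). partial_deriv j (partial_deriv i h) (restrict y {..<d}))"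
  define H3 where "H3 = (\<lambda>i j k (y :: nat \<Rightarrow> real). partial_deriv k (partial_deriv j (partial_deriv i h)) (restrict y {..<d}))"
  have \<kappa>: "\<kappa> \<ge> 0" "\<kappa> * \<kappa> = (2 * real l + 1) / (4 * pi) / r" using r by (simp_all add: \<kappa>_def)
  have pc: "continuous_on UNIV (p i)" for i unfolding p_def by (intro continuous_intros)
  have \<Lambda>i: "integrable \<Lambda> f" "(\<integral>\<xi>. f \<xi> \<partial>\<Lambda>) = r * (\<integral>\<xi>. f \<xi> \<partial>sphere_measure)" if "continuous_on UNIV f" for f :: "real ^ 3 \<Rightarrow> real"
    unfolding \<Lambda>_def using integral_scale_measure[OF less_imp_le[OF r] continuous_integrable_sphere[OF that]] by auto
  have space: "space \<Lambda> = sphere 0 1" by (simp add: \<Lambda>_def space_scale_measure)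
  obtain B where B: "\<And>u. \<bar>u\<bar> \<le> 1 \<Longrightarrow> \<bar>poly (legendre l) u\<bar> \<le> B"
    using poly_bounded_interval[of 1 "legendre l"] by blast
  have B0: "B \<ge> 0" using order_trans[OF abs_ge_zero B[of 0]] by simp
  have wc: "continuous_on UNIV (w i)" for i
    unfolding w_def by (cases "i < d") (auto intro!: continuous_intros pc)
  have int_p: "(\<integral>\<xi>. w i \<xi> * w j \<xi> \<partial>\<Lambda>) = S i j" if "i < d" "j < d" for i j
  proof -
    have "(\<integral>\<xi>. w i \<xi> * w j \<xi> \<partial>\<Lambda>) = r * (\<integral>\<xi>. (\<kappa> * \<kappa>) * (p i \<xi> * p j \<xi>) \<partial>sphere_measure)"
      using that by (subst \<Lambda>i(2)) (auto simp: w_def mult_ac intro!: continuous_intros pc)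
    also have "\<dots> = r * (\<kappa> * \<kappa>) * (4 * pi / (2 * real l + 1) * S i j)"
      using legendre_reproducing[OF l x[OF that(1)] x[OF that(2)]] by (simp add: p_def S_def)
    also have "\<dots> = S i j" unfolding \<kappa>(2) using r by simp
    finally show ?thesis .
  qed
  have w2i: "integrable \<Lambda> (\<lambda>\<xi>. (L2_set (\<lambda>i. w i \<xi>) {..<d})\<^sup>2)"
    and w3i: "integrable \<Lambda> (\<lambda>\<xi>. L2_set (\<lambda>i. w i \<xi>) {..<d} ^ 3)"
    unfolding L2_set_def by (intro \<Lambda>i(1) continuous_intros wc)+
  have "Ck d (Suc (Suc (Suc 0))) h" using h(1) by (simp add: numeral_3_eq_3)
  hence Ck1: "Ck d (Suc (Suc 0)) (partial_deriv i h)" and Ck2: "j < d \<Longrightarrow> Ck d (Suc 0) (partial_deriv j (partial_deriv i h))"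
    if "i < d" for i j using that unfolding Ck.simps(2)[of d "Suc (Suc 0)"] Ck.simps(2)[of d "Suc 0"] by blast+
  note hb = C3_norm_bounds[OF h(2) restrict_in_Rd]
  interpret M: prob_space M by (rule M)
  interpret P: prob_space P by (rule P)
  interpret comparison M \<Lambda> N P d S Z' w "\<kappa> * B" H H1 H2 H3
  proof (unfold_locales)
    show "poisson_random_measure M \<Lambda> N" using N by (simp add: \<Lambda>_def)
    have "emeasure \<Lambda> (sphere 0 1) = ennreal r * ennreal (4 * pi)"
      by (simp add: \<Lambda>_def emeasure_sphere_measure)
    thus "emeasure \<Lambda> (space \<Lambda>) \<noteq> \<infinity>" by (simp add: space ennreal_mult_eq_top_iff)
  next
    have "(\<Sum>i<d. u i * Z' i \<omega>) = (\<Sum>i<d. u i * Z i \<omega>)" for u \<omega> by (simp add: Z'_def)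
    thus "centred_gaussian_vector P d S Z'"
      using Z unfolding centred_gaussian_vector_def S_def by (simp add: Z'_def)
  next
    fix i
    have "w i \<in> borel_measurable sphere_measure" by (intro measurable_sphere_measure borel_measurable_continuous_onI wc)
    thus "w i \<in> borel_measurable \<Lambda>" by (simp add: \<Lambda>_def cong: measurable_cong_sets)
    fix \<xi> assume "\<xi> \<in> space \<Lambda>"
    hence \<xi>: "norm \<xi> = 1" by (simp add: space)
    show "\<bar>w i \<xi>\<bar> \<le> \<kappa> * B"
    proof (cases "i < d")
      case True
      have "\<bar>p i \<xi>\<bar> \<le> B" unfolding p_def
        by (rule B) (use Cauchy_Schwarz_ineq2[of "x i" \<xi>] x[OF True] \<xi> in simp)
      thus ?thesis using True \<kappa> by (simp add: w_def abs_mult mult_left_mono)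
    qed (use \<kappa> B0 in \<open>simp add: w_def\<close>)
  next
    fix i assume i: "i < d"
    have "(\<integral>\<xi>. w i \<xi> \<partial>\<Lambda>) = r * (\<kappa> * (\<integral>\<xi>. p i \<xi> \<partial>sphere_measure))"
      using i by (subst \<Lambda>i(2)) (auto simp: w_def intro!: continuous_intros pc)
    thus "(\<integral>\<xi>. w i \<xi> \<partial>\<Lambda>) = 0" using integral_sphere_legendre[OF x[OF i] l] by (simp add: p_def)
  next
    show "C1_on d H H1" unfolding H_def H1_def using \<open>Ck d (Suc (Suc (Suc 0))) h\<close> by (rule Ck_C1_on)
  next
    show "C1_on d (H1 i) (H2 i)" if "i < d" for i unfolding H1_def H2_def using Ck1[OF that] by (rule Ck_C1_on)
    show "C1_on d (H2 i j) (H3 i j)" if "i < d" "j < d" for i j unfolding H2_def H3_def using Ck2[OF that] by (rule Ck_C1_on)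
  next
    show "Z' i = (\<lambda>_. 0)" if "i \<ge> d" for i using that by (simp add: Z'_def)
    show "(\<integral>\<xi>. w i \<xi> * w j \<xi> \<partial>\<Lambda>) = S i j" if "i < d" "j < d" for i j by (rule int_p[OF that])
    show "\<bar>H1 i y\<bar> \<le> 1" if "i < d" for i y unfolding H1_def by (rule hb(1)[OF that])
    show "\<bar>H2 i j y\<bar> \<le> 1" if "i < d" "j < d" for i j y unfolding H2_def by (rule hb(2)[OF that])
    show "\<bar>H3 i j k y\<bar> \<le> 1" if "i < d" "j < d" "k < d" for i j k y unfolding H3_def by (rule hb(3)[OF that])
  qed
  have X: "restrict (X \<omega>) {..<d} = (\<lambda>i\<in>{..<d}. poisson_wave r (N \<omega>) l (x i))" for \<omega>
  proof (rule restrict_ext)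
    fix i assume "i \<in> {..<d}"
    thus "X \<omega> i = poisson_wave r (N \<omega>) l (x i)"
      unfolding X_def poisson_wave_def by (simp add: w_def p_def \<kappa>_def)
  qed
  have Zr: "restrict (\<lambda>i. Z' i \<omega>) {..<d} = (\<lambda>i\<in>{..<d}. Z i \<omega>)" for \<omega> by (auto simp: Z'_def)
  have \<Delta>: "\<Delta> = \<bar>(\<integral>\<omega>. H (X \<omega>) \<partial>M) - (\<integral>\<omega>. H (\<lambda>i. Z' i \<omega>) \<partial>P)\<bar>"
    by (simp add: \<Delta>_def H_def X Zr)
  show "\<Delta> \<le> 32 * (real d)\<^sup>2 / sqrt r"
  proof -
    have "\<Delta> \<le> 2 * (\<integral>\<xi>. L2_set (\<lambda>i. w i \<xi>) {..<d} ^ 3 \<partial>\<Lambda>)"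
      unfolding \<Delta>
    proof (rule gaussian_comparison[OF w3i])
      fix c :: real and \<xi> y assume c: "0 < c" "c \<le> 1"
      let ?A = "\<bar>\<Sum>i<d. \<Sum>j<d. \<Sum>k<d. w i \<xi> * w j \<xi> * w k \<xi> * smooth c (H3 i j k) y\<bar>"
      have "c * ?A \<le> 1 * ?A" using c by (intro mult_right_mono) auto
      also have "?A \<le> L2_set (\<lambda>i. w i \<xi>) {..<d} ^ 3"
        by (rule smooth_form_cube) (unfold H3_def, rule hb(5))
      finally show "c * ?A \<le> L2_set (\<lambda>i. w i \<xi>) {..<d} ^ 3" by simp
    qed
    also have "\<dots> \<le> 2 * (\<integral>\<xi>. real d * (\<Sum>i<d. \<bar>w i \<xi>\<bar> ^ 3) \<partial>\<Lambda>)"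
      by (intro mult_left_mono integral_mono w3i L2_set_cube_le \<Lambda>i(1) continuous_intros wc) simp
    also have "(\<integral>\<xi>. real d * (\<Sum>i<d. \<bar>w i \<xi>\<bar> ^ 3) \<partial>\<Lambda>) = real d * (\<Sum>i<d. \<integral>\<xi>. \<bar>w i \<xi>\<bar> ^ 3 \<partial>\<Lambda>)"
      unfolding integral_mult_right_zero
      by (subst Bochner_Integration.integral_sum) (intro \<Lambda>i(1) continuous_intros wc, simp)
    also have "\<dots> \<le> real d * (\<Sum>i<d. 16 / sqrt r)"
    proof (intro mult_left_mono sum_mono)
      fix i assume "i \<in> {..<d}"
      hence i: "i < d" by simp
      have "(\<integral>\<xi>. \<bar>w i \<xi>\<bar> ^ 3 \<partial>\<Lambda>) = r * (\<integral>\<xi>. \<kappa> ^ 3 * \<bar>p i \<xi>\<bar> ^ 3 \<partial>sphere_measure)"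
        using i \<kappa> by (subst \<Lambda>i(2)) (auto simp: w_def abs_mult power_mult_distrib intro!: continuous_intros pc)
      also have "\<dots> = r * (\<kappa> ^ 3 * (\<integral>\<xi>. \<bar>p i \<xi>\<bar> ^ 3 \<partial>sphere_measure))" by simp
      also have "\<dots> \<le> r * (\<kappa> ^ 3 * (32 * pi * (2 / (2 * real l + 1)) powr (3 / 2)))"
        using r \<kappa> integral_sphere_legendre_cube[OF x[OF i] l] unfolding p_def by (intro mult_left_mono) auto
      also have "\<dots> \<le> 16 / sqrt r" unfolding \<kappa>_def by (rule third_moment_constant[OF r]) simp
      finally show "(\<integral>\<xi>. \<bar>w i \<xi>\<bar> ^ 3 \<partial>\<Lambda>) \<le> 16 / sqrt r" .
    qed simp
    finally show ?thesis by (simp add: power2_eq_square)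
  qed
  show "\<Delta> \<le> 2 * real d * sqrt ((2 * real l + 1) / (4 * pi)) / sqrt r"
  proof -
    have "\<Delta> \<le> 2 * (\<integral>\<xi>. \<kappa> * (L2_set (\<lambda>i. w i \<xi>) {..<d})\<^sup>2 \<partial>\<Lambda>)"
      unfolding \<Delta>
    proof (rule gaussian_comparison[OF integrable_mult_right[OF w2i]])
      fix c :: real and \<xi> y assume c: "0 < c" "c \<le> 1" and "\<xi> \<in> space \<Lambda>"
      hence \<xi>: "norm \<xi> = 1" by (simp add: space)
      obtain a where a: "\<And>i. i < d \<Longrightarrow> (\<Sum>j<d. a j * S j i) = p i \<xi>" "(\<Sum>i<d. \<Sum>j<d. a i * a j * S i j) \<le> 1"
        using legendre_kernel_solve[of l d x \<xi>, OF l x \<xi>] unfolding S_def p_def by blast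
      have "\<bar>c * (\<Sum>i<d. \<Sum>j<d. \<Sum>k<d. w i \<xi> * w j \<xi> * w k \<xi> * smooth c (H3 i j k) y)\<bar> \<le> \<kappa> * (L2_set (\<lambda>i. w i \<xi>) {..<d})\<^sup>2"
      proof (rule smooth_form_square)
        show "\<bar>\<Sum>i<d. \<Sum>j<d. w i \<xi> * w j \<xi> * H2 i j z\<bar> \<le> (L2_set (\<lambda>i. w i \<xi>) {..<d})\<^sup>2" for z
          unfolding H2_def by (rule hb(4))
        show "w i \<xi> = \<kappa> * (\<Sum>j<d. a j * S j i)" if "i < d" for i using a(1)[OF that] that by (simp add: w_def)
        show "gauss.V a a \<le> 1" using a(2) by (simp add: gauss.V_def)
      qed (rule \<kappa>)
      thus "c * \<bar>\<Sum>i<d. \<Sum>j<d. \<Sum>k<d. w i \<xi> * w j \<xi> * w k \<xi> * smooth c (H3 i j k) y\<bar> \<le> \<kappa> * (L2_set (\<lambda>i. w i \<xi>) {..<d})\<^sup>2"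
        using c by (simp add: abs_mult)
    qed
    also have "\<dots> = 2 * (\<kappa> * (\<Sum>i<d. \<integral>\<xi>. w i \<xi> * w i \<xi> \<partial>\<Lambda>))"
    proof -
      have "(L2_set (\<lambda>i. w i \<xi>) {..<d})\<^sup>2 = (\<Sum>i<d. w i \<xi> * w i \<xi>)" for \<xi>
        by (simp add: L2_set_def sum_nonneg power2_eq_square)
      moreover have "(\<integral>\<xi>. (\<Sum>i<d. w i \<xi> * w i \<xi>) \<partial>\<Lambda>) = (\<Sum>i<d. \<integral>\<xi>. w i \<xi> * w i \<xi> \<partial>\<Lambda>)"
        by (rule Bochner_Integration.integral_sum) (intro \<Lambda>i(1) continuous_intros wc)
      ultimately show ?thesis by simp
    qed
    also have "(\<Sum>i<d. \<integral>\<xi>. w i \<xi> * w i \<xi> \<partial>\<Lambda>) = (\<Sum>i<d. 1)"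
    proof (intro sum.cong refl)
      fix i assume "i \<in> {..<d}"
      moreover from this have "x i \<bullet> x i = 1" using x by (simp add: norm_eq_1)
      ultimately show "(\<integral>\<xi>. w i \<xi> * w i \<xi> \<partial>\<Lambda>) = 1" using int_p[of i i] by (simp add: S_def legendre_1)
    qed
    finally show ?thesis by (simp add: \<kappa>_def mult_ac)
  qed
qed

theorem mainTheorem7:
  fixes M :: "'w measure"
    and \<nu> :: "real \<Rightarrow> real"
    and N :: "real \<Rightarrow> 'w \<Rightarrow> (real ^ 3) measure"
  assumes "prob_space M"
    and "\<forall>t>0. \<nu> t > 0"
    and "filterlim \<nu> at_top at_top"
    and "\<forall>t>0. poisson_random_measure M (scale_measure (ennreal (\<nu> t)) sphere_measure) (N t)"
  shows "\<exists>C::real. \<forall>\<^sub>F (l, t) in sequentially \<times>\<^sub>F at_top.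
           \<forall>d\<ge>1. \<forall>x :: nat \<Rightarrow> real ^ 3. \<forall>(P :: 'v measure) Z.
             (\<forall>i<d. x i \<in> sphere 0 1) \<and> prob_space P \<and>
             centred_gaussian_vector P d (\<lambda>i j. poly (legendre l) (x i \<bullet> x j)) Z \<longrightarrow>
             (SUP h\<in>{h. Ck d 3 h \<and> C3_norm d h < 1}.
                ereal \<bar>(\<integral>\<omega>. h (\<lambda>i\<in>{..<d}. poisson_wave (\<nu> t) (N t \<omega>) l (x i)) \<partial>M)
                       - (\<integral>\<omega>. h (\<lambda>i\<in>{..<d}. Z i \<omega>) \<partial>P)\<bar>)
             \<le> ereal (C * (real d * min (sqrt (real l)) (real d) * sqrt (ln (real l) / \<nu> t)))"
proof (intro exI[of _ 32])
  let ?Q = "\<lambda>l t. \<forall>d\<ge>1. \<forall>x :: nat \<Rightarrow> real ^ 3. \<forall>(P :: 'v measure) Z.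
             (\<forall>i<d. x i \<in> sphere 0 1) \<and> prob_space P \<and>
             centred_gaussian_vector P d (\<lambda>i j. poly (legendre l) (x i \<bullet> x j)) Z \<longrightarrow>
             (SUP h\<in>{h. Ck d 3 h \<and> C3_norm d h < 1}.
                ereal \<bar>(\<integral>\<omega>. h (\<lambda>i\<in>{..<d}. poisson_wave (\<nu> t) (N t \<omega>) l (x i)) \<partial>M)
                       - (\<integral>\<omega>. h (\<lambda>i\<in>{..<d}. Z i \<omega>) \<partial>P)\<bar>)
             \<le> ereal (32 * (real d * min (sqrt (real l)) (real d) * sqrt (ln (real l) / \<nu> t)))"
  have Q: "?Q l t" if l: "l \<ge> 3" and t: "t > 0" for l t
  proof (intro allI impI SUP_least, elim conjE)
    fix d :: nat and x :: "nat \<Rightarrow> real ^ 3" and P :: "'v measure" and Z h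
    assume x: "\<forall>i<d. x i \<in> sphere 0 1" and P: "prob_space P"
      and Z: "centred_gaussian_vector P d (\<lambda>i j. poly (legendre l) (x i \<bullet> x j)) Z"
      and "h \<in> {h. Ck d 3 h \<and> C3_norm d h < 1}"
    hence h: "Ck d 3 h" "C3_norm d h < 1" and x1: "\<And>i. i < d \<Longrightarrow> norm (x i) = 1" by auto
    have r: "\<nu> t > 0" and N: "poisson_random_measure M (scale_measure (ennreal (\<nu> t)) sphere_measure) (N t)"
      using assms(2,4) t by auto
    have l1: "l \<ge> 1" using l by simp
    define \<Delta> where "\<Delta> = \<bar>(\<integral>\<omega>. h (\<lambda>i\<in>{..<d}. poisson_wave (\<nu> t) (N t \<omega>) l (x i)) \<partial>M) - (\<integral>\<omega>. h (\<lambda>i\<in>{..<d}. Z i \<omega>) \<partial>P)\<bar>"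
    note \<Delta> = poisson_wave_gaussian_distance[OF assms(1) r N l1 x1 P Z h, folded \<Delta>_def]
    have "sqrt ((2 * real l + 1) / (4 * pi)) \<le> sqrt (real l)"
    proof (rule real_sqrt_le_mono)
      have "2 * real l + 1 \<le> 3 * real l" using l by simp
      also have "\<dots> \<le> real l * (4 * pi)" using pi_gt3 l by (simp add: mult.commute[of 3])
      finally show "(2 * real l + 1) / (4 * pi) \<le> real l" by (simp add: pos_divide_le_eq)
    qed
    hence "2 * real d * sqrt ((2 * real l + 1) / (4 * pi)) \<le> 32 * real d * sqrt (real l)" by (intro mult_mono) auto
    hence "2 * real d * sqrt ((2 * real l + 1) / (4 * pi)) \<le> 32 * (real d * sqrt (real l))" by simp
    hence b2: "\<Delta> \<le> 32 * (real d * sqrt (real l)) / sqrt (\<nu> t)"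
      using r by (intro order_trans[OF \<Delta>(2)] divide_right_mono) auto
    have b1: "\<Delta> \<le> 32 * (real d * real d) / sqrt (\<nu> t)" using \<Delta>(1) by (simp add: power2_eq_square)
    have "\<Delta> \<le> 32 * (real d * min (sqrt (real l)) (real d)) / sqrt (\<nu> t)"
      using b1 b2 by (simp add: min_def)
    also have "\<dots> \<le> 32 * (real d * min (sqrt (real l)) (real d)) * (sqrt (ln (real l)) / sqrt (\<nu> t))"
    proof -
      \<comment> \<open>\<open>l \<ge> 3\<close> makes the logarithm at least 1, so the square root of it may be inserted\<close>
      have "exp 1 \<le> real l" using exp_le l by linarith
      hence "1 \<le> ln (real l)" using l by (subst ln_ge_iff) auto
      hence "1 \<le> sqrt (ln (real l))" by simp
      hence "1 / sqrt (\<nu> t) \<le> sqrt (ln (real l)) / sqrt (\<nu> t)" using r by (intro divide_right_mono) auto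
      hence "32 * (real d * min (sqrt (real l)) (real d)) * (1 / sqrt (\<nu> t)) \<le> 32 * (real d * min (sqrt (real l)) (real d)) * (sqrt (ln (real l)) / sqrt (\<nu> t))"
        by (rule mult_left_mono) (auto simp: min_def)
      thus ?thesis by simp
    qed
    also have "\<dots> = 32 * (real d * min (sqrt (real l)) (real d) * sqrt (ln (real l) / \<nu> t))"
      by (simp add: real_sqrt_divide)
    finally show "ereal \<bar>(\<integral>\<omega>. h (\<lambda>i\<in>{..<d}. poisson_wave (\<nu> t) (N t \<omega>) l (x i)) \<partial>M) - (\<integral>\<omega>. h (\<lambda>i\<in>{..<d}. Z i \<omega>) \<partial>P)\<bar>
        \<le> ereal (32 * (real d * min (sqrt (real l)) (real d) * sqrt (ln (real l) / \<nu> t)))"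
      unfolding \<Delta>_def by simp
  qed
  have "\<forall>\<^sub>F p in sequentially \<times>\<^sub>F at_top. ?Q (fst p) (snd p)"
    unfolding eventually_prod_filter
    by (rule exI[of _ "\<lambda>l. 3 \<le> l"], rule exI[of _ "\<lambda>t. 0 < t"])
       (use Q eventually_ge_at_top eventually_gt_at_top in simp)
  thus "\<forall>\<^sub>F (l, t) in sequentially \<times>\<^sub>F at_top. ?Q l t" by (simp add: case_prod_unfold)
qed

end
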